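(* Let $\tilde I\subset(0,\infty)$ be a compact interval, let $\sigma_0:\mathbb R\to\tilde I$ have bounded total variation, and let $G:\tilde I\to\mathbb R$ be of class $\mathcal C^2$ with $G'(\sigma)>0$ for all $\sigma\in\tilde I$. Then the Cauchy problem $$\eta_t-G\left(\frac{v}{\eta}\right)_x=0,\quad \eta(x,0)=1,\qquad\qquad v_t=0,\quad v(x,0)=\sigma_0(x),\qquad x\in\mathbb R,\ t>0,$$ has a unique admissible weak solution $(\eta,v)\in\mathcal C\big((0,\infty);BV^2\big)$ for $t>0$.
   Context: State space: $\Omega=\{(\eta,v)\in\mathbb R^2:\eta>0,\ v/\eta\in\tilde I\}$. Solutions take values in $\Omega$, so that $G(v/\eta)$ is defined. Weak solution: a bounded measurable $w=(\eta,v):\mathbb R\times[0,\infty)\to\Omega$ such that $t\mapsto w(\cdot,t)$ is continuous from $[0,\infty)$ into $L^1_{loc}(\mathbb R;\mathbb R^2)$, attains the prescribed initial data at $t=0$, and satisfies both equations in the sense of distributions on $\mathbb R\times(0,\infty)$. Convex extension of the system: a pair $(\mathcal E,\mathcal Q)$ of $\mathcal C^1$ functions on $\Omega$ with $\mathcal E$ smooth and convex and $$\mathcal Q_\eta=\mathcal E_\eta\,\frac{v}{\eta^2}\,G'\left(\frac v\eta\right),\qquad \mathcal Q_v=-\mathcal E_\eta\,\frac1\eta\,G'\left(\frac v\eta\right).$$ Admissible (entropy admissible) weak solution: a weak solution such that, for every convex extension $(\mathcal E,\mathcal Q)$, $\mathcal E(w)_t+\mathcal Q(w)_x\le 0$ in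 the sense of distributions, i.e. $\iint(\psi_t\,\mathcal E(w)+\psi_x\,\mathcal Q(w))\,dx\,dt\ge0$ for every nonnegative $\psi\in \mathcal C_c^1(\mathbb R\times(0,\infty))$. $(\eta,v)\in\mathcal C((0,\infty);BV^2)$ means: for each $t>0$, $\eta(\cdot,t)$ and $v(\cdot,t)$ have bounded total variation on $\mathbb R$, and $t\mapsto(\eta,v)(\cdot,t)$ is continuous in the $L^1_{loc}(\mathbb R)$ topology. Uniqueness is within the class of admissible weak solutions belonging to $\mathcal C((0,\infty);BV^2)$. *)

theory Defs
  imports "HOL-Analysis.Analysis"
begin

text \<open>One-sided at boundary points of \<open>S\<close>; well defined when \<open>S\<close> is an interval with more
  than one point.\<close>

definition deriv_on :: "real set \<Rightarrow> (real \<Rightarrow> real) \<Rightarrow> real \<Rightarrow> real" where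
  "deriv_on S g x = vector_derivative g (at x within S)"

definition C2_on :: "real set \<Rightarrow> (real \<Rightarrow> real) \<Rightarrow> bool" where
  "C2_on S g \<longleftrightarrow>
     g differentiable_on S \<and>
     deriv_on S g differentiable_on S \<and>
     continuous_on S (deriv_on S (deriv_on S g))"

definition has_gradient_on ::
  "(real \<times> real) set \<Rightarrow> (real \<times> real \<Rightarrow> real) \<Rightarrow>
   (real \<times> real \<Rightarrow> real) \<Rightarrow> (real \<times> real \<Rightarrow> real) \<Rightarrow> bool" where
  "has_gradient_on S f f1 f2 \<longleftrightarrow>
     (\<forall>z\<in>S. (f has_derivative (\<lambda>h. f1 z * fst h + f2 z * snd h)) (at z within S))"

text \<open>Differentiability is relative to \<open>S\<close>, which need not be open. On the sets used below (the
  whole plane and the convex set \<open>state_space {a..b}\<close> with \<open>0 < a < b\<close>, which has nonempty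
  interior) the gradient relative to \<open>S\<close> is unique at every point of \<open>S\<close>.\<close>

primrec Ck_on :: "nat \<Rightarrow> (real \<times> real) set \<Rightarrow> (real \<times> real \<Rightarrow> real) \<Rightarrow> bool" where
  "Ck_on 0 S f \<longleftrightarrow> continuous_on S f"
| "Ck_on (Suc k) S f \<longleftrightarrow>
     (\<exists>f1 f2. has_gradient_on S f f1 f2 \<and> Ck_on k S f1 \<and> Ck_on k S f2)"

definition smooth_on :: "(real \<times> real) set \<Rightarrow> (real \<times> real \<Rightarrow> real) \<Rightarrow> bool" where
  "smooth_on S f \<longleftrightarrow> (\<forall>k. Ck_on k S f)"

definition bounded_total_variation :: "(real \<Rightarrow> real) \<Rightarrow> bool" where
  "bounded_total_variation f \<longleftrightarrow>
     (\<exists>M. \<forall>(n::nat) p. (\<forall>i<n. p i \<le> p (Suc i)) \<longrightarrow> (\<Sum>i<n. \<bar>f (p (Suc i)) - f (p i)\<bar>) \<le> M)"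

text \<open>Points of the state space are pairs \<open>(\<eta>, v)\<close>; points of space-time are pairs \<open>(x, t)\<close>.\<close>

definition state_space :: "real set \<Rightarrow> (real \<times> real) set" where
  "state_space I = {(\<eta>, v). \<eta> > 0 \<and> v / \<eta> \<in> I}"

text \<open>Continuity of \<open>t \<mapsto> w(\<cdot>, t)\<close> from \<open>T\<close> into \<open>L\<^sup>1\<^sub>l\<^sub>o\<^sub>c\<close>,
  including that every slice is locally integrable.\<close>

definition L1loc_continuous_on :: "real set \<Rightarrow> (real \<times> real \<Rightarrow> real \<times> real) \<Rightarrow> bool" where
  "L1loc_continuous_on T w \<longleftrightarrow>
     (\<forall>K. compact K \<longrightarrow>
        (\<forall>t\<in>T. set_integrable lebesgue K (\<lambda>x. w (x, t))) \<and>
        (\<forall>t\<in>T. ((\<lambda>s. LINT x:K|lebesgue. norm (w (x, s) - w (x, t))) \<longlongrightarrow> 0) (at t within T)))"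

definition supported_in_upper_half :: "(real \<times> real \<Rightarrow> real) \<Rightarrow> bool" where
  "supported_in_upper_half \<psi> \<longleftrightarrow>
     compact (closure {z. \<psi> z \<noteq> 0}) \<and> closure {z. \<psi> z \<noteq> 0} \<subseteq> UNIV \<times> {0<..}"

definition dx :: "(real \<times> real \<Rightarrow> real) \<Rightarrow> real \<times> real \<Rightarrow> real" where
  "dx \<psi> = (\<lambda>(x, t). deriv (\<lambda>y. \<psi> (y, t)) x)"

definition dt :: "(real \<times> real \<Rightarrow> real) \<Rightarrow> real \<times> real \<Rightarrow> real" where
  "dt \<psi> = (\<lambda>(x, t). deriv (\<lambda>s. \<psi> (x, s)) t)"

text \<open>The values of \<open>w\<close> at negative times are irrelevant. The initial data are attained as
  elements of \<open>L\<^sup>1\<^sub>l\<^sub>o\<^sub>c\<close>, i.e. almost everywhere.\<close>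

definition weak_solution ::
  "real set \<Rightarrow> (real \<Rightarrow> real) \<Rightarrow> (real \<Rightarrow> real) \<Rightarrow> (real \<times> real \<Rightarrow> real \<times> real) \<Rightarrow> bool" where
  "weak_solution I G \<sigma>\<^sub>0 w \<longleftrightarrow>
     w ` (UNIV \<times> {0..}) \<subseteq> state_space I \<and>
     bounded (w ` (UNIV \<times> {0..})) \<and>
     w \<in> borel_measurable (lebesgue_on (UNIV \<times> {0..})) \<and>
     L1loc_continuous_on {0..} w \<and>
     (AE x in lebesgue. w (x, 0) = (1, \<sigma>\<^sub>0 x)) \<and>
     (\<forall>\<phi>. smooth_on UNIV \<phi> \<and> supported_in_upper_half \<phi> \<longrightarrow>
        (LINT z:UNIV \<times> {0<..}|lebesgue.
           dt \<phi> z * fst (w z) - dx \<phi> z * G (snd (w z) / fst (w z))) = 0 \<and>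
        (LINT z:UNIV \<times> {0<..}|lebesgue. dt \<phi> z * snd (w z)) = 0)"

definition convex_extension ::
  "real set \<Rightarrow> (real \<Rightarrow> real) \<Rightarrow> (real \<times> real \<Rightarrow> real) \<Rightarrow> (real \<times> real \<Rightarrow> real) \<Rightarrow> bool" where
  "convex_extension I G E Q \<longleftrightarrow>
     Ck_on 1 (state_space I) E \<and> Ck_on 1 (state_space I) Q \<and>
     smooth_on (state_space I) E \<and> convex_on (state_space I) E \<and>
     (\<exists>E\<^sub>\<eta> E\<^sub>v Q\<^sub>\<eta> Q\<^sub>v.
        has_gradient_on (state_space I) E E\<^sub>\<eta> E\<^sub>v \<and>
        has_gradient_on (state_space I) Q Q\<^sub>\<eta> Q\<^sub>v \<and>
        (\<forall>(\<eta>, v) \<in> state_space I.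
           Q\<^sub>\<eta> (\<eta>, v) = E\<^sub>\<eta> (\<eta>, v) * (v / \<eta>\<^sup>2) * deriv_on I G (v / \<eta>) \<and>
           Q\<^sub>v (\<eta>, v) = - E\<^sub>\<eta> (\<eta>, v) * (1 / \<eta>) * deriv_on I G (v / \<eta>)))"

definition admissible_weak_solution ::
  "real set \<Rightarrow> (real \<Rightarrow> real) \<Rightarrow> (real \<Rightarrow> real) \<Rightarrow> (real \<times> real \<Rightarrow> real \<times> real) \<Rightarrow> bool" where
  "admissible_weak_solution I G \<sigma>\<^sub>0 w \<longleftrightarrow>
     weak_solution I G \<sigma>\<^sub>0 w \<and>
     (\<forall>E Q. convex_extension I G E Q \<longrightarrow>
        (\<forall>\<psi>. Ck_on 1 UNIV \<psi> \<and> supported_in_upper_half \<psi> \<and> (\<forall>z. \<psi> z \<ge> 0) \<longrightarrow>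
           (LINT z:UNIV \<times> {0<..}|lebesgue. dt \<psi> z * E (w z) + dx \<psi> z * Q (w z)) \<ge> 0))"

definition continuous_in_BV2 :: "(real \<times> real \<Rightarrow> real \<times> real) \<Rightarrow> bool" where
  "continuous_in_BV2 w \<longleftrightarrow>
     (\<forall>t>0. bounded_total_variation (\<lambda>x. fst (w (x, t))) \<and>
            bounded_total_variation (\<lambda>x. snd (w (x, t)))) \<and>
     L1loc_continuous_on {0<..} w"

end

(* Since v does not depend on t, v = sigma_0 =: s, and with eta = s r the system is the scalar
   conservation law s r_t + f(r)_x = 0 with f(r) = -G(1/r) increasing, so that waves travel in one
   direction only. Existence: the implicit scheme s (V_n - V_(n-1)) / tau + f(V_n)_x = 0 is a
   contraction of the weighted L1 distance, preserves bounds on the total variation, and converges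
   by the argument of Crandall and Liggett; convexity turns each step into a discrete entropy
   inequality. Uniqueness: the entropies E = +-v force v = s for every admissible solution, and the
   smooth convex entropies sqrt((eta - k v)^2 + eps^2 v^2) yield Kruzhkov's inequalities as eps -> 0.
   Comparing an admissible solution with the scheme (doubling only x) bounds its distance from V_n
   by sqrt((t - n tau)^2 + t tau + tau^2) up to constants, so two solutions have distance 0. *)

theory Submission
  imports Defs
begin

text \<open>Because s may jump, the equation is not invariant under translation in x: comparing a
  solution with its translate gives no variation bound, and doubling x and t together would put the
  factor s x - s y in front of a singular time kernel. Both difficulties are met by taking the flux
  z = f(V) of an implicit step as the unknown. It satisfies z' = s (g - \<phi> z) / \<tau> in
  integral form and is Lipschitz in x even where s and g jump, so its chain rules need no
  differentiation theorem. Its total variation is the L1 norm of the discrete time derivative, and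
  the contraction carries a bound for that norm from the first step to all others. In the comparison
  with an admissible solution, the rough partner enters only as a constant and z is the regular
  partner; what must be avoided is a null set of x, the jumps of s and g. Since f increases, the
  weight exp x absorbs the flux term: cutting it off on the left costs exp(-c), cutting it off on
  the right has the favourable sign. Total variation is a condition at every point, so the limit of
  the scheme is chosen as a cluster point in the product topology and not merely almost
  everywhere.\<close>

section \<open>Bounded Borel functions on the line and their primitives\<close>

definition bounded_borel :: "(real \<Rightarrow> real) \<Rightarrow> bool" where
  "bounded_borel p \<longleftrightarrow> p \<in> borel_measurable borel \<and> (\<exists>C. \<forall>x. \<bar>p x\<bar> \<le> C)"

text \<open>Encodes a Lipschitz function together with its almost everywhere derivative. Sum,
  product and chain rules are proved from increments over short intervals, so pointwise
  differentiability of \<open>X\<close> is never discussed.\<close>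

definition primitive :: "(real \<Rightarrow> real) \<Rightarrow> (real \<Rightarrow> real) \<Rightarrow> bool" where
  "primitive X p \<longleftrightarrow> bounded_borel p \<and> (\<forall>x y. x \<le> y \<longrightarrow> X y - X x = (LINT t:{x..y}|lborel. p t))"

lemma bounded_borelI:
  "p \<in> borel_measurable borel \<Longrightarrow> (\<And>x. \<bar>p x\<bar> \<le> C) \<Longrightarrow> bounded_borel p"
  by (auto simp: bounded_borel_def)

lemma bounded_borel_measurable: "bounded_borel p \<Longrightarrow> p \<in> borel_measurable borel"
  by (simp add: bounded_borel_def)

lemma bounded_borel_bound:
  assumes "bounded_borel p" shows "\<exists>C>0. \<forall>x. \<bar>p x\<bar> \<le> C"
proof -
  obtain C where "\<And>x. \<bar>p x\<bar> \<le> C" using assms by (auto simp: bounded_borel_def)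
  then have "\<And>x. \<bar>p x\<bar> \<le> max C 1" by (meson max.coboundedI1)
  then show ?thesis by (intro exI[of _ "max C 1"]) auto
qed

lemma bounded_borel_const [simp]: "bounded_borel (\<lambda>x. c)"
  by (auto simp: bounded_borel_def)

lemma bounded_borel_add:
  assumes "bounded_borel p" "bounded_borel q" shows "bounded_borel (\<lambda>x. p x + q x)"
proof -
  obtain C where C: "\<And>x. \<bar>p x\<bar> \<le> C" using bounded_borel_bound[OF assms(1)] by blast
  obtain D where D: "\<And>x. \<bar>q x\<bar> \<le> D" using bounded_borel_bound[OF assms(2)] by blast
  have "\<bar>p x + q x\<bar> \<le> C + D" for x
    using abs_triangle_ineq[of "p x" "q x"] C[of x] D[of x] by linarith
  then show ?thesis using assms by (intro bounded_borelI) (auto simp: bounded_borel_def)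
qed

lemma bounded_borel_mult:
  assumes "bounded_borel p" "bounded_borel q" shows "bounded_borel (\<lambda>x. p x * q x)"
proof -
  obtain C where C: "\<And>x. \<bar>p x\<bar> \<le> C" using bounded_borel_bound[OF assms(1)] by blast
  obtain D where D: "\<And>x. \<bar>q x\<bar> \<le> D" using bounded_borel_bound[OF assms(2)] by blast
  have "\<bar>p x * q x\<bar> \<le> C * D" for x unfolding abs_mult by (rule mult_mono'[OF C D]) auto
  then show ?thesis using assms by (intro bounded_borelI) (auto simp: bounded_borel_def)
qed

lemma bounded_borel_uminus: "bounded_borel p \<Longrightarrow> bounded_borel (\<lambda>x. - p x)"
  by (auto simp: bounded_borel_def)

lemma bounded_borel_diff: "bounded_borel p \<Longrightarrow> bounded_borel q \<Longrightarrow> bounded_borel (\<lambda>x. p x - q x)"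
  using bounded_borel_add[of p "\<lambda>x. - q x"] bounded_borel_uminus[of q] by simp

lemma bounded_borel_abs: "bounded_borel p \<Longrightarrow> bounded_borel (\<lambda>x. \<bar>p x\<bar>)"
  by (auto simp: bounded_borel_def)

lemma bounded_borel_shift: "bounded_borel p \<Longrightarrow> bounded_borel (\<lambda>x. p (x + h))"
proof -
  assume "bounded_borel p"
  then have [measurable]: "p \<in> borel_measurable borel" and "\<exists>C. \<forall>x. \<bar>p x\<bar> \<le> C"
    by (auto simp: bounded_borel_def)
  then show ?thesis unfolding bounded_borel_def by (intro conjI) (measurable, blast)
qed

lemmas bounded_borel_intros = bounded_borel_const bounded_borel_add bounded_borel_mult
  bounded_borel_uminus bounded_borel_diff bounded_borel_abs

lemma bounded_borel_Icc:
  assumes "bounded_borel p" shows "set_integrable lborel {c..d} p"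
proof -
  obtain C where C: "\<And>x. \<bar>p x\<bar> \<le> C" "C > 0" using bounded_borel_bound[OF assms] by blast
  have "set_integrable lborel {c..d} (\<lambda>_. C)"
    unfolding set_integrable_def by (intro integrable_scaleR_left integrable_real_indicator) (auto simp: emeasure_lborel_Icc_eq)
  then show ?thesis
    by (rule set_integrable_bound) 
      (use C bounded_borel_measurable[OF assms] in \<open>auto simp: set_borel_measurable_def\<close>)
qed

lemma LINT_Icc_const: "c \<le> d \<Longrightarrow> (LINT t:{c..d}|lborel. K) = K * (d - c)" for K c d :: real
  by (simp add: set_lebesgue_integral_def)

lemma LINT_Icc_combine:
  assumes "bounded_borel p" "x \<le> y" "y \<le> z"
  shows "(LINT t:{x..z}|lborel. p t) = (LINT t:{x..y}|lborel. p t) + (LINT t:{y..z}|lborel. p t)"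
  using assms bounded_borel_Icc[OF assms(1)]
  by (simp add: set_borel_integral_eq_integral Henstock_Kurzweil_Integration.integral_combine)

lemma LINT_Icc_mono:
  assumes "bounded_borel p" "bounded_borel q" "\<And>t. c \<le> t \<Longrightarrow> t \<le> d \<Longrightarrow> p t \<le> q t"
  shows "(LINT t:{c..d}|lborel. p t) \<le> (LINT t:{c..d}|lborel. q t)"
  by (rule set_integral_mono) (use assms bounded_borel_Icc in auto)

lemma LINT_Icc_bound:
  assumes "bounded_borel p" "\<And>t. c \<le> t \<Longrightarrow> t \<le> d \<Longrightarrow> \<bar>p t\<bar> \<le> K" "c \<le> d"
  shows "\<bar>LINT t:{c..d}|lborel. p t\<bar> \<le> K * (d - c)"
proof -
  have "(LINT t:{c..d}|lborel. p t) \<le> (LINT t:{c..d}|lborel. K)"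
    by (rule LINT_Icc_mono) (use assms in \<open>auto simp: abs_le_iff\<close>)
  moreover have "(LINT t:{c..d}|lborel. - K) \<le> (LINT t:{c..d}|lborel. p t)"
    by (rule LINT_Icc_mono) (use assms in \<open>force simp: abs_le_iff\<close>)+
  ultimately show ?thesis using assms(3) by (simp add: LINT_Icc_const abs_le_iff del: set_integral_const)
qed

lemma LINT_Icc_abs:
  assumes "bounded_borel p"
  shows "\<bar>LINT t:{c..d}|lborel. p t\<bar> \<le> (LINT t:{c..d}|lborel. \<bar>p t\<bar>)"
  using set_integral_norm_bound[OF bounded_borel_Icc[OF assms]] by simp

lemma LINT_Icc_add:
  assumes "bounded_borel p" "bounded_borel q"
  shows "(LINT t:{c..d}|lborel. p t + q t) = (LINT t:{c..d}|lborel. p t) + (LINT t:{c..d}|lborel. q t)"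
  by (rule set_integral_add) (use assms bounded_borel_Icc in auto)

lemma LINT_Icc_diff:
  assumes "bounded_borel p" "bounded_borel q"
  shows "(LINT t:{c..d}|lborel. p t - q t) = (LINT t:{c..d}|lborel. p t) - (LINT t:{c..d}|lborel. q t)"
  by (rule set_integral_diff) (use assms bounded_borel_Icc in auto)

lemma LINT_Icc_shift:
  "(LINT t:{c..d}|lborel. p (t + h)) = (LINT t:{c+h..d+h}|lborel. p t)" for p :: "real \<Rightarrow> real"
  unfolding set_lebesgue_integral_def
  by (subst (2) lborel_integral_real_affine[of 1 _ h])
     (auto intro!: Bochner_Integration.integral_cong simp: indicator_def add.commute)

text \<open>The interval is walked through in pieces of length at most \<open>h\<close>, starting
  from the right end; additivity of \<open>J\<close> stands in for a sum over a partition. The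
  induction counts the pieces.\<close>

lemma local_to_global:
  fixes X :: "real \<Rightarrow> real" and J :: "real \<Rightarrow> real \<Rightarrow> real"
  assumes add: "\<And>x y z. x \<le> y \<Longrightarrow> y \<le> z \<Longrightarrow> J x z = J x y + J y z"
    and h: "h > 0"
    and loc: "\<And>x y. c \<le> x \<Longrightarrow> x \<le> y \<Longrightarrow> y \<le> d \<Longrightarrow> y - x \<le> h \<Longrightarrow> X y - X x \<le> J x y"
    and "c \<le> d"
  shows "X d - X c \<le> J c d"
proof -
  have "X y - X c \<le> J c y" if "c \<le> y" "y \<le> d" "y - c \<le> real n * h" for n y
    using that
  proof (induction n arbitrary: y)
    case 0 then show ?case using loc[of y y] h by auto
  next
    case (Suc n)
    let ?w = "max c (y - h)"
    have "X ?w - X c \<le> J c ?w" by (rule Suc.IH) (use Suc.prems h in \<open>auto simp: algebra_simps max_def\<close>)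
    moreover have "X y - X ?w \<le> J ?w y" by (rule loc) (use Suc.prems h in auto)
    moreover have "J c y = J c ?w + J ?w y" by (rule add) (use Suc.prems h in auto)
    ultimately show ?case by linarith
  qed
  moreover obtain n :: nat where "d - c \<le> real n * h"
    using h by (metis reals_Archimedean3 less_imp_le)
  ultimately show ?thesis using \<open>c \<le> d\<close> by blast
qed

text \<open>The error \<open>e * (y - x)\<close> is additive in the interval, so the local errors
  add up to \<open>e * (d - c)\<close> whatever the number of pieces, and \<open>e\<close> is
  arbitrary.\<close>

lemma increment_le_integral:
  assumes R: "bounded_borel R" and "c \<le> d"
    and loc: "\<And>e. e > 0 \<Longrightarrow> \<exists>h>0. \<forall>x y. c \<le> x \<and> x \<le> y \<and> y \<le> d \<and> y - x \<le> h \<longrightarrow>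
      X y - X x \<le> (LINT t:{x..y}|lborel. R t) + e * (y - x)"
  shows "X d - X c \<le> (LINT t:{c..d}|lborel. R t)"
proof -
  have "X d - X c \<le> (LINT t:{c..d}|lborel. R t) + e * (d - c)" if e: "e > 0" for e
  proof -
    obtain h where "h > 0" and "\<forall>x y. c \<le> x \<and> x \<le> y \<and> y \<le> d \<and> y - x \<le> h \<longrightarrow>
      X y - X x \<le> (LINT t:{x..y}|lborel. R t) + e * (y - x)" using loc[OF e] by blast
    note loc' = this
    show ?thesis
    proof (rule local_to_global[of "\<lambda>x y. (LINT t:{x..y}|lborel. R t) + e * (y - x)" h c d X])
      show "(LINT t:{x..z}|lborel. R t) + e * (z - x) = (LINT t:{x..y}|lborel. R t) + e * (y - x)
          + ((LINT t:{y..z}|lborel. R t) + e * (z - y))" if "x \<le> y" "y \<le> z" for x y z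
        using LINT_Icc_combine[OF R that] by (simp add: algebra_simps)
    qed (use loc' \<open>c \<le> d\<close> in blast)+
  qed
  note * = this
  have "X d - X c \<le> (LINT t:{c..d}|lborel. R t) + e" if "e > 0" for e
  proof -
    \<comment> \<open>The summand 1 keeps the quotient meaningful when \<open>c = d\<close>.\<close>
    have "e / (d - c + 1) * (d - c) = e * ((d - c) / (d - c + 1))" by simp
    also have "\<dots> \<le> e * 1" using that \<open>c \<le> d\<close> by (intro mult_left_mono) auto
    finally show ?thesis using *[of "e / (d - c + 1)"] that \<open>c \<le> d\<close> by auto
  qed
  then show ?thesis using field_le_epsilon by blast
qed

text \<open>An error that is o(y - x) uniformly on compact intervals leaves no trace in the total
  increment. The one-sided result is applied to \<open>X\<close> and to its negative.\<close>

lemma primitiveI: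
  assumes p: "bounded_borel p"
    and loc: "\<And>c d e. e > 0 \<Longrightarrow> c \<le> d \<Longrightarrow> \<exists>h>0. \<forall>x y. c \<le> x \<and> x \<le> y \<and> y \<le> d \<and> y - x \<le> h \<longrightarrow>
      \<bar>X y - X x - (LINT t:{x..y}|lborel. p t)\<bar> \<le> e * (y - x)"
  shows "primitive X p"
  unfolding primitive_def
proof (intro conjI allI impI p)
  fix c d :: real assume cd: "c \<le> d"
  have "X d - X c \<le> (LINT t:{c..d}|lborel. p t)"
  proof (rule increment_le_integral[OF p cd])
    fix e :: real assume "e > 0"
    from loc[OF this cd] obtain h where "h>0" "\<forall>x y. c \<le> x \<and> x \<le> y \<and> y \<le> d \<and> y - x \<le> h \<longrightarrow>
      \<bar>X y - X x - (LINT t:{x..y}|lborel. p t)\<bar> \<le> e * (y - x)" by blast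
    then show "\<exists>h>0. \<forall>x y. c \<le> x \<and> x \<le> y \<and> y \<le> d \<and> y - x \<le> h \<longrightarrow>
      X y - X x \<le> (LINT t:{x..y}|lborel. p t) + e * (y - x)"
      by (intro exI[of _ h]) (smt (verit))
  qed
  moreover have "- X d - - X c \<le> (LINT t:{c..d}|lborel. - p t)"
  proof (rule increment_le_integral[OF bounded_borel_uminus[OF p] cd])
    fix e :: real assume "e > 0"
    from loc[OF this cd] obtain h where h: "h>0" "\<And>x y. c \<le> x \<Longrightarrow> x \<le> y \<Longrightarrow> y \<le> d \<Longrightarrow> y - x \<le> h \<Longrightarrow>
      \<bar>X y - X x - (LINT t:{x..y}|lborel. p t)\<bar> \<le> e * (y - x)" by blast
    have "- X y - - X x \<le> (LINT t:{x..y}|lborel. - p t) + e * (y - x)"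
      if "c \<le> x" "x \<le> y" "y \<le> d" "y - x \<le> h" for x y
      using h(2)[OF that] by (subst set_integral_uminus[OF bounded_borel_Icc[OF p]]) linarith
    then show "\<exists>h>0. \<forall>x y. c \<le> x \<and> x \<le> y \<and> y \<le> d \<and> y - x \<le> h \<longrightarrow>
      - X y - - X x \<le> (LINT t:{x..y}|lborel. - p t) + e * (y - x)"
      using h(1) by blast
  qed
  ultimately show "X d - X c = (LINT t:{c..d}|lborel. p t)"
    by (subst (asm) set_integral_uminus[OF bounded_borel_Icc[OF p]]) linarith
qed

lemma primitiveD: "primitive X p \<Longrightarrow> x \<le> y \<Longrightarrow> X y - X x = (LINT t:{x..y}|lborel. p t)"
  by (simp add: primitive_def)

lemma primitive_bounded_borel: "primitive X p \<Longrightarrow> bounded_borel p"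
  by (simp add: primitive_def)

lemma primitive_lipschitz:
  assumes "primitive X p" "\<And>x. \<bar>p x\<bar> \<le> C"
  shows "\<bar>X y - X x\<bar> \<le> C * \<bar>y - x\<bar>"
proof -
  have *: "\<bar>X y - X x\<bar> \<le> C * (y - x)" if "x \<le> y" for x y
    unfolding primitiveD[OF assms(1) that] by (rule LINT_Icc_bound) (use assms that primitive_bounded_borel in auto)
  show ?thesis using *[of x y] *[of y x] by (cases "x \<le> y") (auto simp: abs_minus_commute)
qed

lemma lipschitz_continuous:
  fixes X :: "real \<Rightarrow> real"
  assumes "\<And>x y. \<bar>X y - X x\<bar> \<le> C * \<bar>y - x\<bar>" shows "continuous_on UNIV X"
proof -
  have "C \<ge> 0" using assms[of 0 1] by auto
  then have "C-lipschitz_on UNIV X"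
    using assms by (auto intro!: lipschitz_onI simp: dist_real_def abs_minus_commute)
  then show ?thesis by (rule lipschitz_on_continuous_on)
qed

lemma primitive_continuous: "primitive X p \<Longrightarrow> continuous_on UNIV X"
  using bounded_borel_bound[OF primitive_bounded_borel] lipschitz_continuous primitive_lipschitz by blast

lemma primitive_diff:
  assumes "primitive X p" "primitive Y q" shows "primitive (\<lambda>x. X x - Y x) (\<lambda>x. p x - q x)"
proof -
  have "X y - Y y - (X x - Y x) = (LINT t:{x..y}|lborel. p t - q t)" if "x \<le> y" for x y
    using assms that by (subst LINT_Icc_diff) (auto simp: primitive_def algebra_simps)
  then show ?thesis using assms by (auto simp: primitive_def bounded_borel_diff)
qed

lemma primitive_shift:
  assumes "primitive X p" shows "primitive (\<lambda>x. X (x + h)) (\<lambda>x. p (x + h))"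
  using assms by (auto simp: primitive_def bounded_borel_shift LINT_Icc_shift)

text \<open>A chain rule for \<open>\<bar>X\<bar>\<close> that needs no differentiability of \<open>X\<close>: convexity gives
  \<open>\<bar>X y\<bar> - \<bar>X x\<bar> \<le> sgn (X y) * (X y - X x)\<close> on every short interval.\<close>

lemma abs_increment_le:
  assumes X: "primitive X p" and R: "bounded_borel R" and "c \<le> d"
    and le: "\<And>x y. c \<le> x \<Longrightarrow> x \<le> y \<Longrightarrow> y \<le> d \<Longrightarrow> sgn (X y) * p x \<le> R x + K * \<bar>y - x\<bar>"
  shows "\<bar>X d\<bar> - \<bar>X c\<bar> \<le> (LINT t:{c..d}|lborel. R t)"
proof (rule increment_le_integral[OF R \<open>c \<le> d\<close>])
  fix e :: real assume e: "e > 0"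
  define h where "h = e / (\<bar>K\<bar> + 1)"
  have p: "bounded_borel p" by (rule primitive_bounded_borel[OF X])
  show "\<exists>h>0. \<forall>x y. c \<le> x \<and> x \<le> y \<and> y \<le> d \<and> y - x \<le> h \<longrightarrow>
      \<bar>X y\<bar> - \<bar>X x\<bar> \<le> (LINT t:{x..y}|lborel. R t) + e * (y - x)"
  proof (intro exI[of _ h] conjI allI impI)
    show "h > 0" using e by (simp add: h_def)
    fix x y assume xy: "c \<le> x \<and> x \<le> y \<and> y \<le> d \<and> y - x \<le> h"
    have hK: "K * \<bar>y - t\<bar> \<le> e" if "x \<le> t" "t \<le> y" for t
    proof -
      have "K * \<bar>y - t\<bar> \<le> \<bar>K\<bar> * h" using that xy by (intro mult_mono) auto
      also have "\<dots> \<le> (\<bar>K\<bar> + 1) * h" using \<open>h > 0\<close> by (simp add: algebra_simps)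
      also have "\<dots> = e" by (simp add: h_def)
      finally show ?thesis .
    qed
    have "\<bar>X y\<bar> - \<bar>X x\<bar> \<le> sgn (X y) * (X y - X x)" by (auto simp: sgn_if abs_if)
    also have "\<dots> = (LINT t:{x..y}|lborel. sgn (X y) * p t)"
      using primitiveD[OF X] xy by simp
    also have "\<dots> \<le> (LINT t:{x..y}|lborel. R t + e)"
    proof (rule LINT_Icc_mono)
      fix t assume t: "x \<le> t" "t \<le> y"
      show "sgn (X y) * p t \<le> R t + e" using le[of t y] hK[OF t] t xy by auto
    qed (use p R in \<open>auto intro!: bounded_borel_intros\<close>)
    also have "\<dots> = (LINT t:{x..y}|lborel. R t) + e * (y - x)"
      using xy by (subst LINT_Icc_add) (use R in \<open>auto simp: LINT_Icc_const simp del: set_integral_const\<close>)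
    finally show "\<bar>X y\<bar> - \<bar>X x\<bar> \<le> (LINT t:{x..y}|lborel. R t) + e * (y - x)" .
  qed
qed

text \<open>The mean value theorem turns the increment of \<open>Th\<close> over a short interval
  into \<open>th \<xi>\<close> times the increment of \<open>X\<close>, with one and the same
  \<open>\<xi>\<close> for the whole interval. Uniform continuity of \<open>th\<close> and the
  Lipschitz bound for \<open>X\<close> then allow \<open>th \<xi>\<close> to be replaced by
  \<open>th (X t)\<close> under the integral.\<close>

lemma primitive_chain:
  assumes X: "primitive X p" and S: "\<And>x. X x \<in> {lo..hi}"
    and th: "\<And>u. u \<in> {lo..hi} \<Longrightarrow> (Th has_real_derivative th u) (at u within {lo..hi})"
    and cont: "continuous_on {lo..hi} th"
  shows "primitive (\<lambda>x. Th (X x)) (\<lambda>x. th (X x) * p x)"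
proof (rule primitiveI)
  obtain C where C: "\<And>x. \<bar>p x\<bar> \<le> C" "C > 0" using bounded_borel_bound[OF primitive_bounded_borel[OF X]] by blast
  have Xc: "continuous_on UNIV X" by (rule primitive_continuous[OF X])
  have thX: "continuous_on UNIV (\<lambda>x. th (X x))"
    by (rule continuous_on_compose2[OF cont Xc]) (use S in auto)
  have "compact (th ` {lo..hi})" using cont by (intro compact_continuous_image) auto
  then obtain D where D: "\<And>u. u \<in> {lo..hi} \<Longrightarrow> \<bar>th u\<bar> \<le> D"
    by (metis compact_imp_bounded bounded_iff imageI real_norm_def)
  have bthX: "bounded_borel (\<lambda>x. th (X x))"
    by (rule bounded_borelI[of _ D]) (use borel_measurable_continuous_onI[OF thX] D S in auto)
  show b: "bounded_borel (\<lambda>x. th (X x) * p x)" by (rule bounded_borel_mult[OF bthX primitive_bounded_borel[OF X]])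
  fix c d e :: real assume e: "e > 0" and cd: "c \<le> d"
  have "uniformly_continuous_on {lo..hi} th" by (rule compact_uniformly_continuous[OF cont]) simp
  then obtain r where r: "r > 0" "\<And>u v. u \<in> {lo..hi} \<Longrightarrow> v \<in> {lo..hi} \<Longrightarrow> \<bar>u - v\<bar> < r \<Longrightarrow> \<bar>th u - th v\<bar> < e / C"
    unfolding uniformly_continuous_on_def dist_real_def using e C(2) by (metis divide_pos_pos)
  \<comment> \<open>The point \<open>\<xi>\<close> lies within 2 C h of \<open>X t\<close>, one C h
    for each end of the interval; the 3 makes this strictly less than \<open>r\<close>.\<close>
  define h where "h = r / (3 * C)"
  have Xl: "\<bar>X y - X x\<bar> \<le> C * \<bar>y - x\<bar>" for x y by (rule primitive_lipschitz[OF X C(1)])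
  show "\<exists>h>0. \<forall>x y. c \<le> x \<and> x \<le> y \<and> y \<le> d \<and> y - x \<le> h \<longrightarrow>
     \<bar>Th (X y) - Th (X x) - (LINT t:{x..y}|lborel. th (X t) * p t)\<bar> \<le> e * (y - x)"
  proof (intro exI[of _ h] conjI allI impI)
    show "h > 0" using r C by (simp add: h_def)
    fix x y assume xy: "c \<le> x \<and> x \<le> y \<and> y \<le> d \<and> y - x \<le> h"
    let ?l = "min (X x) (X y)" and ?u = "max (X x) (X y)"
    have sub: "{?l..?u} \<subseteq> {lo..hi}" using S[of x] S[of y] by auto
    have "\<exists>\<xi>\<in>{?l..?u}. Th (X y) - Th (X x) = th \<xi> * (X y - X x)"
    proof -
      have "\<exists>\<xi>\<in>{?l..?u}. Th ?u - Th ?l = th \<xi> * (?u - ?l)"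
      proof (rule mvt_very_simple)
        show "?l \<le> ?u" by auto
        fix u assume u: "?l \<le> u" "u \<le> ?u"
        have "(Th has_real_derivative th u) (at u within {?l..?u})"
          by (rule has_field_derivative_subset[OF th sub]) (use u sub in auto)
        then show "(Th has_derivative (*) (th u)) (at u within {?l..?u})" 
          by (simp add: has_field_derivative_def)
      qed
      then obtain \<xi> where \<xi>: "\<xi> \<in> {?l..?u}" "Th ?u - Th ?l = th \<xi> * (?u - ?l)" by blast
      have "Th (X y) - Th (X x) = th \<xi> * (X y - X x)"
        using \<xi>(2) by (cases "X x \<le> X y") (simp_all add: min_def max_def algebra_simps split: if_splits)
      then show ?thesis using \<xi>(1) by blast
    qed
    then obtain \<xi> where xi: "\<xi> \<in> {?l..?u}" "Th (X y) - Th (X x) = th \<xi> * (X y - X x)" by blast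
    have near: "\<bar>th \<xi> * p t - th (X t) * p t\<bar> \<le> e" if t: "x \<le> t" "t \<le> y" for t
    proof -
      have "\<bar>\<xi> - X t\<bar> \<le> \<bar>X x - X t\<bar> + \<bar>X y - X t\<bar>" using xi(1) by (auto simp: min_def max_def split: if_splits)
      also have "\<dots> \<le> C * h + C * h"
        using Xl[of x t] Xl[of y t] xy t C(2)
        by (intro add_mono order_trans[OF Xl] mult_left_mono) auto
      also have "C * h + C * h < r" using C r(1) by (simp add: h_def)
      finally have *: "\<bar>\<xi> - X t\<bar> < r" .
      have "\<bar>th \<xi> - th (X t)\<bar> * \<bar>p t\<bar> \<le> e / C * C"
        using r(2)[of \<xi> "X t"] * subsetD[OF sub xi(1)] S[of t] C e by (intro mult_mono) (auto intro: less_imp_le)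
      then show ?thesis using C by (simp flip: abs_mult add: left_diff_distrib)
    qed
    have "Th (X y) - Th (X x) - (LINT t:{x..y}|lborel. th (X t) * p t)
        = (LINT t:{x..y}|lborel. th \<xi> * p t - th (X t) * p t)"
      unfolding xi(2) using primitiveD[OF X, of x y] xy
      by (subst LINT_Icc_diff) (use b primitive_bounded_borel[OF X] in \<open>auto intro!: bounded_borel_intros\<close>)
    also have "\<bar>\<dots>\<bar> \<le> e * (y - x)"
      by (rule LINT_Icc_bound) (use b primitive_bounded_borel[OF X] near xy in \<open>auto intro!: bounded_borel_intros\<close>)
    finally show "\<bar>Th (X y) - Th (X x) - (LINT t:{x..y}|lborel. th (X t) * p t)\<bar> \<le> e * (y - x)" .
  qed
qed

section \<open>Compactly supported test functions and integration by parts\<close>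

definition C1c :: "(real \<Rightarrow> real) \<Rightarrow> (real \<Rightarrow> real) \<Rightarrow> bool" where
  "C1c \<theta> \<theta>' \<longleftrightarrow> (\<forall>x. (\<theta> has_real_derivative \<theta>' x) (at x)) \<and> continuous_on UNIV \<theta>' \<and>
     (\<exists>K. \<forall>x. \<bar>x\<bar> \<ge> K \<longrightarrow> \<theta> x = 0 \<and> \<theta>' x = 0)"

lemma C1c_continuous: "C1c \<theta> \<theta>' \<Longrightarrow> continuous_on UNIV \<theta>" "C1c \<theta> \<theta>' \<Longrightarrow> continuous_on UNIV \<theta>'"
  unfolding C1c_def by (auto intro!: DERIV_isCont continuous_at_imp_continuous_on)

lemma compact_support_bounded_borel:
  assumes "continuous_on UNIV f" "\<And>x. \<bar>x\<bar> \<ge> K \<Longrightarrow> f x = 0"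
  shows "bounded_borel f"
proof -
  have "compact (f ` {-K..K})" using assms(1) by (intro compact_continuous_image) (auto intro: continuous_on_subset)
  then obtain D where D: "\<And>x. x \<in> {-K..K} \<Longrightarrow> \<bar>f x\<bar> \<le> D"
    by (metis compact_imp_bounded bounded_iff imageI real_norm_def)
  have "\<bar>f x\<bar> \<le> \<bar>D\<bar>" for x
  proof (cases "\<bar>x\<bar> \<ge> K")
    case True then show ?thesis using assms(2)[of x] by simp
  next
    case False then have "x \<in> {-K..K}" by auto
    then show ?thesis using D by fastforce
  qed
  then show ?thesis using assms(1) by (intro bounded_borelI[of _ "\<bar>D\<bar>"]) (auto intro: borel_measurable_continuous_onI)
qed

lemma C1c_bounded_borel:
  assumes *: "C1c \<theta> \<theta>'" shows "bounded_borel \<theta>" "bounded_borel \<theta>'"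
proof -
  obtain K where K: "\<And>x. \<bar>x\<bar> \<ge> K \<Longrightarrow> \<theta> x = 0 \<and> \<theta>' x = 0"
    using * unfolding C1c_def by blast
  show "bounded_borel \<theta>" by (rule compact_support_bounded_borel[OF C1c_continuous(1)[OF *]]) (use K in blast)
  show "bounded_borel \<theta>'" by (rule compact_support_bounded_borel[OF C1c_continuous(2)[OF *]]) (use K in blast)
qed

lemma primitive_of_C1:
  assumes "\<And>x. (F has_real_derivative f x) (at x)" "continuous_on UNIV f" "bounded_borel f"
  shows "primitive F f"
  unfolding primitive_def
proof (intro conjI allI impI assms)
  fix x y :: real assume "x \<le> y"
  have "(f has_integral (F y - F x)) {x..y}"
    by (rule fundamental_theorem_of_calculus)
       (use assms \<open>x \<le> y\<close> in \<open>auto simp: has_real_derivative_iff_has_vector_derivative intro: has_vector_derivative_at_within\<close>)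
  then show "F y - F x = (LINT t:{x..y}|lborel. f t)"
    using set_borel_integral_eq_integral(2)[OF bounded_borel_Icc[OF assms(3)]] by (simp add: integral_unique)
qed

text \<open>Discrete product rule with one factor frozen at the right end and the other at the left
  end. Each freezing error is at most C D h per unit length, hence the value of \<open>h\<close> in
  the proof.\<close>

lemma primitive_mult:
  assumes X: "primitive X p" and Y: "primitive Y q" and bX: "bounded_borel X" and bY: "bounded_borel Y"
  shows "primitive (\<lambda>x. X x * Y x) (\<lambda>x. p x * Y x + X x * q x)"
proof (rule primitiveI)
  have p: "bounded_borel p" and q: "bounded_borel q" using X Y primitive_bounded_borel by auto
  then show b: "bounded_borel (\<lambda>x. p x * Y x + X x * q x)" using bX bY by (intro bounded_borel_intros)
  fix c d e :: real assume e: "e > 0" and "c \<le> d"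
  obtain C where C: "C > 0" "\<And>x. \<bar>p x\<bar> \<le> C" using bounded_borel_bound[OF p] by blast
  obtain D where D: "D > 0" "\<And>x. \<bar>q x\<bar> \<le> D" using bounded_borel_bound[OF q] by blast
  define h where "h = e / (2 * C * D)"
  show "\<exists>h>0. \<forall>x y. c \<le> x \<and> x \<le> y \<and> y \<le> d \<and> y - x \<le> h \<longrightarrow>
     \<bar>X y * Y y - X x * Y x - (LINT t:{x..y}|lborel. p t * Y t + X t * q t)\<bar> \<le> e * (y - x)"
  proof (intro exI[of _ h] conjI allI impI)
    show "h > 0" using e C D by (simp add: h_def)
    fix x y assume xy: "c \<le> x \<and> x \<le> y \<and> y \<le> d \<and> y - x \<le> h"
    have "X y * Y y - X x * Y x = (X y - X x) * Y y + X x * (Y y - Y x)" by (simp add: algebra_simps)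
    also have "\<dots> = (LINT t:{x..y}|lborel. p t * Y y + X x * q t)"
      using primitiveD[OF X, of x y] primitiveD[OF Y, of x y] xy
      by (subst LINT_Icc_add) (use p q in \<open>auto intro!: bounded_borel_intros\<close>)
    finally have "X y * Y y - X x * Y x - (LINT t:{x..y}|lborel. p t * Y t + X t * q t)
       = (LINT t:{x..y}|lborel. (p t * Y y + X x * q t) - (p t * Y t + X t * q t))"
      by (subst LINT_Icc_diff) (use p q b in \<open>auto intro!: bounded_borel_intros\<close>)
    also have "\<bar>\<dots>\<bar> \<le> e * (y - x)"
    proof (rule LINT_Icc_bound)
      fix t assume t: "x \<le> t" "t \<le> y"
      have "\<bar>p t * (Y y - Y t)\<bar> \<le> C * (D * h)"
        unfolding abs_mult using t xy D C
        by (intro mult_mono order_trans[OF primitive_lipschitz[OF Y D(2)]] mult_left_mono) auto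
      moreover have "\<bar>(X t - X x) * q t\<bar> \<le> (C * h) * D"
        unfolding abs_mult using t xy D C
        by (intro mult_mono order_trans[OF primitive_lipschitz[OF X C(2)]] mult_left_mono) auto
      moreover have "C * (D * h) + (C * h) * D = e" using C D by (simp add: h_def field_simps)
      moreover have "(p t * Y y + X x * q t) - (p t * Y t + X t * q t) = p t * (Y y - Y t) - (X t - X x) * q t"
        by (simp add: algebra_simps)
      ultimately show "\<bar>(p t * Y y + X x * q t) - (p t * Y t + X t * q t)\<bar> \<le> e" by linarith
    qed (use p q b xy in \<open>auto intro!: bounded_borel_intros\<close>)
    finally show "\<bar>X y * Y y - X x * Y x - (LINT t:{x..y}|lborel. p t * Y t + X t * q t)\<bar> \<le> e * (y - x)" .
  qed
qed

lemma LINT_compact_support: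
  assumes "bounded_borel f" "\<And>x. \<bar>x\<bar> \<ge> K \<Longrightarrow> f x = 0"
  shows "integrable lborel f" "(LINT t|lborel. f t) = (LINT t:{-K..K}|lborel. f t)"
proof -
  have "f t = indicator {-K..K} t * f t" for t
    using assms(2)[of t] by (cases "\<bar>t\<bar> \<ge> K") (auto simp: indicator_def)
  then have eq: "f = (\<lambda>t. indicator {-K..K} t * f t)" by blast
  show "integrable lborel f" "(LINT t|lborel. f t) = (LINT t:{-K..K}|lborel. f t)"
    using bounded_borel_Icc[OF assms(1), of "-K" K] unfolding set_integrable_def set_lebesgue_integral_def
    by (simp_all flip: eq)
qed

lemma integration_by_parts:
  assumes X: "primitive X p" and bX: "bounded_borel X" and chi: "C1c \<theta> \<theta>'"
  shows "(LINT x|lborel. \<theta> x * p x) = - (LINT x|lborel. \<theta>' x * X x)"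
proof -
  obtain K where K: "\<And>x. \<bar>x\<bar> \<ge> K \<Longrightarrow> \<theta> x = 0 \<and> \<theta>' x = 0" using chi by (auto simp: C1c_def)
  define N where "N = max K 0"
  have P: "primitive (\<lambda>x. \<theta> x * X x) (\<lambda>x. \<theta>' x * X x + \<theta> x * p x)"
    by (rule primitive_mult[OF primitive_of_C1 X C1c_bounded_borel(1)[OF chi] bX])
       (use chi C1c_bounded_borel[OF chi] in \<open>simp_all add: C1c_def\<close>)
  have "\<theta> N = 0" "\<theta> (-N) = 0" using K[of N] K[of "-N"] by (simp_all add: N_def)
  moreover have "-N \<le> N" by (simp add: N_def)
  ultimately have "0 = (LINT t:{-N..N}|lborel. \<theta>' t * X t + \<theta> t * p t)"
    using primitiveD[OF P, of "-N" N] by simp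
  also have "\<dots> = (LINT t|lborel. \<theta>' t * X t + \<theta> t * p t)"
    by (rule LINT_compact_support(2)[symmetric, OF primitive_bounded_borel[OF P]]) (use K in \<open>simp add: N_def\<close>)
  also have "\<dots> = (LINT t|lborel. \<theta>' t * X t) + (LINT t|lborel. \<theta> t * p t)"
    by (intro Bochner_Integration.integral_add LINT_compact_support(1)[of _ K] bounded_borel_mult C1c_bounded_borel[OF chi]
         bX primitive_bounded_borel[OF X]) (use K in simp_all)
  finally show ?thesis by simp
qed

section \<open>The bounded solution of a linear relaxation equation\<close>

text \<open>Variation of constants from minus infinity: this is the solution, bounded on the whole
  line, of r' + k r = h. No boundary condition is imposed; boundedness selects it.\<close>

definition relax :: "real \<Rightarrow> (real \<Rightarrow> real) \<Rightarrow> real \<Rightarrow> real" where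
  "relax k h x = (LINT u:{0<..}|lborel. exp (- (k * u)) * h (x - u))"

lemma exp_decay_integral:
  fixes k :: real assumes "k > 0"
  shows "set_integrable lborel {0<..} (\<lambda>u. exp (- (k * u)))"
    and "(LINT u:{0<..}|lborel. exp (- (k * u))) = 1 / k"
proof -
  have hi: "((\<lambda>u. exp (- (k * u))) has_integral 1 / k) {0<..}"
  proof -
    have "((\<lambda>u. exp (- (k * u))) has_integral 1 / k) {0..}"
      using has_integral_exp_minus_to_infinity[OF assms, of 0] by simp
    moreover have "negligible {u \<in> {0..} - {0<..}. exp (- (k * u)) \<noteq> 0}"
      by (rule negligible_subset[OF negligible_sing[of 0]]) force
    moreover have "negligible {u \<in> {0<..} - {0..}. exp (- (k * u)) \<noteq> 0}"
      by (rule negligible_subset[OF negligible_empty]) force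
    ultimately show ?thesis
      using has_integral_spike_set_eq[of "{0..}" "{0<..}" "\<lambda>u. exp (- (k * u))" "1 / k"] by blast
  qed
  have "(\<lambda>u. exp (- (k * u))) absolutely_integrable_on {0<..}"
    using hi by (intro nonnegative_absolutely_integrable_1) (auto simp: has_integral_iff)
  then show 1: "set_integrable lborel {0<..} (\<lambda>u. exp (- (k * u)))"
    unfolding set_integrable_def by (subst (asm) integrable_completion) auto
  show "(LINT u:{0<..}|lborel. exp (- (k * u))) = 1 / k"
    using set_borel_integral_eq_integral(2)[OF 1] hi by (simp add: integral_unique)
qed

lemma bounded_borel_reflect:
  assumes "bounded_borel h" shows "bounded_borel (\<lambda>u. h (x - u))"
proof -
  have [measurable]: "h \<in> borel_measurable borel" and "\<exists>C. \<forall>x. \<bar>h x\<bar> \<le> C"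
    using assms by (auto simp: bounded_borel_def)
  then show ?thesis unfolding bounded_borel_def by (intro conjI) (measurable, blast)
qed

lemma relax_integrable:
  assumes "k > 0" "bounded_borel h"
  shows "set_integrable lborel {0<..} (\<lambda>u. exp (- (k * u)) * h (x - u))"
proof -
  obtain C where C: "C > 0" "\<And>x. \<bar>h x\<bar> \<le> C" using bounded_borel_bound[OF assms(2)] by blast
  have m[measurable]: "(\<lambda>u. h (x - u)) \<in> borel_measurable borel"
    using bounded_borel_reflect[OF assms(2)] by (rule bounded_borel_measurable)
  have "set_integrable lborel {0<..} (\<lambda>u. C * exp (- (k * u)))"
    by (rule set_integrable_mult_right) (rule exp_decay_integral(1)[OF assms(1)])
  then show ?thesis
  proof (rule set_integrable_bound)
    show "set_borel_measurable lborel {0<..} (\<lambda>u. exp (- (k * u)) * h (x - u))"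
      unfolding set_borel_measurable_def by measurable
    show "AE u in lborel. u \<in> {0<..} \<longrightarrow> norm (exp (- (k * u)) * h (x - u)) \<le> norm (C * exp (- (k * u)))"
    proof (intro AE_I2 impI)
      fix u
      have "exp (- (k * u)) * \<bar>h (x - u)\<bar> \<le> exp (- (k * u)) * C" using C by (intro mult_left_mono) auto
      then show "norm (exp (- (k * u)) * h (x - u)) \<le> norm (C * exp (- (k * u)))"
        using C(1) by (simp add: abs_mult mult.commute)
    qed
  qed
qed

lemma relax_const: "k > 0 \<Longrightarrow> relax k (\<lambda>x. c) x = c / k"
  unfolding relax_def by (simp add: exp_decay_integral(2))

lemma relax_mono:
  assumes "k > 0" "bounded_borel g" "bounded_borel h" "\<And>x. g x \<le> h x"
  shows "relax k g x \<le> relax k h x"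
  unfolding relax_def by (rule set_integral_mono) (use assms relax_integrable in auto)

lemma relax_diff:
  assumes "k > 0" "bounded_borel g" "bounded_borel h"
  shows "relax k (\<lambda>x. g x - h x) x = relax k g x - relax k h x"
  unfolding relax_def right_diff_distrib
  by (rule set_integral_diff) (use assms relax_integrable in auto)

lemma relax_bounds:
  assumes "k > 0" "bounded_borel h" "\<And>x. lo \<le> h x" "\<And>x. h x \<le> hi"
  shows "lo / k \<le> relax k h x" "relax k h x \<le> hi / k"
  using relax_mono[of k "\<lambda>x. lo" h] relax_mono[of k h "\<lambda>x. hi"] assms by (auto simp: relax_const)

lemma relax_diff_bound:
  assumes "k > 0" "bounded_borel g" "bounded_borel h" "\<And>x. \<bar>g x - h x\<bar> \<le> C"
  shows "\<bar>relax k g x - relax k h x\<bar> \<le> C / k"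
proof -
  have "bounded_borel (\<lambda>x. g x - h x)" using assms by (intro bounded_borel_intros)
  moreover have "- C \<le> g x - h x" "g x - h x \<le> C" for x using assms(4)[of x] by auto
  ultimately show ?thesis
    using relax_bounds[of k "\<lambda>x. g x - h x" "-C" C x] assms by (auto simp: relax_diff abs_le_iff)
qed

text \<open>Duhamel's formula for a stretch of length \<open>d\<close>: the integral is split at
  \<open>u = d\<close> and the tail is translated back.\<close>

lemma relax_step:
  assumes k: "k > 0" and h: "bounded_borel h" and d: "d \<ge> 0"
  shows "relax k h (x + d) = (LINT u:{0..d}|lborel. exp (- (k * u)) * h (x + d - u)) + exp (- (k * d)) * relax k h x"
proof -
  let ?f = "\<lambda>u. exp (- (k * u)) * h (x + d - u)"
  have i: "set_integrable lborel {0<..} ?f" by (rule relax_integrable[OF k h])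
  have "{0<..} = {0<..d} \<union> {d<..}" using d by auto
  then have "relax k h (x + d) = (LINT u:{0<..d} \<union> {d<..}|lborel. ?f u)" by (simp add: relax_def)
  also have "\<dots> = (LINT u:{0<..d}|lborel. ?f u) + (LINT u:{d<..}|lborel. ?f u)"
    by (rule set_integral_Un) (use d in \<open>auto intro!: set_integrable_subset[OF i]\<close>)
  also have "(LINT u:{0<..d}|lborel. ?f u) = (LINT u:{0..d}|lborel. ?f u)"
    by (rule set_integral_discrete_difference[of "{0}"]) auto
  also have "(LINT u:{d<..}|lborel. ?f u) = (LINT u:{0<..}|lborel. exp (- (k * d)) * (exp (- (k * u)) * h (x - u)))"
    unfolding set_lebesgue_integral_def
    by (subst lborel_integral_real_affine[of 1 _ d])
       (auto intro!: Bochner_Integration.integral_cong simp: indicator_def algebra_simps simp flip: exp_add)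
  also have "\<dots> = exp (- (k * d)) * relax k h x" by (simp add: relax_def)
  finally show ?thesis .
qed

lemma exp_decay_bounds:
  fixes v :: real assumes "v \<ge> 0" shows "1 - v \<le> exp (- v)" "exp (- v) \<le> 1" "exp (- v) - 1 + v \<le> v\<^sup>2"
proof -
  show "1 - v \<le> exp (- v)" using exp_ge_add_one_self[of "-v"] by simp
  show "exp (- v) \<le> 1" using assms by simp
  have "exp (- v) \<le> 1 / (1 + v)"
    using exp_ge_add_one_self[of v] assms by (auto simp: exp_minus field_simps)
  also have "\<dots> \<le> 1 - v + v\<^sup>2"
  proof -
    \<comment> \<open>The product equals 1 + v^3.\<close>
    have "1 \<le> (1 - v + v\<^sup>2) * (1 + v)" using assms by (simp add: algebra_simps power2_eq_square)
    then show ?thesis using assms by (simp add: pos_divide_le_eq)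
  qed
  finally show "exp (- v) - 1 + v \<le> v\<^sup>2" by simp
qed

text \<open>First order expansion of \<open>relax_step\<close> in \<open>d\<close>: replacing the
  kernel by 1 and exp(-k d) by 1 - k d costs O(d^2). A Lipschitz bound and continuity of
  \<open>relax k h\<close> come first, so that the proposed derivative is known to be Borel and its
  value at \<open>x\<close> may be frozen.\<close>

lemma relax_primitive:
  assumes k: "k > 0" and h: "bounded_borel h"
  shows "primitive (relax k h) (\<lambda>x. h x - k * relax k h x)"
proof -
  let ?r = "relax k h"
  obtain C where C: "C > 0" "\<And>x. \<bar>h x\<bar> \<le> C" using bounded_borel_bound[OF h] by blast
  have rb: "\<bar>?r x\<bar> \<le> C / k" for x
    using relax_diff_bound[OF k h, of "\<lambda>x. 0" C x] C by (auto simp: relax_const[OF k])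
  \<comment> \<open>The kernel, frozen at 1 for negative \<open>u\<close> so that it is bounded on
    the whole line; only \<open>u \<ge> 0\<close> matters below.\<close>
  define w where "w u = exp (- (k * max 0 u))" for u
  have w: "bounded_borel w" 
    unfolding w_def by (rule bounded_borelI[of _ 1]) (use k in \<open>auto intro!: borel_measurable_continuous_onI continuous_intros\<close>)
  have hr: "bounded_borel (\<lambda>u. h (y - u))" for y by (rule bounded_borel_reflect[OF h])
  have refl: "(LINT u:{0..d}|lborel. h (x + d - u)) = (LINT t:{x..x+d}|lborel. h t)" for x d
    unfolding set_lebesgue_integral_def
    by (subst (2) lborel_integral_real_affine[of "-1" _ "x+d"])
       (auto intro!: Bochner_Integration.integral_cong simp: indicator_def)
  have step: "?r (x + d) - ?r x = (LINT u:{0..d}|lborel. (w u - 1) * h (x + d - u)) + (LINT t:{x..x+d}|lborel. h t)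
     + (exp (- (k * d)) - 1) * ?r x" if d: "d \<ge> 0" for x d
  proof -
    have "(LINT u:{0..d}|lborel. exp (- (k * u)) * h (x + d - u)) = (LINT u:{0..d}|lborel. w u * h (x + d - u))"
      by (rule set_lebesgue_integral_cong) (auto simp: w_def)
    moreover have "(LINT u:{0..d}|lborel. (w u - 1) * h (x + d - u))
      = (LINT u:{0..d}|lborel. w u * h (x + d - u)) - (LINT u:{0..d}|lborel. h (x + d - u))"
      unfolding left_diff_distrib mult_1 by (intro LINT_Icc_diff bounded_borel_mult w hr)
    ultimately show ?thesis
      using relax_step[OF k h d, of x] refl[of d x] by (simp add: algebra_simps)
  qed
  have w1: "\<bar>w u - 1\<bar> \<le> k * d" if "0 \<le> u" "u \<le> d" for u d
  proof -
    have "k * u \<ge> 0" "k * u \<le> k * d" using that k by (auto intro: mult_left_mono)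
    then show ?thesis using exp_decay_bounds(1,2)[of "k * u"] that by (simp add: w_def)
  qed
  have first: "\<bar>LINT u:{0..d}|lborel. (w u - 1) * h (x + d - u)\<bar> \<le> k * d * C * d" if d: "d \<ge> 0" for x d
  proof -
    have "\<bar>LINT u:{0..d}|lborel. (w u - 1) * h (x + d - u)\<bar> \<le> (k * d * C) * (d - 0)"
    proof (rule LINT_Icc_bound)
      show "bounded_borel (\<lambda>u. (w u - 1) * h (x + d - u))"
        by (intro bounded_borel_mult bounded_borel_diff bounded_borel_const w hr)
      fix u assume "0 \<le> u" "u \<le> d"
      then show "\<bar>(w u - 1) * h (x + d - u)\<bar> \<le> k * d * C"
        unfolding abs_mult using w1[of u d] C d k by (intro mult_mono) auto
    qed (rule d)
    then show ?thesis by simp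
  qed
  have ed: "\<bar>exp (- (k * d)) - 1\<bar> \<le> k * d" "\<bar>exp (- (k * d)) - 1 + k * d\<bar> \<le> (k * d)\<^sup>2" if "d \<ge> 0" for d
    using exp_decay_bounds[of "k * d"] that k by auto
  have lip: "\<bar>?r (x + d) - ?r x\<bar> \<le> (C * (k * d) + 2 * C) * d" if d: "d \<ge> 0" for x d
  proof -
    have "\<bar>(exp (- (k * d)) - 1) * ?r x\<bar> \<le> (k * d) * (C / k)"
      unfolding abs_mult using ed(1)[OF d] rb[of x] d k by (intro mult_mono) auto
    moreover have "\<bar>LINT t:{x..x+d}|lborel. h t\<bar> \<le> C * (x + d - x)"
      by (rule LINT_Icc_bound) (use h C d in auto)
    ultimately show ?thesis using step[OF d, of x] first[OF d, of x] k by (simp add: algebra_simps abs_le_iff)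
  qed
  have rc: "continuous_on UNIV ?r"
  proof -
    have right: "\<exists>\<delta>>0. \<forall>x y. x \<le> y \<and> y - x < \<delta> \<longrightarrow> \<bar>?r y - ?r x\<bar> < e" if e: "e > 0" for e
    proof (intro exI[of _ "min (1 / k) (e / (4 * C))"] conjI allI impI)
      show "min (1 / k) (e / (4 * C)) > 0" using k C e by simp
      fix x y assume xy: "x \<le> y \<and> y - x < min (1 / k) (e / (4 * C))"
      then have kd: "k * (y - x) \<le> 1" using k by (simp add: field_simps)
      have "\<bar>?r y - ?r x\<bar> \<le> (C * (k * (y - x)) + 2 * C) * (y - x)" using lip[of "y - x" x] xy by simp
      also have "\<dots> \<le> (3 * C) * (y - x)"
      proof (rule mult_right_mono)
        have "C * (k * (y - x)) \<le> C * 1" using kd C(1) by (intro mult_left_mono) auto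
        then show "C * (k * (y - x)) + 2 * C \<le> 3 * C" by simp
      qed (use xy in simp)
      also have "\<dots> \<le> (3 * C) * (e / (4 * C))" using xy C by (intro mult_left_mono) auto
      also have "\<dots> < e" using C e by simp
      finally show "\<bar>?r y - ?r x\<bar> < e" .
    qed
    show ?thesis unfolding continuous_on_iff
    proof (intro ballI allI impI)
      fix x e :: real assume "e > 0"
      from right[OF this] obtain \<delta> where d: "\<delta> > 0" "\<And>x y. x \<le> y \<Longrightarrow> y - x < \<delta> \<Longrightarrow> \<bar>?r y - ?r x\<bar> < e" by blast
      have "dist (?r y) (?r x) < e" if "dist y x < \<delta>" for y
        using d(2)[of x y] d(2)[of y x] that by (cases "x \<le> y") (auto simp: dist_real_def abs_minus_commute)
      then show "\<exists>d>0. \<forall>x'\<in>UNIV. dist x' x < d \<longrightarrow> dist (?r x') (?r x) < e" using d(1) by blast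
    qed
  qed
  have br: "bounded_borel ?r" by (rule bounded_borelI[OF borel_measurable_continuous_onI[OF rc] rb])
  show ?thesis
  proof (rule primitiveI)
    show bp: "bounded_borel (\<lambda>x. h x - k * ?r x)" using h br by (intro bounded_borel_intros)
    fix c d e :: real assume e: "e > 0" and "c \<le> d"
    \<comment> \<open>The bound 1 / k gives k D <= 1 and hence the Lipschitz constant 3 C. The 5
      counts the three errors, which are 1, 1 and 3 times C k D^2.\<close>
    define \<delta> where "\<delta> = min (1 / k) (e / (5 * C * k))"
    show "\<exists>\<delta>>0. \<forall>x y. c \<le> x \<and> x \<le> y \<and> y \<le> d \<and> y - x \<le> \<delta> \<longrightarrow>
       \<bar>?r y - ?r x - (LINT t:{x..y}|lborel. h t - k * ?r t)\<bar> \<le> e * (y - x)"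
    proof (intro exI[of _ \<delta>] conjI allI impI)
      show "\<delta> > 0" using e k C by (simp add: \<delta>_def)
      fix x y assume xy: "c \<le> x \<and> x \<le> y \<and> y \<le> d \<and> y - x \<le> \<delta>"
      define D where "D = y - x"
      have D: "D \<ge> 0" "y = x + D" using xy by (auto simp: D_def)
      have D1: "D \<le> 1 / k" "D \<le> e / (5 * C * k)" using xy by (auto simp: D_def \<delta>_def)
      have kD: "k * D \<le> 1" using D1(1) k by (simp add: field_simps)
      have kD2: "5 * C * k * D \<le> e" using D1(2) k C(1) by (simp add: field_simps)
      have split: "(LINT t:{x..y}|lborel. h t - k * ?r t)
          = (LINT t:{x..y}|lborel. h t) - k * D * ?r x - (LINT t:{x..y}|lborel. k * (?r t - ?r x))"
      proof -
        have "(LINT t:{x..y}|lborel. k * (?r t - ?r x)) = (LINT t:{x..y}|lborel. k * ?r t) - (LINT t:{x..y}|lborel. k * ?r x)"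
          unfolding right_diff_distrib by (intro LINT_Icc_diff bounded_borel_intros br)
        moreover have "(LINT t:{x..y}|lborel. k * ?r x) = k * ?r x * (y - x)" using xy by (intro LINT_Icc_const) auto
        moreover have "(LINT t:{x..y}|lborel. h t - k * ?r t) = (LINT t:{x..y}|lborel. h t) - (LINT t:{x..y}|lborel. k * ?r t)"
          by (intro LINT_Icc_diff bounded_borel_intros br h)
        ultimately show ?thesis by (simp add: D_def algebra_simps)
      qed
      have "\<bar>LINT t:{x..y}|lborel. k * (?r t - ?r x)\<bar> \<le> (k * (3 * C * D)) * (y - x)"
      proof (rule LINT_Icc_bound)
        show "bounded_borel (\<lambda>t. k * (?r t - ?r x))" by (intro bounded_borel_intros br)
        fix t assume t: "x \<le> t" "t \<le> y"
        have "\<bar>?r t - ?r x\<bar> \<le> (C * (k * (t - x)) + 2 * C) * (t - x)" using lip[of "t - x" x] t by simp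
        also have "\<dots> \<le> (3 * C) * D"
        proof (rule mult_mono)
          have "k * (t - x) \<le> k * D" using t k by (intro mult_left_mono) (auto simp: D_def)
          then have "C * (k * (t - x)) \<le> C * 1" using kD C(1) by (intro mult_left_mono) auto
          then show "C * (k * (t - x)) + 2 * C \<le> 3 * C" by simp
        qed (use t C in \<open>auto simp: D_def\<close>)
        finally show "\<bar>k * (?r t - ?r x)\<bar> \<le> k * (3 * C * D)"
          using k by (simp add: abs_mult)
      qed (use xy in auto)
      then have e3: "\<bar>LINT t:{x..y}|lborel. k * (?r t - ?r x)\<bar> \<le> 3 * (C * k * D) * D" by (simp add: D_def algebra_simps)
      have "\<bar>(exp (- (k * D)) - 1 + k * D) * ?r x\<bar> \<le> (k * D)\<^sup>2 * (C / k)"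
        unfolding abs_mult using ed(2)[OF D(1)] rb[of x] by (intro mult_mono) auto
      then have e2: "\<bar>(exp (- (k * D)) - 1 + k * D) * ?r x\<bar> \<le> (C * k * D) * D"
        using k by (simp add: power2_eq_square algebra_simps)
      have e1: "\<bar>LINT u:{0..D}|lborel. (w u - 1) * h (x + D - u)\<bar> \<le> (C * k * D) * D"
        using first[OF D(1), of x] by (simp add: algebra_simps)
      have "?r y - ?r x - (LINT t:{x..y}|lborel. h t - k * ?r t)
        = (LINT u:{0..D}|lborel. (w u - 1) * h (x + D - u)) + (exp (- (k * D)) - 1 + k * D) * ?r x
          + (LINT t:{x..y}|lborel. k * (?r t - ?r x))"
        unfolding split using step[OF D(1), of x] D(2) by (simp add: algebra_simps)
      then have "\<bar>?r y - ?r x - (LINT t:{x..y}|lborel. h t - k * ?r t)\<bar> \<le> 5 * (C * k * D) * D"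
        using e1 e2 e3 by linarith
      also have "\<dots> \<le> e * D" using kD2 D(1) by (intro mult_right_mono) (auto simp: algebra_simps)
      finally show "\<bar>?r y - ?r x - (LINT t:{x..y}|lborel. h t - k * ?r t)\<bar> \<le> e * (y - x)" by (simp add: D_def)
    qed
  qed
qed

section \<open>The implicit step: setting and existence\<close>

text \<open>Here \<open>s\<close> is the initial stress and \<open>P\<close> an increasing function
  whose increments dominate those of \<open>s\<close>. The function \<open>f\<close> stands for r
  |-> -G(1/r), continued to the whole line with slopes between \<open>m\<close> and
  \<open>L\<close>, so that its inverse \<open>\<phi>\<close> is total.\<close>

locale flux_data =
  fixes a b m L TV :: real and s f \<phi> P :: "real \<Rightarrow> real"
  assumes a_pos: "0 < a" and a_le_b: "a \<le> b"
    and s_bounds: "\<And>x. a \<le> s x" "\<And>x. s x \<le> b"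
    and s_measurable [measurable]: "s \<in> borel_measurable borel"
    and P_bounds: "\<And>x. 0 \<le> P x" "\<And>x. P x \<le> TV" and P_mono: "mono P"
    and s_variation: "\<And>x y. x \<le> y \<Longrightarrow> \<bar>s y - s x\<bar> \<le> P y - P x"
    and m_pos: "0 < m"
    and f_bounds: "\<And>x y. x \<le> y \<Longrightarrow> m * (y - x) \<le> f y - f x" "\<And>x y. x \<le> y \<Longrightarrow> f y - f x \<le> L * (y - x)"
    and f_phi: "\<And>u. f (\<phi> u) = u"
begin

text \<open>\<open>A\<close> and \<open>B\<close> bound the unknown r = eta / v, the reciprocal of
  the stress in [a, b].\<close>

definition "A = 1 / b"
definition "B = 1 / a"

lemma b_pos: "b > 0" using a_pos a_le_b by simp
lemma s_pos: "s x > 0" using s_bounds(1)[of x] a_pos by simp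
lemma A_le_B: "A \<le> B" using a_pos a_le_b by (simp add: A_def B_def frac_le)
lemma A_pos: "A > 0" using b_pos by (simp add: A_def)
lemma B_pos: "B > 0" using a_pos by (simp add: B_def)
lemma m_le_L: "m \<le> L" using f_bounds[of 0 1] by simp
lemma L_pos: "L > 0" using m_le_L m_pos by simp

lemma f_strict: "x < y \<Longrightarrow> f x < f y"
  using f_bounds(1)[of x y] m_pos by (smt (verit) mult_pos_pos)

lemma f_mono: "x \<le> y \<Longrightarrow> f x \<le> f y" using f_strict[of x y] by (cases "x = y") auto

lemma f_less_iff: "f x < f y \<longleftrightarrow> x < y" using f_strict[of x y] f_mono[of y x] by (auto simp: not_less[symmetric])
lemma f_le_iff: "f x \<le> f y \<longleftrightarrow> x \<le> y" using f_less_iff[of y x] by (auto simp: not_less[symmetric])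

lemma phi_f: "\<phi> (f x) = x"
  using f_less_iff[of "\<phi> (f x)" x] f_less_iff[of x "\<phi> (f x)"] f_phi[of "f x"] by auto

lemma phi_le_iff: "\<phi> u \<le> \<phi> v \<longleftrightarrow> u \<le> v" using f_le_iff[of "\<phi> u" "\<phi> v"] by (simp add: f_phi)
lemma phi_less_iff: "\<phi> u < \<phi> v \<longleftrightarrow> u < v" using f_less_iff[of "\<phi> u" "\<phi> v"] by (simp add: f_phi)
lemma phi_eq_iff: "\<phi> u = \<phi> v \<longleftrightarrow> u = v" by (metis f_phi)

lemma f_lipschitz: "\<bar>f y - f x\<bar> \<le> L * \<bar>y - x\<bar>"
  using f_bounds(2)[of x y] f_bounds(2)[of y x] f_mono[of x y] f_mono[of y x]
  by (cases "x \<le> y") (auto simp: abs_if)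

lemma phi_bounds:
  assumes "u \<le> v"
  shows "\<phi> v - \<phi> u \<le> (v - u) / m" "(v - u) / L \<le> \<phi> v - \<phi> u"
proof -
  have "\<phi> u \<le> \<phi> v" using assms by (simp add: phi_le_iff)
  from f_bounds[OF this] show "\<phi> v - \<phi> u \<le> (v - u) / m" "(v - u) / L \<le> \<phi> v - \<phi> u"
    using m_pos L_pos by (simp_all add: f_phi field_simps)
qed

lemma phi_lipschitz: "\<bar>\<phi> v - \<phi> u\<bar> \<le> \<bar>v - u\<bar> / m"
  using phi_bounds(1)[of u v] phi_bounds(1)[of v u] phi_le_iff[of u v] phi_le_iff[of v u]
  by (cases "u \<le> v") (auto simp: abs_if)

lemma phi_expand: "\<bar>v - u\<bar> \<le> L * \<bar>\<phi> v - \<phi> u\<bar>"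
  using f_lipschitz[of "\<phi> v" "\<phi> u"] by (simp add: f_phi)

lemma sgn_phi: "sgn (\<phi> u - \<phi> v) = sgn (u - v)"
  using phi_less_iff[of u v] phi_less_iff[of v u] by (auto simp: sgn_if)

lemma phi_continuous: "continuous_on UNIV \<phi>"
  by (rule lipschitz_continuous[of _ "1 / m"]) (use phi_lipschitz in \<open>simp add: abs_minus_commute\<close>)

lemma f_continuous: "continuous_on UNIV f"
  by (rule lipschitz_continuous) (rule f_lipschitz)

lemma phi_measurable [measurable]: "\<phi> \<in> borel_measurable borel"
  using phi_continuous by (rule borel_measurable_continuous_onI)

lemma f_measurable [measurable]: "f \<in> borel_measurable borel"
  using f_continuous by (rule borel_measurable_continuous_onI)

lemma phi_range: "u \<in> {f A..f B} \<Longrightarrow> \<phi> u \<in> {A..B}"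
  using phi_le_iff[of "f A" u] phi_le_iff[of u "f B"] by (simp add: phi_f)

lemma s_bounded_borel: "bounded_borel s"
  using s_bounds s_pos by (intro bounded_borelI[of _ b]) (auto simp: less_imp_le abs_of_pos)

text \<open>With V = \<phi> z this is the implicit step s (V - g) / \<tau> + f(V)_x = 0. The unknown
  is the flux and not the density, because z is Lipschitz in x while V - g and s may jump.\<close>

definition resolves :: "real \<Rightarrow> (real \<Rightarrow> real) \<Rightarrow> (real \<Rightarrow> real) \<Rightarrow> bool" where
  "resolves \<tau> g z \<longleftrightarrow> (\<forall>x. z x \<in> {f A..f B}) \<and> primitive z (\<lambda>x. s x * (g x - \<phi> (z x)) / \<tau>)"

lemma range_bounded_borel:
  assumes "g \<in> borel_measurable borel" "\<And>x. g x \<in> {A..B}" shows "bounded_borel g"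
proof (rule bounded_borelI[OF assms(1)])
  show "\<bar>g x\<bar> \<le> B" for x using assms(2)[of x] A_pos by auto
qed

text \<open>The slope of s \<phi> / \<tau> lies between a / (\<tau> L) and b / (\<tau> m).
  Subtracting it from the constant b / (\<tau> m) leaves an increasing function whose slope is
  strictly below that constant.\<close>

lemma relaxation_monotone:
  assumes "\<tau> > 0" and "u \<le> v"
  shows "0 \<le> b / (\<tau> * m) * (v - u) - s x / \<tau> * (\<phi> v - \<phi> u)"
    and "b / (\<tau> * m) * (v - u) - s x / \<tau> * (\<phi> v - \<phi> u) \<le> (b / (\<tau> * m) - a / (\<tau> * L)) * (v - u)"
proof -
  have "s x / \<tau> * (\<phi> v - \<phi> u) \<le> b / \<tau> * ((v - u) / m)"
    using assms s_bounds phi_bounds[of u v] phi_le_iff[of u v] b_pos by (intro mult_mono divide_right_mono) auto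
  then show "0 \<le> b / (\<tau> * m) * (v - u) - s x / \<tau> * (\<phi> v - \<phi> u)" by simp
  have "a / \<tau> * ((v - u) / L) \<le> s x / \<tau> * (\<phi> v - \<phi> u)"
    using assms s_bounds phi_bounds[of u v] a_pos s_pos[of x] L_pos
    by (intro mult_mono divide_right_mono) (auto simp: less_imp_le)
  then show "b / (\<tau> * m) * (v - u) - s x / \<tau> * (\<phi> v - \<phi> u) \<le> (b / (\<tau> * m) - a / (\<tau> * L)) * (v - u)"
    by (simp add: algebra_simps)
qed

text \<open>Adding k z to both sides gives z' + k z = H(z), that is, the fixed point equation z =
  \<open>relax k (H z)\<close>. With k = b / (\<tau> m) the map \<open>H\<close> is increasing and
  has Lipschitz constant q k with q < 1, and \<open>relax k\<close> gains the factor 1 / k, so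
  Banach's theorem applies in the supremum norm.\<close>

lemma resolvent_exists:
  assumes tau: "\<tau> > 0" and g: "g \<in> borel_measurable borel" "\<And>x. g x \<in> {A..B}"
  shows "\<exists>z. resolves \<tau> g z"
proof -
  define k where "k = b / (\<tau> * m)"
  define q where "q = 1 - (a / (\<tau> * L)) / k"
  have k: "k > 0" using tau m_pos b_pos by (simp add: k_def)
  have "(a / (\<tau> * L)) / k = (a * m) / (b * L)" using tau m_pos b_pos L_pos by (simp add: k_def field_simps)
  moreover have "(a * m) / (b * L) \<le> 1"
    using m_le_L a_le_b a_pos m_pos b_pos L_pos by (simp add: mult_mono)
  moreover have "(a * m) / (b * L) > 0" using a_pos m_pos b_pos L_pos by simp
  ultimately have q: "0 \<le> q" "q < 1" by (auto simp: q_def)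
  have qk: "q * k = k - a / (\<tau> * L)" using k by (simp add: q_def algebra_simps)
  define H where "H z x = k * z x + s x / \<tau> * (g x - \<phi> (z x))" for z :: "real \<Rightarrow> real" and x
  have gb: "bounded_borel g" by (rule range_bounded_borel[OF g])
  have Hdiff: "H z2 x - H z1 x = k * (z2 x - z1 x) - s x / \<tau> * (\<phi> (z2 x) - \<phi> (z1 x))" for z1 z2 x
    by (simp add: H_def algebra_simps)
  have Hmono: "H z1 x \<le> H z2 x" if "z1 x \<le> z2 x" for z1 z2 x
    using relaxation_monotone(1)[OF tau that, of x] Hdiff[of z2 x z1] by (simp add: k_def)
  have Hlip0: "\<bar>H z2 x - H z1 x\<bar> \<le> q * k * \<bar>z2 x - z1 x\<bar>" if "z1 x \<le> z2 x" for z1 z2 x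
  proof -
    have "0 \<le> H z2 x - H z1 x" "H z2 x - H z1 x \<le> (k - a / (\<tau> * L)) * (z2 x - z1 x)"
      using relaxation_monotone[OF tau that, of x] unfolding Hdiff k_def by auto
    then show ?thesis using that unfolding qk by simp
  qed
  have Hlip: "\<bar>H z2 x - H z1 x\<bar> \<le> q * k * \<bar>z2 x - z1 x\<bar>" for z1 z2 x
    using Hlip0[of z1 x z2] Hlip0[of z2 x z1] by (cases "z1 x \<le> z2 x") (auto simp: abs_minus_commute)
  have Hrange: "k * f A \<le> H z x" "H z x \<le> k * f B" if "\<And>x. z x \<in> {f A..f B}" for z x
  proof -
    \<comment> \<open>As g lies between \<open>A\<close> and \<open>B\<close>, the constants
      \<open>f A\<close> and \<open>f B\<close> are a sub- and a supersolution; monotonicity of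
      \<open>H\<close> then keeps the range invariant.\<close>
    have "H (\<lambda>_. f A) x \<ge> k * f A" 
      using g(2)[of x] s_pos[of x] tau by (simp add: H_def phi_f)
    then show "k * f A \<le> H z x" using Hmono[of "\<lambda>_. f A" x z] that[of x] by auto
    have "s x / \<tau> * (g x - B) \<le> 0" using g(2)[of x] s_pos[of x] tau by (intro mult_nonneg_nonpos) auto
    then have "H (\<lambda>_. f B) x \<le> k * f B" by (simp add: H_def phi_f)
    then show "H z x \<le> k * f B" using Hmono[of z x "\<lambda>_. f B"] that[of x] by auto
  qed
  have Hb: "bounded_borel (H z)" if "continuous_on UNIV z" "\<And>x. z x \<in> {f A..f B}" for z
  proof (rule bounded_borelI)
    have [measurable]: "z \<in> borel_measurable borel" using that(1) by (rule borel_measurable_continuous_onI)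
    note g(1)[measurable]
    show "H z \<in> borel_measurable borel" unfolding H_def by measurable
    show "\<bar>H z x\<bar> \<le> \<bar>k * f A\<bar> + \<bar>k * f B\<bar>" for x using Hrange[of z x] that(2) by (auto simp: abs_if)
  qed
  define S where "S = PiC (UNIV :: real set) (\<lambda>_. {f A..f B})"
  define T where "T z = Bcontfun (relax k (H (apply_bcontfun z)))" for z :: "real \<Rightarrow>\<^sub>C real"
  have Srange: "\<And>x. apply_bcontfun z x \<in> {f A..f B}" if "z \<in> S" for z
    using mem_PiCD[OF that[unfolded S_def]] by auto
  have Sb: "bounded_borel (H (apply_bcontfun z))" if "z \<in> S" for z
    by (rule Hb) (use Srange[OF that] in \<open>auto intro: continuous_intros\<close>)
  have Trange: "relax k (H (apply_bcontfun z)) x \<in> {f A..f B}" if "z \<in> S" for z x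
    using relax_bounds[OF k Sb[OF that], of "k * f A" "k * f B"] Hrange[of "apply_bcontfun z"] Srange[OF that] k by auto
  have Tapp: "apply_bcontfun (T z) = relax k (H (apply_bcontfun z))" if "z \<in> S" for z
    unfolding T_def
  proof (rule Bcontfun_inverse, unfold bcontfun_def, intro CollectI conjI)
    show "continuous_on UNIV (relax k (H (apply_bcontfun z)))"
      by (rule primitive_continuous[OF relax_primitive[OF k Sb[OF that]]])
    show "bounded (range (relax k (H (apply_bcontfun z))))"
      by (rule bounded_subset[of "{f A..f B}"]) (use Trange[OF that] in auto)
  qed
  have "\<exists>!z\<in>S. T z = z"
  proof (rule Banach_fix[OF _ _ q])
    show "complete S" unfolding S_def using closed_PiC[of UNIV "\<lambda>_. {f A..f B}"] by (simp add: complete_eq_closed)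
    have "const_bcontfun (f A) \<in> S" unfolding S_def using f_mono[OF A_le_B] by (intro mem_PiCI) auto
    then show "S \<noteq> {}" by blast
    show "T ` S \<subseteq> S"
    proof
      fix w assume "w \<in> T ` S"
      then obtain z where "z \<in> S" "w = T z" by blast
      then show "w \<in> S" using Trange[OF \<open>z \<in> S\<close>] Tapp[OF \<open>z \<in> S\<close>] unfolding S_def by (intro mem_PiCI) auto
    qed
    fix z1 z2 assume z: "z1 \<in> S" "z2 \<in> S"
    have "\<bar>H (apply_bcontfun z1) x - H (apply_bcontfun z2) x\<bar> \<le> q * k * dist z1 z2" for x
    proof -
      have "\<bar>apply_bcontfun z1 x - apply_bcontfun z2 x\<bar> \<le> dist z1 z2"
        using dist_bounded[of z1 x z2] by (simp add: dist_real_def)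
      then have "q * k * \<bar>apply_bcontfun z1 x - apply_bcontfun z2 x\<bar> \<le> q * k * dist z1 z2"
        using q k by (intro mult_left_mono) auto
      then show ?thesis using Hlip[of "apply_bcontfun z1" x "apply_bcontfun z2"] by linarith
    qed
    from relax_diff_bound[OF k Sb[OF z(1)] Sb[OF z(2)] this]
    show "dist (T z1) (T z2) \<le> q * dist z1 z2"
      using k by (intro dist_bound) (simp add: Tapp[OF z(1)] Tapp[OF z(2)] dist_real_def)
  qed
  then obtain z where z: "z \<in> S" "T z = z" by blast
  define w where "w = apply_bcontfun z"
  have w: "relax k (H w) = w" using Tapp[OF z(1)] z(2) by (simp add: w_def)
  have "primitive w (\<lambda>x. H w x - k * w x)"
    using relax_primitive[OF k Sb[OF z(1)]] w by (simp add: w_def)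
  moreover have "(\<lambda>x. H w x - k * w x) = (\<lambda>x. s x * (g x - \<phi> (w x)) / \<tau>)" by (simp add: H_def)
  ultimately have "resolves \<tau> g w" using Srange[OF z(1)] by (simp add: resolves_def w_def)
  then show ?thesis by blast
qed

end

section \<open>Contraction estimates for the implicit step\<close>

lemma integrable_of_Icc_bound:
  fixes Q :: "real \<Rightarrow> real"
  assumes Q: "bounded_borel Q" "\<And>x. 0 \<le> Q x" and le: "\<And>n::nat. (LINT t:{-real n..real n}|lborel. Q t) \<le> K"
  shows "integrable lborel Q" "(LINT t|lborel. Q t) \<le> K"
proof -
  let ?F = "\<lambda>n x. indicator {-real n..real n} x * Q x"
  let ?I = "\<lambda>n. LINT t|lborel. ?F n t"
  have int: "integrable lborel (?F n)" for n
    using bounded_borel_Icc[OF Q(1)] by (simp add: set_integrable_def)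
  have mono: "?F n x \<le> ?F k x" if "n \<le> k" for n k x
    using that Q(2)[of x] by (auto simp: indicator_def)
  have incI: "incseq ?I" by (intro incseq_SucI integral_mono int mono) auto
  have leI: "?I n \<le> K" for n using le[of n] by (simp add: set_lebesgue_integral_def)
  obtain l where l: "?I \<longlonglongrightarrow> l" using incseq_convergent[OF incI] leI by blast
  have lim: "(\<lambda>n. ?F n x) \<longlonglongrightarrow> Q x" for x
  proof (rule tendsto_eventually)
    obtain N :: nat where "\<bar>x\<bar> \<le> real N" using real_arch_simple by blast
    then show "\<forall>\<^sub>F n in sequentially. ?F n x = Q x"
      by (intro eventually_sequentiallyI[of N]) (auto simp: indicator_def)
  qed
  have *: "AE x in lborel. mono (\<lambda>n. ?F n x)" "AE x in lborel. (\<lambda>n. ?F n x) \<longlonglongrightarrow> Q x"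
    using mono lim by (auto simp: mono_def)
  have m: "Q \<in> borel_measurable lborel" using bounded_borel_measurable[OF Q(1)] by simp
  show "integrable lborel Q" by (rule integrable_monotone_convergence[OF int * l m])
  have "(LINT t|lborel. Q t) = l" by (rule integral_monotone_convergence[OF int * l m])
  then show "(LINT t|lborel. Q t) \<le> K" using LIMSEQ_le_const2[OF l] leI by auto
qed

lemma LINT_Icc_le_integral:
  fixes Q :: "real \<Rightarrow> real"
  assumes "integrable lborel Q" "\<And>x. 0 \<le> Q x"
  shows "(LINT t:{c..d}|lborel. Q t) \<le> (LINT t|lborel. Q t)"
  unfolding set_lebesgue_integral_def
proof (rule integral_mono)
  show "integrable lborel (\<lambda>t. indicator {c..d} t *\<^sub>R Q t)"
    by (rule integrable_mult_indicator) (use assms in auto)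
qed (use assms in \<open>auto simp: indicator_def\<close>)

lemma LINT_Icc_subset_mono:
  assumes "bounded_borel Q" "\<And>x. 0 \<le> Q x" "c' \<le> c" "d \<le> d'"
  shows "(LINT t:{c..d}|lborel. Q t) \<le> (LINT t:{c'..d'}|lborel. Q t)"
  unfolding set_lebesgue_integral_def
proof (rule integral_mono)
  show "integrable lborel (\<lambda>t. indicator {c..d} t *\<^sub>R Q t)" "integrable lborel (\<lambda>t. indicator {c'..d'} t *\<^sub>R Q t)"
    using bounded_borel_Icc[OF assms(1)] by (simp_all add: set_integrable_def)
qed (use assms in \<open>auto simp: indicator_def\<close>)

text \<open>The boundary term \<open>\<bar>X c\<bar>\<close> at the left end disappears because \<open>\<bar>X\<bar>\<close> is integrable.\<close>

lemma global_dissipation: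
  assumes X: "primitive X p" and bX: "\<And>x. \<bar>X x\<bar> \<le> M"
    and Q: "bounded_borel Q" "\<And>x. 0 \<le> Q x"
    and R: "bounded_borel R" "\<And>x. 0 \<le> R x" "integrable lborel R"
    and le: "\<And>x y. x \<le> y \<Longrightarrow> sgn (X y) * p x \<le> R x - Q x + K * \<bar>y - x\<bar>"
    and \<delta>: "\<delta> > 0" "\<And>x. \<delta> * \<bar>X x\<bar> \<le> Q x"
  shows "integrable lborel Q" "(LINT t|lborel. Q t) \<le> (LINT t|lborel. R t)"
proof -
  have main: "(LINT t:{c..d}|lborel. Q t) \<le> (LINT t|lborel. R t) + \<bar>X c\<bar>" if "c \<le> d" for c d
  proof -
    have "\<bar>X d\<bar> - \<bar>X c\<bar> \<le> (LINT t:{c..d}|lborel. R t - Q t)"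
      by (rule abs_increment_le[OF X _ that]) (use le Q R in \<open>auto intro!: bounded_borel_intros\<close>)
    also have "\<dots> = (LINT t:{c..d}|lborel. R t) - (LINT t:{c..d}|lborel. Q t)" by (intro LINT_Icc_diff Q R)
    finally show ?thesis using LINT_Icc_le_integral[OF R(3,2), of c d] by auto
  qed
  \<comment> \<open>First pass: the boundary term is bounded by \<open>M\<close>, which already
    yields integrability of \<open>Q\<close>. The second pass uses integrability to find left ends
    where the boundary term is small.\<close>
  have "(LINT t:{-real n..real n}|lborel. Q t) \<le> (LINT t|lborel. R t) + M" for n
    using main[of "-real n" "real n"] bX[of "-real n"] by auto
  note 1 = integrable_of_Icc_bound[OF Q this]
  show iQ: "integrable lborel Q" by (rule 1)
  have "(LINT t|lborel. Q t) \<le> (LINT t|lborel. R t) + e" if e: "e > 0" for e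
  proof (rule integrable_of_Icc_bound(2)[OF Q])
    fix n :: nat
    have "\<exists>c\<le>-real n. \<bar>X c\<bar> < e"
    proof (rule ccontr)
      assume "\<not> ?thesis"
      then have far: "e \<le> \<bar>X c\<bar>" if "c \<le> - real n" for c using that by (auto simp: not_less)
      \<comment> \<open>A stretch of length \<open>N\<close> on which \<open>Q\<close> is at least
        \<open>\<delta> * e\<close> would carry more than the whole integral of
        \<open>Q\<close>.\<close>
      obtain N :: nat where N: "(LINT t|lborel. Q t) < real N * (\<delta> * e)"
        using reals_Archimedean3[of "\<delta> * e"] \<delta>(1) e by auto
      have "(\<delta> * e) * (- real n - (- real n - real N)) = (LINT t:{- real n - real N..- real n}|lborel. \<delta> * e)"
        by (rule LINT_Icc_const[symmetric]) simp
      also have "\<dots> \<le> (LINT t:{- real n - real N..- real n}|lborel. Q t)"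
      proof (rule LINT_Icc_mono[OF bounded_borel_const Q(1)])
        fix t assume "t \<le> - real n"
        then have "\<delta> * e \<le> \<delta> * \<bar>X t\<bar>" using far \<delta>(1) by (intro mult_left_mono) auto
        then show "\<delta> * e \<le> Q t" using \<delta>(2)[of t] by simp
      qed
      also have "\<dots> \<le> (LINT t|lborel. Q t)" by (rule LINT_Icc_le_integral[OF iQ Q(2)])
      finally show False using N by (simp add: algebra_simps)
    qed
    then obtain c where c: "c \<le> - real n" "\<bar>X c\<bar> < e" by blast
    have "(LINT t:{-real n..real n}|lborel. Q t) \<le> (LINT t:{c..real n}|lborel. Q t)"
      by (rule LINT_Icc_subset_mono[OF Q]) (use c in auto)
    then show "(LINT t:{-real n..real n}|lborel. Q t) \<le> (LINT t|lborel. R t) + e"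
      using main[of c "real n"] c by linarith
  qed
  then show "(LINT t|lborel. Q t) \<le> (LINT t|lborel. R t)" by (rule field_le_epsilon)
qed

text \<open>The sign is sampled at \<open>y\<close> and \<open>U\<close> at \<open>x\<close>. If the
  two signs disagree, then |U x| is at most |U y - U x|, which the Lipschitz bound controls.\<close>

lemma sgn_lipschitz_bound:
  fixes U :: "real \<Rightarrow> real"
  assumes "\<And>x y. \<bar>U y - U x\<bar> \<le> C * \<bar>y - x\<bar>" "sgn \<sigma> = sgn (U y)"
  shows "sgn \<sigma> * (- U x) \<le> - \<bar>U x\<bar> + 2 * C * \<bar>y - x\<bar>"
proof -
  have "\<bar>U x\<bar> + sgn (U y) * (- U x) \<le> 2 * \<bar>U y - U x\<bar>" by (auto simp: sgn_if abs_if)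
  then show ?thesis using assms(1)[of y x] assms(2) by simp
qed

lemma sgn_mult_le_abs: "sgn u * v \<le> \<bar>v\<bar>" for u v :: real
  by (auto simp: sgn_if)

context flux_data
begin

lemma resolvesD:
  assumes "resolves \<tau> g z"
  shows "z x \<in> {f A..f B}" "primitive z (\<lambda>x. s x * (g x - \<phi> (z x)) / \<tau>)" "continuous_on UNIV z"
    "\<phi> (z x) \<in> {A..B}" "bounded_borel (\<lambda>x. \<phi> (z x))"
proof -
  show 1: "z x \<in> {f A..f B}" for x using assms by (simp add: resolves_def)
  show p: "primitive z (\<lambda>x. s x * (g x - \<phi> (z x)) / \<tau>)" using assms by (simp add: resolves_def)
  show c: "continuous_on UNIV z" by (rule primitive_continuous[OF p])
  show 2: "\<phi> (z x) \<in> {A..B}" for x by (rule phi_range[OF 1])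
  have [measurable]: "z \<in> borel_measurable borel" using c by (rule borel_measurable_continuous_onI)
  show "bounded_borel (\<lambda>x. \<phi> (z x))" by (rule range_bounded_borel[OF _ 2]) measurable
qed

lemma resolves_lipschitz:
  assumes "resolves \<tau> g z"
  shows "\<exists>C\<ge>0. \<forall>x y. \<bar>\<phi> (z y) - \<phi> (z x)\<bar> \<le> C * \<bar>y - x\<bar>"
proof -
  note p = resolvesD(2)[OF assms]
  obtain C where C: "C > 0" "\<And>x. \<bar>s x * (g x - \<phi> (z x)) / \<tau>\<bar> \<le> C"
    using bounded_borel_bound[OF primitive_bounded_borel[OF p]] by blast
  have "\<bar>\<phi> (z y) - \<phi> (z x)\<bar> \<le> C / m * \<bar>y - x\<bar>" for x y
  proof -
    have "\<bar>\<phi> (z y) - \<phi> (z x)\<bar> \<le> \<bar>z y - z x\<bar> / m" by (rule phi_lipschitz)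
    also have "\<dots> \<le> (C * \<bar>y - x\<bar>) / m"
      using primitive_lipschitz[OF p C(2)] m_pos by (intro divide_right_mono) auto
    finally show ?thesis by simp
  qed
  then show ?thesis using C m_pos by (intro exI[of _ "C / m"]) auto
qed

lemma resolves_lipschitz_pair:
  assumes "resolves \<tau> g z" "resolves \<sigma> h w"
  shows "\<exists>C\<ge>0. \<forall>x y. \<bar>(\<phi> (z y) - \<phi> (w y)) - (\<phi> (z x) - \<phi> (w x))\<bar> \<le> C * \<bar>y - x\<bar>"
proof -
  obtain C where C: "C \<ge> 0" "\<And>x y. \<bar>\<phi> (z y) - \<phi> (z x)\<bar> \<le> C * \<bar>y - x\<bar>"
    using resolves_lipschitz[OF assms(1)] by blast
  obtain D where D: "D \<ge> 0" "\<And>x y. \<bar>\<phi> (w y) - \<phi> (w x)\<bar> \<le> D * \<bar>y - x\<bar>"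
    using resolves_lipschitz[OF assms(2)] by blast
  have "\<bar>(\<phi> (z y) - \<phi> (w y)) - (\<phi> (z x) - \<phi> (w x))\<bar> \<le> (C + D) * \<bar>y - x\<bar>" for x y
    using C(2)[of y x] D(2)[of y x] unfolding distrib_right by linarith
  then show ?thesis using C D by (intro exI[of _ "C + D"]) auto
qed

text \<open>Because f is Lipschitz and s is bounded below, flux differences are controlled by mass
  differences. This supplies the lower bound on the dissipation here and the growth rate
  \<open>\<kappa>\<close> in the uniqueness proof.\<close>

lemma flux_le_mass: "\<bar>u - v\<bar> \<le> L / a * (s x * \<bar>\<phi> u - \<phi> v\<bar>)"
proof -
  have "L * \<bar>\<phi> u - \<phi> v\<bar> = L / a * (a * \<bar>\<phi> u - \<phi> v\<bar>)" using a_pos by simp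
  also have "\<dots> \<le> L / a * (s x * \<bar>\<phi> u - \<phi> v\<bar>)"
    using a_pos L_pos s_bounds by (intro mult_left_mono mult_right_mono) auto
  finally show ?thesis using phi_expand[of u v] by linarith
qed

lemma resolves_difference_bounded:
  assumes "resolves \<tau> g z" "resolves \<sigma> h w"
  shows "\<bar>z x - w x\<bar> \<le> f B - f A"
  using resolvesD(1)[OF assms(1), of x] resolvesD(1)[OF assms(2), of x] by auto

text \<open>Subtract the two equations and multiply by the sign of z - w, which is also the sign of
  \<phi> z - \<phi> w as \<phi> increases. The increment of |z - w| is then at most the data term
  minus the solution term, and integrating over the whole line removes the left-hand side.\<close>

lemma resolvent_contraction:
  assumes tau: "\<tau> > 0" and z: "resolves \<tau> g z" and w: "resolves \<tau> h w"
    and g: "bounded_borel g" and h: "bounded_borel h" and int: "integrable lborel (\<lambda>x. s x * \<bar>g x - h x\<bar>)"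
  shows "integrable lborel (\<lambda>x. s x * \<bar>\<phi> (z x) - \<phi> (w x)\<bar>)"
    "(LINT x|lborel. s x * \<bar>\<phi> (z x) - \<phi> (w x)\<bar>) \<le> (LINT x|lborel. s x * \<bar>g x - h x\<bar>)"
proof -
  obtain C where C: "C \<ge> 0" "\<And>x y. \<bar>(\<phi> (z y) - \<phi> (w y)) - (\<phi> (z x) - \<phi> (w x))\<bar> \<le> C * \<bar>y - x\<bar>"
    using resolves_lipschitz_pair[OF z w] by blast
  let ?Q = "\<lambda>x. s x * \<bar>\<phi> (z x) - \<phi> (w x)\<bar> / \<tau>" and ?R = "\<lambda>x. s x * \<bar>g x - h x\<bar> / \<tau>"
  have bQ: "bounded_borel ?Q" and bR: "bounded_borel ?R"
    unfolding divide_inverse by (intro bounded_borel_intros s_bounded_borel g h resolvesD(5)[OF z] resolvesD(5)[OF w])+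
  have X: "primitive (\<lambda>x. z x - w x) (\<lambda>x. s x * (g x - \<phi> (z x)) / \<tau> - s x * (h x - \<phi> (w x)) / \<tau>)"
      by (intro primitive_diff resolvesD(2) z w)
  have le: "sgn (z y - w y) * (s x * (g x - \<phi> (z x)) / \<tau> - s x * (h x - \<phi> (w x)) / \<tau>)
      \<le> ?R x - ?Q x + b / \<tau> * (2 * C) * \<bar>y - x\<bar>" for x y
  proof -
    have "sgn (z y - w y) * (s x * (g x - \<phi> (z x)) / \<tau> - s x * (h x - \<phi> (w x)) / \<tau>)
       = s x / \<tau> * (sgn (z y - w y) * (g x - h x) + sgn (z y - w y) * (- (\<phi> (z x) - \<phi> (w x))))"
      using tau by (simp add: field_simps)
    also have "\<dots> \<le> s x / \<tau> * (\<bar>g x - h x\<bar> + (- \<bar>\<phi> (z x) - \<phi> (w x)\<bar> + 2 * C * \<bar>y - x\<bar>))"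
      using s_pos[of x] tau
      by (intro mult_left_mono add_mono sgn_mult_le_abs sgn_lipschitz_bound[of "\<lambda>x. \<phi> (z x) - \<phi> (w x)"] C(2)) (auto simp: sgn_phi)
    also have "\<dots> = ?R x - ?Q x + s x / \<tau> * (2 * C * \<bar>y - x\<bar>)" using tau by (simp add: field_simps)
    also have "\<dots> \<le> ?R x - ?Q x + b / \<tau> * (2 * C * \<bar>y - x\<bar>)"
      using s_bounds(2)[of x] tau C(1) by (intro add_left_mono mult_right_mono divide_right_mono) auto
    finally show "sgn (z y - w y) * (s x * (g x - \<phi> (z x)) / \<tau> - s x * (h x - \<phi> (w x)) / \<tau>)
      \<le> ?R x - ?Q x + b / \<tau> * (2 * C) * \<bar>y - x\<bar>" by (simp add: mult.assoc)
  qed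
  have dom: "a / (L * \<tau>) * \<bar>z x - w x\<bar> \<le> ?Q x" for x
    using flux_le_mass[of "z x" "w x" x] a_pos L_pos tau by (simp add: field_simps)
  have nn: "0 \<le> ?Q x" "0 \<le> ?R x" for x using s_pos[of x] tau by simp_all
  have d: "a / (L * \<tau>) > 0" using a_pos L_pos tau by simp
  have iR: "integrable lborel ?R" using int by (rule integrable_divide)
  note gd = global_dissipation[OF X resolves_difference_bounded[OF z w] bQ nn(1) bR nn(2) iR le d dom]
  show "integrable lborel (\<lambda>x. s x * \<bar>\<phi> (z x) - \<phi> (w x)\<bar>)"
    using integrable_mult_right[of \<tau>, OF gd(1)] tau by simp
  show "(LINT x|lborel. s x * \<bar>\<phi> (z x) - \<phi> (w x)\<bar>) \<le> (LINT x|lborel. s x * \<bar>g x - h x\<bar>)"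
    using gd(2) tau by (simp add: divide_le_cancel)
qed

text \<open>The contraction argument for two different step sizes. Writing g - \<phi> z = (g -
  \<phi> w) - (\<phi> z - \<phi> w) and \<phi> w - h = (\<phi> z - h) - (\<phi> z - \<phi> w)
  produces the dissipation with the factor 1 / \<tau> + 1 / \<sigma>. It is the recursion behind the
  Crandall-Liggett estimate.\<close>

lemma resolvent_pair:
  assumes tau: "\<tau> > 0" and sig: "\<sigma> > 0" and z: "resolves \<tau> g z" and w: "resolves \<sigma> h w"
    and g: "bounded_borel g" and h: "bounded_borel h" 
    and int1: "integrable lborel (\<lambda>x. s x * \<bar>g x - \<phi> (w x)\<bar>)"
    and int2: "integrable lborel (\<lambda>x. s x * \<bar>\<phi> (z x) - h x\<bar>)"
  shows "(1 / \<tau> + 1 / \<sigma>) * (LINT x|lborel. s x * \<bar>\<phi> (z x) - \<phi> (w x)\<bar>)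
    \<le> (LINT x|lborel. s x * \<bar>g x - \<phi> (w x)\<bar>) / \<tau> + (LINT x|lborel. s x * \<bar>\<phi> (z x) - h x\<bar>) / \<sigma>"
proof -
  obtain C where C: "C \<ge> 0" "\<And>x y. \<bar>(\<phi> (z y) - \<phi> (w y)) - (\<phi> (z x) - \<phi> (w x))\<bar> \<le> C * \<bar>y - x\<bar>"
    using resolves_lipschitz_pair[OF z w] by blast
  let ?k = "1 / \<tau> + 1 / \<sigma>"
  have k: "?k > 0" using tau sig by (simp add: add_pos_pos)
  let ?Q = "\<lambda>x. ?k * (s x * \<bar>\<phi> (z x) - \<phi> (w x)\<bar>)"
  let ?R = "\<lambda>x. s x * \<bar>g x - \<phi> (w x)\<bar> / \<tau> + s x * \<bar>\<phi> (z x) - h x\<bar> / \<sigma>"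
  have bQ: "bounded_borel ?Q" and bR: "bounded_borel ?R"
    unfolding divide_inverse by (intro bounded_borel_intros s_bounded_borel g h resolvesD(5)[OF z] resolvesD(5)[OF w])+
  have "(LINT t|lborel. ?Q t) \<le> (LINT t|lborel. ?R t)"
  proof (rule global_dissipation(2)[where ?X="\<lambda>x. z x - w x" and ?K="b * ?k * (2 * C)" and ?\<delta>="a * ?k / L"
        and ?p="\<lambda>x. s x * (g x - \<phi> (z x)) / \<tau> - s x * (h x - \<phi> (w x)) / \<sigma>"])
    show "primitive (\<lambda>x. z x - w x) (\<lambda>x. s x * (g x - \<phi> (z x)) / \<tau> - s x * (h x - \<phi> (w x)) / \<sigma>)"
      by (intro primitive_diff resolvesD(2) z w)
    show "integrable lborel ?R" using int1 int2 by (intro Bochner_Integration.integrable_add integrable_divide)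
    fix x y :: real
    let ?s = "sgn (z y - w y)" and ?D = "\<phi> (z x) - \<phi> (w x)"
    have "?s * (s x * (g x - \<phi> (z x)) / \<tau> - s x * (h x - \<phi> (w x)) / \<sigma>)
       = s x * ((?s * (g x - \<phi> (w x)) + ?s * (- ?D)) / \<tau> + (?s * (\<phi> (z x) - h x) + ?s * (- ?D)) / \<sigma>)"
      using tau sig by (simp add: field_simps)
    also have "\<dots> \<le> s x * ((\<bar>g x - \<phi> (w x)\<bar> + (- \<bar>?D\<bar> + 2 * C * \<bar>y - x\<bar>)) / \<tau>
        + (\<bar>\<phi> (z x) - h x\<bar> + (- \<bar>?D\<bar> + 2 * C * \<bar>y - x\<bar>)) / \<sigma>)"
      using s_pos[of x] tau sig
      by (intro mult_left_mono add_mono divide_right_mono sgn_mult_le_abs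
          sgn_lipschitz_bound[of "\<lambda>x. \<phi> (z x) - \<phi> (w x)"] C(2)) (auto simp: sgn_phi)
    also have "\<dots> = ?R x - ?Q x + s x * (?k * (2 * C * \<bar>y - x\<bar>))" using tau sig by (simp add: field_simps)
    also have "\<dots> \<le> ?R x - ?Q x + b * (?k * (2 * C * \<bar>y - x\<bar>))"
      using s_bounds(2)[of x] k C(1) by (intro add_left_mono mult_right_mono) auto
    finally show "?s * (s x * (g x - \<phi> (z x)) / \<tau> - s x * (h x - \<phi> (w x)) / \<sigma>)
      \<le> ?R x - ?Q x + b * ?k * (2 * C) * \<bar>y - x\<bar>" by (simp add: mult.assoc)
    have "a * ?k / L * \<bar>z x - w x\<bar> \<le> a * ?k / L * (L / a * (s x * \<bar>?D\<bar>))"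
      using flux_le_mass[of "z x" "w x" x] a_pos L_pos k by (intro mult_left_mono) auto
    then show "a * ?k / L * \<bar>z x - w x\<bar> \<le> ?Q x" using a_pos L_pos by simp
    show "\<bar>z x - w x\<bar> \<le> f B - f A" by (rule resolves_difference_bounded[OF z w])
  qed (use tau sig k bQ bR a_pos L_pos s_pos in \<open>auto simp: less_imp_le intro!: add_nonneg_nonneg\<close>)
  also have "(LINT t|lborel. ?R t) = (LINT x|lborel. s x * \<bar>g x - \<phi> (w x)\<bar>) / \<tau> + (LINT x|lborel. s x * \<bar>\<phi> (z x) - h x\<bar>) / \<sigma>"
    by (subst Bochner_Integration.integral_add) (use int1 int2 in \<open>auto intro!: integrable_divide\<close>)
  finally show ?thesis by simp
qed

end

section \<open>The scheme and the variation of its first step\<close>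

context flux_data
begin

text \<open>The start 1 / s is the ratio eta / v of the initial data eta = 1, v = s.\<close>

primrec scheme :: "real \<Rightarrow> nat \<Rightarrow> real \<Rightarrow> real" where
  "scheme \<tau> 0 = (\<lambda>x. 1 / s x)"
| "scheme \<tau> (Suc n) = (\<lambda>x. \<phi> ((SOME z. resolves \<tau> (scheme \<tau> n) z) x))"

text \<open>Index shift: \<open>flux \<tau> n\<close> is the flux f(V) of step \<open>Suc n\<close>,
  obtained by resolving from step \<open>n\<close>.\<close>

definition flux :: "real \<Rightarrow> nat \<Rightarrow> real \<Rightarrow> real" where
  "flux \<tau> n = (SOME z. resolves \<tau> (scheme \<tau> n) z)"

declare scheme.simps(2) [simp del]

lemma scheme_Suc: "scheme \<tau> (Suc n) x = \<phi> (flux \<tau> n x)"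
  by (simp add: flux_def scheme.simps(2))

lemma initial_range: "1 / s x \<in> {A..B}"
  using s_bounds[of x] s_pos[of x] a_pos b_pos by (auto simp: A_def B_def frac_le)

lemma scheme_props:
  assumes "\<tau> > 0"
  shows "(\<forall>x. scheme \<tau> n x \<in> {A..B}) \<and> scheme \<tau> n \<in> borel_measurable borel \<and> resolves \<tau> (scheme \<tau> n) (flux \<tau> n)"
proof (induction n)
  case 0
  have "scheme \<tau> 0 \<in> borel_measurable borel" by simp
  moreover have "\<forall>x. scheme \<tau> 0 x \<in> {A..B}" using initial_range by simp
  moreover have "\<exists>z. resolves \<tau> (scheme \<tau> 0) z" by (rule resolvent_exists[OF assms calculation(1)]) (use calculation(2) in blast)
  ultimately show ?case unfolding flux_def by (metis (mono_tags) someI_ex)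
next
  case (Suc n)
  then have r: "resolves \<tau> (scheme \<tau> n) (flux \<tau> n)" by blast
  have eq: "scheme \<tau> (Suc n) = (\<lambda>x. \<phi> (flux \<tau> n x))" by (simp add: flux_def scheme.simps(2))
  have "scheme \<tau> (Suc n) \<in> borel_measurable borel"
    unfolding eq by (rule bounded_borel_measurable[OF resolvesD(5)[OF r]])
  moreover have "\<forall>x. scheme \<tau> (Suc n) x \<in> {A..B}" unfolding eq using resolvesD(4)[OF r] by blast
  moreover have "\<exists>z. resolves \<tau> (scheme \<tau> (Suc n)) z" by (rule resolvent_exists[OF assms calculation(1)]) (use calculation(2) in blast)
  ultimately show ?case unfolding flux_def[of \<tau> "Suc n"] by (metis (mono_tags) someI_ex)
qed

lemma scheme_range: "\<tau> > 0 \<Longrightarrow> scheme \<tau> n x \<in> {A..B}" using scheme_props by blast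
lemma scheme_measurable: "\<tau> > 0 \<Longrightarrow> scheme \<tau> n \<in> borel_measurable borel" using scheme_props by blast
lemma scheme_resolves: "\<tau> > 0 \<Longrightarrow> resolves \<tau> (scheme \<tau> n) (flux \<tau> n)" using scheme_props by blast
lemma scheme_bounded_borel: "\<tau> > 0 \<Longrightarrow> bounded_borel (scheme \<tau> n)"
  by (rule range_bounded_borel[OF scheme_measurable scheme_range])

lemma flux_primitive:
  "\<tau> > 0 \<Longrightarrow> primitive (flux \<tau> n) (\<lambda>x. s x * (scheme \<tau> n x - scheme \<tau> (Suc n) x) / \<tau>)"
  using resolvesD(2)[OF scheme_resolves] by (simp add: scheme_Suc)

lemma P_bounded_borel: "bounded_borel P"
  using P_bounds by (intro bounded_borelI[of _ TV] borel_measurable_mono[OF P_mono]) (auto simp: abs_of_nonneg)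

lemma P_shift_bounded_borel: "bounded_borel (\<lambda>x. P (x + h))"
  by (rule bounded_borel_shift[OF P_bounded_borel])

text \<open>Translation telescopes: only the two end strips of width \<open>h\<close> remain, and
  \<open>P\<close> takes values in [0, TV].\<close>

lemma P_increment_integral:
  assumes h: "h \<ge> 0"
  shows "(LINT t:{c..d}|lborel. P (t + h) - P t) \<le> TV * h"
proof (cases "c \<le> d")
  case True
  note bP = P_bounded_borel
  have "(LINT t:{c..d}|lborel. P (t + h) - P t) = (LINT t:{c+h..d+h}|lborel. P t) - (LINT t:{c..d}|lborel. P t)"
    using LINT_Icc_diff[OF P_shift_bounded_borel bP] by (simp add: LINT_Icc_shift)
  also have "(LINT t:{c+h..d+h}|lborel. P t) = (LINT t:{c..d+h}|lborel. P t) - (LINT t:{c..c+h}|lborel. P t)"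
    using LINT_Icc_combine[OF bP, of c "c+h" "d+h"] True h by simp
  also have "(LINT t:{c..d+h}|lborel. P t) = (LINT t:{c..d}|lborel. P t) + (LINT t:{d..d+h}|lborel. P t)"
    using LINT_Icc_combine[OF bP, of c d "d+h"] True h by simp
  finally have "(LINT t:{c..d}|lborel. P (t + h) - P t) = (LINT t:{d..d+h}|lborel. P t) - (LINT t:{c..c+h}|lborel. P t)" by simp
  moreover have "\<bar>LINT t:{d..d+h}|lborel. P t\<bar> \<le> TV * (d + h - d)"
    by (rule LINT_Icc_bound[OF bP]) (use P_bounds h in auto)
  moreover have "(LINT t:{c..c+h}|lborel. 0) \<le> (LINT t:{c..c+h}|lborel. P t)"
    by (rule LINT_Icc_mono) (use bP P_bounds in auto)
  ultimately show ?thesis by simp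
next
  case False
  have "TV \<ge> 0" using P_bounds[of 0] by simp
  then show ?thesis using False h by (simp add: set_lebesgue_integral_def)
qed

text \<open>Bound for the L1 norm of the first discrete time derivative. The term b (B - A) comes
  from the boundary value of the differenced equation, B TV from the jumps of s, and L / a from
  inverting the dissipation.\<close>

definition "M = L / a * (b * (B - A) + B * TV)"

lemma TV_nonneg: "TV \<ge> 0" using P_bounds[of 0] by simp
lemma M_nonneg: "M \<ge> 0"
  using a_pos L_pos b_pos A_le_B B_pos TV_nonneg by (simp add: M_def)

text \<open>For the initial datum \<open>1 / s\<close> the first step solves \<open>\<tau> z' = 1 - s \<phi> z\<close>, whose translation
  differences are controlled by the variation of \<open>s\<close>.\<close>

lemma first_step_variation:
  assumes tau: "\<tau> > 0" and "c \<le> d"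
  shows "(LINT x:{c..d}|lborel. \<bar>s x * (scheme \<tau> 0 x - scheme \<tau> 1 x) / \<tau>\<bar>) \<le> M"
proof -
  define z where "z = flux \<tau> 0"
  define p where "p x = (1 - s x * \<phi> (z x)) / \<tau>" for x
  have r: "resolves \<tau> (scheme \<tau> 0) z" unfolding z_def by (rule scheme_resolves[OF tau])
  have peq: "s x * (scheme \<tau> 0 x - \<phi> (z x)) / \<tau> = p x" for x
    using s_pos[of x] by (simp add: p_def right_diff_distrib)
  have p: "primitive z p" using resolvesD(2)[OF r] unfolding peq by simp
  have bp: "bounded_borel p" by (rule primitive_bounded_borel[OF p])
  have range: "\<phi> (z x) \<in> {A..B}" for x by (rule resolvesD(4)[OF r])
  obtain C where C: "C \<ge> 0" "\<And>x y. \<bar>\<phi> (z y) - \<phi> (z x)\<bar> \<le> C * \<bar>y - x\<bar>" using resolves_lipschitz[OF r] by blast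
  have pb: "\<bar>p x\<bar> \<le> b * (B - A) / \<tau>" for x
  proof -
    have "\<bar>scheme \<tau> 0 x - \<phi> (z x)\<bar> \<le> B - A" using range[of x] initial_range[of x] by auto
    then have "s x * \<bar>scheme \<tau> 0 x - \<phi> (z x)\<bar> \<le> b * (B - A)"
      using s_bounds[of x] b_pos by (intro mult_mono) auto
    then show ?thesis using s_pos[of x] tau unfolding peq[symmetric] by (simp add: abs_mult divide_right_mono)
  qed
  \<comment> \<open>The derivative \<open>p\<close> of z contains s and cannot be differentiated
    again. The equation is therefore differenced over a distance \<open>h\<close>, and
    \<open>h\<close> tends to 0 only in the final estimate.\<close>
  have est: "(LINT x:{c..d}|lborel. \<bar>p x\<bar>) \<le> M + (B * TV + b * C * (d - c)) / \<tau> * h" if h: "h > 0" for h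
  proof -
    let ?X = "\<lambda>x. z (x + h) - z x" and ?U = "\<lambda>x. \<phi> (z (x + h)) - \<phi> (z x)"
    have X: "primitive ?X (\<lambda>x. p (x + h) - p x)" by (intro primitive_diff primitive_shift p)
    have bX: "bounded_borel ?X"
    proof (rule bounded_borelI)
      show "?X \<in> borel_measurable borel" using primitive_continuous[OF X] by (rule borel_measurable_continuous_onI)
      show "\<bar>?X x\<bar> \<le> f B - f A" for x using resolvesD(1)[OF r, of x] resolvesD(1)[OF r, of "x+h"] by auto
    qed
    let ?R = "\<lambda>x. B / \<tau> * (P (x + h) - P x) - a / (\<tau> * L) * \<bar>?X x\<bar>"
    have bR: "bounded_borel ?R" by (intro bounded_borel_intros P_bounded_borel P_shift_bounded_borel bX)
    have le: "sgn (?X y) * (p (x + h) - p x) \<le> ?R x + b / \<tau> * (4 * C) * \<bar>y - x\<bar>" for x y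
    proof -
      have UL: "\<bar>?U y - ?U x\<bar> \<le> (2 * C) * \<bar>y - x\<bar>" for x y
        using C(2)[of "y + h" "x + h"] C(2)[of y x] unfolding distrib_right by simp
      \<comment> \<open>The change of s is multiplied by a quantity bounded by \<open>B\<close> and
        is paid for by \<open>P\<close>; the other term contains \<open>?U\<close>, whose sign
        agrees with that of \<open>?X\<close>, and acts as damping.\<close>
      have pdiff: "p (x + h) - p x = ((s x - s (x + h)) * \<phi> (z x)) / \<tau> + s (x + h) / \<tau> * (- ?U x)"
        using tau by (simp add: p_def field_simps)
      have "sgn (?X y) * (p (x + h) - p x)
         = sgn (?X y) * ((s x - s (x + h)) * \<phi> (z x)) / \<tau> + s (x + h) / \<tau> * (sgn (?X y) * (- ?U x))"
        unfolding pdiff by (simp add: distrib_left)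
      also have "\<dots> \<le> ((P (x + h) - P x) * B) / \<tau> + (- (a / \<tau> * \<bar>?U x\<bar>) + b / \<tau> * (4 * C * \<bar>y - x\<bar>))"
      proof (intro add_mono divide_right_mono)
        have "sgn (?X y) * ((s x - s (x + h)) * \<phi> (z x)) \<le> \<bar>(s x - s (x + h)) * \<phi> (z x)\<bar>" by (rule sgn_mult_le_abs)
        also have "\<dots> \<le> (P (x + h) - P x) * B"
          unfolding abs_mult using s_variation[of x "x + h"] h range[of x] A_pos
          by (intro mult_mono) (auto simp: abs_minus_commute)
        finally show "sgn (?X y) * ((s x - s (x + h)) * \<phi> (z x)) \<le> (P (x + h) - P x) * B" .
        have "s (x + h) / \<tau> * (sgn (?X y) * (- ?U x)) \<le> s (x + h) / \<tau> * (- \<bar>?U x\<bar> + 2 * (2 * C) * \<bar>y - x\<bar>)"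
          using s_pos[of "x + h"] tau
          by (intro mult_left_mono sgn_lipschitz_bound[of ?U] UL) (auto simp: sgn_phi)
        also have "\<dots> \<le> - (a / \<tau> * \<bar>?U x\<bar>) + b / \<tau> * (4 * C * \<bar>y - x\<bar>)"
        proof -
          have "a / \<tau> * \<bar>?U x\<bar> \<le> s (x + h) / \<tau> * \<bar>?U x\<bar>"
            using s_bounds[of "x + h"] tau by (intro mult_right_mono divide_right_mono) auto
          moreover have "s (x + h) / \<tau> * (4 * C * \<bar>y - x\<bar>) \<le> b / \<tau> * (4 * C * \<bar>y - x\<bar>)"
            using s_bounds[of "x + h"] tau C by (intro mult_right_mono divide_right_mono) auto
          ultimately show ?thesis unfolding distrib_left mult_minus_right by (simp only: mult.assoc[symmetric])
        qed
        finally show "s (x + h) / \<tau> * (sgn (?X y) * (- ?U x)) \<le> - (a / \<tau> * \<bar>?U x\<bar>) + b / \<tau> * (4 * C * \<bar>y - x\<bar>)" .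
      qed (use tau in simp)
      also have "\<dots> \<le> ((P (x + h) - P x) * B) / \<tau> + (- (a / (\<tau> * L) * \<bar>?X x\<bar>) + b / \<tau> * (4 * C * \<bar>y - x\<bar>))"
      proof -
        have "a / (\<tau> * L) * \<bar>?X x\<bar> \<le> a / (\<tau> * L) * (L * \<bar>?U x\<bar>)"
          using a_pos tau L_pos by (intro mult_left_mono phi_expand) auto
        then show ?thesis using L_pos by simp
      qed
      finally show ?thesis by (simp add: algebra_simps diff_divide_distrib)
    qed
    have "\<bar>?X d\<bar> - \<bar>?X c\<bar> \<le> (LINT t:{c..d}|lborel. ?R t)"
      by (rule abs_increment_le[OF X bR \<open>c \<le> d\<close> le])
    also have "\<dots> = (LINT t:{c..d}|lborel. B / \<tau> * (P (t + h) - P t)) - (LINT t:{c..d}|lborel. a / (\<tau> * L) * \<bar>?X t\<bar>)"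
      by (intro LINT_Icc_diff bounded_borel_intros P_bounded_borel P_shift_bounded_borel bX)
    also have "\<dots> = B / \<tau> * (LINT t:{c..d}|lborel. P (t + h) - P t) - a / (\<tau> * L) * (LINT t:{c..d}|lborel. \<bar>?X t\<bar>)"
      by simp
    also have "B / \<tau> * (LINT t:{c..d}|lborel. P (t + h) - P t) \<le> B / \<tau> * (TV * h)"
      using B_pos tau h P_increment_integral[of h c d] by (intro mult_left_mono) auto
    finally have "a / (\<tau> * L) * (LINT t:{c..d}|lborel. \<bar>?X t\<bar>) \<le> B / \<tau> * (TV * h) + \<bar>?X c\<bar>" by simp
    also have "\<bar>?X c\<bar> \<le> b * (B - A) / \<tau> * h" using primitive_lipschitz[OF p pb, of "c + h" c] h by simp
    finally have "a / (\<tau> * L) * (LINT t:{c..d}|lborel. \<bar>?X t\<bar>) \<le> (b * (B - A) + B * TV) * h / \<tau>"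
      by (simp add: add_divide_distrib diff_divide_distrib algebra_simps)
    then have "(\<tau> * L / a) * (a / (\<tau> * L) * (LINT t:{c..d}|lborel. \<bar>?X t\<bar>)) \<le> (\<tau> * L / a) * ((b * (B - A) + B * TV) * h / \<tau>)"
      using tau L_pos a_pos by (intro mult_left_mono) auto
    then have XI: "(LINT t:{c..d}|lborel. \<bar>?X t\<bar>) \<le> M * h"
      using tau L_pos a_pos by (simp add: M_def)
    \<comment> \<open>\<open>?X x\<close> is the integral of \<open>p\<close> over [x, x + h].
      Replacing \<open>p t\<close> by \<open>p x\<close> costs the oscillation of s and of \<phi> z
      over that interval; after integration in x this cost is of second order in
      \<open>h\<close>.\<close>
    have pw: "h * \<bar>p x\<bar> \<le> \<bar>?X x\<bar> + h * ((B * (P (x + h) - P x) + b * C * h) / \<tau>)" for x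
    proof -
      have "?X x - h * p x = (LINT t:{x..x+h}|lborel. p t - p x)"
        using primitiveD[OF p, of x "x+h"] h
        by (subst LINT_Icc_diff) (use bp in \<open>auto intro!: bounded_borel_intros simp: LINT_Icc_const simp del: set_integral_const\<close>)
      also have "\<bar>\<dots>\<bar> \<le> ((B * (P (x + h) - P x) + b * C * h) / \<tau>) * (x + h - x)"
      proof (rule LINT_Icc_bound)
        fix t assume t: "x \<le> t" "t \<le> x + h"
        have "\<bar>(s x - s t) * \<phi> (z x)\<bar> \<le> (P (x + h) - P x) * B"
          unfolding abs_mult
        proof (rule mult_mono)
          have "\<bar>s t - s x\<bar> \<le> P t - P x" by (rule s_variation[OF t(1)])
          also have "P t \<le> P (x + h)" using P_mono t by (auto simp: mono_def)
          finally show "\<bar>s x - s t\<bar> \<le> P (x + h) - P x" by (simp add: abs_minus_commute)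
        qed (use range[of x] A_pos P_mono h in \<open>auto simp: mono_def\<close>)
        moreover have "\<bar>s t * (\<phi> (z x) - \<phi> (z t))\<bar> \<le> b * (C * h)"
          unfolding abs_mult using s_bounds[of t] s_pos[of t] t C(1)
          by (intro mult_mono order_trans[OF C(2)] mult_left_mono) auto
        moreover have "p t - p x = ((s x - s t) * \<phi> (z x) + s t * (\<phi> (z x) - \<phi> (z t))) / \<tau>"
          using tau by (simp add: p_def field_simps)
        moreover have "\<bar>(s x - s t) * \<phi> (z x) + s t * (\<phi> (z x) - \<phi> (z t))\<bar> \<le> B * (P (x + h) - P x) + b * C * h"
          using calculation(1,2) by (simp add: algebra_simps)
        ultimately show "\<bar>p t - p x\<bar> \<le> (B * (P (x + h) - P x) + b * C * h) / \<tau>"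
          using tau by (simp add: divide_right_mono)
      qed (use bp h in \<open>auto intro!: bounded_borel_intros\<close>)
      finally have "\<bar>h * p x\<bar> \<le> \<bar>?X x\<bar> + h * ((B * (P (x + h) - P x) + b * C * h) / \<tau>)" by (simp add: algebra_simps)
      then show ?thesis using h by (simp add: abs_mult)
    qed
    have "(LINT t:{c..d}|lborel. h * \<bar>p t\<bar>)
       \<le> (LINT t:{c..d}|lborel. \<bar>?X t\<bar> + ((h * B / \<tau>) * (P (t + h) - P t) + h * b * C * h / \<tau>))"
    proof (intro LINT_Icc_mono)
      show "bounded_borel (\<lambda>t. h * \<bar>p t\<bar>)" by (intro bounded_borel_intros bp)
      show "bounded_borel (\<lambda>t. \<bar>?X t\<bar> + ((h * B / \<tau>) * (P (t + h) - P t) + h * b * C * h / \<tau>))"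
        by (rule bounded_borel_add[OF bounded_borel_abs[OF bX]]) (intro bounded_borel_intros P_bounded_borel P_shift_bounded_borel)
      fix t
      have "h * ((B * (P (t + h) - P t) + b * C * h) / \<tau>) = (h * B / \<tau>) * (P (t + h) - P t) + h * b * C * h / \<tau>"
        by (simp add: add_divide_distrib diff_divide_distrib algebra_simps)
      then show "h * \<bar>p t\<bar> \<le> \<bar>?X t\<bar> + ((h * B / \<tau>) * (P (t + h) - P t) + h * b * C * h / \<tau>)"
        using pw[of t] by linarith
    qed
    also have "\<dots> = (LINT t:{c..d}|lborel. \<bar>?X t\<bar>) + ((h * B / \<tau>) * (LINT t:{c..d}|lborel. P (t + h) - P t) + h * b * C * h / \<tau> * (d - c))"
    proof -
      have "(LINT t:{c..d}|lborel. \<bar>?X t\<bar> + ((h * B / \<tau>) * (P (t + h) - P t) + h * b * C * h / \<tau>))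
         = (LINT t:{c..d}|lborel. \<bar>?X t\<bar>) + (LINT t:{c..d}|lborel. (h * B / \<tau>) * (P (t + h) - P t) + h * b * C * h / \<tau>)"
        by (intro LINT_Icc_add bounded_borel_intros bX P_bounded_borel P_shift_bounded_borel)
      moreover have "(LINT t:{c..d}|lborel. (h * B / \<tau>) * (P (t + h) - P t) + h * b * C * h / \<tau>)
         = (LINT t:{c..d}|lborel. (h * B / \<tau>) * (P (t + h) - P t)) + (LINT t:{c..d}|lborel. h * b * C * h / \<tau>)"
        by (intro LINT_Icc_add bounded_borel_intros P_bounded_borel P_shift_bounded_borel)
      moreover have "(LINT t:{c..d}|lborel. h * b * C * h / \<tau>) = h * b * C * h / \<tau> * (d - c)"
        by (rule LINT_Icc_const[OF \<open>c \<le> d\<close>])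
      ultimately show ?thesis by simp
    qed
    also have "\<dots> \<le> M * h + ((h * B / \<tau>) * (TV * h) + h * b * C * h / \<tau> * (d - c))"
      using B_pos tau h P_increment_integral[of h c d] XI
      by (intro add_mono[OF _ add_right_mono[OF mult_left_mono]]) auto
    also have "\<dots> = h * (M + (B * TV + b * C * (d - c)) / \<tau> * h)" using tau by (simp add: field_simps)
    finally show ?thesis using h by simp
  qed
  define E where "E = (B * TV + b * C * (d - c)) / \<tau>"
  have E: "E \<ge> 0" using B_pos TV_nonneg b_pos C \<open>c \<le> d\<close> tau by (simp add: E_def)
  have "(LINT x:{c..d}|lborel. \<bar>p x\<bar>) \<le> M + e" if "e > 0" for e
  proof -
    have "E * (e / (E + 1)) = e * (E / (E + 1))" by simp
    also have "\<dots> \<le> e * 1" using that E by (intro mult_left_mono) auto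
    finally show ?thesis using est[of "e / (E + 1)"] that E unfolding E_def[symmetric] by auto
  qed
  then have "(LINT x:{c..d}|lborel. \<bar>p x\<bar>) \<le> M" by (rule field_le_epsilon)
  moreover have "s x * (scheme \<tau> 0 x - scheme \<tau> 1 x) / \<tau> = p x" for x
    unfolding peq[of x, symmetric] One_nat_def scheme_Suc z_def ..
  ultimately show ?thesis by (simp only:)
qed

end

section \<open>Crandall-Liggett estimate and total variation of the scheme\<close>

text \<open>Concavity of the square root with weights \<sigma> and \<tau>, proved by squaring: the
  difference of the squares is \<sigma> \<tau> (sqrt X - sqrt Y)^2.\<close>

lemma sqrt_weighted_mean:
  fixes \<sigma> \<tau> X Y D :: real
  assumes "\<sigma> > 0" "\<tau> > 0" "X \<ge> 0" "Y \<ge> 0" and eq: "\<sigma> * X + \<tau> * Y = (\<sigma> + \<tau>) * D"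
  shows "\<sigma> * sqrt X + \<tau> * sqrt Y \<le> (\<sigma> + \<tau>) * sqrt D"
proof -
  have "(\<sigma> + \<tau>) * D \<ge> 0" using assms by (simp flip: eq)
  then have D: "D \<ge> 0" using assms by (simp add: zero_le_mult_iff)
  have X2: "sqrt X * sqrt X = X" and Y2: "sqrt Y * sqrt Y = Y" and D2: "sqrt D * sqrt D = D" using assms D by simp_all
  have "((\<sigma> + \<tau>) * sqrt D)\<^sup>2 - (\<sigma> * sqrt X + \<tau> * sqrt Y)\<^sup>2
     = (\<sigma> + \<tau>) * ((\<sigma> + \<tau>) * (sqrt D * sqrt D)) - (\<sigma> * sqrt X + \<tau> * sqrt Y)\<^sup>2"
    by (simp add: power2_eq_square algebra_simps)
  also have "\<dots> = (\<sigma> + \<tau>) * (\<sigma> * (sqrt X * sqrt X) + \<tau> * (sqrt Y * sqrt Y)) - (\<sigma> * sqrt X + \<tau> * sqrt Y)\<^sup>2"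
    unfolding X2 Y2 D2 eq ..
  also have "\<dots> = \<sigma> * \<tau> * (sqrt X - sqrt Y)\<^sup>2" by (simp add: power2_eq_square algebra_simps)
  also have "\<dots> \<ge> 0" using assms by simp
  finally have "(\<sigma> * sqrt X + \<tau> * sqrt Y)\<^sup>2 \<le> ((\<sigma> + \<tau>) * sqrt D)\<^sup>2" by simp
  then show ?thesis by (rule power2_le_imp_le) (use assms D in simp)
qed

context flux_data
begin

text \<open>The integral has the default value 0 for a non-integrable difference, so integrability
  accompanies the estimates below.\<close>

definition dist1 :: "(real \<Rightarrow> real) \<Rightarrow> (real \<Rightarrow> real) \<Rightarrow> real" where
  "dist1 g h = (LINT x|lborel. s x * \<bar>g x - h x\<bar>)"

text \<open>The variation bound for the first step gives the start; every later pair of consecutive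
  steps arises from the previous pair by the same resolvent, so the contraction carries the bound
  along.\<close>

lemma scheme_step_mass:
  assumes tau: "\<tau> > 0"
  shows "integrable lborel (\<lambda>x. s x * \<bar>scheme \<tau> n x - scheme \<tau> (Suc n) x\<bar>)
    \<and> dist1 (scheme \<tau> n) (scheme \<tau> (Suc n)) \<le> M * \<tau>"
proof (induction n)
  case 0
  let ?Q = "\<lambda>x. s x * \<bar>scheme \<tau> 0 x - scheme \<tau> (Suc 0) x\<bar>"
  have bQ: "bounded_borel ?Q" by (intro bounded_borel_intros s_bounded_borel scheme_bounded_borel tau)
  have "(LINT x:{-real n..real n}|lborel. ?Q x) \<le> M * \<tau>" for n :: nat
  proof -
    have eq: "?Q x = \<bar>s x * (scheme \<tau> 0 x - scheme \<tau> 1 x) / \<tau>\<bar> * \<tau>" for x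
      using s_pos[of x] tau by (simp add: abs_mult)
    show ?thesis unfolding eq
      using first_step_variation[OF tau, of "-real n" "real n"] tau by (simp add: pos_divide_le_eq)
  qed
  from integrable_of_Icc_bound[OF bQ _ this] s_pos show ?case unfolding dist1_def by (simp add: less_imp_le)
next
  case (Suc n)
  note r = resolvent_contraction[OF tau scheme_resolves[OF tau, of n] scheme_resolves[OF tau, of "Suc n"]
      scheme_bounded_borel[OF tau] scheme_bounded_borel[OF tau]]
  note r' = r[unfolded scheme_Suc[symmetric], OF conjunct1[OF Suc.IH]]
  show ?case using r' conjunct2[OF Suc.IH] unfolding dist1_def by (intro conjI) simp_all
qed

lemma mass_triangle:
  assumes "integrable lborel (\<lambda>x. s x * \<bar>g x - h x\<bar>)" "integrable lborel (\<lambda>x. s x * \<bar>h x - k x\<bar>)"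
    and [measurable]: "g \<in> borel_measurable borel" "k \<in> borel_measurable borel"
  shows "integrable lborel (\<lambda>x. s x * \<bar>g x - k x\<bar>)" "dist1 g k \<le> dist1 g h + dist1 h k"
proof -
  have le: "s x * \<bar>g x - k x\<bar> \<le> s x * \<bar>g x - h x\<bar> + s x * \<bar>h x - k x\<bar>" for x
    using s_pos[of x] by (simp flip: distrib_left)
  note add = Bochner_Integration.integrable_add[OF assms(1,2)]
  show i: "integrable lborel (\<lambda>x. s x * \<bar>g x - k x\<bar>)"
  proof (rule Bochner_Integration.integrable_bound[OF add])
    show "(\<lambda>x. s x * \<bar>g x - k x\<bar>) \<in> borel_measurable lborel" by measurable
    have "norm (s x * \<bar>g x - k x\<bar>) \<le> norm (s x * \<bar>g x - h x\<bar> + s x * \<bar>h x - k x\<bar>)" for x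
      using le[of x] s_pos[of x] by (simp add: abs_mult)
    then show "AE x in lborel. norm (s x * \<bar>g x - k x\<bar>) \<le> norm (s x * \<bar>g x - h x\<bar> + s x * \<bar>h x - k x\<bar>)" by simp
  qed
  have "dist1 g k \<le> (LINT x|lborel. s x * \<bar>g x - h x\<bar> + s x * \<bar>h x - k x\<bar>)"
    unfolding dist1_def by (rule integral_mono[OF i add le])
  also have "\<dots> = dist1 g h + dist1 h k"
    unfolding dist1_def by (rule Bochner_Integration.integral_add[OF assms(1,2)])
  finally show "dist1 g k \<le> dist1 g h + dist1 h k" .
qed

lemma dist1_commute: "dist1 g h = dist1 h g"
  by (simp add: dist1_def abs_minus_commute)

lemma scheme_initial_mass:
  assumes tau: "\<tau> > 0"
  shows "integrable lborel (\<lambda>x. s x * \<bar>scheme \<tau> 0 x - scheme \<tau> n x\<bar>)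
    \<and> dist1 (scheme \<tau> 0) (scheme \<tau> n) \<le> M * (real n * \<tau>)"
proof (induction n)
  case 0 then show ?case by (simp add: dist1_def)
next
  case (Suc n)
  note tri = mass_triangle[OF conjunct1[OF Suc.IH] conjunct1[OF scheme_step_mass[OF tau]] scheme_measurable[OF tau] scheme_measurable[OF tau]]
  have "dist1 (scheme \<tau> 0) (scheme \<tau> (Suc n)) \<le> M * (real n * \<tau>) + M * \<tau>"
    using tri(2) conjunct2[OF Suc.IH] conjunct2[OF scheme_step_mass[OF tau, of n]] by linarith
  then show ?case using tri(1) by (simp add: algebra_simps)
qed

lemma scheme_pair_integrable:
  assumes "\<tau> > 0" "\<sigma> > 0"
  shows "integrable lborel (\<lambda>x. s x * \<bar>scheme \<tau> i x - scheme \<sigma> j x\<bar>)"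
proof (rule mass_triangle(1))
  show "integrable lborel (\<lambda>x. s x * \<bar>scheme \<tau> i x - scheme \<tau> 0 x\<bar>)"
    using scheme_initial_mass[OF assms(1), of i] by (simp add: abs_minus_commute)
  show "integrable lborel (\<lambda>x. s x * \<bar>scheme \<tau> 0 x - scheme \<sigma> j x\<bar>)"
    using scheme_initial_mass[OF assms(2), of j] by simp
qed (use assms scheme_measurable in auto)

text \<open>Double induction. \<open>resolvent_pair\<close> bounds the distance at (i+1, j+1) by the
  weighted mean of those at (i, j+1) and (i+1, j). The summands i \<tau>^2 and j \<sigma>^2 are
  chosen so that the radicands satisfy the recursion with equality, after which concavity of the
  square root closes it.\<close>

lemma crandall_liggett:
  assumes tau: "\<tau> > 0" and sig: "\<sigma> > 0"
  shows "dist1 (scheme \<tau> i) (scheme \<sigma> j) \<le> M * sqrt ((i * \<tau> - j * \<sigma>)\<^sup>2 + i * \<tau>\<^sup>2 + j * \<sigma>\<^sup>2)"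
proof (induction i arbitrary: j)
  case 0
  have "real j * \<sigma> \<le> sqrt ((real j * \<sigma>)\<^sup>2 + j * \<sigma>\<^sup>2)"
    by (rule real_le_rsqrt) simp
  then have "M * (real j * \<sigma>) \<le> M * sqrt ((real j * \<sigma>)\<^sup>2 + j * \<sigma>\<^sup>2)" using M_nonneg by (rule mult_left_mono)
  moreover have "dist1 (scheme \<tau> 0) (scheme \<sigma> j) \<le> M * (real j * \<sigma>)"
    using scheme_initial_mass[OF sig, of j] by simp
  ultimately show ?case by simp
next
  case (Suc i)
  note IH = this
  show ?case
  proof (induction j)
    case 0
    have "real (Suc i) * \<tau> \<le> sqrt ((real (Suc i) * \<tau>)\<^sup>2 + real (Suc i) * \<tau>\<^sup>2)"
      by (rule real_le_rsqrt) simp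
    then have "M * (real (Suc i) * \<tau>) \<le> M * sqrt ((real (Suc i) * \<tau>)\<^sup>2 + real (Suc i) * \<tau>\<^sup>2)"
      using M_nonneg by (rule mult_left_mono)
    moreover have "dist1 (scheme \<tau> (Suc i)) (scheme \<sigma> 0) \<le> M * (real (Suc i) * \<tau>)"
      using scheme_initial_mass[OF tau, of "Suc i"] by (subst dist1_commute) simp
    ultimately show ?case by simp
  next
    case (Suc j)
    define I where "I = real i * \<tau>"
    define J where "J = real j * \<sigma>"
    \<comment> \<open>The radicands at (i, j+1), (i+1, j) and (i+1, j+1), in terms of the times I =
      i \<tau> and J = j \<sigma>.\<close>
    let ?X = "(I - (J + \<sigma>))\<^sup>2 + I * \<tau> + (J + \<sigma>) * \<sigma>"
    let ?Y = "((I + \<tau>) - J)\<^sup>2 + (I + \<tau>) * \<tau> + J * \<sigma>"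
    let ?D = "((I + \<tau>) - (J + \<sigma>))\<^sup>2 + (I + \<tau>) * \<tau> + (J + \<sigma>) * \<sigma>"
    have nn: "I \<ge> 0" "J \<ge> 0" using tau sig by (auto simp: I_def J_def)
    have x: "dist1 (scheme \<tau> i) (scheme \<sigma> (Suc j)) \<le> M * sqrt ?X"
      using IH[of "Suc j"] by (simp add: I_def J_def power2_eq_square algebra_simps)
    have y: "dist1 (scheme \<tau> (Suc i)) (scheme \<sigma> j) \<le> M * sqrt ?Y"
      using Suc.IH by (simp add: I_def J_def power2_eq_square algebra_simps)
    have "(1 / \<tau> + 1 / \<sigma>) * dist1 (scheme \<tau> (Suc i)) (scheme \<sigma> (Suc j))
      \<le> dist1 (scheme \<tau> i) (scheme \<sigma> (Suc j)) / \<tau> + dist1 (scheme \<tau> (Suc i)) (scheme \<sigma> j) / \<sigma>"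
      using resolvent_pair[OF tau sig scheme_resolves[OF tau, of i] scheme_resolves[OF sig, of j]
          scheme_bounded_borel[OF tau] scheme_bounded_borel[OF sig]]
        scheme_pair_integrable[OF tau sig, of i "Suc j"] scheme_pair_integrable[OF tau sig, of "Suc i" j]
      unfolding dist1_def scheme_Suc by simp
    then have mul: "(\<sigma> * \<tau>) * ((1 / \<tau> + 1 / \<sigma>) * dist1 (scheme \<tau> (Suc i)) (scheme \<sigma> (Suc j)))
      \<le> (\<sigma> * \<tau>) * (dist1 (scheme \<tau> i) (scheme \<sigma> (Suc j)) / \<tau> + dist1 (scheme \<tau> (Suc i)) (scheme \<sigma> j) / \<sigma>)"
      using tau sig by (intro mult_left_mono) auto
    have "(\<sigma> + \<tau>) * dist1 (scheme \<tau> (Suc i)) (scheme \<sigma> (Suc j))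
      \<le> \<sigma> * dist1 (scheme \<tau> i) (scheme \<sigma> (Suc j)) + \<tau> * dist1 (scheme \<tau> (Suc i)) (scheme \<sigma> j)"
    proof -
      have e1: "(\<sigma> * \<tau>) * ((1 / \<tau> + 1 / \<sigma>) * d) = (\<sigma> + \<tau>) * d" for d
        using tau sig by (simp add: field_simps)
      have e2: "(\<sigma> * \<tau>) * (u / \<tau> + v / \<sigma>) = \<sigma> * u + \<tau> * v" for u v
        using tau sig by (simp add: field_simps)
      show ?thesis using mul unfolding e1 e2 .
    qed
    also have "\<dots> \<le> \<sigma> * (M * sqrt ?X) + \<tau> * (M * sqrt ?Y)"
      using x y tau sig by (intro add_mono mult_left_mono) auto
    also have "\<dots> = M * (\<sigma> * sqrt ?X + \<tau> * sqrt ?Y)" by (simp add: algebra_simps)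
    also have "\<dots> \<le> M * ((\<sigma> + \<tau>) * sqrt ?D)"
    proof (rule mult_left_mono[OF sqrt_weighted_mean M_nonneg])
      show "\<sigma> * ?X + \<tau> * ?Y = (\<sigma> + \<tau>) * ?D" by (simp add: power2_eq_square algebra_simps)
    qed (use tau sig nn in auto)
    finally have "dist1 (scheme \<tau> (Suc i)) (scheme \<sigma> (Suc j)) \<le> M * sqrt ?D"
      using tau sig by (simp add: mult.left_commute[of M])
    then show ?case by (simp add: I_def J_def power2_eq_square algebra_simps)
  qed
qed

text \<open>The equation trades space for time: the variation of z is at most the integral of |z'|,
  which is the distance of consecutive steps divided by \<tau>, and that is at most
  \<open>M\<close>.\<close>

lemma flux_variation:
  assumes tau: "\<tau> > 0" and p: "\<forall>i<k. p i \<le> p (Suc i)"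
  shows "(\<Sum>i<k. \<bar>flux \<tau> n (p (Suc i)) - flux \<tau> n (p i)\<bar>) \<le> M"
proof -
  let ?q = "\<lambda>x. s x * (scheme \<tau> n x - scheme \<tau> (Suc n) x) / \<tau>"
  note pr = flux_primitive[OF tau, of n]
  have bq: "bounded_borel (\<lambda>x. \<bar>?q x\<bar>)" by (intro bounded_borel_abs primitive_bounded_borel[OF pr])
  have "p 0 \<le> p k \<and> (\<Sum>i<k. \<bar>flux \<tau> n (p (Suc i)) - flux \<tau> n (p i)\<bar>) \<le> (LINT x:{p 0..p k}|lborel. \<bar>?q x\<bar>)"
    using p
  proof (induction k)
    case 0
    have "(LINT x:{p 0..p 0}|lborel. 0) \<le> (LINT x:{p 0..p 0}|lborel. \<bar>?q x\<bar>)"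
      by (rule LINT_Icc_mono[OF bounded_borel_const bq]) simp
    then show ?case by simp
  next
    case (Suc k)
    then have IH: "p 0 \<le> p k" "(\<Sum>i<k. \<bar>flux \<tau> n (p (Suc i)) - flux \<tau> n (p i)\<bar>) \<le> (LINT x:{p 0..p k}|lborel. \<bar>?q x\<bar>)"
      and le: "p k \<le> p (Suc k)" by auto
    have "\<bar>flux \<tau> n (p (Suc k)) - flux \<tau> n (p k)\<bar> \<le> (LINT x:{p k..p (Suc k)}|lborel. \<bar>?q x\<bar>)"
      unfolding primitiveD[OF pr le] by (rule LINT_Icc_abs[OF primitive_bounded_borel[OF pr]])
    then show ?case using IH le LINT_Icc_combine[OF bq IH(1) le] by simp
  qed
  then have "(\<Sum>i<k. \<bar>flux \<tau> n (p (Suc i)) - flux \<tau> n (p i)\<bar>) \<le> (LINT x:{p 0..p k}|lborel. \<bar>?q x\<bar>)" ..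
  also have "\<dots> \<le> M"
  proof -
    have eq: "\<bar>?q x\<bar> = s x * \<bar>scheme \<tau> n x - scheme \<tau> (Suc n) x\<bar> / \<tau>" for x
      using s_pos[of x] tau by (simp add: abs_mult)
    have "integrable lborel (\<lambda>x. \<bar>?q x\<bar>)" unfolding eq using scheme_step_mass[OF tau, of n] by (intro integrable_divide) blast
    then have "(LINT x:{p 0..p k}|lborel. \<bar>?q x\<bar>) \<le> (LINT x|lborel. \<bar>?q x\<bar>)"
      by (rule LINT_Icc_le_integral) (rule abs_ge_zero)
    also have "\<dots> = dist1 (scheme \<tau> n) (scheme \<tau> (Suc n)) / \<tau>" unfolding eq dist1_def by simp
    also have "\<dots> \<le> M" using scheme_step_mass[OF tau, of n] tau by (simp add: pos_divide_le_eq)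
    finally show ?thesis .
  qed
  finally show ?thesis .
qed

lemma scheme_variation:
  assumes tau: "\<tau> > 0" and p: "\<forall>i<k. p i \<le> p (Suc i)"
  shows "(\<Sum>i<k. \<bar>scheme \<tau> (Suc n) (p (Suc i)) - scheme \<tau> (Suc n) (p i)\<bar>) \<le> M / m"
proof -
  have "(\<Sum>i<k. \<bar>scheme \<tau> (Suc n) (p (Suc i)) - scheme \<tau> (Suc n) (p i)\<bar>)
     \<le> (\<Sum>i<k. \<bar>flux \<tau> n (p (Suc i)) - flux \<tau> n (p i)\<bar> / m)"
    unfolding scheme_Suc by (intro sum_mono phi_lipschitz)
  also have "\<dots> = (\<Sum>i<k. \<bar>flux \<tau> n (p (Suc i)) - flux \<tau> n (p i)\<bar>) / m" by (simp add: sum_divide_distrib)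
  also have "\<dots> \<le> M / m" using flux_variation[OF tau p] m_pos by (simp add: divide_right_mono)
  finally show ?thesis .
qed

end

section \<open>Convergence of the scheme\<close>

text \<open>Tychonoff's theorem: the sequence has a cluster point in a product of compact intervals.
  A bound that eventually holds for a functional continuous in the topology of pointwise convergence
  passes to it. In contrast to a subsequence converging almost everywhere, the result is meaningful
  at every x.\<close>

lemma frequent_limit_point:
  fixes u :: "nat \<Rightarrow> real \<Rightarrow> real"
  assumes "\<And>k x. u k x \<in> {A..B}"
  shows "\<exists>r. (\<forall>x. r x \<in> {A..B}) \<and>
    (\<forall>\<Phi> C. continuous_on UNIV \<Phi> \<longrightarrow> (\<forall>\<^sub>F k in sequentially. \<Phi> (u k) \<le> (C :: real)) \<longrightarrow> \<Phi> r \<le> C)"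
proof -
  define S where "S = PiE (UNIV :: real set) (\<lambda>_. {A..B})"
  have "compactin (product_topology (\<lambda>_ :: real. euclidean :: real topology) UNIV) S"
    unfolding S_def by (subst compactin_PiE) (auto simp: compactin_euclidean_iff)
  then have S: "compact S" by (simp add: euclidean_product_topology compactin_euclidean_iff)
  define F where "F = filtermap u sequentially"
  have F: "F \<noteq> bot" by (simp add: F_def filtermap_bot_iff)
  have "eventually (\<lambda>g. g \<in> S) F"
    unfolding F_def S_def eventually_filtermap using assms by (intro always_eventually) (auto simp: PiE_iff)
  then obtain r where r: "r \<in> S" "inf (nhds r) F \<noteq> bot" using S F unfolding compact_filter by blast
  have "\<Phi> r \<le> C" if cont: "continuous_on UNIV \<Phi>" and ev: "\<forall>\<^sub>F k in sequentially. \<Phi> (u k) \<le> C" for \<Phi> and C :: real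
  proof (rule ccontr)
    assume "\<not> \<Phi> r \<le> C"
    then have "r \<in> {g. \<Phi> g > C}" by simp
    moreover have "open {g. \<Phi> g > C}" using cont by (intro open_Collect_less) auto
    ultimately have "eventually (\<lambda>g. \<Phi> g > C) (nhds r)" by (auto simp: eventually_nhds)
    moreover have "eventually (\<lambda>g. \<Phi> g \<le> C) F" using ev by (simp add: F_def eventually_filtermap)
    ultimately have "eventually (\<lambda>g. False) (inf (nhds r) F)"
      unfolding eventually_inf by (intro exI[of _ "\<lambda>g. \<Phi> g > C"] exI[of _ "\<lambda>g. \<Phi> g \<le> C"]) auto
    then show False using r(2) by (simp add: eventually_False)
  qed
  moreover have "r x \<in> {A..B}" for x using r(1) by (auto simp: S_def)
  ultimately show ?thesis by blast
qed

text \<open>The functionals used are the distance to a limit at one point and the finite variation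
  sums; both depend on finitely many values.\<close>

lemma pointwise_limit_point:
  fixes u :: "nat \<Rightarrow> real \<Rightarrow> real"
  assumes "\<And>k x. u k x \<in> {A..B}"
  shows "\<exists>r. (\<forall>x. r x \<in> {A..B}) \<and> (\<forall>x l. (\<lambda>k. u k x) \<longlonglongrightarrow> l \<longrightarrow> r x = l) \<and>
    (\<forall>n p C. (\<forall>k. (\<Sum>i<n. \<bar>u k (p (Suc i)) - u k (p i)\<bar>) \<le> C) \<longrightarrow> (\<Sum>i<(n::nat). \<bar>r (p (Suc i)) - r (p i)\<bar>) \<le> C)"
proof -
  obtain r where r: "\<forall>x. r x \<in> {A..B}"
    and lim: "\<And>\<Phi> C. continuous_on UNIV \<Phi> \<Longrightarrow> (\<forall>\<^sub>F k in sequentially. \<Phi> (u k) \<le> C) \<Longrightarrow> \<Phi> r \<le> (C::real)"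
    using frequent_limit_point[of u A B, OF assms] by blast
  have "r x = l" if l: "(\<lambda>k. u k x) \<longlonglongrightarrow> l" for x l
  proof -
    have "\<bar>r x - l\<bar> \<le> e" if "e > 0" for e
    proof (rule lim[of "\<lambda>g. \<bar>g x - l\<bar>" e])
      show "continuous_on UNIV (\<lambda>g :: real \<Rightarrow> real. \<bar>g x - l\<bar>)" by (intro continuous_intros) simp
      show "\<forall>\<^sub>F k in sequentially. \<bar>u k x - l\<bar> \<le> e"
        using tendstoD[OF l that] by eventually_elim (simp add: dist_real_def less_imp_le)
    qed
    then have "\<bar>r x - l\<bar> \<le> 0" by (rule field_le_epsilon[of _ 0, simplified])
    then show ?thesis by simp
  qed
  moreover have "(\<Sum>i<n. \<bar>r (p (Suc i)) - r (p i)\<bar>) \<le> C"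
    if "\<forall>k. (\<Sum>i<n. \<bar>u k (p (Suc i)) - u k (p i)\<bar>) \<le> C" for n p C
    by (rule lim[of "\<lambda>g. \<Sum>i<n. \<bar>g (p (Suc i)) - g (p i)\<bar>"]) (use that in \<open>auto intro!: continuous_intros\<close>)
  ultimately show ?thesis using r by blast
qed

context flux_data
begin

text \<open>The error is of the order of the square root of the step size, so the ratio 1/4 makes it
  2^(-k) and hence summable.\<close>

definition mesh :: "nat \<Rightarrow> real" where "mesh k = (1 / 4) ^ k"

text \<open>Rounding up guarantees at least one implicit step for every \<open>t > 0\<close>, and
  only after a step does \<open>scheme_variation\<close> apply. For \<open>t \<le> 0\<close> the
  value is 0, so the approximation equals the initial datum there.\<close>

definition steps :: "nat \<Rightarrow> real \<Rightarrow> nat" where "steps k t = nat \<lceil>t / mesh k\<rceil>"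

definition approx :: "nat \<Rightarrow> real \<Rightarrow> real \<Rightarrow> real" where
  "approx k t = scheme (mesh k) (steps k t)"

lemma mesh_pos: "mesh k > 0" by (simp add: mesh_def)
lemma mesh_le_1: "mesh k \<le> 1" unfolding mesh_def by (rule power_le_one) auto

lemma steps_bounds:
  assumes "t \<ge> 0" shows "t \<le> steps k t * mesh k" "steps k t * mesh k \<le> t + mesh k"
proof -
  have "\<lceil>t / mesh k\<rceil> \<ge> 0" using assms mesh_pos[of k] by (simp add: less_le_trans[of "-1" 0])
  then have eq: "real (steps k t) = of_int \<lceil>t / mesh k\<rceil>" by (simp add: steps_def)
  have "t / mesh k \<le> real (steps k t)" "real (steps k t) \<le> t / mesh k + 1" unfolding eq by linarith+
  then show "t \<le> steps k t * mesh k" "steps k t * mesh k \<le> t + mesh k"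
    using mesh_pos[of k] by (simp_all add: field_simps)
qed

lemma steps_pos: "t > 0 \<Longrightarrow> steps k t > 0"
  using mesh_pos[of k] by (simp add: steps_def)

lemma steps_0 [simp]: "t \<le> 0 \<Longrightarrow> steps k t = 0"
  using mesh_pos[of k] by (simp add: steps_def divide_nonpos_pos)

lemma approx_0: "t \<le> 0 \<Longrightarrow> approx k t x = 1 / s x" by (simp add: approx_def)
lemma approx_range: "approx k t x \<in> {A..B}" unfolding approx_def by (rule scheme_range[OF mesh_pos])
lemma approx_measurable [measurable]: "approx k t \<in> borel_measurable borel"
  unfolding approx_def by (rule scheme_measurable[OF mesh_pos])

lemma approx_cauchy:
  assumes "t \<ge> 0"
  shows "dist1 (approx k t) (approx (Suc k) t) \<le> M * sqrt (2 * t + 3) * (1 / 2) ^ k"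
proof -
  let ?\<tau> = "mesh k" and ?\<sigma> = "mesh (Suc k)" and ?i = "steps k t" and ?j = "steps (Suc k) t"
  have sig: "?\<sigma> \<le> ?\<tau>" by (simp add: mesh_def)
  note b = steps_bounds[OF assms, of k] steps_bounds[OF assms, of "Suc k"]
  have "\<bar>?i * ?\<tau> - ?j * ?\<sigma>\<bar> \<le> ?\<tau>" using b sig by linarith
  then have "(?i * ?\<tau> - ?j * ?\<sigma>)\<^sup>2 \<le> ?\<tau>\<^sup>2" by (metis abs_ge_zero power2_abs power_mono)
  also have "?\<tau>\<^sup>2 \<le> ?\<tau>" using mesh_pos[of k] mesh_le_1[of k] by (simp add: power2_eq_square mult_left_le)
  finally have 1: "(?i * ?\<tau> - ?j * ?\<sigma>)\<^sup>2 \<le> ?\<tau>" .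
  have 2: "?i * ?\<tau>\<^sup>2 \<le> (t + 1) * ?\<tau>"
    unfolding power2_eq_square mult.assoc[symmetric] using b mesh_pos[of k] mesh_le_1[of k] by (intro mult_right_mono) linarith+
  have "?j * ?\<sigma>\<^sup>2 \<le> (t + 1) * ?\<sigma>"
    unfolding power2_eq_square mult.assoc[symmetric] using b mesh_pos[of "Suc k"] mesh_le_1[of "Suc k"] by (intro mult_right_mono) linarith+
  also have "\<dots> \<le> (t + 1) * ?\<tau>" using sig assms by (intro mult_left_mono) auto
  finally have 3: "?j * ?\<sigma>\<^sup>2 \<le> (t + 1) * ?\<tau>" .
  \<comment> \<open>One \<open>mesh k\<close> from the difference of the rounded times and t + 1
    from each of the two remaining sums.\<close>
  have "sqrt ((?i * ?\<tau> - ?j * ?\<sigma>)\<^sup>2 + ?i * ?\<tau>\<^sup>2 + ?j * ?\<sigma>\<^sup>2) \<le> sqrt ((2 * t + 3) * ?\<tau>)"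
    using 1 2 3 by (simp add: algebra_simps)
  also have "\<dots> = sqrt (2 * t + 3) * (1 / 2) ^ k"
    by (simp add: real_sqrt_mult mesh_def real_sqrt_power real_sqrt_divide)
  finally have "M * sqrt ((?i * ?\<tau> - ?j * ?\<sigma>)\<^sup>2 + ?i * ?\<tau>\<^sup>2 + ?j * ?\<sigma>\<^sup>2) \<le> M * (sqrt (2 * t + 3) * (1 / 2) ^ k)"
    using M_nonneg by (rule mult_left_mono)
  then show ?thesis using crandall_liggett[OF mesh_pos mesh_pos, of k ?i "Suc k" ?j] by (simp add: approx_def mult.assoc)
qed

lemma approx_integrable: "integrable lborel (\<lambda>x. s x * \<bar>approx k t x - approx j t' x\<bar>)"
  unfolding approx_def by (rule scheme_pair_integrable[OF mesh_pos mesh_pos])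

text \<open>The increments have summable L1 norms, so the integral of their sum is finite and the
  telescoping series converges absolutely almost everywhere. Division by s > 0 removes the
  weight.\<close>

lemma approx_convergent:
  assumes t: "t \<ge> 0"
  shows "AE x in lborel. convergent (\<lambda>k. approx k t x)"
proof -
  let ?d = "\<lambda>k x. s x * \<bar>approx k t x - approx (Suc k) t x\<bar>"
  let ?c = "\<lambda>k. M * sqrt (2 * t + 3) * (1 / 2) ^ k"
  have nn: "0 \<le> ?d k x" for k x using s_pos[of x] by simp
  have c0: "0 \<le> ?c k" for k using M_nonneg t by simp
  have "(\<integral>\<^sup>+x. ennreal (?d k x) \<partial>lborel) \<le> ennreal (?c k)" for k
    using approx_cauchy[OF t, of k] nn approx_integrable unfolding dist1_def
    by (subst nn_integral_eq_integral) (auto intro: ennreal_leI)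
  then have "(\<Sum>k. \<integral>\<^sup>+x. ennreal (?d k x) \<partial>lborel) \<le> (\<Sum>k. ennreal (?c k))"
    by (intro suminf_le) auto
  moreover have "(\<Sum>k. ennreal (?c k)) \<noteq> top"
    by (rule ennreal_suminf_neq_top) (use c0 in \<open>auto intro!: summable_mult summable_geometric\<close>)
  ultimately have "(\<Sum>k. \<integral>\<^sup>+x. ennreal (?d k x) \<partial>lborel) \<noteq> top" by (metis top.extremum_uniqueI)
  also have "(\<Sum>k. \<integral>\<^sup>+x. ennreal (?d k x) \<partial>lborel) = (\<integral>\<^sup>+x. (\<Sum>k. ennreal (?d k x)) \<partial>lborel)"
    by (rule nn_integral_suminf[symmetric]) measurable
  finally have "AE x in lborel. (\<Sum>k. ennreal (?d k x)) \<noteq> \<infinity>"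
    by (intro nn_integral_PInf_AE) auto
  then show ?thesis
  proof eventually_elim
    case (elim x)
    then have "summable (\<lambda>k. ?d k x)" by (intro summable_suminf_not_top nn) simp
    then have "summable (\<lambda>k. (1 / s x) * ?d k x)" by (rule summable_mult)
    then have "summable (\<lambda>k. \<bar>approx (Suc k) t x - approx k t x\<bar>)"
      using s_pos[of x] by (simp add: abs_minus_commute)
    then have "summable (\<lambda>k. approx (Suc k) t x - approx k t x)" by (rule summable_rabs_cancel)
    then have "convergent (\<lambda>n. \<Sum>k<n. (approx (Suc k) t x - approx k t x))" by (simp add: summable_iff_convergent)
    moreover have "(\<Sum>k<n. (approx (Suc k) t x - approx k t x)) = approx n t x - approx 0 t x" for n
      by (rule sum_lessThan_telescope)
    ultimately have "convergent (\<lambda>n. approx n t x - approx 0 t x)" by (simp only:)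
    then show ?case by (simp add: convergent_diff_const_right_iff)
  qed
qed

text \<open>Chosen separately for each \<open>t\<close>: it keeps the variation bound at every point
  and equals the limit wherever one exists, but nothing is known about its measurability in (x, t).
  The function \<open>blim\<close> is its Borel companion.\<close>

definition limit_sol :: "real \<Rightarrow> real \<Rightarrow> real" where
  "limit_sol t = (SOME r. (\<forall>x. r x \<in> {A..B}) \<and> (\<forall>x l. (\<lambda>k. approx k t x) \<longlonglongrightarrow> l \<longrightarrow> r x = l) \<and>
    (\<forall>n p C. (\<forall>k. (\<Sum>i<n. \<bar>approx k t (p (Suc i)) - approx k t (p i)\<bar>) \<le> C) \<longrightarrow>
      (\<Sum>i<(n::nat). \<bar>r (p (Suc i)) - r (p i)\<bar>) \<le> C))"

lemma limit_sol_props: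
  shows "limit_sol t x \<in> {A..B}" "(\<lambda>k. approx k t x) \<longlonglongrightarrow> l \<Longrightarrow> limit_sol t x = l"
    "(\<And>k. (\<Sum>i<n. \<bar>approx k t (p (Suc i)) - approx k t (p i)\<bar>) \<le> C) \<Longrightarrow>
      (\<Sum>i<(n::nat). \<bar>limit_sol t (p (Suc i)) - limit_sol t (p i)\<bar>) \<le> C"
proof -
  note ex = pointwise_limit_point[of "\<lambda>k. approx k t" A B, OF approx_range]
  from someI_ex[OF ex, folded limit_sol_def]
  show "limit_sol t x \<in> {A..B}" "(\<lambda>k. approx k t x) \<longlonglongrightarrow> l \<Longrightarrow> limit_sol t x = l"
    "(\<And>k. (\<Sum>i<n. \<bar>approx k t (p (Suc i)) - approx k t (p i)\<bar>) \<le> C) \<Longrightarrow>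
      (\<Sum>i<(n::nat). \<bar>limit_sol t (p (Suc i)) - limit_sol t (p i)\<bar>) \<le> C"
    by blast+
qed

lemma limit_sol_0: "t \<le> 0 \<Longrightarrow> limit_sol t x = 1 / s x"
  by (rule limit_sol_props(2)) (simp add: approx_0)

lemma limit_sol_variation:
  assumes "t > 0" "\<forall>i<n. p i \<le> p (Suc i)"
  shows "(\<Sum>i<n. \<bar>limit_sol t (p (Suc i)) - limit_sol t (p i)\<bar>) \<le> M / m"
proof (rule limit_sol_props(3))
  fix k
  obtain j where j: "steps k t = Suc j" using steps_pos[OF assms(1), of k] gr0_implies_Suc by blast
  show "(\<Sum>i<n. \<bar>approx k t (p (Suc i)) - approx k t (p i)\<bar>) \<le> M / m"
    unfolding approx_def j by (rule scheme_variation[OF mesh_pos assms(2)])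
qed

end

section \<open>Passage to the limit in the entropy inequality\<close>

lemma continuous_compose_measurable:
  fixes F :: "'a::topological_space \<Rightarrow> 'b::topological_space"
  assumes "continuous_on S F" "S \<in> sets borel" "h \<in> borel_measurable M" "\<And>x. h x \<in> S"
  shows "(\<lambda>x. F (h x)) \<in> borel_measurable M"
proof -
  have "h \<in> measurable M (restrict_space borel S)" using assms(3,4) by (intro measurable_restrict_space2) auto
  moreover have "F \<in> borel_measurable (restrict_space borel S)"
    by (rule borel_measurable_continuous_on_restrict[OF assms(1)])
  ultimately show ?thesis by (rule measurable_compose)
qed

lemma plane_integrable:
  fixes g :: "real \<times> real \<Rightarrow> real"
  assumes g: "g \<in> borel_measurable borel" "\<And>z. \<bar>g z\<bar> \<le> C"
    and supp: "\<And>x t. \<bar>x\<bar> \<ge> K \<or> \<bar>t\<bar> \<ge> K \<Longrightarrow> g (x, t) = 0"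
  shows "integrable lborel g"
proof (rule Bochner_Integration.integrable_bound)
  let ?S = "cbox (-K, -K) (K, K) :: (real \<times> real) set"
  show "integrable lborel (\<lambda>z. indicator ?S z * C)"
    by (intro integrable_mult_left integrable_real_indicator) (auto simp: emeasure_lborel_cbox_eq)
  have "norm (g z) \<le> norm (indicator ?S z * C)" for z
  proof (cases "z \<in> ?S")
    case True then show ?thesis using g(2)[of z] by simp
  next
    case False
    then have "\<bar>fst z\<bar> \<ge> K \<or> \<bar>snd z\<bar> \<ge> K" by (cases z) (auto simp: cbox_Pair_eq)
    then show ?thesis using supp[of "fst z" "snd z"] False by simp
  qed
  then show "AE z in lborel. norm (g z) \<le> norm (indicator ?S z * C)" by simp
qed (use g in simp)

lemma plane_Fubini:
  fixes g :: "real \<times> real \<Rightarrow> real"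
  assumes "integrable lborel g"
  shows "(LINT x|lborel. LINT t|lborel. g (x, t)) = (LINT z|lborel. g z)"
    "(LINT t|lborel. LINT x|lborel. g (x, t)) = (LINT z|lborel. g z)"
proof -
  have i: "integrable (lborel \<Otimes>\<^sub>M lborel) g" using assms by (simp add: lborel_prod)
  show "(LINT x|lborel. LINT t|lborel. g (x, t)) = (LINT z|lborel. g z)"
    using lborel_pair.integral_fst'[OF i] by (simp add: lborel_prod)
  have "integrable (lborel \<Otimes>\<^sub>M lborel) (case_prod (\<lambda>x t. g (x, t)))" using i by simp
  from lborel_pair.integral_snd[OF this]
  show "(LINT t|lborel. LINT x|lborel. g (x, t)) = (LINT z|lborel. g z)" by (simp add: lborel_prod)
qed

definition test2 :: "(real \<times> real \<Rightarrow> real) \<Rightarrow> (real \<times> real \<Rightarrow> real) \<Rightarrow> (real \<times> real \<Rightarrow> real) \<Rightarrow> bool" where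
  "test2 \<psi> \<psi>x \<psi>t \<longleftrightarrow>
     (\<forall>x t. ((\<lambda>y. \<psi> (y, t)) has_real_derivative \<psi>x (x, t)) (at x)) \<and>
     (\<forall>x t. ((\<lambda>\<tau>. \<psi> (x, \<tau>)) has_real_derivative \<psi>t (x, t)) (at t)) \<and>
     continuous_on UNIV \<psi> \<and> continuous_on UNIV \<psi>x \<and> continuous_on UNIV \<psi>t \<and>
     (\<exists>K. \<forall>x t. \<bar>x\<bar> \<ge> K \<or> \<bar>t\<bar> \<ge> K \<or> t \<le> 0 \<longrightarrow> \<psi> (x, t) = 0 \<and> \<psi>x (x, t) = 0 \<and> \<psi>t (x, t) = 0)"

lemma plane_compact_support_bound:
  fixes g :: "real \<times> real \<Rightarrow> real"
  assumes "continuous_on UNIV g" "\<And>x t. \<bar>x\<bar> \<ge> K \<or> \<bar>t\<bar> \<ge> K \<Longrightarrow> g (x, t) = 0"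
  shows "\<exists>C>0. \<forall>z. \<bar>g z\<bar> \<le> C"
proof -
  let ?S = "cbox (-K, -K) (K, K) :: (real \<times> real) set"
  have "compact (g ` ?S)" using assms(1) by (intro compact_continuous_image compact_cbox) (auto intro: continuous_on_subset)
  then obtain D where D: "\<forall>y\<in>g ` ?S. norm y \<le> D" using compact_imp_bounded bounded_iff by blast
  have "\<bar>g z\<bar> \<le> \<bar>D\<bar> + 1" for z
  proof (cases "z \<in> ?S")
    case True then have "norm (g z) \<le> D" using D by blast
    then show ?thesis by simp
  next
    case False
    then have "\<bar>fst z\<bar> \<ge> K \<or> \<bar>snd z\<bar> \<ge> K" by (cases z) (auto simp: cbox_Pair_eq)
    then show ?thesis using assms(2)[of "fst z" "snd z"] by simp
  qed
  then show ?thesis by (intro exI[of _ "\<bar>D\<bar> + 1"]) auto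
qed

lemma test2_C1c:
  assumes "test2 \<psi> \<psi>x \<psi>t" shows "C1c (\<lambda>x. \<psi> (x, t)) (\<lambda>x. \<psi>x (x, t))"
proof -
  have "continuous_on UNIV (\<lambda>x. \<psi>x (x, t))"
    using assms unfolding test2_def by (intro continuous_on_compose2[of UNIV \<psi>x UNIV "\<lambda>x. (x, t)"] continuous_intros) auto
  then show ?thesis using assms unfolding C1c_def test2_def by blast
qed

context flux_data
begin

lemma approx_joint_measurable [measurable]: "(\<lambda>z. approx k (snd z) (fst z)) \<in> borel_measurable (borel \<Otimes>\<^sub>M borel)"
proof -
  have 1: "(\<lambda>z :: real \<times> real. scheme (mesh k) n (fst z)) \<in> borel_measurable (borel \<Otimes>\<^sub>M borel)" for n
    using scheme_measurable[OF mesh_pos, of k n] by measurable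
  have 2: "(\<lambda>z :: real \<times> real. steps k (snd z)) \<in> measurable (borel \<Otimes>\<^sub>M borel) (count_space UNIV)"
    unfolding steps_def by measurable
  show ?thesis unfolding approx_def
    by (rule measurable_compose_countable[OF 1 2])
qed

text \<open>Truncated to [A, B] because \<open>lim\<close> is an unspecified number where the
  sequence diverges.\<close>

definition blim :: "real \<Rightarrow> real \<Rightarrow> real" where
  "blim t x = max A (min B (lim (\<lambda>k. approx k t x)))"

lemma blim_measurable [measurable]: "(\<lambda>z. blim (snd z) (fst z)) \<in> borel_measurable (borel \<Otimes>\<^sub>M borel)"
  unfolding blim_def by measurable

lemma blim_range: "blim t x \<in> {A..B}" using A_le_B by (auto simp: blim_def)

lemma approx_tendsto_blim:
  assumes "convergent (\<lambda>k. approx k t x)"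
  shows "(\<lambda>k. approx k t x) \<longlonglongrightarrow> blim t x" "limit_sol t x = blim t x"
proof -
  obtain l where l: "(\<lambda>k. approx k t x) \<longlonglongrightarrow> l" using assms by (auto simp: convergent_def)
  have "l \<in> {A..B}" by (rule Lim_in_closed_set[OF _ _ _ l]) (use approx_range in auto)
  then have "blim t x = l" using limI[OF l] by (auto simp: blim_def)
  then show "(\<lambda>k. approx k t x) \<longlonglongrightarrow> blim t x" "limit_sol t x = blim t x" using l limit_sol_props(2)[OF l] by auto
qed

text \<open>Convergence is expressed by the Cauchy property, whose set is measurable; the null sets
  on the lines t = const then combine to a null set of the plane by Fubini.\<close>

lemma plane_convergent: "AE z in lborel. snd z \<ge> 0 \<longrightarrow> convergent (\<lambda>k. approx k (snd z) (fst z))"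
proof -
  let ?P = "\<lambda>x t. t \<ge> 0 \<longrightarrow> Cauchy (\<lambda>k. approx k t x)"
  have m: "{z \<in> space ((lborel :: real measure) \<Otimes>\<^sub>M (lborel :: real measure)). ?P (fst z) (snd z)} \<in> sets (lborel \<Otimes>\<^sub>M lborel)"
  proof -
    have "{z \<in> space (borel \<Otimes>\<^sub>M borel). Cauchy (\<lambda>k. approx k (snd z) (fst z))} \<in> sets (borel \<Otimes>\<^sub>M borel)"
      by (rule sets_Collect_Cauchy) measurable
    then have [measurable]: "Measurable.pred (borel \<Otimes>\<^sub>M borel) (\<lambda>z. Cauchy (\<lambda>k. approx k (snd z) (fst z)))"
      by (simp add: pred_def)
    have "Measurable.pred (borel \<Otimes>\<^sub>M borel) (\<lambda>z :: real \<times> real. ?P (fst z) (snd z))" by measurable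
    moreover have "sets ((lborel :: real measure) \<Otimes>\<^sub>M (lborel :: real measure)) = sets (borel \<Otimes>\<^sub>M borel)"
      by (intro sets_pair_measure_cong) simp_all
    ultimately show ?thesis by (simp add: pred_def space_pair_measure)
  qed
  have "AE t in lborel. AE x in lborel. ?P x t"
  proof (rule AE_I2)
    fix t :: real
    show "AE x in lborel. ?P x t"
    proof (cases "t \<ge> 0")
      case True then show ?thesis using approx_convergent[OF True] by (simp add: Cauchy_convergent_iff)
    qed simp
  qed
  then have "AE x in lborel. AE t in lborel. ?P x t" using lborel_pair.AE_commute[OF m] by simp
  then have "AE z in lborel \<Otimes>\<^sub>M lborel. ?P (fst z) (snd z)" by (intro lborel_pair.AE_pair_measure m) simp
  then show ?thesis unfolding lborel_prod Cauchy_convergent_iff .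
qed

lemma entropy_bounded_borel:
  assumes E: "continuous_on ({a..b} \<times> {A..B}) E" and g: "g \<in> borel_measurable borel" "\<And>x. g x \<in> {A..B}"
  shows "bounded_borel (\<lambda>x. E (s x, g x))"
proof -
  have "compact (E ` ({a..b} \<times> {A..B}))" using E by (intro compact_continuous_image compact_Times) auto
  then obtain C where C: "\<forall>y\<in>E ` ({a..b} \<times> {A..B}). norm y \<le> C" using compact_imp_bounded bounded_iff by blast
  have S: "(s x, g x) \<in> {a..b} \<times> {A..B}" for x using s_bounds[of x] g(2)[of x] by simp
  have [measurable]: "g \<in> borel_measurable borel" by (rule g)
  have "(\<lambda>x. E (s x, g x)) \<in> borel_measurable borel"
    by (rule continuous_compose_measurable[OF E _ _ S]) (measurable, auto intro!: borel_closed closed_Times)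
  moreover have "\<bar>E (s x, g x)\<bar> \<le> C" for x using C S[of x] by (metis imageI real_norm_def)
  ultimately show ?thesis by (rule bounded_borelI)
qed

text \<open>The entropy is written in the variables (s, r). Multiply the step equation by th(z): the
  space term is the derivative of Th(z) by the chain rule, and \<open>ineq\<close>, the tangent
  inequality at the new value, bounds the time difference of E. The weight \<theta> stands inside
  \<open>ineq\<close> so that an entropy with equality may be tested with either sign.\<close>

lemma entropy_step:
  assumes tau: "\<tau> > 0"
    and E: "continuous_on ({a..b} \<times> {A..B}) E"
    and Th: "\<And>u. u \<in> {f A..f B} \<Longrightarrow> (Th has_real_derivative th u) (at u within {f A..f B})"
    and th: "continuous_on {f A..f B} th"
    and chi: "C1c \<theta> \<theta>'"
    and ineq: "\<And>x r1 r2. r1 \<in> {A..B} \<Longrightarrow> r2 \<in> {A..B} \<Longrightarrow>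
      \<theta> x * (E (s x, r2) - E (s x, r1)) \<le> \<theta> x * (s x * (th (f r2) * (r2 - r1)))"
  shows "0 \<le> (LINT x|lborel. \<theta>' x * Th (f (scheme \<tau> (Suc n) x))
     - \<theta> x * (E (s x, scheme \<tau> (Suc n) x) - E (s x, scheme \<tau> n x)) / \<tau>)"
proof -
  let ?z = "flux \<tau> n"
  define p where "p x = s x * (scheme \<tau> n x - scheme \<tau> (Suc n) x) / \<tau>" for x
  have p: "primitive ?z p" unfolding p_def by (rule flux_primitive[OF tau])
  have z: "?z x \<in> {f A..f B}" for x by (rule resolvesD(1)[OF scheme_resolves[OF tau]])
  have fz: "f (scheme \<tau> (Suc n) x) = ?z x" for x by (simp add: scheme_Suc f_phi)
  have ch: "primitive (\<lambda>x. Th (?z x)) (\<lambda>x. th (?z x) * p x)" by (rule primitive_chain[OF p z Th th])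
  have cTh: "continuous_on {f A..f B} Th"
    using Th by (meson DERIV_continuous continuous_on_eq_continuous_within)
  have "compact (Th ` {f A..f B})" using cTh by (intro compact_continuous_image) auto
  then obtain C where C: "\<forall>y\<in>Th ` {f A..f B}. norm y \<le> C" using compact_imp_bounded bounded_iff by blast
  have bTh: "bounded_borel (\<lambda>x. Th (?z x))"
  proof (rule bounded_borelI)
    show "(\<lambda>x. Th (?z x)) \<in> borel_measurable borel"
      using primitive_continuous[OF ch] by (rule borel_measurable_continuous_onI)
    show "\<bar>Th (?z x)\<bar> \<le> C" for x using C z[of x] by (metis imageI real_norm_def)
  qed
  obtain K where K: "\<And>x. \<bar>x\<bar> \<ge> K \<Longrightarrow> \<theta> x = 0 \<and> \<theta>' x = 0" using chi unfolding C1c_def by blast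
  note bc = C1c_bounded_borel[OF chi]
  note bE = entropy_bounded_borel[OF E scheme_measurable[OF tau] scheme_range[OF tau]]
  have i1: "integrable lborel (\<lambda>x. \<theta>' x * Th (?z x))"
    by (rule LINT_compact_support(1)[of _ K]) (use bc bTh K in \<open>auto intro: bounded_borel_mult\<close>)
  have i2: "integrable lborel (\<lambda>x. \<theta> x * (th (?z x) * p x))"
    by (rule LINT_compact_support(1)[of _ K]) (use bc primitive_bounded_borel[OF ch] K in \<open>auto intro: bounded_borel_mult\<close>)
  have i3: "integrable lborel (\<lambda>x. \<theta>' x * Th (?z x) - \<theta> x * (E (s x, scheme \<tau> (Suc n) x) - E (s x, scheme \<tau> n x)) / \<tau>)"
    unfolding divide_inverse
    by (rule LINT_compact_support(1)[of _ K]) (use K in \<open>simp_all, intro bounded_borel_intros bc bTh bE\<close>)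
  have "0 = (LINT x|lborel. \<theta>' x * Th (?z x)) + (LINT x|lborel. \<theta> x * (th (?z x) * p x))"
    using integration_by_parts[OF ch bTh chi] by simp
  also have "\<dots> = (LINT x|lborel. \<theta>' x * Th (?z x) + \<theta> x * (th (?z x) * p x))"
    by (rule Bochner_Integration.integral_add[OF i1 i2, symmetric])
  also have "\<dots> \<le> (LINT x|lborel. \<theta>' x * Th (?z x) - \<theta> x * (E (s x, scheme \<tau> (Suc n) x) - E (s x, scheme \<tau> n x)) / \<tau>)"
  proof (rule integral_mono[OF Bochner_Integration.integrable_add[OF i1 i2] i3])
    fix x
    have "\<theta> x * (E (s x, scheme \<tau> (Suc n) x) - E (s x, scheme \<tau> n x)) / \<tau>
       \<le> \<theta> x * (s x * (th (?z x) * (scheme \<tau> (Suc n) x - scheme \<tau> n x))) / \<tau>"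
      using ineq[OF scheme_range[OF tau, of n x] scheme_range[OF tau, of "Suc n" x], of x] tau unfolding fz by (intro divide_right_mono) auto
    also have "\<dots> = - (\<theta> x * (th (?z x) * p x))" using tau by (simp add: p_def field_simps)
    finally show "\<theta>' x * Th (?z x) + \<theta> x * (th (?z x) * p x)
      \<le> \<theta>' x * Th (?z x) - \<theta> x * (E (s x, scheme \<tau> (Suc n) x) - E (s x, scheme \<tau> n x)) / \<tau>" by simp
  qed
  finally show ?thesis by (simp only: fz)
qed

lemma steps_pred: "t > 0 \<Longrightarrow> steps k t = Suc (steps k (t - mesh k))"
proof -
  assume t: "t > 0"
  have "(t - mesh k) / mesh k = t / mesh k - 1" using mesh_pos[of k] by (simp add: field_simps)
  then have "\<lceil>(t - mesh k) / mesh k\<rceil> = \<lceil>t / mesh k\<rceil> - 1" by (simp add: ceiling_diff_one)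
  moreover have "\<lceil>t / mesh k\<rceil> > 0" using t mesh_pos[of k] by simp
  ultimately show ?thesis unfolding steps_def by (simp add: nat_diff_distrib)
qed

text \<open>Integrate \<open>entropy_step\<close> over t, move the time difference from E to \<psi>
  by a translation, and let the mesh tend to 0 by dominated convergence: the difference quotient of
  \<psi> tends to its time derivative, and the approximations converge almost everywhere for t >=
  0.\<close>

lemma entropy_limit:
  assumes E: "continuous_on ({a..b} \<times> {A..B}) E"
    and Th: "\<And>u. u \<in> {f A..f B} \<Longrightarrow> (Th has_real_derivative th u) (at u within {f A..f B})"
    and th: "continuous_on {f A..f B} th"
    and psi: "test2 \<psi> \<psi>x \<psi>t"
    and ineq: "\<And>x t r1 r2. r1 \<in> {A..B} \<Longrightarrow> r2 \<in> {A..B} \<Longrightarrow>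
      \<psi> (x, t) * (E (s x, r2) - E (s x, r1)) \<le> \<psi> (x, t) * (s x * (th (f r2) * (r2 - r1)))"
  shows "0 \<le> (LINT z|lborel. \<psi>t z * E (s (fst z), blim (snd z) (fst z)) + \<psi>x z * Th (f (blim (snd z) (fst z))))"
proof -
  obtain K where K: "\<And>x t. \<bar>x\<bar> \<ge> K \<or> \<bar>t\<bar> \<ge> K \<or> t \<le> 0 \<Longrightarrow> \<psi> (x, t) = 0 \<and> \<psi>x (x, t) = 0 \<and> \<psi>t (x, t) = 0"
    using psi unfolding test2_def by blast
  have c: "continuous_on UNIV \<psi>" "continuous_on UNIV \<psi>x" "continuous_on UNIV \<psi>t" using psi by (auto simp: test2_def)
  have m[measurable]: "\<psi> \<in> borel_measurable (borel \<Otimes>\<^sub>M borel)" "\<psi>x \<in> borel_measurable (borel \<Otimes>\<^sub>M borel)" "\<psi>t \<in> borel_measurable (borel \<Otimes>\<^sub>M borel)"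
    unfolding borel_prod by (intro borel_measurable_continuous_onI c)+
  obtain Cp where Cp: "Cp > 0" "\<And>z. \<bar>\<psi> z\<bar> \<le> Cp" using plane_compact_support_bound[OF c(1), of K] K by blast
  obtain Cx where Cx: "Cx > 0" "\<And>z. \<bar>\<psi>x z\<bar> \<le> Cx" using plane_compact_support_bound[OF c(2), of K] K by blast
  obtain Ct where Ct: "Ct > 0" "\<And>z. \<bar>\<psi>t z\<bar> \<le> Ct" using plane_compact_support_bound[OF c(3), of K] K by blast
  have "compact (E ` ({a..b} \<times> {A..B}))" using E by (intro compact_continuous_image compact_Times) auto
  then obtain CE where CE: "\<forall>y\<in>E ` ({a..b} \<times> {A..B}). norm y \<le> CE" using compact_imp_bounded bounded_iff by blast
  have cTh: "continuous_on {f A..f B} Th"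
    using Th by (meson DERIV_continuous continuous_on_eq_continuous_within)
  have fin: "f r \<in> {f A..f B}" if "r \<in> {A..B}" for r using that f_mono by auto
  have cThf: "continuous_on {A..B} (\<lambda>r. Th (f r))"
    by (rule continuous_on_compose2[OF cTh]) (use f_continuous fin in \<open>auto intro: continuous_on_subset\<close>)
  have "compact ((\<lambda>r. Th (f r)) ` {A..B})" using cThf by (intro compact_continuous_image) auto
  then obtain CT where CT: "\<forall>y\<in>(\<lambda>r. Th (f r)) ` {A..B}. norm y \<le> CT" using compact_imp_bounded bounded_iff by blast
  have bE: "\<bar>E (s x, r)\<bar> \<le> CE" if "r \<in> {A..B}" for x r
    using CE s_bounds[of x] that by (metis atLeastAtMost_iff image_eqI mem_Sigma_iff real_norm_def)
  have bT: "\<bar>Th (f r)\<bar> \<le> CT" if "r \<in> {A..B}" for r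
    using CT that by (metis (mono_tags, lifting) image_eqI real_norm_def)
  have nonneg: "CE \<ge> 0" "CT \<ge> 0" using bE[of A 0] bT[of A] A_le_B by auto
  have mE: "(\<lambda>z. E (s (fst z), g z)) \<in> borel_measurable (borel \<Otimes>\<^sub>M borel)"
    if "g \<in> borel_measurable (borel \<Otimes>\<^sub>M borel)" "\<And>z. g z \<in> {A..B}" for g :: "real \<times> real \<Rightarrow> real"
  proof (rule continuous_compose_measurable[OF E])
    note that(1)[measurable]
    show "(\<lambda>z. (s (fst z), g z)) \<in> borel_measurable (borel \<Otimes>\<^sub>M borel)" by measurable
    show "{a..b} \<times> {A..B} \<in> sets borel" by (auto intro!: borel_closed closed_Times)
  qed (use that s_bounds in auto)
  have mT: "(\<lambda>z. Th (f (g z))) \<in> borel_measurable (borel \<Otimes>\<^sub>M borel)"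
    if "g \<in> borel_measurable (borel \<Otimes>\<^sub>M borel)" "\<And>z. g z \<in> {A..B}" for g :: "real \<times> real \<Rightarrow> real"
    using continuous_compose_measurable[OF cThf _ that] by simp
  define u where "u k z = approx k (snd z) (fst z)" for k and z :: "real \<times> real"
  \<comment> \<open>For t > 0 a delay by exactly one mesh width is the previous step of the scheme,
    by \<open>steps_pred\<close>.\<close>
  define u' where "u' k z = approx k (snd z - mesh k) (fst z)" for k and z :: "real \<times> real"
  have um[measurable]: "u k \<in> borel_measurable (borel \<Otimes>\<^sub>M borel)" for k unfolding u_def by measurable
  have u'm[measurable]: "u' k \<in> borel_measurable (borel \<Otimes>\<^sub>M borel)" for k
  proof -
    have "(\<lambda>z. u k (fst z, snd z - mesh k)) \<in> borel_measurable (borel \<Otimes>\<^sub>M borel)" by measurable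
    then show ?thesis by (simp add: u_def u'_def[abs_def])
  qed
  have ur: "u k z \<in> {A..B}" "u' k z \<in> {A..B}" for k z by (auto simp: u_def u'_def simp del: atLeastAtMost_iff intro: approx_range)
  note mEu[measurable] = mE[OF um ur(1)] and mEu'[measurable] = mE[OF u'm ur(2)] and mTu[measurable] = mT[OF um ur(1)]
  have quot: "\<bar>(\<psi> (x, t + h) - \<psi> (x, t)) / h\<bar> \<le> Ct" if "h > 0" for x t h
  proof -
    have "norm (\<psi> (x, t + h) - \<psi> (x, t)) \<le> Ct * norm (t + h - t)"
      by (rule field_differentiable_bound[of UNIV _ "\<lambda>\<tau>. \<psi>t (x, \<tau>)"])
         (use psi Ct in \<open>auto simp: test2_def\<close>)
    then show ?thesis using that by (simp add: pos_divide_le_eq)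
  qed
  have step: "0 \<le> (LINT z|lborel. (\<psi> (fst z, snd z + mesh k) - \<psi> z) / mesh k * E (s (fst z), u k z) + \<psi>x z * Th (f (u k z)))" for k
  proof -
    let ?\<tau> = "mesh k"
    let ?G = "\<lambda>z. \<psi>x z * Th (f (u k z)) - \<psi> z * (E (s (fst z), u k z) - E (s (fst z), u' k z)) / ?\<tau>"
    have iT: "integrable lborel (\<lambda>z. \<psi>x z * Th (f (u k z)))"
      by (rule plane_integrable[of _ "Cx * CT" K])
         (use K Cx bT[OF ur(1)] nonneg in \<open>auto simp: abs_mult borel_prod[symmetric] intro!: mult_mono\<close>)
    have iE: "integrable lborel (\<lambda>z. \<psi> z * E (s (fst z), u k z))"
      by (rule plane_integrable[of _ "Cp * CE" K])
         (use K Cp bE[OF ur(1)] nonneg in \<open>auto simp: abs_mult borel_prod[symmetric] intro!: mult_mono\<close>)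
    have iE': "integrable lborel (\<lambda>z. \<psi> z * E (s (fst z), u' k z))"
      by (rule plane_integrable[of _ "Cp * CE" K])
         (use K Cp bE[OF ur(2)] nonneg in \<open>auto simp: abs_mult borel_prod[symmetric] intro!: mult_mono\<close>)
    have iS: "integrable lborel (\<lambda>z. \<psi> (fst z, snd z + ?\<tau>) * E (s (fst z), u k z))"
    proof (rule plane_integrable[of _ "Cp * CE" "K + 1"])
      show "(\<lambda>z. \<psi> (fst z, snd z + ?\<tau>) * E (s (fst z), u k z)) \<in> borel_measurable borel"
        unfolding borel_prod[symmetric] by measurable
      show "\<bar>\<psi> (fst z, snd z + ?\<tau>) * E (s (fst z), u k z)\<bar> \<le> Cp * CE" for z
        unfolding abs_mult using Cp bE[OF ur(1)] nonneg by (intro mult_mono) auto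
      fix x t assume "\<bar>x\<bar> \<ge> K + 1 \<or> \<bar>t\<bar> \<ge> K + 1"
      then have "\<bar>x\<bar> \<ge> K \<or> \<bar>t + ?\<tau>\<bar> \<ge> K \<or> t + ?\<tau> \<le> 0" using mesh_pos[of k] mesh_le_1[of k] by linarith
      then show "\<psi> (fst (x, t), snd (x, t) + ?\<tau>) * E (s (fst (x, t)), u k (x, t)) = 0" using K by simp
    qed
    \<comment> \<open>Summation by parts in time, as a translation of the line.\<close>
    have shift: "(LINT z|lborel. \<psi> z * E (s (fst z), u' k z)) = (LINT z|lborel. \<psi> (fst z, snd z + ?\<tau>) * E (s (fst z), u k z))"
    proof -
      have "(LINT z|lborel. \<psi> z * E (s (fst z), u' k z)) = (LINT x|lborel. LINT t|lborel. \<psi> (x, t) * E (s x, u' k (x, t)))"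
        using plane_Fubini(1)[OF iE'] by simp
      also have "\<dots> = (LINT x|lborel. LINT t|lborel. \<psi> (x, t + ?\<tau>) * E (s x, u k (x, t)))"
        by (subst lborel_integral_real_affine[of 1 _ ?\<tau>]) (simp_all add: u_def u'_def add.commute)
      also have "\<dots> = (LINT z|lborel. \<psi> (fst z, snd z + ?\<tau>) * E (s (fst z), u k z))"
        using plane_Fubini(1)[OF iS] by simp
      finally show ?thesis .
    qed
    have iG: "integrable lborel ?G"
      using iT integrable_divide[OF Bochner_Integration.integrable_diff[OF iE iE'], of ?\<tau>]
      by (subst right_diff_distrib) (rule Bochner_Integration.integrable_diff)
    have "0 \<le> (LINT t|lborel. LINT x|lborel. ?G (x, t))"
    proof (rule Bochner_Integration.integral_nonneg)
      fix t :: real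
      show "0 \<le> (LINT x|lborel. ?G (x, t))"
      proof (cases "t > 0")
        case True
        show ?thesis
          using entropy_step[OF mesh_pos E Th th test2_C1c[OF psi] ineq, of t k "steps k (t - ?\<tau>)"]
          by (simp add: u_def u'_def approx_def steps_pred[OF True])
      next
        case False then show ?thesis using K by simp
      qed
    qed
    also have "\<dots> = (LINT z|lborel. ?G z)" by (rule plane_Fubini(2)[OF iG])
    also have "\<dots> = (LINT z|lborel. \<psi>x z * Th (f (u k z))) - (LINT z|lborel. \<psi> z * E (s (fst z), u k z)) / ?\<tau>
        + (LINT z|lborel. \<psi> z * E (s (fst z), u' k z)) / ?\<tau>"
      using iT iE iE' by (simp add: right_diff_distrib diff_divide_distrib)
    also have "\<dots> = (LINT z|lborel. (\<psi> (fst z, snd z + ?\<tau>) - \<psi> z) / ?\<tau> * E (s (fst z), u k z) + \<psi>x z * Th (f (u k z)))"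
      unfolding shift using iT iE iS by (simp add: left_diff_distrib diff_divide_distrib)
    finally show ?thesis .
  qed
  let ?L = "\<lambda>z. \<psi>t z * E (s (fst z), blim (snd z) (fst z)) + \<psi>x z * Th (f (blim (snd z) (fst z)))"
  let ?F = "\<lambda>k z. (\<psi> (fst z, snd z + mesh k) - \<psi> z) / mesh k * E (s (fst z), u k z) + \<psi>x z * Th (f (u k z))"
  \<comment> \<open>The margin 1 makes room for the translation by \<open>mesh k\<close>, which is
    at most 1.\<close>
  let ?S = "cbox (-K-1, -K-1) (K+1, K+1) :: (real \<times> real) set"
  have mF: "?F k \<in> borel_measurable lborel" for k
  proof -
    have "?F k \<in> borel_measurable (borel \<Otimes>\<^sub>M borel)" by measurable
    then show ?thesis by (simp add: borel_prod)
  qed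
  have mL: "?L \<in> borel_measurable lborel"
  proof -
    note [measurable] = mE[OF blim_measurable blim_range] mT[OF blim_measurable blim_range]
    have "?L \<in> borel_measurable (borel \<Otimes>\<^sub>M borel)" by measurable
    then show ?thesis by (simp add: borel_prod)
  qed
  have meshlim: "mesh \<longlonglongrightarrow> 0" unfolding mesh_def by (rule LIMSEQ_realpow_zero) auto
  have lim: "(\<lambda>k. ?F k z) \<longlonglongrightarrow> ?L z" if "snd z \<ge> 0 \<longrightarrow> convergent (\<lambda>k. approx k (snd z) (fst z))" for z
  proof (cases "snd z \<ge> 0")
    case True
    then have u: "(\<lambda>k. u k z) \<longlonglongrightarrow> blim (snd z) (fst z)" unfolding u_def using that approx_tendsto_blim(1) by blast
    have "(\<lambda>k. (s (fst z), u k z)) \<longlonglongrightarrow> (s (fst z), blim (snd z) (fst z))" by (intro tendsto_intros u)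
    then have e: "(\<lambda>k. E (s (fst z), u k z)) \<longlonglongrightarrow> E (s (fst z), blim (snd z) (fst z))"
      by (rule continuous_on_tendsto_compose[OF E]) (use s_bounds blim_range ur(1) in auto)
    have T: "(\<lambda>k. Th (f (u k z))) \<longlonglongrightarrow> Th (f (blim (snd z) (fst z)))"
      by (rule continuous_on_tendsto_compose[OF cThf u]) (use blim_range ur(1) in auto)
    have "((\<lambda>\<tau>. \<psi> (fst z, \<tau>)) has_real_derivative \<psi>t z) (at (snd z))" using psi by (cases z) (auto simp: test2_def)
    then have "((\<lambda>h. (\<psi> (fst z, snd z + h) - \<psi> z) / h) \<longlongrightarrow> \<psi>t z) (at 0)" by (simp add: DERIV_def)
    moreover have "filterlim mesh (at 0) sequentially"
      using meshlim mesh_pos by (intro filterlim_atI) (auto intro!: always_eventually simp: less_imp_neq[symmetric])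
    ultimately have q: "(\<lambda>k. (\<psi> (fst z, snd z + mesh k) - \<psi> z) / mesh k) \<longlonglongrightarrow> \<psi>t z" by (rule filterlim_compose)
    show ?thesis by (intro tendsto_intros q e T)
  next
    case False
    \<comment> \<open>At negative times convergence is not asserted, but both values of \<psi> in
      the difference quotient vanish once the mesh is small enough.\<close>
    have "?F k z = 0" if "mesh k < - snd z" for k
      using K[of "fst z" "snd z"] K[of "fst z" "snd z + mesh k"] False that by simp
    moreover have "\<forall>\<^sub>F k in sequentially. mesh k < - snd z" using meshlim False by (intro order_tendstoD(2)) auto
    ultimately have "\<forall>\<^sub>F k in sequentially. ?F k z = 0" by (auto elim: eventually_mono)
    moreover have "?L z = 0" using K[of "fst z" "snd z"] False by simp
    ultimately show ?thesis by (simp add: tendsto_eventually)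
  qed
  have dom: "norm (?F k z) \<le> indicator ?S z * (Ct * CE + Cx * CT)" for k z
  proof (cases "z \<in> ?S")
    case True
    have "\<bar>(\<psi> (fst z, snd z + mesh k) - \<psi> z) / mesh k * E (s (fst z), u k z)\<bar> \<le> Ct * CE"
      unfolding abs_mult using quot[OF mesh_pos, of "fst z" "snd z" k] bE[OF ur(1)] Ct nonneg by (intro mult_mono) auto
    moreover have "\<bar>\<psi>x z * Th (f (u k z))\<bar> \<le> Cx * CT"
      unfolding abs_mult using Cx bT[OF ur(1)] nonneg by (intro mult_mono) auto
    ultimately have "\<bar>?F k z\<bar> \<le> Ct * CE + Cx * CT" by (rule order_trans[OF abs_triangle_ineq add_mono])
    then show ?thesis using True by simp
  next
    case False
    then have "\<bar>fst z\<bar> \<ge> K + 1 \<or> \<bar>snd z\<bar> \<ge> K + 1" by (cases z) (auto simp: cbox_Pair_eq)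
    then have "\<bar>fst z\<bar> \<ge> K \<or> \<bar>snd z + mesh k\<bar> \<ge> K \<or> snd z + mesh k \<le> 0" "\<bar>fst z\<bar> \<ge> K \<or> \<bar>snd z\<bar> \<ge> K"
      using mesh_pos[of k] mesh_le_1[of k] by linarith+
    then have "\<psi> (fst z, snd z + mesh k) = 0" "\<psi> (fst z, snd z) = 0" "\<psi>x (fst z, snd z) = 0" using K by blast+
    then show ?thesis using False by simp
  qed
  have "(\<lambda>k. LINT z|lborel. ?F k z) \<longlonglongrightarrow> (LINT z|lborel. ?L z)"
  proof (rule integral_dominated_convergence[OF mL mF])
    show "integrable lborel (\<lambda>z. indicator ?S z * (Ct * CE + Cx * CT))"
      by (intro integrable_mult_left integrable_real_indicator) (auto simp: emeasure_lborel_cbox_eq)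
    show "AE z in lborel. (\<lambda>k. ?F k z) \<longlonglongrightarrow> ?L z"
      using plane_convergent by eventually_elim (rule lim)
  qed (use dom in simp)
  then show ?thesis by (rule LIMSEQ_le_const) (use step in simp)
qed

end

section \<open>The limit as a function of space and time\<close>

text \<open>Bridge from the integrals in the definitions, over the half plane and with respect to
  the completed measure, to Borel integrands on the whole plane that vanish outside.\<close>

lemma lebesgue_plane_transfer:
  fixes h h0 :: "real \<times> real \<Rightarrow> real"
  assumes h0: "h0 \<in> borel_measurable borel" and ae: "AE z in lborel. z \<in> S \<longrightarrow> h z = h0 z"
    and zero: "\<And>z. z \<notin> S \<Longrightarrow> h0 z = 0"
  shows "(LINT z:S|lebesgue. h z) = (LINT z|lborel. h0 z)"
proof -
  have m0: "h0 \<in> borel_measurable lebesgue" using h0 by (intro measurable_completion) simp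
  have "AE z in lborel. h0 z = indicator S z *\<^sub>R h z"
    using ae by eventually_elim (use zero in \<open>auto simp: indicator_def\<close>)
  then have e: "AE z in lebesgue. h0 z = indicator S z *\<^sub>R h z" by (rule AE_completion)
  have m: "(\<lambda>z. indicator S z *\<^sub>R h z) \<in> borel_measurable lebesgue" by (rule borel_measurable_AE[OF m0 e])
  have "(LINT z:S|lebesgue. h z) = (LINT z|lebesgue. h0 z)"
    unfolding set_lebesgue_integral_def by (rule integral_cong_AE[OF m m0]) (use e in eventually_elim, simp)
  also have "\<dots> = (LINT z|lborel. h0 z)" by (rule integral_completion) (use h0 in simp)
  finally show ?thesis .
qed

context flux_data
begin

lemma blim_slice_measurable [measurable]: "blim t \<in> borel_measurable borel"
  unfolding blim_def by measurable

lemma limit_sol_AE: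
  assumes "t \<ge> 0" shows "AE x in lborel. limit_sol t x = blim t x"
  using approx_convergent[OF assms] by eventually_elim (rule approx_tendsto_blim(2))

text \<open>Fatou's lemma applied to the Crandall-Liggett bound with equal meshes; its right-hand
  side tends to M |t - t'|.\<close>

lemma blim_lipschitz:
  assumes t: "t \<ge> 0" "t' \<ge> 0"
  shows "integrable lborel (\<lambda>x. s x * \<bar>blim t x - blim t' x\<bar>)" "dist1 (blim t) (blim t') \<le> M * \<bar>t - t'\<bar>"
proof -
  define C where "C k = M * sqrt ((\<bar>t - t'\<bar> + mesh k)\<^sup>2 + (t + t' + 2) * mesh k)" for k
  have meshlim: "mesh \<longlonglongrightarrow> 0" unfolding mesh_def by (rule LIMSEQ_realpow_zero) auto
  have "C \<longlonglongrightarrow> M * sqrt ((\<bar>t - t'\<bar> + 0)\<^sup>2 + (t + t' + 2) * 0)" unfolding C_def by (intro tendsto_intros meshlim)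
  then have C: "C \<longlonglongrightarrow> M * \<bar>t - t'\<bar>" by simp
  have le: "(\<integral>\<^sup>+x. ennreal (s x * \<bar>approx k t x - approx k t' x\<bar>) \<partial>lborel) \<le> ennreal (C k)" for k
  proof -
    let ?\<tau> = "mesh k" and ?i = "steps k t" and ?j = "steps k t'"
    note b = steps_bounds[OF t(1), of k] steps_bounds[OF t(2), of k]
    have "\<bar>?i * ?\<tau> - ?j * ?\<tau>\<bar> \<le> \<bar>\<bar>t - t'\<bar> + ?\<tau>\<bar>" using b mesh_pos[of k] by linarith
    then have 1: "(?i * ?\<tau> - ?j * ?\<tau>)\<^sup>2 \<le> (\<bar>t - t'\<bar> + ?\<tau>)\<^sup>2" by (simp only: abs_le_square_iff)
    have "?i * ?\<tau>\<^sup>2 \<le> (t + 1) * ?\<tau>" "?j * ?\<tau>\<^sup>2 \<le> (t' + 1) * ?\<tau>"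
      unfolding power2_eq_square mult.assoc[symmetric] using b mesh_pos[of k] mesh_le_1[of k] by (intro mult_right_mono; linarith)+
    then have "sqrt ((?i * ?\<tau> - ?j * ?\<tau>)\<^sup>2 + ?i * ?\<tau>\<^sup>2 + ?j * ?\<tau>\<^sup>2) \<le> sqrt ((\<bar>t - t'\<bar> + ?\<tau>)\<^sup>2 + (t + t' + 2) * ?\<tau>)"
      using 1 by (simp add: algebra_simps)
    then have "dist1 (approx k t) (approx k t') \<le> C k"
      using crandall_liggett[OF mesh_pos mesh_pos, of k ?i k ?j] M_nonneg unfolding C_def approx_def
      by (meson mult_left_mono order_trans)
    then show ?thesis
      using approx_integrable[of k t k t'] s_pos unfolding dist1_def
      by (subst nn_integral_eq_integral) (auto intro!: ennreal_leI simp: less_imp_le)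
  qed
  have m: "(\<lambda>x. ennreal (s x * \<bar>approx k t x - approx k t' x\<bar>)) \<in> borel_measurable lborel" for k
    by measurable
  have "(\<integral>\<^sup>+x. ennreal (s x * \<bar>blim t x - blim t' x\<bar>) \<partial>lborel)
      = (\<integral>\<^sup>+x. liminf (\<lambda>k. ennreal (s x * \<bar>approx k t x - approx k t' x\<bar>)) \<partial>lborel)"
  proof (rule nn_integral_cong_AE)
    show "AE x in lborel. ennreal (s x * \<bar>blim t x - blim t' x\<bar>) = liminf (\<lambda>k. ennreal (s x * \<bar>approx k t x - approx k t' x\<bar>))"
      using approx_convergent[OF t(1)] approx_convergent[OF t(2)]
    proof eventually_elim
      case (elim x)
      have "(\<lambda>k. ennreal (s x * \<bar>approx k t x - approx k t' x\<bar>)) \<longlonglongrightarrow> ennreal (s x * \<bar>blim t x - blim t' x\<bar>)"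
        by (intro tendsto_ennrealI tendsto_intros approx_tendsto_blim(1) elim)
      then show ?case by (metis lim_imp_Liminf trivial_limit_sequentially)
    qed
  qed
  also have "\<dots> \<le> liminf (\<lambda>k. \<integral>\<^sup>+x. ennreal (s x * \<bar>approx k t x - approx k t' x\<bar>) \<partial>lborel)"
    by (rule nn_integral_liminf[OF m])
  also have "\<dots> \<le> liminf (\<lambda>k. ennreal (C k))"
    by (intro Liminf_mono always_eventually allI le)
  also have "\<dots> = ennreal (M * \<bar>t - t'\<bar>)"
    by (intro lim_imp_Liminf tendsto_ennrealI C) simp
  finally have fin: "(\<integral>\<^sup>+x. ennreal (s x * \<bar>blim t x - blim t' x\<bar>) \<partial>lborel) \<le> ennreal (M * \<bar>t - t'\<bar>)" .
  have nn: "0 \<le> s x * \<bar>blim t x - blim t' x\<bar>" for x using s_pos[of x] by simp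
  show i: "integrable lborel (\<lambda>x. s x * \<bar>blim t x - blim t' x\<bar>)"
    unfolding integrable_iff_bounded using fin nn by (auto intro: le_less_trans)
  show "dist1 (blim t) (blim t') \<le> M * \<bar>t - t'\<bar>"
    using fin M_nonneg unfolding dist1_def
    by (subst (asm) nn_integral_eq_integral[OF i]) (use nn in \<open>auto simp: ennreal_le_iff\<close>)
qed

definition w_sol :: "real \<times> real \<Rightarrow> real \<times> real" where
  "w_sol = (\<lambda>(x, t). (s x * limit_sol t x, s x))"

lemma w_sol_blim: "AE z in lborel. snd z \<ge> 0 \<longrightarrow> w_sol z = (s (fst z) * blim (snd z) (fst z), s (fst z))"
  using plane_convergent by eventually_elim (auto simp: w_sol_def split_def approx_tendsto_blim(2))

lemma w_sol_state: "w_sol z \<in> state_space {a..b}"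
proof -
  obtain x t where z: "z = (x, t)" by force
  have r: "limit_sol t x \<in> {A..B}" by (rule limit_sol_props(1))
  then have "limit_sol t x > 0" using A_pos by simp
  moreover have "s x / (s x * limit_sol t x) = 1 / limit_sol t x" using s_pos[of x] by simp
  moreover have "1 / limit_sol t x \<in> {a..b}"
    using r calculation(1) a_pos b_pos by (auto simp: A_def B_def field_simps)
  ultimately show ?thesis using s_pos[of x] by (simp add: z w_sol_def state_space_def)
qed

lemma w_sol_bounded: "bounded (range w_sol)"
proof (rule boundedI)
  fix y assume "y \<in> range w_sol"
  then obtain x t where y: "y = (s x * limit_sol t x, s x)" by (auto simp: w_sol_def)
  have r: "limit_sol t x \<in> {A..B}" by (rule limit_sol_props(1))
  have "norm y \<le> \<bar>s x * limit_sol t x\<bar> + \<bar>s x\<bar>" unfolding y using norm_Pair_le[of "s x * limit_sol t x" "s x"] by simp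
  also have "\<bar>s x * limit_sol t x\<bar> \<le> b * B"
    unfolding abs_mult using r s_bounds[of x] s_pos[of x] A_pos b_pos by (intro mult_mono) auto
  finally show "norm y \<le> b * B + b" using s_bounds[of x] s_pos[of x] by linarith
qed

lemma w_sol_measurable: "w_sol \<in> borel_measurable (lebesgue_on (UNIV \<times> {0..}))"
proof -
  let ?S = "UNIV \<times> {0..} :: (real \<times> real) set"
  let ?g = "\<lambda>z :: real \<times> real. (s (fst z) * blim (snd z) (fst z), s (fst z))"
  have "?g \<in> borel_measurable (borel \<Otimes>\<^sub>M borel)" by measurable
  then have "?g \<in> borel_measurable lebesgue" by (intro measurable_completion) (simp add: borel_prod)
  moreover have "?S \<in> sets lebesgue" by (auto intro!: lborelD borel_closed closed_Times)
  ultimately have "(\<lambda>z. if z \<in> ?S then ?g z else 0) \<in> borel_measurable lebesgue"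
    by (intro measurable_If_set) auto
  moreover have "AE z in lebesgue. (if z \<in> ?S then ?g z else 0) = (if z \<in> ?S then w_sol z else 0)"
    using AE_completion[OF w_sol_blim] by eventually_elim (auto simp: mem_Times_iff)
  ultimately have "(\<lambda>z. if z \<in> ?S then w_sol z else 0) \<in> borel_measurable lebesgue" by (rule borel_measurable_AE)
  then show ?thesis using \<open>?S \<in> sets lebesgue\<close> by (simp add: borel_measurable_if)
qed

lemma w_sol_slice_measurable: 
  assumes "t \<ge> 0" shows "(\<lambda>x. w_sol (x, t)) \<in> borel_measurable lebesgue"
proof -
  have "(\<lambda>x. (s x * blim t x, s x)) \<in> borel_measurable lebesgue" by (intro measurable_completion) (simp, measurable)
  moreover have "AE x in lebesgue. (s x * blim t x, s x) = w_sol (x, t)"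
    using AE_completion[OF limit_sol_AE[OF assms]] by eventually_elim (simp add: w_sol_def)
  ultimately show ?thesis by (rule borel_measurable_AE)
qed

lemma w_sol_L1loc: "L1loc_continuous_on {0..} w_sol"
  unfolding L1loc_continuous_on_def
proof (intro allI impI conjI ballI)
  fix K :: "real set" and t :: real assume K: "compact K" and "t \<in> {0..}"
  then have t: "t \<ge> 0" by simp
  have Ks: "K \<in> sets lebesgue" using K by (simp add: borel_compact)
  have Kf: "emeasure lebesgue K < \<infinity>" using K emeasure_compact_finite[OF K] by (simp add: borel_compact)
  obtain D where D: "\<And>z. norm (w_sol z) \<le> D" using w_sol_bounded unfolding bounded_iff by auto
  show "set_integrable lebesgue K (\<lambda>x. w_sol (x, t))" unfolding set_integrable_def
  proof (rule integrableI_bounded_set[where A=K and B=D])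
    show "(\<lambda>x. indicat_real K x *\<^sub>R w_sol (x, t)) \<in> borel_measurable lebesgue"
      using Ks w_sol_slice_measurable[OF t] by measurable
  qed (use Ks Kf D in \<open>auto simp: indicator_def order_trans[OF norm_ge_zero D]\<close>)
  have est: "(LINT x:K|lebesgue. norm (w_sol (x, \<tau>) - w_sol (x, t))) \<le> M * \<bar>\<tau> - t\<bar>"
    "0 \<le> (LINT x:K|lebesgue. norm (w_sol (x, \<tau>) - w_sol (x, t)))" if "\<tau> \<ge> 0" for \<tau>
  proof -
    let ?d = "\<lambda>x. s x * \<bar>blim \<tau> x - blim t x\<bar>"
    note i = blim_lipschitz[OF that t]
    have il: "integrable lebesgue ?d" by (subst integrable_completion) (use i(1) in \<open>auto intro: borel_measurable_integrable\<close>)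
    have e: "AE x in lebesgue. indicat_real K x *\<^sub>R norm (w_sol (x, \<tau>) - w_sol (x, t)) \<le> ?d x"
      using AE_completion[OF limit_sol_AE[OF that]] AE_completion[OF limit_sol_AE[OF t]]
    proof eventually_elim
      case (elim x)
      have "w_sol (x, \<tau>) - w_sol (x, t) = (s x * (blim \<tau> x - blim t x), 0)"
        by (simp add: w_sol_def elim right_diff_distrib)
      then show ?case using s_pos[of x] by (simp add: indicator_def abs_mult norm_prod_def)
    qed
    have m: "(\<lambda>x. indicat_real K x *\<^sub>R norm (w_sol (x, \<tau>) - w_sol (x, t))) \<in> borel_measurable lebesgue"
      using Ks w_sol_slice_measurable[OF t] w_sol_slice_measurable[OF that] by measurable
    have iK: "integrable lebesgue (\<lambda>x. indicat_real K x *\<^sub>R norm (w_sol (x, \<tau>) - w_sol (x, t)))"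
      by (rule Bochner_Integration.integrable_bound[OF il m]) (use e s_pos in \<open>auto elim!: eventually_mono simp: indicator_def abs_mult abs_of_pos split: if_splits\<close>)
    have "(LINT x:K|lebesgue. norm (w_sol (x, \<tau>) - w_sol (x, t))) \<le> (LINT x|lebesgue. ?d x)"
      unfolding set_lebesgue_integral_def by (rule integral_mono_AE[OF iK il e])
    also have "\<dots> = dist1 (blim \<tau>) (blim t)" unfolding dist1_def by (rule integral_completion) simp
    finally show "(LINT x:K|lebesgue. norm (w_sol (x, \<tau>) - w_sol (x, t))) \<le> M * \<bar>\<tau> - t\<bar>" using i(2) by simp
    show "0 \<le> (LINT x:K|lebesgue. norm (w_sol (x, \<tau>) - w_sol (x, t)))"
      unfolding set_lebesgue_integral_def by (rule Bochner_Integration.integral_nonneg) simp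
  qed
  have "((\<lambda>\<tau>. M * \<bar>\<tau> - t\<bar>) \<longlongrightarrow> M * \<bar>t - t\<bar>) (at t within {0..})" by (intro tendsto_intros)
  then have lim: "((\<lambda>\<tau>. M * \<bar>\<tau> - t\<bar>) \<longlongrightarrow> 0) (at t within {0..})" by simp
  have ev: "\<forall>\<^sub>F \<tau> in at t within {0..}. \<tau> \<ge> 0" by (simp add: eventually_at_filter)
  show "((\<lambda>\<tau>. LINT x:K|lebesgue. norm (w_sol (x, \<tau>) - w_sol (x, t))) \<longlongrightarrow> 0) (at t within {0..})"
    by (rule tendsto_sandwich[OF _ _ tendsto_const lim]; rule eventually_mono[OF ev]) (use est in auto)
qed

lemma w_sol_initial: "w_sol (x, 0) = (1, s x)"
  using s_pos[of x] by (simp add: w_sol_def limit_sol_0)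

lemma w_sol_BV:
  assumes sBV: "bounded_total_variation s" shows "continuous_in_BV2 w_sol"
  unfolding continuous_in_BV2_def
proof (intro conjI allI impI)
  fix t :: real assume t: "t > 0"
  obtain V where V: "\<And>n p. (\<forall>i<n. p i \<le> p (Suc i)) \<Longrightarrow> (\<Sum>i<(n::nat). \<bar>s (p (Suc i)) - s (p i)\<bar>) \<le> V"
    using sBV unfolding bounded_total_variation_def by blast
  show "bounded_total_variation (\<lambda>x. snd (w_sol (x, t)))" using sBV by (simp add: w_sol_def)
  show "bounded_total_variation (\<lambda>x. fst (w_sol (x, t)))"
    unfolding bounded_total_variation_def
  proof (intro exI[of _ "b * (M / m) + B * V"] allI impI)
    fix n :: nat and p :: "nat \<Rightarrow> real" assume p: "\<forall>i<n. p i \<le> p (Suc i)"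
    have "(\<Sum>i<n. \<bar>fst (w_sol (p (Suc i), t)) - fst (w_sol (p i, t))\<bar>)
      \<le> (\<Sum>i<n. b * \<bar>limit_sol t (p (Suc i)) - limit_sol t (p i)\<bar> + B * \<bar>s (p (Suc i)) - s (p i)\<bar>)"
    proof (rule sum_mono)
      fix i
      have eq: "fst (w_sol (p (Suc i), t)) - fst (w_sol (p i, t)) = s (p (Suc i)) * (limit_sol t (p (Suc i)) - limit_sol t (p i))
          + limit_sol t (p i) * (s (p (Suc i)) - s (p i))" by (simp add: w_sol_def algebra_simps)
      show "\<bar>fst (w_sol (p (Suc i), t)) - fst (w_sol (p i, t))\<bar>
        \<le> b * \<bar>limit_sol t (p (Suc i)) - limit_sol t (p i)\<bar> + B * \<bar>s (p (Suc i)) - s (p i)\<bar>"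
        unfolding eq
      proof (rule order_trans[OF abs_triangle_ineq], unfold abs_mult, rule add_mono)
        show "\<bar>s (p (Suc i))\<bar> * \<bar>limit_sol t (p (Suc i)) - limit_sol t (p i)\<bar> \<le> b * \<bar>limit_sol t (p (Suc i)) - limit_sol t (p i)\<bar>"
          using s_bounds[of "p (Suc i)"] s_pos[of "p (Suc i)"] by (intro mult_right_mono) auto
        show "\<bar>limit_sol t (p i)\<bar> * \<bar>s (p (Suc i)) - s (p i)\<bar> \<le> B * \<bar>s (p (Suc i)) - s (p i)\<bar>"
          using limit_sol_props(1)[of t "p i"] A_pos by (intro mult_right_mono) auto
      qed
    qed
    also have "\<dots> = b * (\<Sum>i<n. \<bar>limit_sol t (p (Suc i)) - limit_sol t (p i)\<bar>) + B * (\<Sum>i<n. \<bar>s (p (Suc i)) - s (p i)\<bar>)"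
      by (simp add: sum.distrib sum_distrib_left)
    also have "\<dots> \<le> b * (M / m) + B * V"
      using limit_sol_variation[OF t p] V[OF p] b_pos B_pos by (intro add_mono mult_left_mono) auto
    finally show "(\<Sum>i<n. \<bar>fst (w_sol (p (Suc i), t)) - fst (w_sol (p i, t))\<bar>) \<le> b * (M / m) + B * V" .
  qed
next
  show "L1loc_continuous_on {0<..} w_sol"
    using w_sol_L1loc unfolding L1loc_continuous_on_def
    by (auto intro: tendsto_within_subset[where S="{0..}"])
qed

end

section \<open>Convex extensions and admissibility of the limit\<close>

lemma gradient_line:
  assumes grad: "has_gradient_on S F F1 F2" and path: "\<And>\<tau>. \<tau> \<in> T \<Longrightarrow> (c1 + d1 * \<tau>, c2 + d2 * \<tau>) \<in> S" and t: "t \<in> T"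
  shows "((\<lambda>\<tau>. F (c1 + d1 * \<tau>, c2 + d2 * \<tau>)) has_real_derivative
     F1 (c1 + d1 * t, c2 + d2 * t) * d1 + F2 (c1 + d1 * t, c2 + d2 * t) * d2) (at t within T)"
proof -
  let ?\<gamma> = "\<lambda>\<tau>. (c1 + d1 * \<tau>, c2 + d2 * \<tau>)"
  have g: "(?\<gamma> has_derivative (\<lambda>h. (d1 * h, d2 * h))) (at t within T)"
    by (auto intro!: derivative_eq_intros)
  have "(F has_derivative (\<lambda>h. F1 (?\<gamma> t) * fst h + F2 (?\<gamma> t) * snd h)) (at (?\<gamma> t) within S)"
    using grad path[OF t] by (simp add: has_gradient_on_def)
  then have "(F has_derivative (\<lambda>h. F1 (?\<gamma> t) * fst h + F2 (?\<gamma> t) * snd h)) (at (?\<gamma> t) within ?\<gamma> ` T)"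
    by (rule has_derivative_subset) (use path in blast)
  from has_derivative_in_compose[OF g this]
  have "((\<lambda>\<tau>. F (?\<gamma> \<tau>)) has_derivative (\<lambda>h. F1 (?\<gamma> t) * (d1 * h) + F2 (?\<gamma> t) * (d2 * h))) (at t within T)" by simp
  moreover have "(\<lambda>h. F1 (?\<gamma> t) * (d1 * h) + F2 (?\<gamma> t) * (d2 * h)) = (*) (F1 (?\<gamma> t) * d1 + F2 (?\<gamma> t) * d2)"
    by (auto simp: algebra_simps)
  ultimately show ?thesis by (simp add: has_field_derivative_def)
qed

lemma real_derivative_unique_Icc:
  fixes F :: "real \<Rightarrow> real"
  assumes "lo < hi" "x \<in> {lo..hi}" "(F has_real_derivative D) (at x within {lo..hi})" "(F has_real_derivative D') (at x within {lo..hi})"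
  shows "D = D'"
  using vector_derivative_unique_within_closed_interval[of lo hi x F D D'] assms
  by (simp add: has_real_derivative_iff_has_vector_derivative cbox_interval)

text \<open>By convexity the difference quotients along the segment from \<open>c\<close> to
  \<open>x\<close> are at most F x - F c, and their one-sided limit is D (x - c). Only the
  derivative relative to \<open>S\<close> enters, so boundary points are covered.\<close>

lemma convex_on_tangent:
  fixes F :: "'a::real_normed_vector \<Rightarrow> real"
  assumes conv: "convex_on S F" and c: "c \<in> S" "x \<in> S" and der: "(F has_derivative D) (at c within S)"
  shows "D (x - c) \<le> F x - F c"
proof -
  let ?\<gamma> = "\<lambda>t. c + t *\<^sub>R (x - c)"
  have cS: "convex S" using conv by (rule convex_on_imp_convex)
  have path: "?\<gamma> t \<in> S" if "t \<in> {0..1}" for t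
    using convexD[OF cS c, of "1 - t" t] that by (simp add: algebra_simps)
  have lin: "linear D" using der by (rule has_derivative_linear)
  have "(?\<gamma> has_derivative (\<lambda>h. h *\<^sub>R (x - c))) (at 0 within {0..1})" by (auto intro!: derivative_eq_intros)
  moreover have "(F has_derivative D) (at (?\<gamma> 0) within ?\<gamma> ` {0..1})"
    by (rule has_derivative_subset[of _ _ _ S]) (use der path in auto)
  ultimately have "((\<lambda>t. F (?\<gamma> t)) has_derivative (\<lambda>h. D (h *\<^sub>R (x - c)))) (at 0 within {0..1})"
    by (rule has_derivative_in_compose)
  then have "((\<lambda>t. F (?\<gamma> t)) has_real_derivative D (x - c)) (at 0 within {0..1})"
    by (simp add: has_field_derivative_def linear_scale[OF lin] mult_commute_abs)
  then have lim: "((\<lambda>t. (F (?\<gamma> t) - F c) / t) \<longlongrightarrow> D (x - c)) (at 0 within {0..1})"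
    by (simp add: has_field_derivative_iff)
  have nt: "at (0::real) within {0..1} \<noteq> bot" by (simp add: trivial_limit_within islimpt_Icc)
  show ?thesis
  proof (rule tendsto_upperbound[OF lim _ nt])
    show "\<forall>\<^sub>F t in at 0 within {0..1}. (F (?\<gamma> t) - F c) / t \<le> F x - F c"
      unfolding eventually_at_filter
    proof (intro always_eventually allI impI)
      fix t :: real assume t: "t \<noteq> 0" "t \<in> {0..1}"
      have "F ((1 - t) *\<^sub>R c + t *\<^sub>R x) \<le> (1 - t) * F c + t * F x"
        using convex_onD[OF conv, of t c x] t c by auto
      moreover have "(1 - t) *\<^sub>R c + t *\<^sub>R x = ?\<gamma> t" by (simp add: algebra_simps)
      ultimately have "F (?\<gamma> t) - F c \<le> t * (F x - F c)" by (simp add: algebra_simps)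
      then show "(F (?\<gamma> t) - F c) / t \<le> F x - F c" using t by (simp add: pos_divide_le_eq mult.commute)
    qed
  qed
qed

lemma test2_of_Ck:
  assumes ck: "Ck_on 1 UNIV \<psi>" and supp: "supported_in_upper_half \<psi>"
  shows "test2 \<psi> (dx \<psi>) (dt \<psi>)"
proof -
  obtain f1 f2 where g: "has_gradient_on UNIV \<psi> f1 f2" and c: "continuous_on UNIV f1" "continuous_on UNIV f2"
    using ck by auto
  have D1: "((\<lambda>y. \<psi> (y, t)) has_real_derivative f1 (x, t)) (at x)" for x t
    using gradient_line[OF g, of UNIV 0 1 t 0 x] by simp
  have D2: "((\<lambda>\<tau>. \<psi> (x, \<tau>)) has_real_derivative f2 (x, t)) (at t)" for x t
    using gradient_line[OF g, of UNIV x 0 0 1 t] by simp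
  have eq: "dx \<psi> = f1" "dt \<psi> = f2"
    using DERIV_imp_deriv[OF D1] DERIV_imp_deriv[OF D2] by (auto simp: dx_def dt_def fun_eq_iff)
  have der: "(\<psi> has_derivative (\<lambda>h. f1 z * fst h + f2 z * snd h)) (at z)" for z
    using g unfolding has_gradient_on_def by blast
  have cont: "continuous_on UNIV \<psi>"
    using has_derivative_continuous[OF der] by (simp add: continuous_on_eq_continuous_within)
  let ?C = "closure {z. \<psi> z \<noteq> 0}"
  have out: "\<psi> z = 0 \<and> f1 z = 0 \<and> f2 z = 0" if z: "z \<notin> ?C" for z
  proof -
    have zero: "\<psi> y = 0" if "y \<in> - ?C" for y using that closure_subset[of "{z. \<psi> z \<noteq> 0}"] by blast
    have "(\<psi> has_derivative (\<lambda>h. 0)) (at z)"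
    proof (rule has_derivative_transform_within_open[OF has_derivative_const[of 0]])
      show "open (- ?C)" by (rule open_Compl[OF closed_closure])
      show "z \<in> - ?C" using z by blast
      show "0 = \<psi> y" if "y \<in> - ?C" for y using zero[OF that] by (rule sym)
    qed
    then have "(\<lambda>h. f1 z * fst h + f2 z * snd h) = (\<lambda>h. 0)" using der[of z] by (intro has_derivative_unique)
    then have "f1 z * fst h + f2 z * snd h = 0" for h by (rule fun_cong)
    from this[of "(1, 0)"] this[of "(0, 1)"] show ?thesis using zero[of z] z by simp
  qed
  have "bounded ?C" using supp unfolding supported_in_upper_half_def by (blast intro: compact_imp_bounded)
  then obtain K0 where K0: "\<forall>z\<in>?C. norm z \<le> K0" unfolding bounded_iff by blast
  have "\<psi> (x, t) = 0 \<and> f1 (x, t) = 0 \<and> f2 (x, t) = 0" if "\<bar>x\<bar> \<ge> K0 + 1 \<or> \<bar>t\<bar> \<ge> K0 + 1 \<or> t \<le> 0" for x t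
  proof (rule out)
    show "(x, t) \<notin> ?C"
    proof
      assume "(x, t) \<in> ?C"
      then have "norm (x, t) \<le> K0" "t > 0" using K0 supp unfolding supported_in_upper_half_def by auto
      moreover have "\<bar>x\<bar> \<le> norm (x, t)" "\<bar>t\<bar> \<le> norm (x, t)"
        using norm_fst_le[of x t] norm_snd_le[of t x] by simp_all
      ultimately show False using that by linarith
    qed
  qed
  then show ?thesis unfolding test2_def eq using D1 D2 cont c by blast
qed

lemma test2_support:
  assumes "test2 \<psi> \<psi>x \<psi>t" "snd z \<le> 0" shows "\<psi>x z = 0" "\<psi>t z = 0"
proof -
  obtain K where K: "\<forall>x t. \<bar>x\<bar> \<ge> K \<or> \<bar>t\<bar> \<ge> K \<or> t \<le> 0 \<longrightarrow> \<psi> (x, t) = 0 \<and> \<psi>x (x, t) = 0 \<and> \<psi>t (x, t) = 0"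
    using assms(1) unfolding test2_def by blast
  show "\<psi>x z = 0" "\<psi>t z = 0" using K[rule_format, of "fst z" "snd z"] assms(2) by simp_all
qed

lemma test2_measurable:
  assumes "test2 \<psi> \<psi>x \<psi>t"
  shows "\<psi>x \<in> borel_measurable (borel \<Otimes>\<^sub>M borel)" "\<psi>t \<in> borel_measurable (borel \<Otimes>\<^sub>M borel)"
proof -
  have "continuous_on UNIV \<psi>x" "continuous_on UNIV \<psi>t" using assms unfolding test2_def by blast+
  then show "\<psi>x \<in> borel_measurable (borel \<Otimes>\<^sub>M borel)" "\<psi>t \<in> borel_measurable (borel \<Otimes>\<^sub>M borel)"
    unfolding borel_prod by (simp_all add: borel_measurable_continuous_onI)
qed

lemma test2_uminus:
  assumes t2: "test2 \<psi> \<psi>x \<psi>t" shows "test2 (\<lambda>z. - \<psi> z) (\<lambda>z. - \<psi>x z) (\<lambda>z. - \<psi>t z)"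
proof -
  obtain K where K: "\<forall>x t. \<bar>x\<bar> \<ge> K \<or> \<bar>t\<bar> \<ge> K \<or> t \<le> 0 \<longrightarrow> \<psi> (x, t) = 0 \<and> \<psi>x (x, t) = 0 \<and> \<psi>t (x, t) = 0"
    using t2 unfolding test2_def by blast
  have D: "\<forall>x t. ((\<lambda>y. \<psi> (y, t)) has_real_derivative \<psi>x (x, t)) (at x)"
    "\<forall>x t. ((\<lambda>\<tau>. \<psi> (x, \<tau>)) has_real_derivative \<psi>t (x, t)) (at t)"
    and c: "continuous_on UNIV \<psi>" "continuous_on UNIV \<psi>x" "continuous_on UNIV \<psi>t" 
    using t2 unfolding test2_def by blast+
  show ?thesis unfolding test2_def
  proof (intro conjI allI)
    show "((\<lambda>y. - \<psi> (y, t)) has_real_derivative - \<psi>x (x, t)) (at x)" for x t by (rule DERIV_minus) (rule D(1)[rule_format])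
    show "((\<lambda>\<tau>. - \<psi> (x, \<tau>)) has_real_derivative - \<psi>t (x, t)) (at t)" for x t by (rule DERIV_minus) (rule D(2)[rule_format])
    show "\<exists>K. \<forall>x t. \<bar>x\<bar> \<ge> K \<or> \<bar>t\<bar> \<ge> K \<or> t \<le> 0 \<longrightarrow> - \<psi> (x, t) = 0 \<and> - \<psi>x (x, t) = 0 \<and> - \<psi>t (x, t) = 0"
      unfolding neg_equal_0_iff_equal using K by blast
  qed (rule continuous_on_minus, rule c)+
qed

locale elastic = flux_data +
  fixes G :: "real \<Rightarrow> real"
  assumes a_less_b: "a < b" and G_C2: "C2_on {a..b} G"
    and G_pos: "\<And>\<sigma>. \<sigma> \<in> {a..b} \<Longrightarrow> deriv_on {a..b} G \<sigma> > 0"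
    and f_G: "\<And>r. r \<in> {A..B} \<Longrightarrow> f r = - G (1 / r)"
    and s_BV: "bounded_total_variation s"
begin

abbreviation g :: "real \<Rightarrow> real" where "g \<equiv> deriv_on {a..b} G"

definition f' :: "real \<Rightarrow> real" where "f' r = g (1 / r) / r\<^sup>2"

lemma A_less_B: "A < B" using a_pos a_less_b by (simp add: A_def B_def frac_less2)

lemma inverse_range: "r \<in> {A..B} \<Longrightarrow> 1 / r \<in> {a..b}"
proof -
  assume r: "r \<in> {A..B}"
  then have "r > 0" using A_pos by simp
  then show ?thesis using r a_pos b_pos by (simp add: A_def B_def field_simps)
qed

lemma G_deriv: "\<sigma> \<in> {a..b} \<Longrightarrow> (G has_real_derivative g \<sigma>) (at \<sigma> within {a..b})"
  using G_C2 unfolding C2_on_def differentiable_on_def deriv_on_def has_real_derivative_iff_has_vector_derivative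
  by (auto simp: vector_derivative_works)

lemma g_continuous: "continuous_on {a..b} g"
  using G_C2 unfolding C2_on_def by (blast intro: differentiable_imp_continuous_on)

lemma f_deriv:
  assumes r: "r \<in> {A..B}" shows "(f has_real_derivative f' r) (at r within {A..B})"
proof -
  have rp: "r > 0" using r A_pos by auto
  have inv: "((\<lambda>r. 1 / r) has_real_derivative - (1 / r\<^sup>2)) (at r within {A..B})"
    using rp by (auto intro!: derivative_eq_intros simp: power2_eq_square)
  have "(G has_real_derivative g (1 / r)) (at (1 / r) within (\<lambda>r. 1 / r) ` {A..B})"
    by (rule has_field_derivative_subset[OF G_deriv[OF inverse_range[OF r]]]) (use inverse_range in blast)
  from DERIV_image_chain[OF this inv]
  have "((\<lambda>r. G (1 / r)) has_real_derivative g (1 / r) * - (1 / r\<^sup>2)) (at r within {A..B})" by (simp add: o_def)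
  from DERIV_minus[OF this] have "((\<lambda>r. - G (1 / r)) has_real_derivative f' r) (at r within {A..B})" by (simp add: f'_def)
  then show ?thesis
    by (rule has_field_derivative_transform_within[where d=1]) (use r f_G in auto)
qed

lemma f'_pos: "r \<in> {A..B} \<Longrightarrow> f' r > 0"
  using G_pos[OF inverse_range] A_pos by (auto simp: f'_def)

lemma f'_continuous: "continuous_on {A..B} f'"
proof -
  have "continuous_on {A..B} (\<lambda>r. g (1 / r))"
    by (rule continuous_on_compose2[OF g_continuous]) (use A_pos inverse_range in \<open>auto intro!: continuous_intros\<close>)
  then show ?thesis unfolding f'_def using A_pos by (intro continuous_intros) auto
qed

lemma state_point: "v > 0 \<Longrightarrow> r \<in> {A..B} \<Longrightarrow> (v * r, v) \<in> state_space {a..b}"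
  using A_pos inverse_range[of r] by (auto simp: state_space_def)

text \<open>The difference quotient of the composition is the quotient of those of \<open>q\<close>
  and of \<open>f\<close>, both taken at \<phi> u, and f' is positive. This treats the end points of
  the interval like the interior.\<close>

lemma phi_chain:
  assumes u: "u \<in> {f A..f B}" and q: "(q has_real_derivative D * f' (\<phi> u)) (at (\<phi> u) within {A..B})"
  shows "((\<lambda>u. q (\<phi> u)) has_real_derivative D) (at u within {f A..f B})"
proof -
  have r: "\<phi> u \<in> {A..B}" by (rule phi_range[OF u])
  have ql: "((\<lambda>y. (q y - q (\<phi> u)) / (y - \<phi> u)) \<longlongrightarrow> D * f' (\<phi> u)) (at (\<phi> u) within {A..B})"
    using q by (simp add: has_field_derivative_iff)
  have fl: "((\<lambda>y. (f y - f (\<phi> u)) / (y - \<phi> u)) \<longlongrightarrow> f' (\<phi> u)) (at (\<phi> u) within {A..B})"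
    using f_deriv[OF r] by (simp add: has_field_derivative_iff)
  have fp: "filterlim \<phi> (at (\<phi> u) within {A..B}) (at u within {f A..f B})"
    unfolding filterlim_at
  proof
    show "(\<phi> \<longlongrightarrow> \<phi> u) (at u within {f A..f B})"
      using phi_continuous by (meson UNIV_I continuous_on_def subset_UNIV tendsto_within_subset)
    show "\<forall>\<^sub>F x in at u within {f A..f B}. \<phi> x \<in> {A..B} \<and> \<phi> x \<noteq> \<phi> u"
      unfolding eventually_at_filter using phi_range by (intro always_eventually) (auto simp: phi_eq_iff)
  qed
  have "((\<lambda>y. ((q y - q (\<phi> u)) / (y - \<phi> u)) / ((f y - f (\<phi> u)) / (y - \<phi> u))) \<longlongrightarrow> D * f' (\<phi> u) / f' (\<phi> u)) (at (\<phi> u) within {A..B})"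
    by (rule tendsto_divide[OF ql fl]) (use f'_pos[OF r] in simp)
  from filterlim_compose[OF this fp]
  have "((\<lambda>v. ((q (\<phi> v) - q (\<phi> u)) / (\<phi> v - \<phi> u)) / ((v - u) / (\<phi> v - \<phi> u))) \<longlongrightarrow> D) (at u within {f A..f B})"
    using f'_pos[OF r] by (simp add: f_phi)
  then have "((\<lambda>v. (q (\<phi> v) - q (\<phi> u)) / (v - u)) \<longlongrightarrow> D) (at u within {f A..f B})"
    by (rule Lim_transform_eventually) (auto simp: eventually_at_filter phi_eq_iff)
  then show ?thesis by (simp add: has_field_derivative_iff)
qed

text \<open>The gradient relation makes \<open>Q\<close> constant along rays through the origin, and then forces
  \<open>E\<^sub>\<eta>\<close> to be a function of \<open>\<eta> / v\<close> alone.\<close>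

lemma convex_extension_data:
  assumes ce: "convex_extension {a..b} G E Q"
  shows "\<exists>e q. continuous_on {A..B} e \<and>
    (\<forall>r\<in>{A..B}. (q has_real_derivative e r * f' r) (at r within {A..B})) \<and>
    (\<forall>v>0. \<forall>r\<in>{A..B}. Q (v * r, v) = q r) \<and>
    (\<forall>v>0. \<forall>r1\<in>{A..B}. \<forall>r2\<in>{A..B}. E (v * r2, v) - E (v * r1, v) \<le> v * (e r2 * (r2 - r1))) \<and>
    continuous_on ({a..b} \<times> {A..B}) (\<lambda>y. E (fst y * snd y, fst y))"
proof -
  let ?S = "state_space {a..b}"
  obtain F1 F2 where F: "has_gradient_on ?S E F1 F2" "continuous_on ?S F1"
    using ce unfolding convex_extension_def by auto
  have conv: "convex_on ?S E" using ce by (simp add: convex_extension_def)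
  obtain E1 E2 Q1 Q2 where E: "has_gradient_on ?S E E1 E2" and Q: "has_gradient_on ?S Q Q1 Q2"
    and rel: "\<forall>(\<eta>, v) \<in> ?S. Q1 (\<eta>, v) = E1 (\<eta>, v) * (v / \<eta>\<^sup>2) * g (v / \<eta>) \<and>
           Q2 (\<eta>, v) = - E1 (\<eta>, v) * (1 / \<eta>) * g (v / \<eta>)"
    using ce unfolding convex_extension_def by blast
  have rel': "Q1 (v * r, v) * v = E1 (v * r, v) * f' r" "Q1 (v * r, v) * r + Q2 (v * r, v) = 0"
    if v: "v > 0" and r: "r \<in> {A..B}" for v r
  proof -
    have rp: "r > 0" using r A_pos by auto
    have "Q1 (v * r, v) = E1 (v * r, v) * (v / (v * r)\<^sup>2) * g (v / (v * r)) \<and>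
           Q2 (v * r, v) = - E1 (v * r, v) * (1 / (v * r)) * g (v / (v * r))"
      using bspec[OF rel state_point[OF v r]] by simp
    moreover have "v / (v * r) = 1 / r" using v by simp
    ultimately have 1: "Q1 (v * r, v) = E1 (v * r, v) * (v / (v * r)\<^sup>2) * g (1 / r)"
      and 2: "Q2 (v * r, v) = - E1 (v * r, v) * (1 / (v * r)) * g (1 / r)" by simp_all
    show "Q1 (v * r, v) * v = E1 (v * r, v) * f' r" unfolding 1 f'_def using v rp by (simp add: power2_eq_square)
    show "Q1 (v * r, v) * r + Q2 (v * r, v) = 0" unfolding 1 2 using v rp by (simp add: power2_eq_square)
  qed
  have along_r: "((\<lambda>\<rho>. F (v * \<rho>, v)) has_real_derivative F1' (v * r, v) * v) (at r within {A..B})"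
    if "has_gradient_on ?S F F1' F2'" "v > 0" "r \<in> {A..B}" for F F1' F2' v r
    using gradient_line[OF that(1), of "{A..B}" 0 v v 0 r] state_point[OF that(2)] that(3) by simp
  \<comment> \<open>Two gradients of E are in play: \<open>F1\<close> is the continuous one,
    \<open>E1\<close> the one in the relation with Q. They agree because the derivative in r is
    unique on a nondegenerate interval.\<close>
  have E1F1: "E1 (v * r, v) = F1 (v * r, v)" if "v > 0" "r \<in> {A..B}" for v r
    using real_derivative_unique_Icc[OF A_less_B that(2) along_r[OF E that] along_r[OF F(1) that]] that by simp
  define q where "q r = Q (r, 1)" for r
  define e where "e r = F1 (r, 1)" for r
  have Qq: "Q (v * r, v) = q r" if v: "v > 0" and r: "r \<in> {A..B}" for v r
  proof -
    have "((\<lambda>\<nu>. Q (r * \<nu>, \<nu>)) has_real_derivative 0) (at \<nu> within {0<..})" if "\<nu> \<in> {0<..}" for \<nu>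
      using gradient_line[OF Q, of "{0<..}" 0 r 0 1 \<nu>] state_point[OF _ r] rel'(2)[of \<nu> r] that r by (simp add: mult.commute)
    then obtain c where c: "\<And>\<nu>. \<nu> \<in> {0<..} \<Longrightarrow> Q (r * \<nu>, \<nu>) = c"
      using has_field_derivative_zero_constant[of "{0<..}" "\<lambda>\<nu>. Q (r * \<nu>, \<nu>)"] by auto
    show ?thesis using c[of v] c[of 1] v by (simp add: q_def mult.commute)
  qed
  have qd: "(q has_real_derivative e r * f' r) (at r within {A..B})" if r: "r \<in> {A..B}" for r
    using along_r[OF Q, of 1 r] rel'(1)[of 1 r] E1F1[of 1 r] r by (simp add: q_def[abs_def] e_def)
  have F1e: "F1 (v * r, v) = e r" if v: "v > 0" and r: "r \<in> {A..B}" for v r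
  proof -
    have "((\<lambda>\<rho>. Q (v * \<rho>, v)) has_real_derivative F1 (v * r, v) * f' r) (at r within {A..B})"
      using along_r[OF Q v r] rel'(1)[OF v r] E1F1[OF v r] by simp
    then have "(q has_real_derivative F1 (v * r, v) * f' r) (at r within {A..B})"
      by (rule has_field_derivative_transform_within[where d=1]) (use Qq[OF v] r in auto)
    from real_derivative_unique_Icc[OF A_less_B r this qd[OF r]] f'_pos[OF r] show ?thesis by simp
  qed
  have "continuous_on {A..B} e"
    unfolding e_def by (rule continuous_on_compose2[OF F(2)]) (use state_point[of 1] in \<open>auto intro!: continuous_intros\<close>)
  moreover have "E (v * r2, v) - E (v * r1, v) \<le> v * (e r2 * (r2 - r1))"
    if v: "v > 0" and r: "r1 \<in> {A..B}" "r2 \<in> {A..B}" for v r1 r2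
  proof -
    have "(E has_derivative (\<lambda>h. F1 (v * r2, v) * fst h + F2 (v * r2, v) * snd h)) (at (v * r2, v) within ?S)"
      using F(1) state_point[OF v r(2)] by (simp add: has_gradient_on_def)
    from convex_on_tangent[OF conv state_point[OF v r(2)] state_point[OF v r(1)] this]
    have "e r2 * (v * r1 - v * r2) \<le> E (v * r1, v) - E (v * r2, v)" by (simp add: F1e[OF v r(2)])
    then show ?thesis by (simp add: algebra_simps)
  qed
  moreover have "continuous_on ({a..b} \<times> {A..B}) (\<lambda>y. E (fst y * snd y, fst y))"
  proof -
    have "continuous_on ?S E"
      using F(1) unfolding has_gradient_on_def continuous_on_eq_continuous_within
      by (blast intro: has_derivative_continuous)
    then show ?thesis
      by (rule continuous_on_compose2) (use state_point a_pos in \<open>auto intro!: continuous_intros\<close>)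
  qed
  ultimately show ?thesis using qd Qq by blast
qed

text \<open>\<open>entropy_limit\<close> with Th = q o \<phi> and th = e o \<phi>. The relation q' =
  e f' becomes (q o \<phi>)' = e o \<phi> after the change of variable u = f(r).\<close>

lemma w_sol_entropy:
  assumes ce: "convex_extension {a..b} G E Q" and ck: "Ck_on 1 UNIV \<psi>" and supp: "supported_in_upper_half \<psi>"
    and pos: "\<And>z. \<psi> z \<ge> 0"
  shows "(LINT z:UNIV \<times> {0<..}|lebesgue. dt \<psi> z * E (w_sol z) + dx \<psi> z * Q (w_sol z)) \<ge> 0"
proof -
  note t2 = test2_of_Ck[OF ck supp]
  obtain e q where e: "continuous_on {A..B} e"
    and q: "\<forall>r\<in>{A..B}. (q has_real_derivative e r * f' r) (at r within {A..B})"
    and Qq: "\<forall>v>0. \<forall>r\<in>{A..B}. Q (v * r, v) = q r"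
    and le: "\<forall>v>0. \<forall>r1\<in>{A..B}. \<forall>r2\<in>{A..B}. E (v * r2, v) - E (v * r1, v) \<le> v * (e r2 * (r2 - r1))"
    and cE: "continuous_on ({a..b} \<times> {A..B}) (\<lambda>y. E (fst y * snd y, fst y))"
    using convex_extension_data[OF ce] by blast
  let ?E = "\<lambda>y. E (fst y * snd y, fst y)"
  let ?h = "\<lambda>z. dt \<psi> z * ?E (s (fst z), blim (snd z) (fst z)) + dx \<psi> z * q (\<phi> (f (blim (snd z) (fst z))))"
  have "0 \<le> (LINT z|lborel. ?h z)"
  proof (rule entropy_limit[OF cE _ _ t2])
    show "((\<lambda>u. q (\<phi> u)) has_real_derivative e (\<phi> u)) (at u within {f A..f B})" if "u \<in> {f A..f B}" for u
      by (rule phi_chain[OF that]) (use q phi_range[OF that] in blast)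
    show "continuous_on {f A..f B} (\<lambda>u. e (\<phi> u))"
      by (rule continuous_on_compose2[OF e]) (use phi_range phi_continuous in \<open>auto intro: continuous_on_subset\<close>)
    fix x t r1 r2 assume "r1 \<in> {A..B}" "r2 \<in> {A..B}"
    then show "\<psi> (x, t) * (?E (s x, r2) - ?E (s x, r1)) \<le> \<psi> (x, t) * (s x * (e (\<phi> (f r2)) * (r2 - r1)))"
      using le s_pos[of x] pos[of "(x, t)"] by (intro mult_left_mono) (simp_all add: phi_f)
  qed
  also have "(LINT z|lborel. ?h z) = (LINT z:UNIV \<times> {0<..}|lebesgue. dt \<psi> z * E (w_sol z) + dx \<psi> z * Q (w_sol z))"
  proof (rule lebesgue_plane_transfer[symmetric])
    note [measurable] = test2_measurable[OF t2]
    have cq: "continuous_on {A..B} q" using q by (meson DERIV_continuous continuous_on_eq_continuous_within)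
    have [measurable]: "(\<lambda>z. q (blim (snd z) (fst z))) \<in> borel_measurable (borel \<Otimes>\<^sub>M borel)"
      by (rule continuous_compose_measurable[OF cq _ blim_measurable blim_range]) simp
    have [measurable]: "(\<lambda>z. ?E (s (fst z), blim (snd z) (fst z))) \<in> borel_measurable (borel \<Otimes>\<^sub>M borel)"
    proof (rule continuous_compose_measurable[OF cE])
      show "(\<lambda>z. (s (fst z), blim (snd z) (fst z))) \<in> borel_measurable (borel \<Otimes>\<^sub>M borel)" by measurable
      show "{a..b} \<times> {A..B} \<in> sets borel" by (auto intro!: borel_closed closed_Times)
    qed (use blim_range s_bounds in auto)
    have "?h \<in> borel_measurable (borel \<Otimes>\<^sub>M borel)" unfolding phi_f by measurable
    then show "?h \<in> borel_measurable borel" by (simp add: borel_prod)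
    show "AE z in lborel. z \<in> UNIV \<times> {0<..} \<longrightarrow> dt \<psi> z * E (w_sol z) + dx \<psi> z * Q (w_sol z) = ?h z"
      using w_sol_blim
    proof eventually_elim
      case (elim z)
      have "Q (s (fst z) * blim (snd z) (fst z), s (fst z)) = q (blim (snd z) (fst z))"
        using Qq s_pos[of "fst z"] blim_range by blast
      then show ?case using elim by (auto simp: phi_f)
    qed
    fix z :: "real \<times> real" assume "z \<notin> UNIV \<times> {0<..}"
    then have "dx \<psi> z = 0 \<and> dt \<psi> z = 0" using test2_support[OF t2, of z] by (simp add: mem_Times_iff)
    then show "?h z = 0" by simp
  qed
  finally show ?thesis .
qed

text \<open>Two entropies satisfy the tangent condition with equality: s r with th = 1 and s with th
  = 0. Hence the entropy inequality holds for \<psi> and for -\<psi>, which gives the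
  equations.\<close>

lemma w_sol_weak:
  assumes ck: "Ck_on 1 UNIV \<psi>" and supp: "supported_in_upper_half \<psi>"
  shows "(LINT z:UNIV \<times> {0<..}|lebesgue. dt \<psi> z * fst (w_sol z) - dx \<psi> z * G (snd (w_sol z) / fst (w_sol z))) = 0"
    "(LINT z:UNIV \<times> {0<..}|lebesgue. dt \<psi> z * snd (w_sol z)) = 0"
proof -
  note t2 = test2_of_Ck[OF ck supp]
  note t2' = test2_uminus[OF t2] and [measurable] = test2_measurable[OF t2]
  have zero: "dx \<psi> z = 0 \<and> dt \<psi> z = 0" if "z \<notin> UNIV \<times> {0<..}" for z
    using test2_support[OF t2, of z] that by (simp add: mem_Times_iff)
  let ?h = "\<lambda>z. dt \<psi> z * (s (fst z) * blim (snd z) (fst z)) + dx \<psi> z * f (blim (snd z) (fst z))"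
  have cE: "continuous_on ({a..b} \<times> {A..B}) (\<lambda>y. fst y * snd y)" by (intro continuous_intros)
  have "0 \<le> (LINT z|lborel. ?h z)"
    using entropy_limit[OF cE, of "\<lambda>u. u" "\<lambda>u. 1", OF _ _ t2] by (auto simp: algebra_simps)
  moreover have "0 \<le> (LINT z|lborel. - ?h z)"
    using entropy_limit[OF cE, of "\<lambda>u. u" "\<lambda>u. 1", OF _ _ t2'] by (auto simp: algebra_simps)
  moreover have "(LINT z|lborel. - ?h z) = - (LINT z|lborel. ?h z)" by (rule Bochner_Integration.integral_minus)
  ultimately have "(LINT z|lborel. ?h z) = 0" by linarith
  moreover have "(LINT z:UNIV \<times> {0<..}|lebesgue. dt \<psi> z * fst (w_sol z) - dx \<psi> z * G (snd (w_sol z) / fst (w_sol z)))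
     = (LINT z|lborel. ?h z)"
  proof (rule lebesgue_plane_transfer)
    have "?h \<in> borel_measurable (borel \<Otimes>\<^sub>M borel)" by measurable
    then show "?h \<in> borel_measurable borel" by (simp add: borel_prod)
    show "AE z in lborel. z \<in> UNIV \<times> {0<..} \<longrightarrow>
       dt \<psi> z * fst (w_sol z) - dx \<psi> z * G (snd (w_sol z) / fst (w_sol z)) = ?h z"
      using w_sol_blim
    proof eventually_elim
      case (elim z)
      have "f (blim (snd z) (fst z)) = - G (1 / blim (snd z) (fst z))" by (rule f_G[OF blim_range])
      then show ?case using elim s_pos[of "fst z"] by auto
    qed
  qed (use zero in simp)
  ultimately show "(LINT z:UNIV \<times> {0<..}|lebesgue. dt \<psi> z * fst (w_sol z) - dx \<psi> z * G (snd (w_sol z) / fst (w_sol z))) = 0" by simp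
  let ?k = "\<lambda>z. dt \<psi> z * s (fst z)"
  have cF: "continuous_on ({a..b} \<times> {A..B}) (\<lambda>y. fst y)" by (intro continuous_intros)
  have "0 \<le> (LINT z|lborel. ?k z)"
    using entropy_limit[OF cF, of "\<lambda>u. 0" "\<lambda>u. 0", OF _ _ t2] by auto
  moreover have "0 \<le> (LINT z|lborel. - ?k z)"
    using entropy_limit[OF cF, of "\<lambda>u. 0" "\<lambda>u. 0", OF _ _ t2'] by auto
  ultimately have "(LINT z|lborel. ?k z) = 0" by simp
  moreover have "(LINT z:UNIV \<times> {0<..}|lebesgue. dt \<psi> z * snd (w_sol z)) = (LINT z|lborel. ?k z)"
  proof (rule lebesgue_plane_transfer)
    have "?k \<in> borel_measurable (borel \<Otimes>\<^sub>M borel)" by measurable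
    then show "?k \<in> borel_measurable borel" by (simp add: borel_prod)
    show "AE z in lborel. z \<in> UNIV \<times> {0<..} \<longrightarrow> dt \<psi> z * snd (w_sol z) = ?k z"
      using w_sol_blim by eventually_elim auto
  qed (use zero in simp)
  ultimately show "(LINT z:UNIV \<times> {0<..}|lebesgue. dt \<psi> z * snd (w_sol z)) = 0" by simp
qed

theorem w_sol_admissible: "admissible_weak_solution {a..b} G s w_sol"
  unfolding admissible_weak_solution_def weak_solution_def
proof (intro conjI allI impI)
  show "w_sol ` (UNIV \<times> {0..}) \<subseteq> state_space {a..b}" using w_sol_state by blast
  show "bounded (w_sol ` (UNIV \<times> {0..}))" using w_sol_bounded by (rule bounded_subset) auto
  show "w_sol \<in> borel_measurable (lebesgue_on (UNIV \<times> {0..}))" by (rule w_sol_measurable)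
  show "L1loc_continuous_on {0..} w_sol" by (rule w_sol_L1loc)
  show "AE x in lebesgue. w_sol (x, 0) = (1, s x)" by (simp add: w_sol_initial)
next
  fix \<psi> :: "real \<times> real \<Rightarrow> real" assume psi: "smooth_on UNIV \<psi> \<and> supported_in_upper_half \<psi>"
  then have "Ck_on 1 UNIV \<psi>" unfolding smooth_on_def by blast
  note w_sol_weak[OF this conjunct2[OF psi]]
  then show "(LINT z:UNIV \<times> {0<..}|lebesgue. dt \<psi> z * fst (w_sol z) - dx \<psi> z * G (snd (w_sol z) / fst (w_sol z))) = 0"
    "(LINT z:UNIV \<times> {0<..}|lebesgue. dt \<psi> z * snd (w_sol z)) = 0" by blast+
next
  fix E Q and \<psi> :: "real \<times> real \<Rightarrow> real"
  assume "convex_extension {a..b} G E Q" "Ck_on 1 UNIV \<psi> \<and> supported_in_upper_half \<psi> \<and> (\<forall>z. \<psi> z \<ge> 0)"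
  then show "(LINT z:UNIV \<times> {0<..}|lebesgue. dt \<psi> z * E (w_sol z) + dx \<psi> z * Q (w_sol z)) \<ge> 0"
    by (intro w_sol_entropy) blast+
qed

end

section \<open>Cut-off functions and one-sided weak derivatives\<close>

definition pos_sq :: "real \<Rightarrow> real" where "pos_sq t = (max 0 t)\<^sup>2"

lemma pos_sq_deriv: "(pos_sq has_real_derivative 2 * max 0 t) (at t)"
proof -
  consider "t < 0" | "t > 0" | "t = 0" by linarith
  then show ?thesis
  proof cases
    case 1
    have "((\<lambda>t. 0) has_real_derivative 0) (at t)" by simp
    then show ?thesis using 1
      by (subst has_field_derivative_cong_eventually[where g="\<lambda>t. 0"])
         (auto simp: pos_sq_def intro!: eventually_mono[OF order_tendstoD(2)[OF tendsto_ident_at 1]])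
  next
    case 2
    have "((\<lambda>t. t\<^sup>2) has_real_derivative 2 * t) (at t)" by (auto intro!: derivative_eq_intros)
    then show ?thesis using 2
      by (subst has_field_derivative_cong_eventually[where g="\<lambda>t. t\<^sup>2"])
         (auto simp: pos_sq_def intro!: eventually_mono[OF order_tendstoD(1)[OF tendsto_ident_at 2]])
  next
    case 3
    have "((\<lambda>h. pos_sq h / h) \<longlongrightarrow> 0) (at 0)"
    proof (rule Lim_null_comparison)
      show "\<forall>\<^sub>F h in at 0. norm (pos_sq h / h) \<le> \<bar>h\<bar>"
        by (intro always_eventually allI) (auto simp: pos_sq_def max_def power2_eq_square)
      show "((\<lambda>h :: real. \<bar>h\<bar>) \<longlongrightarrow> 0) (at 0)" by (rule tendsto_rabs_zero) (rule tendsto_ident_at)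
    qed
    then show ?thesis using 3 by (simp add: DERIV_def pos_sq_def)
  qed
qed

text \<open>A quadratic spline of class C^1 that rises from 0 to 1 on [0, 1], with breaks at 0, 1/2
  and 1; its derivative is the tent of height 2.\<close>

definition ramp :: "real \<Rightarrow> real" where
  "ramp t = 2 * pos_sq t - 4 * pos_sq (t - 1 / 2) + 2 * pos_sq (t - 1)"

definition ramp' :: "real \<Rightarrow> real" where
  "ramp' t = 4 * max 0 t - 8 * max 0 (t - 1 / 2) + 4 * max 0 (t - 1)"

lemma ramp_deriv: "(ramp has_real_derivative ramp' t) (at t)"
proof -
  have sh: "((\<lambda>t. pos_sq (t - c)) has_real_derivative 2 * max 0 (t - c)) (at t)" for c
    using DERIV_shift[of pos_sq "2 * max 0 (t - c)" t "-c"] pos_sq_deriv[of "t - c"] by simp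
  show ?thesis unfolding ramp_def[abs_def] ramp'_def
    by (auto intro!: derivative_eq_intros sh pos_sq_deriv)
qed

lemma ramp'_continuous: "continuous_on S ramp'"
  unfolding ramp'_def[abs_def] by (intro continuous_intros)

lemma ramp_continuous: "continuous_on S ramp"
  using ramp_deriv by (meson DERIV_isCont continuous_at_imp_continuous_on)

lemma ramp_values: "t \<le> 0 \<Longrightarrow> ramp t = 0" "t \<ge> 1 \<Longrightarrow> ramp t = 1"
  "t \<le> 0 \<Longrightarrow> ramp' t = 0" "t \<ge> 1 \<Longrightarrow> ramp' t = 0" "0 \<le> ramp' t" "ramp' t \<le> 2"
  by (auto simp: ramp_def ramp'_def pos_sq_def max_def power2_eq_square algebra_simps)

lemma ramp_mono: "x \<le> y \<Longrightarrow> ramp x \<le> ramp y"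
  by (rule DERIV_nonneg_imp_nondecreasing) (use ramp_deriv ramp_values(5) in blast)+

lemma ramp_range: "0 \<le> ramp t" "ramp t \<le> 1"
  using ramp_mono[of "min t 0" t] ramp_mono[of t "max t 1"] by (auto simp: ramp_values)

lemma ramp_bounded_borel: "bounded_borel ramp" "bounded_borel ramp'"
  by (rule bounded_borelI[of _ 1], auto intro: borel_measurable_continuous_onI ramp_continuous simp: ramp_range)
     (rule bounded_borelI[of _ 2], auto intro: borel_measurable_continuous_onI ramp'_continuous simp: ramp_values)

lemma ramp'_integral: "(LINT u|lborel. ramp' u) = 1"
proof -
  have "primitive ramp ramp'"
    by (rule primitive_of_C1[OF ramp_deriv ramp'_continuous ramp_bounded_borel(2)])
  from primitiveD[OF this, of "-1" 1] have "(LINT u:{-1..1}|lborel. ramp' u) = 1" by (simp add: ramp_values)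
  then show ?thesis
    by (subst LINT_compact_support(2)[OF ramp_bounded_borel(2), of 1]) (auto simp: ramp_values abs_if split: if_splits)
qed

lemma kernel_limit:
  fixes g :: "real \<Rightarrow> real" and d :: "nat \<Rightarrow> real"
  assumes k: "bounded_borel \<kappa>" "\<And>u. \<bar>u\<bar> \<ge> K \<Longrightarrow> \<kappa> u = 0" and g: "bounded_borel g" "isCont g x" and d: "d \<longlonglongrightarrow> 0"
  shows "(\<lambda>n. LINT u|lborel. \<kappa> u * g (x + d n * u)) \<longlonglongrightarrow> (LINT u|lborel. \<kappa> u) * g x"
proof -
  obtain C where C: "C > 0" "\<And>x. \<bar>g x\<bar> \<le> C" using bounded_borel_bound[OF g(1)] by blast
  have [measurable]: "\<kappa> \<in> borel_measurable borel" "g \<in> borel_measurable borel" using k g by (auto simp: bounded_borel_def)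
  have ik: "integrable lborel \<kappa>" by (rule LINT_compact_support(1)[OF k])
  have "(\<lambda>n. LINT u|lborel. \<kappa> u * g (x + d n * u)) \<longlonglongrightarrow> (LINT u|lborel. \<kappa> u * g x)"
  proof (rule integral_dominated_convergence[where w="\<lambda>u. \<bar>\<kappa> u\<bar> * C"])
    show "integrable lborel (\<lambda>u. \<bar>\<kappa> u\<bar> * C)" using ik by simp
    have "(\<lambda>n. g (x + d n * u)) \<longlonglongrightarrow> g x" for u
    proof (rule isCont_tendsto_compose[OF g(2)])
      have "(\<lambda>n. x + d n * u) \<longlonglongrightarrow> x + 0 * u" by (intro tendsto_intros d)
      then show "(\<lambda>n. x + d n * u) \<longlonglongrightarrow> x" by simp
    qed
    then show "AE u in lborel. (\<lambda>n. \<kappa> u * g (x + d n * u)) \<longlonglongrightarrow> \<kappa> u * g x" by (intro AE_I2 tendsto_intros)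
    show "AE u in lborel. norm (\<kappa> u * g (x + d n * u)) \<le> \<bar>\<kappa> u\<bar> * C" for n
      using C by (intro AE_I2) (simp add: abs_mult mult_left_mono)
  qed measurable
  then show ?thesis by simp
qed

definition time_test :: "(real \<Rightarrow> real) \<Rightarrow> (real \<Rightarrow> real) \<Rightarrow> bool" where
  "time_test \<beta> \<beta>' \<longleftrightarrow> C1c \<beta> \<beta>' \<and> (\<forall>t. 0 \<le> \<beta> t) \<and> (\<exists>t0>0. \<forall>t\<le>t0. \<beta> t = 0 \<and> \<beta>' t = 0)"

text \<open>For small \<open>d\<close> this is a C^1 approximation of the indicator of the interval
  from \<open>t1\<close> to \<open>t2\<close>; its derivative is a difference of two approximate
  identities.\<close>

lemma ramp_time_test:
  assumes "0 < t1" "t1 \<le> t2" "d > 0"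
  shows "time_test (\<lambda>t. ramp ((t - t1) / d) - ramp ((t - t2) / d)) (\<lambda>t. (ramp' ((t - t1) / d) - ramp' ((t - t2) / d)) / d)"
  unfolding time_test_def C1c_def
proof (intro conjI allI)
  fix t
  have D: "((\<lambda>t. ramp ((t - c) / d)) has_real_derivative ramp' ((t - c) / d) * (1 / d)) (at t)" for c
    by (rule DERIV_chain2[OF ramp_deriv]) (use assms(3) in \<open>auto intro!: derivative_eq_intros\<close>)
  show "((\<lambda>t. ramp ((t - t1) / d) - ramp ((t - t2) / d)) has_real_derivative (ramp' ((t - t1) / d) - ramp' ((t - t2) / d)) / d) (at t)"
    using DERIV_diff[OF D[of t1] D[of t2]] by (simp add: diff_divide_distrib)
  have "(t - t2) / d \<le> (t - t1) / d" using assms by (intro divide_right_mono) auto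
  then show "0 \<le> ramp ((t - t1) / d) - ramp ((t - t2) / d)" using ramp_mono by simp
next
  show "continuous_on UNIV (\<lambda>t. (ramp' ((t - t1) / d) - ramp' ((t - t2) / d)) / d)"
    by (intro continuous_intros continuous_on_compose2[OF ramp'_continuous[of UNIV]]) (use assms(3) in auto)
  have z: "ramp ((t - t1) / d) = 0 \<and> ramp ((t - t2) / d) = 0 \<and> ramp' ((t - t1) / d) = 0 \<and> ramp' ((t - t2) / d) = 0" if "t \<le> t1" for t
    using that assms by (simp add: ramp_values divide_nonpos_pos)
  have o: "ramp ((t - t1) / d) = 1 \<and> ramp ((t - t2) / d) = 1 \<and> ramp' ((t - t1) / d) = 0 \<and> ramp' ((t - t2) / d) = 0" if "t \<ge> t2 + d" for t
    using that assms by (simp add: ramp_values le_divide_eq)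
  show "\<exists>t0>0. \<forall>t\<le>t0. ramp ((t - t1) / d) - ramp ((t - t2) / d) = 0 \<and> (ramp' ((t - t1) / d) - ramp' ((t - t2) / d)) / d = 0"
    using z assms(1) by (intro exI[of _ t1]) simp
  show "\<exists>K. \<forall>t. K \<le> \<bar>t\<bar> \<longrightarrow> ramp ((t - t1) / d) - ramp ((t - t2) / d) = 0 \<and> (ramp' ((t - t1) / d) - ramp' ((t - t2) / d)) / d = 0"
  proof (intro exI[of _ "t2 + d"] allI impI)
    fix t assume "t2 + d \<le> \<bar>t\<bar>"
    then have "t \<le> t1 \<or> t \<ge> t2 + d" using assms by linarith
    then show "ramp ((t - t1) / d) - ramp ((t - t2) / d) = 0 \<and> (ramp' ((t - t1) / d) - ramp' ((t - t2) / d)) / d = 0"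
      using z[of t] o[of t] by auto
  qed
qed

text \<open>Testing with smoothed indicators of (t1, t2] yields the increment of \<alpha> in the
  limit, because the rescaled tents concentrate at \<open>t1\<close> and \<open>t2\<close> and
  \<alpha> is continuous there.\<close>

lemma weak_decrease:
  assumes A: "bounded_borel \<alpha>" "continuous_on {0..} \<alpha>" and B: "bounded_borel \<gamma>"
    and weak: "\<And>\<beta> \<beta>'. time_test \<beta> \<beta>' \<Longrightarrow> 0 \<le> (LINT t|lborel. \<beta>' t * \<alpha> t + \<beta> t * \<gamma> t)"
    and t: "0 \<le> t1" "t1 \<le> t2"
  shows "\<alpha> t2 - \<alpha> t1 \<le> (LINT t:{t1..t2}|lborel. \<gamma> t)"
proof -
  have pos: "\<alpha> t2 - \<alpha> t1 \<le> (LINT t:{t1..t2}|lborel. \<gamma> t)" if t: "0 < t1" "t1 \<le> t2" for t1 t2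
  proof -
    define d :: "nat \<Rightarrow> real" where "d n = 1 / real (Suc n)" for n
    have d: "d n > 0" for n by (simp add: d_def)
    have d0: "d \<longlonglongrightarrow> 0" unfolding d_def by (rule LIMSEQ_Suc[OF lim_1_over_n])
    let ?b = "\<lambda>n t. ramp ((t - t1) / d n) - ramp ((t - t2) / d n)"
    let ?b' = "\<lambda>n t. (ramp' ((t - t1) / d n) - ramp' ((t - t2) / d n)) / d n"
    have T: "time_test (?b n) (?b' n)" for n by (rule ramp_time_test[OF t d])
    then have C: "C1c (?b n) (?b' n)" for n by (simp add: time_test_def)
    have supp: "?b n t = 0" if "\<bar>t\<bar> \<ge> t2 + 1" for n t
    proof -
      have "d n \<le> 1" by (simp add: d_def)
      then have "t \<le> t1 \<or> t \<ge> t2 + d n" using that t by linarith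
      then show ?thesis using t d[of n] by (auto simp: ramp_values divide_nonpos_pos le_divide_eq)
    qed
    have ia: "integrable lborel (\<lambda>t. ramp' ((t - c) / d n) / d n * \<alpha> t)"
      and ea: "(LINT t|lborel. ramp' ((t - c) / d n) / d n * \<alpha> t) = (LINT u|lborel. ramp' u * \<alpha> (c + d n * u))" for n c
    proof -
      have "integrable lborel (\<lambda>u. ramp' u * \<alpha> (c + d n * u))"
      proof (rule LINT_compact_support(1)[of _ 1])
        have [measurable]: "\<alpha> \<in> borel_measurable borel" using A(1) by (simp add: bounded_borel_def)
        obtain D where "\<And>x. \<bar>\<alpha> x\<bar> \<le> D" using bounded_borel_bound[OF A(1)] by blast
        then have "bounded_borel (\<lambda>u. \<alpha> (c + d n * u))" by (intro bounded_borelI[of _ D]) simp_all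
        then show "bounded_borel (\<lambda>u. ramp' u * \<alpha> (c + d n * u))" using ramp_bounded_borel(2) by (intro bounded_borel_mult)
        show "ramp' x * \<alpha> (c + d n * x) = 0" if "\<bar>x\<bar> \<ge> 1" for x
          using that ramp_values(3,4)[of x] by (cases "x \<ge> 1") auto
      qed
      moreover have eq: "ramp' ((c + d n * u - c) / d n) / d n * \<alpha> (c + d n * u) = ramp' u * \<alpha> (c + d n * u) / d n" for u
        using d[of n] by simp
      ultimately show "integrable lborel (\<lambda>t. ramp' ((t - c) / d n) / d n * \<alpha> t)"
        using d[of n] by (subst lborel_integrable_real_affine_iff[of "d n" _ c, symmetric]) (simp_all only: eq, simp_all)
      show "(LINT t|lborel. ramp' ((t - c) / d n) / d n * \<alpha> t) = (LINT u|lborel. ramp' u * \<alpha> (c + d n * u))"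
        using d[of n] by (subst lborel_integral_real_affine[of "d n" _ c]) (simp_all only: eq, simp_all)
    qed
    have ib: "integrable lborel (\<lambda>t. ?b n t * \<gamma> t)" for n
      by (rule LINT_compact_support(1)[of _ "t2 + 1"]) (use supp in \<open>simp_all add: bounded_borel_mult C1c_bounded_borel(1)[OF C] B\<close>)
    have "0 \<le> (LINT t|lborel. ?b' n t * \<alpha> t + ?b n t * \<gamma> t)" for n by (rule weak[OF T])
    also have "(LINT t|lborel. ?b' n t * \<alpha> t + ?b n t * \<gamma> t)
       = (LINT u|lborel. ramp' u * \<alpha> (t1 + d n * u)) - (LINT u|lborel. ramp' u * \<alpha> (t2 + d n * u)) + (LINT t|lborel. ?b n t * \<gamma> t)" for n
    proof -
      have "(LINT t|lborel. ?b' n t * \<alpha> t + ?b n t * \<gamma> t)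
        = (LINT t|lborel. (ramp' ((t - t1) / d n) / d n * \<alpha> t - ramp' ((t - t2) / d n) / d n * \<alpha> t) + ?b n t * \<gamma> t)"
        by (simp add: diff_divide_distrib left_diff_distrib)
      also have "\<dots> = (LINT t|lborel. ramp' ((t - t1) / d n) / d n * \<alpha> t) - (LINT t|lborel. ramp' ((t - t2) / d n) / d n * \<alpha> t)
          + (LINT t|lborel. ?b n t * \<gamma> t)"
        using ia[of t1 n] ia[of t2 n] ib[of n] by (simp del: times_divide_eq_left)
      finally show ?thesis unfolding ea .
    qed
    finally have ge: "0 \<le> (LINT u|lborel. ramp' u * \<alpha> (t1 + d n * u)) - (LINT u|lborel. ramp' u * \<alpha> (t2 + d n * u)) + (LINT t|lborel. ?b n t * \<gamma> t)" for n .
    have cont: "isCont \<alpha> x" if "x > 0" for x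
      using A(2) that by (metis continuous_on_interior interior_real_atLeast greaterThan_iff)
    have L: "(\<lambda>n. LINT u|lborel. ramp' u * \<alpha> (x + d n * u)) \<longlonglongrightarrow> \<alpha> x" if "x > 0" for x
      using kernel_limit[OF ramp_bounded_borel(2) _ A(1) cont[OF that] d0, of 1] ramp'_integral ramp_values(3,4)
      by (auto simp: abs_if split: if_splits)
    obtain D where D: "D > 0" "\<And>x. \<bar>\<gamma> x\<bar> \<le> D" using bounded_borel_bound[OF B] by blast
    have [measurable]: "\<gamma> \<in> borel_measurable borel" using B by (simp add: bounded_borel_def)
    have "(\<lambda>n. LINT t|lborel. ?b n t * \<gamma> t) \<longlonglongrightarrow> (LINT t|lborel. indicator {t1<..t2} t * \<gamma> t)"
    proof (rule integral_dominated_convergence[where w="\<lambda>t. indicator {-t2-1..t2+1} t * D"])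
      show "integrable lborel (\<lambda>t. indicator {-t2-1..t2+1} t * D)"
        by (intro integrable_mult_left integrable_real_indicator) (auto simp: emeasure_lborel_Icc_eq)
      show "(\<lambda>t. ?b n t * \<gamma> t) \<in> borel_measurable lborel" for n using ib[of n] by (rule borel_measurable_integrable)
      show "AE t in lborel. norm (?b n t * \<gamma> t) \<le> indicator {-t2-1..t2+1} t * D" for n
      proof (rule AE_I2)
        fix t
        have "\<bar>?b n t\<bar> \<le> 1" using ramp_range[of "(t - t1) / d n"] ramp_range[of "(t - t2) / d n"] by auto
        then have "\<bar>?b n t\<bar> * \<bar>\<gamma> t\<bar> \<le> 1 * D" using D by (intro mult_mono) auto
        then show "norm (?b n t * \<gamma> t) \<le> indicator {-t2-1..t2+1} t * D"
          using supp[of t n] t by (cases "\<bar>t\<bar> \<ge> t2 + 1") (auto simp: abs_mult indicator_def D less_imp_le)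
      qed
      show "AE t in lborel. (\<lambda>n. ?b n t * \<gamma> t) \<longlonglongrightarrow> indicator {t1<..t2} t * \<gamma> t"
      proof (rule AE_I2)
        fix t
        have ev: "(\<lambda>n. ramp ((t - c) / d n)) \<longlonglongrightarrow> (if t > c then 1 else 0)" for c
        proof (cases "t > c")
          case True
          then have "\<forall>\<^sub>F n in sequentially. d n < t - c" using order_tendstoD(2)[OF d0, of "t - c"] by simp
          then have "\<forall>\<^sub>F n in sequentially. ramp ((t - c) / d n) = 1"
            by eventually_elim (use d in \<open>auto simp: ramp_values le_divide_eq\<close>)
          then show ?thesis using True by (simp add: tendsto_eventually)
        next
          case False
          then have "ramp ((t - c) / d n) = 0" for n using d[of n] by (simp add: ramp_values divide_nonpos_pos)
          then show ?thesis using False by simp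
        qed
        have "(\<lambda>n. ?b n t * \<gamma> t) \<longlonglongrightarrow> ((if t > t1 then 1 else 0) - (if t > t2 then 1 else 0)) * \<gamma> t"
          by (intro tendsto_intros ev)
        moreover have "((if t > t1 then 1 else 0) - (if t > t2 then 1 else 0)) * \<gamma> t = indicator {t1<..t2} t * \<gamma> t"
          using t by (auto simp: indicator_def)
        ultimately show "(\<lambda>n. ?b n t * \<gamma> t) \<longlonglongrightarrow> indicator {t1<..t2} t * \<gamma> t" by simp
      qed
    qed measurable
    from LIMSEQ_le_const[OF tendsto_add[OF tendsto_diff[OF L[of t1] L[of t2]] this], of 0] ge t
    have "0 \<le> \<alpha> t1 - \<alpha> t2 + (LINT t|lborel. indicator {t1<..t2} t * \<gamma> t)" by auto
    also have "(LINT t|lborel. indicator {t1<..t2} t * \<gamma> t) = (LINT t:{t1<..t2}|lborel. \<gamma> t)" by (simp add: set_lebesgue_integral_def)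
    also have "\<dots> = (LINT t:{t1..t2}|lborel. \<gamma> t)" by (rule set_integral_discrete_difference[of "{t1}"]) auto
    finally show ?thesis by simp
  qed
  show ?thesis
  proof (cases "t1 > 0")
    case True then show ?thesis by (rule pos[OF _ t(2)])
  next
    case False
    then have t1: "t1 = 0" using t by simp
    show ?thesis
    proof (cases "t2 = 0")
      case True
      obtain D where "\<And>x. \<bar>\<gamma> x\<bar> \<le> D" using bounded_borel_bound[OF B] by blast
      then show ?thesis using t1 True LINT_Icc_bound[OF B, of 0 0 D] by simp
    next
      case False
      then have t2: "t2 > 0" using t by simp
      obtain D where D: "D > 0" "\<And>x. \<bar>\<gamma> x\<bar> \<le> D" using bounded_borel_bound[OF B] by blast
      \<comment> \<open>\<open>pos\<close> needs a positive left end, since time tests vanish near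
        0. Continuity of \<alpha> at 0 from the right lets the left end \<open>\<epsilon> n\<close>
        tend to 0.\<close>
      define \<epsilon> :: "nat \<Rightarrow> real" where "\<epsilon> n = t2 / real (Suc n)" for n
      have e: "0 < \<epsilon> n" "\<epsilon> n \<le> t2" for n using t2 by (auto simp: \<epsilon>_def divide_le_eq)
      have e0: "\<epsilon> \<longlonglongrightarrow> 0" unfolding \<epsilon>_def using LIMSEQ_Suc[OF lim_const_over_n] .
      have "(\<lambda>n. \<alpha> (\<epsilon> n)) \<longlonglongrightarrow> \<alpha> 0"
        by (rule continuous_on_tendsto_compose[OF A(2) e0]) (use e in \<open>auto simp: less_imp_le\<close>)
      then have "(\<lambda>n. \<alpha> t2 - \<alpha> (\<epsilon> n) - D * \<epsilon> n) \<longlonglongrightarrow> \<alpha> t2 - \<alpha> 0 - D * 0" by (intro tendsto_intros e0)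
      moreover have "\<alpha> t2 - \<alpha> (\<epsilon> n) - D * \<epsilon> n \<le> (LINT t:{0..t2}|lborel. \<gamma> t)" for n
      proof -
        have "\<bar>LINT t:{0..\<epsilon> n}|lborel. \<gamma> t\<bar> \<le> D * \<epsilon> n"
          using LINT_Icc_bound[OF B D(2), of 0 "\<epsilon> n"] e[of n] by simp
        moreover have "(LINT t:{0..t2}|lborel. \<gamma> t) = (LINT t:{0..\<epsilon> n}|lborel. \<gamma> t) + (LINT t:{\<epsilon> n..t2}|lborel. \<gamma> t)"
          by (rule LINT_Icc_combine[OF B]) (use e[of n] in auto)
        ultimately show ?thesis using pos[OF e(1)[of n] e(2)[of n]] by linarith
      qed
      ultimately have "\<alpha> t2 - \<alpha> 0 - D * 0 \<le> (LINT t:{0..t2}|lborel. \<gamma> t)" by (intro LIMSEQ_le_const2) auto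
      then show ?thesis using t1 by simp
    qed
  qed
qed

text \<open>Integration by parts when only an upper bound for the increments of \<open>X\<close> is
  available, as for the absolute value of a flux difference. The sign of \<theta> preserves the
  inequality in the product rule.\<close>

lemma parts_inequality:
  assumes X: "\<And>x y. \<bar>X y - X x\<bar> \<le> C * \<bar>y - x\<bar>" and bX: "bounded_borel X" and R: "bounded_borel R"
    and le: "\<And>x y. x \<le> y \<Longrightarrow> X y - X x \<le> (LINT t:{x..y}|lborel. R t)"
    and th: "C1c \<theta> \<theta>'" "\<And>x. 0 \<le> \<theta> x"
  shows "0 \<le> (LINT y|lborel. \<theta>' y * X y) + (LINT y|lborel. \<theta> y * R y)"
proof -
  obtain K where K: "\<forall>x. \<bar>x\<bar> \<ge> K \<longrightarrow> \<theta> x = 0 \<and> \<theta>' x = 0" using th(1) unfolding C1c_def by blast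
  note b = C1c_bounded_borel[OF th(1)]
  have C0: "C \<ge> 0" using X[of 0 1] by auto
  obtain D where D: "D > 0" "\<And>x. \<bar>\<theta>' x\<bar> \<le> D" using bounded_borel_bound[OF b(2)] by blast
  obtain E where E: "E > 0" "\<And>x. \<bar>R x\<bar> \<le> E" using bounded_borel_bound[OF R] by blast
  have pr: "primitive \<theta> \<theta>'"
    by (rule primitive_of_C1) (use th(1) b in \<open>auto simp: C1c_def\<close>)
  define N where "N = max K 0"
  let ?Y = "\<lambda>y. \<theta> y * X y" and ?F = "\<lambda>y. \<theta>' y * X y + \<theta> y * R y"
  have bF: "bounded_borel ?F" by (intro bounded_borel_intros b bX R)
  have "?Y N - ?Y (-N) \<le> (LINT y:{-N..N}|lborel. ?F y)"
  proof (rule increment_le_integral[OF bF])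
    show "-N \<le> N" by (simp add: N_def)
    fix e :: real assume e: "e > 0"
    define h where "h = e / (D * C + D * E + 1)"
    have den: "D * C + D * E + 1 > 0" using C0 D E by (simp add: add_nonneg_pos)
    show "\<exists>h>0. \<forall>x y. -N \<le> x \<and> x \<le> y \<and> y \<le> N \<and> y - x \<le> h \<longrightarrow> ?Y y - ?Y x \<le> (LINT t:{x..y}|lborel. ?F t) + e * (y - x)"
    proof (intro exI[of _ h] conjI allI impI)
      show "h > 0" using e den by (simp add: h_def)
      fix x y assume xy: "-N \<le> x \<and> x \<le> y \<and> y \<le> N \<and> y - x \<le> h"
      have "?Y y - ?Y x = (\<theta> y - \<theta> x) * X y + \<theta> x * (X y - X x)" by (simp add: algebra_simps)
      also have "\<dots> \<le> (LINT t:{x..y}|lborel. \<theta>' t) * X y + \<theta> x * (LINT t:{x..y}|lborel. R t)"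
        using primitiveD[OF pr, of x y] le[of x y] xy th(2)[of x] by (simp add: mult_left_mono)
      also have "\<dots> = (LINT t:{x..y}|lborel. \<theta>' t * X y + \<theta> x * R t)"
        by (subst LINT_Icc_add) (use b R in \<open>simp_all add: bounded_borel_mult\<close>)
      also have "\<dots> \<le> (LINT t:{x..y}|lborel. ?F t + e)"
      proof (rule LINT_Icc_mono)
        fix t assume t: "x \<le> t" "t \<le> y"
        have "\<bar>\<theta>' t * (X y - X t)\<bar> \<le> D * (C * h)"
          unfolding abs_mult using D C0 xy t by (intro mult_mono order_trans[OF X] mult_left_mono) auto
        moreover have "\<bar>(\<theta> x - \<theta> t) * R t\<bar> \<le> (D * h) * E"
          unfolding abs_mult using D E xy t by (intro mult_mono order_trans[OF primitive_lipschitz[OF pr D(2)]] mult_left_mono) auto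
        moreover have "D * (C * h) + (D * h) * E \<le> e"
        proof -
          have "D * (C * h) + (D * h) * E = (D * C + D * E) * h" by (simp add: algebra_simps)
          also have "\<dots> \<le> (D * C + D * E + 1) * h" using \<open>h > 0\<close> by (intro mult_right_mono) auto
          also have "\<dots> = e" using den by (simp add: h_def)
          finally show ?thesis .
        qed
        moreover have "\<theta>' t * X y + \<theta> x * R t = ?F t + \<theta>' t * (X y - X t) + (\<theta> x - \<theta> t) * R t" by (simp add: algebra_simps)
        ultimately show "\<theta>' t * X y + \<theta> x * R t \<le> ?F t + e" by linarith
      qed (intro bounded_borel_intros b bX R)+
      also have "\<dots> = (LINT t:{x..y}|lborel. ?F t) + e * (y - x)"
        using xy LINT_Icc_add[OF bF bounded_borel_const[of e], of x y] LINT_Icc_const[of x y e] by simp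
      finally show "?Y y - ?Y x \<le> (LINT t:{x..y}|lborel. ?F t) + e * (y - x)" .
    qed
  qed
  moreover have "\<theta> N = 0" "\<theta> (-N) = 0" using K by (simp_all add: N_def)
  ultimately have "0 \<le> (LINT y:{-N..N}|lborel. ?F y)" by simp
  also have "\<dots> = (LINT y|lborel. ?F y)"
    by (rule LINT_compact_support(2)[symmetric, OF bF]) (use K in \<open>simp add: N_def\<close>)
  also have "\<dots> = (LINT y|lborel. \<theta>' y * X y) + (LINT y|lborel. \<theta> y * R y)"
    by (intro Bochner_Integration.integral_add LINT_compact_support(1)[of _ K] bounded_borel_mult b bX R) (use K in simp_all)
  finally show ?thesis .
qed

lemma integrable_cball_const: "integrable lborel (\<lambda>z :: 'a::euclidean_space. indicator (cball 0 K) z * (C :: real))"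
proof (intro integrable_mult_left integrable_real_indicator)
  show "emeasure lborel (cball (0 :: 'a) K) < \<infinity>" by (rule emeasure_bounded_finite) (rule bounded_cball)
qed simp

lemma bounded_support_integrable:
  fixes g :: "'a::euclidean_space \<Rightarrow> real"
  assumes g: "g \<in> borel_measurable borel" "\<And>z. \<bar>g z\<bar> \<le> C" and supp: "\<And>z. norm z \<ge> K \<Longrightarrow> g z = 0"
  shows "integrable lborel g"
proof (rule Bochner_Integration.integrable_bound)
  show "integrable lborel (\<lambda>z. indicator (cball 0 K :: 'a set) z * C)"
    by (rule integrable_cball_const)
  show "AE z in lborel. norm (g z) \<le> norm (indicator (cball 0 K) z * C)"
  proof (rule AE_I2)
    fix z show "norm (g z) \<le> norm (indicator (cball 0 K) z * C)"
      using g(2)[of z] supp[of z] by (cases "norm z \<ge> K") (auto simp: indicator_def)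
  qed
qed (use g in simp)

lemma Fubini_lborel:
  fixes g :: "'a::euclidean_space \<times> 'b::euclidean_space \<Rightarrow> real"
  assumes "integrable lborel g"
  shows "(LINT y|lborel. LINT w|lborel. g (y, w)) = (LINT w|lborel. LINT y|lborel. g (y, w))"
    "integrable lborel (\<lambda>w. LINT y|lborel. g (y, w))"
proof -
  have i: "integrable (lborel \<Otimes>\<^sub>M lborel) (\<lambda>(y, w). g (y, w))" using assms by (simp add: lborel_prod)
  show "(LINT y|lborel. LINT w|lborel. g (y, w)) = (LINT w|lborel. LINT y|lborel. g (y, w))"
    using lborel_pair.Fubini_integral[OF i] by simp
  show "integrable lborel (\<lambda>w. LINT y|lborel. g (y, w))" by (rule lborel_pair.integrable_snd[OF i])
qed

text \<open>A nonnegative C^1 bump supported in [-1, 1]. Of its integral only the positivity is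
  used, to divide it out.\<close>

definition bump :: "real \<Rightarrow> real" where "bump u = ramp (u + 1) - ramp u"
definition bump' :: "real \<Rightarrow> real" where "bump' u = ramp' (u + 1) - ramp' u"

lemma bump_deriv: "(bump has_real_derivative bump' u) (at u)"
proof -
  have "((\<lambda>u. ramp (u + 1)) has_real_derivative ramp' (u + 1)) (at u)"
    using DERIV_shift[of ramp "ramp' (u + 1)" u 1] ramp_deriv by simp
  then show ?thesis unfolding bump_def[abs_def] bump'_def by (intro DERIV_diff ramp_deriv)
qed

lemma bump'_continuous: "continuous_on S bump'"
  unfolding bump'_def[abs_def]
  by (intro continuous_intros ramp'_continuous continuous_on_compose2[OF ramp'_continuous[of UNIV]]) auto

lemma bump_support: "\<bar>u\<bar> \<ge> 1 \<Longrightarrow> bump u = 0 \<and> bump' u = 0"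
  by (cases "u \<ge> 1") (auto simp: bump_def bump'_def ramp_values)

lemma bump_C1c: "C1c bump bump'"
  unfolding C1c_def using bump_deriv bump'_continuous bump_support by blast

lemma bump_bounds: "0 \<le> bump u" "bump u \<le> 1"
  using ramp_mono[of u "u + 1"] ramp_range[of u] ramp_range[of "u + 1"] by (auto simp: bump_def)

lemma bump_integral_pos: "(LINT u|lborel. bump (- u)) > 0"
proof -
  have c: "continuous_on UNIV bump" by (rule C1c_continuous[OF bump_C1c])
  have i: "integrable lborel (\<lambda>u. bump (- u))"
    by (rule LINT_compact_support(1)[of _ 1])
       (use bounded_borel_reflect[OF C1c_bounded_borel(1)[OF bump_C1c], of 0] bump_support in simp_all)
  have nn: "(LINT u|lborel. bump (- u)) \<ge> 0" using bump_bounds by (intro Bochner_Integration.integral_nonneg) simp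
  moreover have "(LINT u|lborel. bump (- u)) \<noteq> 0"
  proof
    assume "(LINT u|lborel. bump (- u)) = 0"
    then have "AE u in lborel. bump (- u) = 0"
      using integral_nonneg_eq_0_iff_AE[OF i] bump_bounds by simp
    then have "AE u in lebesgue. bump (- u) = 0" by (rule AE_completion)
    then have "negligible {u. bump (- u) \<noteq> 0}"
      by (simp add: negligible_iff_null_sets completion.AE_iff_null_sets)
    moreover have "open {u. bump (- u) \<noteq> 0}"
      by (rule open_Collect_neq) (auto intro!: continuous_intros continuous_on_compose2[OF c])
    moreover have "0 \<in> {u. bump (- u) \<noteq> 0}" by (simp add: bump_def ramp_values)
    ultimately show False using open_not_negligible by blast
  qed
  ultimately show ?thesis by simp
qed

lemma C1c_mult_bump:
  assumes th: "C1c \<theta> \<theta>'" and d: "d > 0"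
  shows "C1c (\<lambda>x. \<theta> x * bump ((x - y) / d)) (\<lambda>x. \<theta>' x * bump ((x - y) / d) + \<theta> x * (bump' ((x - y) / d) / d))"
  unfolding C1c_def
proof (intro conjI allI)
  fix x
  have "((\<lambda>x. bump ((x - y) / d)) has_real_derivative bump' ((x - y) / d) * (1 / d)) (at x)"
    by (rule DERIV_chain2[OF bump_deriv]) (use d in \<open>auto intro!: derivative_eq_intros\<close>)
  moreover have "(\<theta> has_real_derivative \<theta>' x) (at x)" using th by (simp add: C1c_def)
  ultimately show "((\<lambda>x. \<theta> x * bump ((x - y) / d)) has_real_derivative \<theta>' x * bump ((x - y) / d) + \<theta> x * (bump' ((x - y) / d) / d)) (at x)"
    by (auto intro!: derivative_eq_intros)
next
  have c: "continuous_on UNIV \<theta>" "continuous_on UNIV \<theta>'" "continuous_on UNIV bump"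
    using C1c_continuous[OF th] C1c_continuous[OF bump_C1c] by auto
  show "continuous_on UNIV (\<lambda>x. \<theta>' x * bump ((x - y) / d) + \<theta> x * (bump' ((x - y) / d) / d))"
    by (intro continuous_intros c continuous_on_compose2[OF c(3)] continuous_on_compose2[OF bump'_continuous[of UNIV]])
       (use d in auto)
  obtain K where "\<forall>x. \<bar>x\<bar> \<ge> K \<longrightarrow> \<theta> x = 0 \<and> \<theta>' x = 0" using th unfolding C1c_def by blast
  then show "\<exists>K. \<forall>x. K \<le> \<bar>x\<bar> \<longrightarrow> \<theta> x * bump ((x - y) / d) = 0 \<and> \<theta>' x * bump ((x - y) / d) + \<theta> x * (bump' ((x - y) / d) / d) = 0"
    by (intro exI[of _ K]) simp
qed

lemma bump_reflected_C1c:
  assumes d: "d > 0" shows "C1c (\<lambda>y. bump ((x - y) / d)) (\<lambda>y. - (bump' ((x - y) / d) / d))"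
  unfolding C1c_def
proof (intro conjI allI)
  fix y
  have "((\<lambda>y. bump ((x - y) / d)) has_real_derivative bump' ((x - y) / d) * (- 1 / d)) (at y)"
    by (rule DERIV_chain2[OF bump_deriv]) (use d in \<open>auto intro!: derivative_eq_intros\<close>)
  then show "((\<lambda>y. bump ((x - y) / d)) has_real_derivative - (bump' ((x - y) / d) / d)) (at y)" by simp
next
  show "continuous_on UNIV (\<lambda>y. - (bump' ((x - y) / d) / d))"
    by (intro continuous_intros continuous_on_compose2[OF bump'_continuous[of UNIV]]) (use d in auto)
  show "\<exists>K. \<forall>y. K \<le> \<bar>y\<bar> \<longrightarrow> bump ((x - y) / d) = 0 \<and> - (bump' ((x - y) / d) / d) = 0"
  proof (intro exI[of _ "\<bar>x\<bar> + d"] allI impI)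
    fix y assume "\<bar>x\<bar> + d \<le> \<bar>y\<bar>"
    then have "d \<le> \<bar>x - y\<bar>" by linarith
    then have "\<bar>(x - y) / d\<bar> \<ge> 1" using d by (simp add: le_divide_eq)
    then show "bump ((x - y) / d) = 0 \<and> - (bump' ((x - y) / d) / d) = 0" using bump_support by simp
  qed
qed

section \<open>Kruzhkov's inequality against a step of the scheme\<close>

context flux_data
begin

text \<open>Both \<open>P\<close> and P - s are increasing and have countably many jumps; s is their
  difference.\<close>

lemma s_isCont_AE: "AE x in lborel. isCont s x"
proof -
  have "mono (\<lambda>x. P x - s x)"
  proof (rule monoI)
    fix x y :: real assume "x \<le> y"
    from s_variation[OF this] show "P x - s x \<le> P y - s y" by linarith
  qed
  then have "countable ({x. \<not> isCont P x} \<union> {x. \<not> isCont (\<lambda>x. P x - s x) x})"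
    using mono_ctble_discont P_mono by blast
  moreover have "{x. \<not> isCont s x} \<subseteq> {x. \<not> isCont P x} \<union> {x. \<not> isCont (\<lambda>x. P x - s x) x}"
  proof -
    have "isCont s x" if "isCont P x" "isCont (\<lambda>x. P x - s x) x" for x
      using continuous_diff[OF that] by simp
    then show ?thesis by blast
  qed
  ultimately have "countable {x. \<not> isCont s x}" by (rule countable_subset[rotated])
  then have "{x. \<not> isCont s x} \<in> null_sets lborel" by (rule countable_imp_null_set_lborel)
  then show ?thesis by (rule AE_I') simp
qed

lemma scheme_isCont_AE:
  assumes tau: "\<tau> > 0" shows "AE x in lborel. isCont (scheme \<tau> n) x"
proof (cases n)
  case 0
  show ?thesis using s_isCont_AE
  proof eventually_elim
    case (elim x)
    then show ?case using s_pos[of x] 0 by (auto intro!: continuous_intros)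
  qed
next
  case (Suc k)
  have "continuous_on UNIV (\<lambda>x. \<phi> (flux \<tau> k x))"
    by (rule continuous_on_compose2[OF phi_continuous resolvesD(3)[OF scheme_resolves[OF tau]]]) simp
  then have "isCont (scheme \<tau> n) x" for x
    unfolding Suc scheme_Suc[abs_def] by (simp add: continuous_on_eq_continuous_at)
  then show ?thesis by simp
qed

text \<open>\<open>R\<close> is a Borel representative of eta / v. Where v = s, the entropy |eta - k
  v| equals s |R - k|, with entropy flux |f(R) - f(k)|. Product tests \<theta>(x) \<beta>(t) suffice
  for the comparison.\<close>

definition kruzhkov :: "(real \<times> real \<Rightarrow> real) \<Rightarrow> bool" where
  "kruzhkov R \<longleftrightarrow> R \<in> borel_measurable (borel \<Otimes>\<^sub>M borel) \<and> (\<forall>w. R w \<in> {A..B}) \<and>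
     (\<forall>k\<in>{A..B}. \<forall>\<theta> \<theta>' \<beta> \<beta>'. C1c \<theta> \<theta>' \<and> (\<forall>x. 0 \<le> \<theta> x) \<and> time_test \<beta> \<beta>' \<longrightarrow>
        0 \<le> (LINT w|lborel. \<beta>' (snd w) * \<theta> (fst w) * (s (fst w) * \<bar>R w - k\<bar>)
              + \<beta> (snd w) * \<theta>' (fst w) * \<bar>f (R w) - f k\<bar>))"

text \<open>Kruzhkov's inequality with the constant replaced by a function of \<open>x\<close>: only the space
  variable is doubled, and the equation of \<open>V = \<phi> \<circ> z\<close> is used before the limit, so that no
  discontinuity of the sign function is met.\<close>

lemma kruzhkov_resolvent:
  assumes R: "kruzhkov R" and tau: "\<tau> > 0" and z: "resolves \<tau> g z"
    and g: "g \<in> borel_measurable borel" "\<And>x. g x \<in> {A..B}" "AE x in lborel. isCont g x"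
    and th: "C1c \<theta> \<theta>'" "\<And>x. 0 \<le> \<theta> x" and be: "time_test \<beta> \<beta>'"
  shows "0 \<le> (LINT w|lborel. \<beta>' (snd w) * \<theta> (fst w) * (s (fst w) * \<bar>R w - \<phi> (z (fst w))\<bar>)
     + \<beta> (snd w) * \<theta>' (fst w) * \<bar>f (R w) - z (fst w)\<bar>
     + \<beta> (snd w) * \<theta> (fst w) * (s (fst w) * (\<bar>R w - g (fst w)\<bar> - \<bar>R w - \<phi> (z (fst w))\<bar>) / \<tau>))"
proof -
  have bC: "C1c \<beta> \<beta>'" and b0: "\<And>t. 0 \<le> \<beta> t" using be by (auto simp: time_test_def)
  obtain K1 where K1: "\<forall>x. \<bar>x\<bar> \<ge> K1 \<longrightarrow> \<theta> x = 0 \<and> \<theta>' x = 0" using th(1) unfolding C1c_def by blast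
  obtain K2 where K2: "\<forall>x. \<bar>x\<bar> \<ge> K2 \<longrightarrow> \<beta> x = 0 \<and> \<beta>' x = 0" using bC unfolding C1c_def by blast
  define K where "K = max 0 (max K1 K2)"
  have K: "\<bar>x\<bar> \<ge> K \<Longrightarrow> \<theta> x = 0 \<and> \<theta>' x = 0" "\<bar>x\<bar> \<ge> K \<Longrightarrow> \<beta> x = 0 \<and> \<beta>' x = 0" "K \<ge> 0" for x
    using K1 K2 by (auto simp: K_def)
  note bb = C1c_bounded_borel[OF th(1)] C1c_bounded_borel[OF bC] C1c_bounded_borel[OF bump_C1c]
  obtain T0 where T0: "T0 > 0" "\<And>x. \<bar>\<theta> x\<bar> \<le> T0" using bounded_borel_bound[OF bb(1)] by blast
  obtain T1 where T1: "T1 > 0" "\<And>x. \<bar>\<theta>' x\<bar> \<le> T1" using bounded_borel_bound[OF bb(2)] by blast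
  obtain S0 where S0: "S0 > 0" "\<And>x. \<bar>\<beta> x\<bar> \<le> S0" using bounded_borel_bound[OF bb(3)] by blast
  obtain S1 where S1: "S1 > 0" "\<And>x. \<bar>\<beta>' x\<bar> \<le> S1" using bounded_borel_bound[OF bb(4)] by blast
  obtain N1 where N1: "N1 > 0" "\<And>x. \<bar>bump' x\<bar> \<le> N1" using bounded_borel_bound[OF bb(6)] by blast
  note zr = resolvesD(1)[OF z] and Vr = resolvesD(4)[OF z] and zc = resolvesD(3)[OF z]
  have Rr: "R w \<in> {A..B}" for w using R unfolding kruzhkov_def by blast
  have Rm: "R \<in> borel_measurable (borel \<Otimes>\<^sub>M borel)" using R unfolding kruzhkov_def by blast
  note [measurable] = Rm g(1) borel_measurable_continuous_onI[OF zc] bb[THEN bounded_borel_measurable]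
  have kr: "\<forall>k\<in>{A..B}. \<forall>\<theta> \<theta>' \<beta> \<beta>'. C1c \<theta> \<theta>' \<and> (\<forall>x. 0 \<le> \<theta> x) \<and> time_test \<beta> \<beta>' \<longrightarrow>
        0 \<le> (LINT w|lborel. \<beta>' (snd w) * \<theta> (fst w) * (s (fst w) * \<bar>R w - k\<bar>)
              + \<beta> (snd w) * \<theta>' (fst w) * \<bar>f (R w) - f k\<bar>)"
    using R unfolding kruzhkov_def by blast
  define F where "F = f B - f A"
  have F0: "F \<ge> 0" using f_mono[OF A_le_B] by (simp add: F_def)
  have d1: "\<bar>R w - \<phi> (z y)\<bar> \<le> B" "\<bar>R w - g y\<bar> \<le> B" "\<bar>f (R w) - z y\<bar> \<le> F" for w y
    using Rr[of w] Vr[of y] g(2)[of y] zr[of y] A_pos f_mono[of A "R w"] f_mono[of "R w" B] by (auto simp: F_def abs_le_iff)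
  \<comment> \<open>For fixed \<open>w\<close>, an upper bound for the derivative in y of |z y - f(R
    w)|, obtained from the equation of z by the sign argument.\<close>
  define p where "p w y = s y * (\<bar>R w - g y\<bar> - \<bar>R w - \<phi> (z y)\<bar>) / \<tau>" for w y
  have pb: "\<bar>p w y\<bar> \<le> b * B / \<tau>" for w y
  proof -
    have "\<bar>\<bar>R w - g y\<bar> - \<bar>R w - \<phi> (z y)\<bar>\<bar> \<le> B" using d1[of w y] by linarith
    then have "s y * \<bar>\<bar>R w - g y\<bar> - \<bar>R w - \<phi> (z y)\<bar>\<bar> \<le> b * B" using s_bounds[of y] b_pos by (intro mult_mono) auto
    then show ?thesis using s_pos[of y] tau by (simp add: p_def abs_mult divide_right_mono)
  qed
  define G where "G w y = \<beta>' (snd w) * \<theta> (fst w) * (s (fst w) * \<bar>R w - \<phi> (z y)\<bar>)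
     + \<beta> (snd w) * \<theta>' (fst w) * \<bar>f (R w) - z y\<bar> + \<beta> (snd w) * \<theta> (fst w) * p w y" for w y
  define CG where "CG = S1 * T0 * (b * B) + S0 * T1 * F + S0 * T0 * (b * B / \<tau>)"
  have sR: "\<bar>s x * \<bar>R w - \<phi> (z y)\<bar>\<bar> \<le> b * B" for x w y
    unfolding abs_mult using s_bounds[of x] s_pos[of x] d1[of w y] b_pos by (intro mult_mono) auto
  have b2: "\<bar>\<beta>' t * \<theta> x\<bar> \<le> S1 * T0" "\<bar>\<beta> t * \<theta>' x\<bar> \<le> S0 * T1" "\<bar>\<beta> t * \<theta> x\<bar> \<le> S0 * T0" for t x
    unfolding abs_mult using S0 S1 T0 T1 by (intro mult_mono; simp add: less_imp_le)+
  have Gb: "\<bar>G w y\<bar> \<le> CG" for w y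
  proof -
    have "\<bar>\<beta>' (snd w) * \<theta> (fst w) * (s (fst w) * \<bar>R w - \<phi> (z y)\<bar>)\<bar> \<le> S1 * T0 * (b * B)"
      unfolding abs_mult[of "\<beta>' (snd w) * \<theta> (fst w)"] using b2 sR S1 T0 by (intro mult_mono) auto
    moreover have "\<bar>\<beta> (snd w) * \<theta>' (fst w) * \<bar>f (R w) - z y\<bar>\<bar> \<le> S0 * T1 * F"
      unfolding abs_mult[of "\<beta> (snd w) * \<theta>' (fst w)"] using b2 d1 S0 T1 by (intro mult_mono) auto
    moreover have "\<bar>\<beta> (snd w) * \<theta> (fst w) * p w y\<bar> \<le> S0 * T0 * (b * B / \<tau>)"
      unfolding abs_mult[of "\<beta> (snd w) * \<theta> (fst w)"] using b2 pb S0 T0 by (intro mult_mono) auto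
    ultimately show ?thesis unfolding G_def CG_def by linarith
  qed
  have CG0: "CG \<ge> 0" using Gb[of "(0, 0)" 0] by linarith
  have Gz: "G w y = 0" if "\<bar>fst w\<bar> \<ge> K \<or> \<bar>snd w\<bar> \<ge> K" for w y
    using K(1)[of "fst w"] K(2)[of "snd w"] that by (auto simp: G_def)
  have Gm[measurable]: "(\<lambda>(y, w). G w y) \<in> borel_measurable (borel \<Otimes>\<^sub>M (borel \<Otimes>\<^sub>M borel))"
    unfolding G_def p_def split_def by measurable
  have Gbb: "bounded_borel (G w)" for w
  proof (rule bounded_borelI[OF _ Gb])
    have "(\<lambda>y. (y, w)) \<in> borel_measurable borel" by (intro borel_measurable_continuous_onI continuous_intros)
    then have "(\<lambda>y. (y, w)) \<in> measurable borel (borel \<Otimes>\<^sub>M (borel \<Otimes>\<^sub>M borel))" by (simp add: borel_prod)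
    from measurable_compose[OF this Gm] show "G w \<in> borel_measurable borel" by simp
  qed
  have tripK: "\<bar>y\<bar> \<ge> K + 1 \<or> \<bar>fst w\<bar> \<ge> K + 1 \<or> \<bar>snd w\<bar> \<ge> K + 1" if "norm (y, w) \<ge> 3 * K + 3" for y :: real and w :: "real \<times> real"
  proof -
    have "norm (y, w) \<le> \<bar>y\<bar> + norm w" using norm_Pair_le[of y w] by simp
    moreover have "norm w \<le> \<bar>fst w\<bar> + \<bar>snd w\<bar>" using norm_Pair_le[of "fst w" "snd w"] by simp
    ultimately show ?thesis using that by linarith
  qed
  have far: "bump ((x - y) / d) = 0 \<and> bump' ((x - y) / d) = 0" if "\<bar>y\<bar> \<ge> K + 1" "\<bar>x\<bar> < K" "0 < d" "d \<le> 1" for x y d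
  proof -
    have "\<bar>x - y\<bar> \<ge> d" using that by linarith
    then show ?thesis using that by (intro bump_support) (simp add: le_divide_eq)
  qed
  have step: "0 \<le> (LINT w|lborel. LINT u|lborel. bump (- u) * G w (fst w + d * u))" if d: "0 < d" "d \<le> 1" for d
  proof -
    define H where "H y w = \<beta>' (snd w) * (\<theta> (fst w) * bump ((fst w - y) / d)) * (s (fst w) * \<bar>R w - \<phi> (z y)\<bar>)
      + \<beta> (snd w) * (\<theta>' (fst w) * bump ((fst w - y) / d) + \<theta> (fst w) * (bump' ((fst w - y) / d) / d)) * \<bar>f (R w) - z y\<bar>" for y w
    \<comment> \<open>For fixed y the number \<phi>(z y) lies in [A, B] and may serve as Kruzhkov's
      constant, with \<theta>(x) bump((x - y) / d) as space test.\<close>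
    have H0: "0 \<le> (LINT w|lborel. H y w)" for y
    proof -
      have "C1c (\<lambda>x. \<theta> x * bump ((x - y) / d)) (\<lambda>x. \<theta>' x * bump ((x - y) / d) + \<theta> x * (bump' ((x - y) / d) / d)) \<and>
        (\<forall>x. 0 \<le> \<theta> x * bump ((x - y) / d)) \<and> time_test \<beta> \<beta>'"
        using C1c_mult_bump[OF th(1) d(1)] th(2) bump_bounds be by simp
      from kr[rule_format, OF Vr[of y] this] show ?thesis unfolding H_def f_phi .
    qed
    have iH: "integrable lborel (\<lambda>(y, w). H y w)"
    proof (rule bounded_support_integrable[of _ "S1 * T0 * (b * B) + S0 * (T1 + T0 * (N1 / d)) * F" "3 * K + 3"])
      have "(\<lambda>(y, w). H y w) \<in> borel_measurable (borel \<Otimes>\<^sub>M (borel \<Otimes>\<^sub>M borel))"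
        unfolding H_def split_def by measurable
      then show "(\<lambda>(y, w). H y w) \<in> borel_measurable borel" by (simp add: borel_prod)
      fix yw :: "real \<times> real \<times> real"
      obtain y w where yw: "yw = (y, w)" by (rule prod.exhaust)
      let ?v = "(fst w - y) / d"
      have "\<bar>\<theta> (fst w) * bump ?v\<bar> \<le> T0 * 1" unfolding abs_mult using T0 bump_bounds[of ?v] by (intro mult_mono) auto
      then have "\<bar>\<beta>' (snd w) * (\<theta> (fst w) * bump ?v)\<bar> \<le> S1 * T0" unfolding abs_mult[of "\<beta>' (snd w)"] using S1 T0 by (intro mult_mono) auto
      then have 1: "\<bar>\<beta>' (snd w) * (\<theta> (fst w) * bump ?v) * (s (fst w) * \<bar>R w - \<phi> (z y)\<bar>)\<bar> \<le> S1 * T0 * (b * B)"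
        unfolding abs_mult[of "\<beta>' (snd w) * (\<theta> (fst w) * bump ?v)"] using sR S1 T0 by (intro mult_mono) auto
      have "\<bar>\<theta>' (fst w) * bump ?v\<bar> \<le> T1 * 1" unfolding abs_mult using T1 bump_bounds[of ?v] by (intro mult_mono) auto
      moreover have "\<bar>\<theta> (fst w) * (bump' ?v / d)\<bar> \<le> T0 * (N1 / d)"
        unfolding abs_mult using T0 N1 d by (intro mult_mono) (auto simp: divide_right_mono)
      ultimately have "\<bar>\<theta>' (fst w) * bump ?v + \<theta> (fst w) * (bump' ?v / d)\<bar> \<le> T1 + T0 * (N1 / d)" by linarith
      then have "\<bar>\<beta> (snd w) * (\<theta>' (fst w) * bump ?v + \<theta> (fst w) * (bump' ?v / d))\<bar> \<le> S0 * (T1 + T0 * (N1 / d))"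
        unfolding abs_mult[of "\<beta> (snd w)"] using S0 by (intro mult_mono) auto
      then have 2: "\<bar>\<beta> (snd w) * (\<theta>' (fst w) * bump ?v + \<theta> (fst w) * (bump' ?v / d)) * \<bar>f (R w) - z y\<bar>\<bar> \<le> S0 * (T1 + T0 * (N1 / d)) * F"
        unfolding abs_mult[of "\<beta> (snd w) * (\<theta>' (fst w) * bump ?v + \<theta> (fst w) * (bump' ?v / d))"]
        using d1(3)[of w y] S0 T0 T1 N1 d by (intro mult_mono) auto
      show "\<bar>(\<lambda>(y, w). H y w) yw\<bar> \<le> S1 * T0 * (b * B) + S0 * (T1 + T0 * (N1 / d)) * F"
        using 1 2 unfolding yw H_def split_conv by linarith
      assume "norm yw \<ge> 3 * K + 3"
      then have *: "\<bar>y\<bar> \<ge> K + 1 \<or> \<bar>fst w\<bar> \<ge> K + 1 \<or> \<bar>snd w\<bar> \<ge> K + 1" using tripK yw by simp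
      show "(\<lambda>(y, w). H y w) yw = 0"
      proof (cases "\<bar>fst w\<bar> \<ge> K \<or> \<bar>snd w\<bar> \<ge> K")
        case True then show ?thesis using K(1)[of "fst w"] K(2)[of "snd w"] by (auto simp: yw H_def)
      next
        case False
        then have "\<bar>y\<bar> \<ge> K + 1" using * by auto
        from far[OF this _ d, of "fst w"] False show ?thesis by (simp add: yw H_def)
      qed
    qed
    have iG: "integrable lborel (\<lambda>(y, w). bump ((fst w - y) / d) * G w y)"
    proof (rule bounded_support_integrable[of _ "1 * CG" "3 * K + 3"])
      have "(\<lambda>(y, w). bump ((fst w - y) / d) * G w y) \<in> borel_measurable (borel \<Otimes>\<^sub>M (borel \<Otimes>\<^sub>M borel))"
        using Gm unfolding split_def by measurable
      then show "(\<lambda>(y, w). bump ((fst w - y) / d) * G w y) \<in> borel_measurable borel" by (simp add: borel_prod)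
      fix yw :: "real \<times> real \<times> real"
      obtain y w where yw: "yw = (y, w)" by (rule prod.exhaust)
      show "\<bar>(\<lambda>(y, w). bump ((fst w - y) / d) * G w y) yw\<bar> \<le> 1 * CG"
        unfolding yw split_conv abs_mult using bump_bounds[of "(fst w - y) / d"] Gb by (intro mult_mono) auto
      assume "norm yw \<ge> 3 * K + 3"
      then have *: "\<bar>y\<bar> \<ge> K + 1 \<or> \<bar>fst w\<bar> \<ge> K + 1 \<or> \<bar>snd w\<bar> \<ge> K + 1" using tripK yw by simp
      show "(\<lambda>(y, w). bump ((fst w - y) / d) * G w y) yw = 0"
      proof (cases "\<bar>fst w\<bar> \<ge> K \<or> \<bar>snd w\<bar> \<ge> K")
        case True then show ?thesis using Gz by (simp add: yw)
      next
        case False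
        then have "\<bar>y\<bar> \<ge> K + 1" using * by auto
        from far[OF this _ d, of "fst w"] False show ?thesis by (simp add: yw)
      qed
    qed
    \<comment> \<open>The singular term carries the x-derivative of the bump, which is minus its
      y-derivative. Integration by parts in y moves it onto |z y - f(R w)|, where \<open>p w\<close>
      replaces it; the factor 1 / d disappears.\<close>
    have inner: "(LINT y|lborel. H y w) \<le> (LINT y|lborel. bump ((fst w - y) / d) * G w y)" for w
    proof -
      let ?x = "fst w" and ?X = "\<lambda>y. \<bar>z y - f (R w)\<bar>"
      let ?r = "\<lambda>y. bump ((?x - y) / d)" and ?r' = "\<lambda>y. - (bump' ((?x - y) / d) / d)"
      note Cr = bump_reflected_C1c[OF d(1), of ?x]
      note br = C1c_bounded_borel[OF Cr]
      obtain Kr where Kr: "\<forall>y. \<bar>y\<bar> \<ge> Kr \<longrightarrow> ?r y = 0 \<and> ?r' y = 0" using Cr unfolding C1c_def by blast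
      have bp: "bounded_borel (p w)"
        by (rule bounded_borelI[OF _ pb]) (unfold p_def, measurable)
      obtain C where C: "C > 0" "\<And>x. \<bar>s x * (g x - \<phi> (z x)) / \<tau>\<bar> \<le> C"
        using bounded_borel_bound[OF primitive_bounded_borel[OF resolvesD(2)[OF z]]] by blast
      have Xl: "\<bar>?X y - ?X x\<bar> \<le> C * \<bar>y - x\<bar>" for x y
        using primitive_lipschitz[OF resolvesD(2)[OF z] C(2), of y x] by linarith
      have bX: "bounded_borel ?X"
        by (rule bounded_borelI[of _ F]) (use d1(3) in \<open>simp_all add: abs_minus_commute\<close>)
      have Xle: "?X y - ?X x \<le> (LINT t:{x..y}|lborel. p w t)" if "x \<le> y" for x y
      proof -
        obtain D where D: "D \<ge> 0" "\<And>x y. \<bar>\<phi> (z y) - \<phi> (z x)\<bar> \<le> D * \<bar>y - x\<bar>" using resolves_lipschitz[OF z] by blast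
        have pr: "primitive (\<lambda>y. z y - f (R w)) (\<lambda>x. s x * (g x - \<phi> (z x)) / \<tau>)"
          using resolvesD(2)[OF z] by (simp add: primitive_def)
        show ?thesis
        proof (rule abs_increment_le[OF pr bp that])
          fix x y :: real
          let ?\<sigma> = "sgn (z y - f (R w))"
          have sg: "sgn (z y - f (R w)) = sgn (\<phi> (z y) - R w)" using sgn_phi[of "z y" "f (R w)"] by (simp add: phi_f)
          have "?\<sigma> * (s x * (g x - \<phi> (z x)) / \<tau>) = s x / \<tau> * (?\<sigma> * (g x - R w) + ?\<sigma> * (- (\<phi> (z x) - R w)))"
            by (simp add: algebra_simps diff_divide_distrib)
          also have "\<dots> \<le> s x / \<tau> * (\<bar>g x - R w\<bar> + (- \<bar>\<phi> (z x) - R w\<bar> + 2 * D * \<bar>y - x\<bar>))"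
            using s_pos[of x] tau D
            by (intro mult_left_mono add_mono sgn_mult_le_abs sgn_lipschitz_bound[of "\<lambda>y. \<phi> (z y) - R w"]) (auto simp: sg)
          also have "\<dots> = p w x + s x / \<tau> * (2 * D * \<bar>y - x\<bar>)" by (simp add: p_def algebra_simps abs_minus_commute add_divide_distrib diff_divide_distrib)
          also have "\<dots> \<le> p w x + b / \<tau> * (2 * D * \<bar>y - x\<bar>)"
            using s_bounds(2)[of x] tau D(1) by (intro add_left_mono mult_right_mono divide_right_mono) auto
          finally show "?\<sigma> * (s x * (g x - \<phi> (z x)) / \<tau>) \<le> p w x + b / \<tau> * (2 * D) * \<bar>y - x\<bar>" by (simp add: mult.assoc)
        qed
      qed
      have parts: "0 \<le> (LINT y|lborel. ?r' y * ?X y) + (LINT y|lborel. ?r y * p w y)"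
        by (rule parts_inequality[OF Xl bX bp Xle Cr]) (use bump_bounds in auto)
      have Kr1: "?r y = 0" and Kr2: "?r' y = 0" if "\<bar>y\<bar> \<ge> Kr" for y using Kr that by blast+
      have i1: "integrable lborel (\<lambda>y. ?r' y * ?X y)"
        by (rule LINT_compact_support(1)[OF bounded_borel_mult[OF br(2) bX], where K=Kr]) (simp only: Kr2 mult_zero_left)
      have i2: "integrable lborel (\<lambda>y. ?r y * p w y)"
        by (rule LINT_compact_support(1)[OF bounded_borel_mult[OF br(1) bp], where K=Kr]) (simp only: Kr1 mult_zero_left)
      have i3: "integrable lborel (\<lambda>y. ?r y * G w y)"
        by (rule LINT_compact_support(1)[OF bounded_borel_mult[OF br(1) Gbb], where K=Kr]) (simp only: Kr1 mult_zero_left)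
      have eq: "H y w = ?r y * G w y - (\<beta> (snd w) * \<theta> ?x) * (?r y * p w y + ?r' y * ?X y)" for y
        unfolding H_def G_def by (simp add: algebra_simps abs_minus_commute)
      have "(LINT y|lborel. H y w) = (LINT y|lborel. ?r y * G w y) - (\<beta> (snd w) * \<theta> ?x) * ((LINT y|lborel. ?r y * p w y) + (LINT y|lborel. ?r' y * ?X y))"
        unfolding eq using i1 i2 i3 by simp
      also have "\<dots> \<le> (LINT y|lborel. ?r y * G w y)"
        using mult_nonneg_nonneg[OF mult_nonneg_nonneg[OF b0 th(2)], of _ "snd w" ?x] parts by (simp add: add.commute)
      finally show ?thesis .
    qed
    have "0 \<le> (LINT y|lborel. LINT w|lborel. H y w)" by (rule Bochner_Integration.integral_nonneg) (rule H0)
    also have "\<dots> = (LINT w|lborel. LINT y|lborel. H y w)" using Fubini_lborel(1)[OF iH] by simp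
    also have "\<dots> \<le> (LINT w|lborel. LINT y|lborel. bump ((fst w - y) / d) * G w y)"
      by (rule integral_mono) (use Fubini_lborel(2)[OF iH] Fubini_lborel(2)[OF iG] inner in simp_all)
    also have "\<dots> = (LINT w|lborel. d * (LINT u|lborel. bump (- u) * G w (fst w + d * u)))"
    proof (rule Bochner_Integration.integral_cong[OF refl])
      fix w :: "real \<times> real"
      have e: "(fst w - (fst w + d * u)) / d = - u" for u using d(1) by simp
      show "(LINT y|lborel. bump ((fst w - y) / d) * G w y) = d * (LINT u|lborel. bump (- u) * G w (fst w + d * u))"
        using d(1) by (subst lborel_integral_real_affine[of d _ "fst w"]) (simp_all add: e)
    qed
    finally show ?thesis using d(1) by (simp add: zero_le_mult_iff)
  qed
  define d :: "nat \<Rightarrow> real" where "d n = 1 / real (Suc n)" for n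
  have d: "0 < d n" "d n \<le> 1" for n by (auto simp: d_def)
  have d0: "d \<longlonglongrightarrow> 0" unfolding d_def by (rule LIMSEQ_Suc[OF lim_1_over_n])
  let ?I = "LINT u|lborel. bump (- u)"
  have bk: "bounded_borel (\<lambda>u. bump (- u))" using bounded_borel_reflect[OF bb(5), of 0] by simp
  have ik: "integrable lborel (\<lambda>u. bump (- u))"
    by (rule LINT_compact_support(1)[OF bk, of 1]) (use bump_support in simp)
  have "(\<lambda>n. LINT w|lborel. LINT u|lborel. bump (- u) * G w (fst w + d n * u)) \<longlonglongrightarrow> (LINT w|lborel. ?I * G w (fst w))"
  proof (rule integral_dominated_convergence[where w="\<lambda>w. indicator (cball 0 (2 * K)) w * (?I * CG)"])
    show "integrable lborel (\<lambda>w :: real \<times> real. indicator (cball 0 (2 * K)) w * (?I * CG))"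
      by (rule integrable_cball_const)
    have Gm2: "(\<lambda>w. G w (h w)) \<in> borel_measurable (borel \<Otimes>\<^sub>M borel)" if [measurable]: "h \<in> borel_measurable (borel \<Otimes>\<^sub>M borel)" for h
      using measurable_compose[OF _ Gm, of "\<lambda>w. (h w, w)"] by simp
    show "(\<lambda>w. ?I * G w (fst w)) \<in> borel_measurable lborel"
    proof -
      have [measurable]: "(\<lambda>w. G w (fst w)) \<in> borel_measurable (borel \<Otimes>\<^sub>M borel)" by (rule Gm2) measurable
      have "(\<lambda>w. ?I * G w (fst w)) \<in> borel_measurable (borel \<Otimes>\<^sub>M borel)" by measurable
      then show ?thesis by (simp add: borel_prod)
    qed
    show "(\<lambda>w. LINT u|lborel. bump (- u) * G w (fst w + d n * u)) \<in> borel_measurable lborel" for n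
    proof -
      have "(\<lambda>x. (\<lambda>(y, w). G w y) (fst (fst x) + d n * snd x, fst x)) \<in> borel_measurable ((borel \<Otimes>\<^sub>M borel) \<Otimes>\<^sub>M lborel)"
        by measurable
      then have [measurable]: "(\<lambda>x. G (fst x) (fst (fst x) + d n * snd x)) \<in> borel_measurable ((borel \<Otimes>\<^sub>M borel) \<Otimes>\<^sub>M lborel)" by simp
      have "(\<lambda>w. LINT u|lborel. bump (- u) * G w (fst w + d n * u)) \<in> borel_measurable (borel \<Otimes>\<^sub>M borel)"
        by (rule lborel.borel_measurable_lebesgue_integral) measurable
      then show ?thesis by (simp add: borel_prod)
    qed
    \<comment> \<open>The integrand as a function of y is continuous at y = x only where s and g
      are; this holds for almost every x, which is enough for the limit d -> 0.\<close>
    have "AE w in lborel \<Otimes>\<^sub>M (lborel :: real measure). isCont s (fst w) \<and> isCont g (fst w)"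
    proof -
      have "AE x in lborel. isCont s x \<and> isCont g x" using s_isCont_AE g(3) by eventually_elim simp
      then obtain N where N: "N \<in> null_sets lborel" "{x. \<not> (isCont s x \<and> isCont g x)} \<subseteq> N"
      proof (rule AE_E)
        fix N assume "{x \<in> space lborel. \<not> (isCont s x \<and> isCont g x)} \<subseteq> N" "emeasure lborel N = 0" "N \<in> sets lborel"
        then show thesis by (intro that[of N]) (simp_all add: null_setsI)
      qed
      have "AE w in lborel \<Otimes>\<^sub>M (lborel :: real measure). fst w \<notin> N"
      proof (rule lborel_pair.AE_pair_measure)
        have "Measurable.pred (lborel \<Otimes>\<^sub>M (lborel :: real measure)) (\<lambda>w. fst w \<notin> N)"
          using N(1) by (intro pred_intros_logic pred_sets2[OF _ measurable_fst]) auto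
        then show "{w \<in> space (lborel \<Otimes>\<^sub>M (lborel :: real measure)). fst w \<notin> N} \<in> sets (lborel \<Otimes>\<^sub>M lborel)" by (simp add: pred_def)
        show "AE x in lborel. AE y in (lborel :: real measure). fst (x, y) \<notin> N"
          using AE_not_in[OF N(1)] by eventually_elim simp
      qed
      then show ?thesis by eventually_elim (use N(2) in blast)
    qed
    then have "AE w in lborel. isCont s (fst (w :: real \<times> real)) \<and> isCont g (fst w)" unfolding lborel_prod .
    then show "AE w in lborel. (\<lambda>n. LINT u|lborel. bump (- u) * G w (fst w + d n * u)) \<longlonglongrightarrow> ?I * G w (fst w)"
    proof eventually_elim
      case (elim w)
      have "isCont z (fst w)" "isCont (\<lambda>y. \<phi> (z y)) (fst w)"
        using zc continuous_on_compose2[OF phi_continuous zc] by (auto simp: continuous_on_eq_continuous_at)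
      then have "isCont (G w) (fst w)" using elim tau unfolding G_def[abs_def] p_def by (intro continuous_intros) auto
      from kernel_limit[OF bk _ Gbb this d0, of 1] show ?case using bump_support by simp
    qed
    show "AE w in lborel. norm (LINT u|lborel. bump (- u) * G w (fst w + d n * u)) \<le> indicator (cball 0 (2 * K)) w * (?I * CG)" for n
    proof (rule AE_I2)
      fix w :: "real \<times> real"
      have [measurable]: "G w \<in> borel_measurable borel" using Gbb by (rule bounded_borel_measurable)
      have "bounded_borel (\<lambda>u. G w (fst w + d n * u))" by (rule bounded_borelI[OF _ Gb]) measurable
      then have "integrable lborel (\<lambda>u. bump (- u) * G w (fst w + d n * u))"
        by (intro LINT_compact_support(1)[of _ 1] bounded_borel_mult bk) (simp_all add: bump_support)
      moreover have "norm (bump (- u) * G w (fst w + d n * u)) \<le> bump (- u) * CG" for u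
        using bump_bounds[of "-u"] Gb by (simp add: abs_mult mult_left_mono)
      ultimately have "(LINT u|lborel. norm (bump (- u) * G w (fst w + d n * u))) \<le> (LINT u|lborel. bump (- u) * CG)"
        using ik by (intro integral_mono integrable_norm) simp_all
      then have "norm (LINT u|lborel. bump (- u) * G w (fst w + d n * u)) \<le> (LINT u|lborel. bump (- u) * CG)"
        using integral_norm_bound[of lborel "\<lambda>u. bump (- u) * G w (fst w + d n * u)"] by linarith
      then have le: "norm (LINT u|lborel. bump (- u) * G w (fst w + d n * u)) \<le> ?I * CG" by simp
      show "norm (LINT u|lborel. bump (- u) * G w (fst w + d n * u)) \<le> indicator (cball 0 (2 * K)) w * (?I * CG)"
      proof (cases "w \<in> cball 0 (2 * K)")
        case True then show ?thesis using le by simp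
      next
        case False
        moreover have "norm w \<le> \<bar>fst w\<bar> + \<bar>snd w\<bar>" using norm_Pair_le[of "fst w" "snd w"] by simp
        ultimately have "\<bar>fst w\<bar> \<ge> K \<or> \<bar>snd w\<bar> \<ge> K" by auto
        then show ?thesis using False Gz by simp
      qed
    qed
  qed
  then have "0 \<le> (LINT w|lborel. ?I * G w (fst w))" by (rule LIMSEQ_le_const) (use step d in blast)
  then have "0 \<le> (LINT w|lborel. G w (fst w))" using bump_integral_pos by (simp add: zero_le_mult_iff)
  then show ?thesis unfolding G_def p_def .
qed

end

section \<open>Comparison with supersolutions and uniqueness of Kruzhkov solutions\<close>

text \<open>Gronwall argument from the last time \<open>t1\<close> at which \<alpha> <= \<Psi>. On a
  following interval of length \<open>h\<close> with k h <= 1/2, the maximum \<mu> of \<alpha> -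
  \<Psi> would satisfy \<mu> <= \<mu> / 2. The rate condition is asked only where \<alpha> lies
  above \<Psi>.\<close>

lemma differential_comparison:
  assumes c: "continuous_on {0..} \<alpha>" and start: "\<alpha> 0 \<le> \<Psi> 0" and \<gamma>: "bounded_borel \<gamma>"
    and dec: "\<And>t1 t2. 0 \<le> t1 \<Longrightarrow> t1 \<le> t2 \<Longrightarrow> \<alpha> t2 - \<alpha> t1 \<le> (LINT t:{t1..t2}|lborel. \<gamma> t)"
    and D: "\<And>t. t \<ge> 0 \<Longrightarrow> (\<Psi> has_real_derivative \<Psi>' t) (at t)" and cD: "continuous_on {0..} \<Psi>'"
    and k: "k \<ge> 0"
    and le: "\<And>t. t \<ge> 0 \<Longrightarrow> \<Psi> t \<le> \<alpha> t \<Longrightarrow> \<gamma> t \<le> \<Psi>' t + k * (\<alpha> t - \<Psi> t)"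
    and t: "t \<ge> 0"
  shows "\<alpha> t \<le> \<Psi> t"
proof (rule ccontr)
  assume "\<not> \<alpha> t \<le> \<Psi> t"
  then have gt: "\<Psi> t < \<alpha> t" by simp
  let ?S = "{r \<in> {0..t}. \<alpha> r - \<Psi> r \<le> 0}"
  have c\<Psi>: "continuous_on {0..t} \<Psi>"
  proof (rule continuous_at_imp_continuous_on, rule ballI)
    fix x assume "x \<in> {0..t}"
    then show "isCont \<Psi> x" using DERIV_isCont[OF D[of x]] by simp
  qed
  have cd: "continuous_on {0..t} (\<lambda>r. \<alpha> r - \<Psi> r)"
    by (intro continuous_on_diff c\<Psi> continuous_on_subset[OF c]) auto
  have cl: "closed ?S" by (rule continuous_on_closed_Collect_le[OF cd continuous_on_const closed_atLeastAtMost])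
  have "compact ?S" by (rule compact_Int_closed[OF compact_Icc[of 0 t] cl, THEN back_subst[where P=compact]]) auto
  moreover have "0 \<in> ?S" using start t by simp
  ultimately obtain t1 where t1: "t1 \<in> ?S" "\<And>r. r \<in> ?S \<Longrightarrow> r \<le> t1" using compact_attains_sup[of ?S] by blast
  have above: "\<Psi> r < \<alpha> r" if r: "t1 < r" "r \<le> t" for r
  proof (rule ccontr)
    assume "\<not> \<Psi> r < \<alpha> r"
    then have "r \<in> ?S" using r t1(1) by auto
    then show False using t1(2)[of r] r by simp
  qed
  have t1t: "0 \<le> t1" "t1 \<le> t" "\<alpha> t1 \<le> \<Psi> t1" using t1(1) by auto
  then have lt: "t1 < t" using gt by (cases "t1 = t") auto
  define h where "h = min (t - t1) (1 / (2 * k + 1))"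
  have h: "h > 0" "t1 + h \<le> t" "k * h \<le> 1 / 2"
  proof -
    show "h > 0" "t1 + h \<le> t" using lt k by (auto simp: h_def)
    have "k * h \<le> k * (1 / (2 * k + 1))" using k by (intro mult_left_mono) (auto simp: h_def)
    also have "\<dots> \<le> 1 / 2" using k by (simp add: field_simps)
    finally show "k * h \<le> 1 / 2" .
  qed
  have "continuous_on {t1..t1+h} (\<lambda>r. \<alpha> r - \<Psi> r)" by (rule continuous_on_subset[OF cd]) (use t1t h in auto)
  moreover have "{t1..t1+h} \<noteq> {}" using h by auto
  ultimately obtain r where r: "r \<in> {t1..t1+h}" "\<And>y. y \<in> {t1..t1+h} \<Longrightarrow> \<alpha> y - \<Psi> y \<le> \<alpha> r - \<Psi> r"
    using continuous_attains_sup[OF compact_Icc] by blast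
  define \<mu> where "\<mu> = \<alpha> r - \<Psi> r"
  have mu: "\<mu> > 0" using r(2)[of "t1 + h"] above[of "t1 + h"] h by (simp add: \<mu>_def)
  have rt: "t1 \<le> r" "r \<le> t" using r(1) h by auto
  have i\<Psi>: "set_integrable lborel {t1..r} \<Psi>'"
    by (rule borel_integrable_atLeastAtMost') (use cD t1t in \<open>auto intro: continuous_on_subset\<close>)
  have "(\<Psi>' has_integral (\<Psi> r - \<Psi> t1)) {t1..r}"
    by (rule fundamental_theorem_of_calculus[OF rt(1)])
       (use D t1t in \<open>auto simp flip: has_real_derivative_iff_has_vector_derivative intro: has_field_derivative_at_within\<close>)
  then have F: "(LINT y:{t1..r}|lborel. \<Psi>' y) = \<Psi> r - \<Psi> t1"
    using set_borel_integral_eq_integral(2)[OF i\<Psi>] by (simp add: integral_unique)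
  have ic: "set_integrable lborel {t1..r} (\<lambda>y. k * \<mu>)" by (rule bounded_borel_Icc[OF bounded_borel_const])
  have i1: "set_integrable lborel {t1<..r} \<gamma>" by (rule set_integrable_subset[OF bounded_borel_Icc[OF \<gamma>, of t1 r]]) auto
  have i2: "set_integrable lborel {t1<..r} (\<lambda>y. \<Psi>' y + k * \<mu>)"
    by (rule set_integrable_subset[OF set_integral_add(1)[OF i\<Psi> ic]]) auto
  have "\<alpha> r - \<alpha> t1 \<le> (LINT y:{t1..r}|lborel. \<gamma> y)" by (rule dec[OF t1t(1) rt(1)])
  \<comment> \<open>The left end is dropped because \<open>above\<close> holds only to the right of
    \<open>t1\<close>.\<close>
  also have "\<dots> = (LINT y:{t1<..r}|lborel. \<gamma> y)" by (rule set_integral_discrete_difference[of "{t1}"]) auto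
  also have "\<dots> \<le> (LINT y:{t1<..r}|lborel. \<Psi>' y + k * \<mu>)"
  proof (rule set_integral_mono[OF i1 i2])
    fix y assume y: "y \<in> {t1<..r}"
    then have "\<gamma> y \<le> \<Psi>' y + k * (\<alpha> y - \<Psi> y)" using le[of y] above[of y] t1t rt by auto
    also have "k * (\<alpha> y - \<Psi> y) \<le> k * \<mu>" using r(2)[of y] y r(1) k by (intro mult_left_mono) (auto simp: \<mu>_def)
    finally show "\<gamma> y \<le> \<Psi>' y + k * \<mu>" by simp
  qed
  also have "\<dots> = (LINT y:{t1..r}|lborel. \<Psi>' y + k * \<mu>)" by (rule set_integral_discrete_difference[of "{t1}"]) auto
  also have "\<dots> = \<Psi> r - \<Psi> t1 + k * \<mu> * (r - t1)"
    using set_integral_add(2)[OF i\<Psi> ic] F LINT_Icc_const[OF rt(1), of "k * \<mu>"] by simp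
  also have "k * \<mu> * (r - t1) \<le> k * \<mu> * h" using r(1) k mu by (intro mult_left_mono) auto
  also have "k * \<mu> * h = (k * h) * \<mu>" by simp
  also have "(k * h) * \<mu> \<le> 1 / 2 * \<mu>" using h(3) mu by (intro mult_right_mono) auto
  finally have "\<alpha> r - \<alpha> t1 \<le> \<Psi> r - \<Psi> t1 + 1 / 2 * \<mu>" by simp
  moreover have "\<alpha> r - \<Psi> r = \<mu>" by (simp add: \<mu>_def)
  ultimately show False using mu t1t(3) by linarith
qed

lemma AE_lborel_of_Icc:
  assumes "\<And>m :: nat. AE x in lborel. x \<in> {-real m..real m} \<longrightarrow> Q x"
  shows "AE x in lborel. Q x"
proof -
  have "AE x in lborel. \<forall>m :: nat. x \<in> {-real m..real m} \<longrightarrow> Q x" 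
    using assms by (subst AE_all_countable) blast
  then show ?thesis
  proof eventually_elim
    case (elim x)
    obtain m :: nat where "\<bar>x\<bar> \<le> real m" using real_arch_simple by blast
    then show ?case using elim by (auto simp: abs_le_iff)
  qed
qed

context flux_data
begin

text \<open>Two representatives of the same function: \<open>R\<close> is Borel on the plane, as
  Fubini requires, and \<open>\<rho> t\<close> is meaningful for every single t, as continuity in
  time and the initial condition require. They need to agree only for almost every t.\<close>

definition kruzhkov_solution :: "(real \<times> real \<Rightarrow> real) \<Rightarrow> (real \<Rightarrow> real \<Rightarrow> real) \<Rightarrow> bool" where
  "kruzhkov_solution R \<rho> \<longleftrightarrow> kruzhkov R \<and>
     (\<forall>t\<ge>0. \<rho> t \<in> borel_measurable borel \<and> (\<forall>x. \<rho> t x \<in> {A..B})) \<and>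
     (AE t in lborel. t \<ge> 0 \<longrightarrow> (AE x in lborel. R (x, t) = \<rho> t x)) \<and>
     (\<forall>t0\<ge>0. \<forall>K. ((\<lambda>t. LINT x:{-K..K}|lborel. \<bar>\<rho> t x - \<rho> t0 x\<bar>) \<longlongrightarrow> 0) (at t0 within {0..})) \<and>
     (AE x in lborel. \<rho> 0 x = 1 / s x)"

text \<open>Set to 0 at negative times so that it becomes a bounded Borel function on the whole
  line; on t >= 0 it is the weighted distance of a solution from a fixed profile.\<close>

definition gap :: "(real \<Rightarrow> real) \<Rightarrow> (real \<Rightarrow> real \<Rightarrow> real) \<Rightarrow> (real \<Rightarrow> real) \<Rightarrow> real \<Rightarrow> real" where
  "gap \<theta> \<rho> V t = (if t \<ge> 0 then LINT x|lborel. \<theta> x * (s x * \<bar>\<rho> t x - V x\<bar>) else 0)"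

definition "\<kappa> = L / a"

lemma kappa_pos: "\<kappa> > 0" using L_pos a_pos by (simp add: \<kappa>_def)

text \<open>Intended weight: exp x, cut off on both sides. The function \<open>E\<close> dominates
  the part of \<theta>' created by the left cut-off, while the right cut-off only lowers \<theta>'.
  The constant \<open>\<epsilon>\<close> is the largest flux that can enter through
  \<open>E\<close>.\<close>

context
  fixes \<theta> \<theta>' E :: "real \<Rightarrow> real" and \<Theta> \<epsilon> K :: real
  assumes th: "C1c \<theta> \<theta>'" "\<And>x. 0 \<le> \<theta> x" "\<And>x. \<theta> x \<le> \<Theta>"
    and E: "bounded_borel E" "\<And>x. 0 \<le> E x" "\<And>x. \<theta>' x \<le> \<theta> x + E x"
    and K: "\<And>x. \<bar>x\<bar> \<ge> K \<Longrightarrow> \<theta> x = 0" "\<And>x. \<bar>x\<bar> \<ge> K \<Longrightarrow> E x = 0"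
    and eps: "\<epsilon> = (f B - f A) * (LINT x|lborel. E x)"
begin

lemma weight_nonneg: "\<Theta> \<ge> 0" using th(2)[of 0] th(3)[of 0] by linarith

lemma weight_mass_bounded_borel:
  assumes "bounded_borel h" shows "bounded_borel (\<lambda>x. \<theta> x * (s x * \<bar>h x\<bar>))"
  by (intro bounded_borel_intros C1c_bounded_borel(1)[OF th(1)] s_bounded_borel assms)

lemma weight_mass_integrable:
  assumes "bounded_borel h" shows "integrable lborel (\<lambda>x. \<theta> x * (s x * \<bar>h x\<bar>))"
  by (rule LINT_compact_support(1)[OF weight_mass_bounded_borel[OF assms], of K]) (simp add: K)

lemma weight_mass_le:
  assumes "bounded_borel h" "integrable lborel (\<lambda>x. s x * \<bar>h x\<bar>)"
  shows "(LINT x|lborel. \<theta> x * (s x * \<bar>h x\<bar>)) \<le> \<Theta> * (LINT x|lborel. s x * \<bar>h x\<bar>)"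
proof -
  have "(LINT x|lborel. \<theta> x * (s x * \<bar>h x\<bar>)) \<le> (LINT x|lborel. \<Theta> * (s x * \<bar>h x\<bar>))"
    by (rule integral_mono) (use assms weight_mass_integrable th(3) s_pos in \<open>auto intro!: mult_right_mono simp: less_imp_le\<close>)
  then show ?thesis by simp
qed

lemma eps_nonneg: "\<epsilon> \<ge> 0"
  using f_mono[OF A_le_B] E(2) unfolding eps by (intro mult_nonneg_nonneg Bochner_Integration.integral_nonneg) auto

lemma slice_bounded_borel: "kruzhkov_solution R \<rho> \<Longrightarrow> t \<ge> 0 \<Longrightarrow> bounded_borel (\<rho> t)"
  unfolding kruzhkov_solution_def by (intro range_bounded_borel) blast+

lemma gap_triangle:
  assumes "kruzhkov_solution R \<rho>" "t \<ge> 0" "bounded_borel V" "bounded_borel W"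
  shows "\<bar>gap \<theta> \<rho> V t - gap \<theta> \<rho> W t\<bar> \<le> (LINT x|lborel. \<theta> x * (s x * \<bar>V x - W x\<bar>))"
proof -
  note br = slice_bounded_borel[OF assms(1,2)]
  have i: "integrable lborel (\<lambda>x. \<theta> x * (s x * \<bar>\<rho> t x - V x\<bar>))" "integrable lborel (\<lambda>x. \<theta> x * (s x * \<bar>\<rho> t x - W x\<bar>))"
    "integrable lborel (\<lambda>x. \<theta> x * (s x * \<bar>V x - W x\<bar>))"
    by (intro weight_mass_integrable bounded_borel_diff br assms(3,4))+
  have p: "\<theta> x * (s x * \<bar>\<rho> t x - V x\<bar>) \<le> \<theta> x * (s x * \<bar>\<rho> t x - W x\<bar>) + \<theta> x * (s x * \<bar>V x - W x\<bar>)"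
    "\<theta> x * (s x * \<bar>\<rho> t x - W x\<bar>) \<le> \<theta> x * (s x * \<bar>\<rho> t x - V x\<bar>) + \<theta> x * (s x * \<bar>V x - W x\<bar>)" for x
    unfolding distrib_left[symmetric] using th(2)[of x] s_pos[of x] by (intro mult_left_mono; linarith)+
  have "gap \<theta> \<rho> V t \<le> gap \<theta> \<rho> W t + (LINT x|lborel. \<theta> x * (s x * \<bar>V x - W x\<bar>))"
    using integral_mono[OF i(1) Bochner_Integration.integrable_add[OF i(2,3)] p(1)] i assms(2) by (simp add: gap_def)
  moreover have "gap \<theta> \<rho> W t \<le> gap \<theta> \<rho> V t + (LINT x|lborel. \<theta> x * (s x * \<bar>V x - W x\<bar>))"
    using integral_mono[OF i(2) Bochner_Integration.integrable_add[OF i(1,3)] p(2)] i assms(2) by (simp add: gap_def)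
  ultimately show ?thesis by linarith
qed

lemma gap_continuous:
  assumes sol: "kruzhkov_solution R \<rho>" and V: "bounded_borel V"
  shows "continuous_on {0..} (gap \<theta> \<rho> V)"
  unfolding continuous_on_def
proof
  fix t0 :: real assume "t0 \<in> {0..}"
  then have t0: "t0 \<ge> 0" by simp
  have est: "\<bar>gap \<theta> \<rho> V t - gap \<theta> \<rho> V t0\<bar> \<le> \<Theta> * b * (LINT x:{-K..K}|lborel. \<bar>\<rho> t x - \<rho> t0 x\<bar>)" if t: "t \<ge> 0" for t
  proof -
    note br = slice_bounded_borel[OF sol t] slice_bounded_borel[OF sol t0]
    have i: "integrable lborel (\<lambda>x. \<theta> x * (s x * \<bar>\<rho> t x - V x\<bar>))" "integrable lborel (\<lambda>x. \<theta> x * (s x * \<bar>\<rho> t0 x - V x\<bar>))"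
      by (intro weight_mass_integrable bounded_borel_diff br V)+
    have j: "integrable lborel (\<lambda>x. indicator {-K..K} x * \<bar>\<rho> t x - \<rho> t0 x\<bar>)"
      using bounded_borel_Icc[OF bounded_borel_abs[OF bounded_borel_diff[OF br]], of "-K" K] by (simp add: set_integrable_def)
    have "\<bar>gap \<theta> \<rho> V t - gap \<theta> \<rho> V t0\<bar> = \<bar>LINT x|lborel. \<theta> x * (s x * \<bar>\<rho> t x - V x\<bar>) - \<theta> x * (s x * \<bar>\<rho> t0 x - V x\<bar>)\<bar>"
      using i t t0 by (simp add: gap_def)
    also have "\<dots> \<le> (LINT x|lborel. \<bar>\<theta> x * (s x * \<bar>\<rho> t x - V x\<bar>) - \<theta> x * (s x * \<bar>\<rho> t0 x - V x\<bar>)\<bar>)"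
      by (rule integral_abs_bound)
    also have "\<dots> \<le> (LINT x|lborel. \<Theta> * b * (indicator {-K..K} x * \<bar>\<rho> t x - \<rho> t0 x\<bar>))"
    proof (rule integral_mono)
      fix x
      show "\<bar>\<theta> x * (s x * \<bar>\<rho> t x - V x\<bar>) - \<theta> x * (s x * \<bar>\<rho> t0 x - V x\<bar>)\<bar> \<le> \<Theta> * b * (indicator {-K..K} x * \<bar>\<rho> t x - \<rho> t0 x\<bar>)"
      proof (cases "\<bar>x\<bar> \<ge> K")
        case True
        then show ?thesis using K(1)[of x] weight_nonneg b_pos by simp
      next
        case False
        have "\<bar>\<theta> x * (s x * \<bar>\<rho> t x - V x\<bar>) - \<theta> x * (s x * \<bar>\<rho> t0 x - V x\<bar>)\<bar> = (\<theta> x * s x) * \<bar>\<bar>\<rho> t x - V x\<bar> - \<bar>\<rho> t0 x - V x\<bar>\<bar>"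
          using th(2)[of x] s_pos[of x] by (simp add: abs_mult mult.assoc flip: right_diff_distrib)
        also have "\<dots> \<le> (\<Theta> * b) * \<bar>\<rho> t x - \<rho> t0 x\<bar>"
          using th(2,3)[of x] s_pos[of x] s_bounds(2)[of x] weight_nonneg by (intro mult_mono) auto
        moreover have "x \<in> {-K..K}" using False by auto
        ultimately show ?thesis by simp
      qed
    qed (use i j in \<open>auto intro: integrable_abs\<close>)
    also have "\<dots> = \<Theta> * b * (LINT x:{-K..K}|lborel. \<bar>\<rho> t x - \<rho> t0 x\<bar>)"
      by (simp add: set_lebesgue_integral_def)
    finally show ?thesis .
  qed
  have "((\<lambda>t. LINT x:{-K..K}|lborel. \<bar>\<rho> t x - \<rho> t0 x\<bar>) \<longlongrightarrow> 0) (at t0 within {0..})"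
    using sol t0 unfolding kruzhkov_solution_def by blast
  then have lim: "((\<lambda>t. \<Theta> * b * (LINT x:{-K..K}|lborel. \<bar>\<rho> t x - \<rho> t0 x\<bar>)) \<longlongrightarrow> 0) (at t0 within {0..})"
    by (rule tendsto_mult_right_zero)
  have "((\<lambda>t. gap \<theta> \<rho> V t - gap \<theta> \<rho> V t0) \<longlongrightarrow> 0) (at t0 within {0..})"
    by (rule Lim_null_comparison[OF _ lim]) (use est in \<open>auto simp: eventually_at_filter\<close>)
  then show "(gap \<theta> \<rho> V \<longlongrightarrow> gap \<theta> \<rho> V t0) (at t0 within {0..})" by (rule LIM_zero_cancel)
qed

lemma gap_bounded_borel:
  assumes sol: "kruzhkov_solution R \<rho>" and V: "V \<in> borel_measurable borel" "\<And>x. V x \<in> {A..B}"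
  shows "bounded_borel (gap \<theta> \<rho> V)"
proof (rule bounded_borelI)
  have bV: "bounded_borel V" by (rule range_bounded_borel[OF V])
  have "(\<lambda>t. indicator {0..} t *\<^sub>R gap \<theta> \<rho> V t) \<in> borel_measurable borel"
    by (rule borel_measurable_continuous_on_indicator[OF _ gap_continuous[OF sol bV]]) simp
  moreover have "(\<lambda>t. indicator {0..} t *\<^sub>R gap \<theta> \<rho> V t) = gap \<theta> \<rho> V" by (auto simp: gap_def indicator_def fun_eq_iff)
  ultimately show "gap \<theta> \<rho> V \<in> borel_measurable borel" by simp
  have iK: "integrable lborel (\<lambda>x. indicator {-K..K} x * (\<Theta> * (b * B)))"
    by (intro integrable_mult_left integrable_real_indicator) (auto simp: emeasure_lborel_Icc_eq)
  show "\<bar>gap \<theta> \<rho> V t\<bar> \<le> (LINT x|lborel. indicator {-K..K} x * (\<Theta> * (b * B)))" for t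
  proof (cases "t \<ge> 0")
    case True
    note br = slice_bounded_borel[OF sol True]
    have rr: "\<rho> t x \<in> {A..B}" for x using sol True unfolding kruzhkov_solution_def by blast
    have nn: "0 \<le> (LINT x|lborel. \<theta> x * (s x * \<bar>\<rho> t x - V x\<bar>))"
      using th(2) s_pos by (intro Bochner_Integration.integral_nonneg) (simp add: less_imp_le)
    have "(LINT x|lborel. \<theta> x * (s x * \<bar>\<rho> t x - V x\<bar>)) \<le> (LINT x|lborel. indicator {-K..K} x * (\<Theta> * (b * B)))"
    proof (rule integral_mono[OF weight_mass_integrable[OF bounded_borel_diff[OF br bV]] iK])
      fix x
      have "\<bar>\<rho> t x - V x\<bar> \<le> B" using rr[of x] V(2)[of x] A_pos by auto
      then have "\<theta> x * (s x * \<bar>\<rho> t x - V x\<bar>) \<le> \<Theta> * (b * B)"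
        using th(2,3)[of x] s_pos[of x] s_bounds(2)[of x] weight_nonneg b_pos by (intro mult_mono) auto
      then show "\<theta> x * (s x * \<bar>\<rho> t x - V x\<bar>) \<le> indicator {-K..K} x * (\<Theta> * (b * B))"
        using K(1)[of x] by (cases "\<bar>x\<bar> \<ge> K") (auto simp: indicator_def)
    qed
    then show ?thesis using nn True by (simp add: gap_def)
  next
    case False
    then show ?thesis using weight_nonneg b_pos B_pos by (auto simp: gap_def intro!: Bochner_Integration.integral_nonneg)
  qed
qed

text \<open>\<open>kruzhkov_resolvent\<close> is applied to step n, and \<theta>' is replaced by
  \<theta> + E: the first part is absorbed by \<open>flux_le_mass\<close> at the rate
  \<open>\<kappa>\<close>, the second is at most \<open>\<epsilon>\<close> in total.
  \<open>weak_decrease\<close> turns the result, which holds in the sense of distributions in t,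
  into increments.\<close>

lemma gap_decrease:
  assumes sol: "kruzhkov_solution R \<rho>" and tau: "\<tau> > 0" and t: "0 \<le> t1" "t1 \<le> t2"
  defines "\<alpha> \<equiv> \<lambda>n. gap \<theta> \<rho> (scheme \<tau> n)"
  shows "\<alpha> (Suc n) t2 - \<alpha> (Suc n) t1 \<le> (LINT t:{t1..t2}|lborel. \<kappa> * \<alpha> (Suc n) t + (\<alpha> n t - \<alpha> (Suc n) t) / \<tau> + \<epsilon>)"
proof (rule weak_decrease[OF _ _ _ _ t])
  have R: "kruzhkov R" using sol by (simp add: kruzhkov_solution_def)
  let ?V = "scheme \<tau> n" and ?W = "scheme \<tau> (Suc n)"
  note bV = scheme_bounded_borel[OF tau]
  have ba: "bounded_borel (\<alpha> k)" for k unfolding \<alpha>_def by (rule gap_bounded_borel[OF sol scheme_measurable[OF tau] scheme_range[OF tau]])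
  show "bounded_borel (\<alpha> (Suc n))" by (rule ba)
  show "continuous_on {0..} (\<alpha> (Suc n))" unfolding \<alpha>_def by (rule gap_continuous[OF sol bV])
  show "bounded_borel (\<lambda>t. \<kappa> * \<alpha> (Suc n) t + (\<alpha> n t - \<alpha> (Suc n) t) / \<tau> + \<epsilon>)"
    unfolding divide_inverse by (intro bounded_borel_intros ba)
  fix \<beta> \<beta>' assume be: "time_test \<beta> \<beta>'"
  then have bC: "C1c \<beta> \<beta>'" and b0: "\<And>t. 0 \<le> \<beta> t" by (auto simp: time_test_def)
  obtain t0 where "t0 > 0" "\<forall>t\<le>t0. \<beta> t = 0 \<and> \<beta>' t = 0" using be unfolding time_test_def by blast
  then have neg: "\<beta> t = 0 \<and> \<beta>' t = 0" if "t \<le> 0" for t using that by simp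
  obtain K2 where K2: "\<forall>x. \<bar>x\<bar> \<ge> K2 \<longrightarrow> \<beta> x = 0 \<and> \<beta>' x = 0" using bC unfolding C1c_def by blast
  have Rm[measurable]: "R \<in> borel_measurable (borel \<Otimes>\<^sub>M borel)" using R unfolding kruzhkov_def by blast
  have Rr: "R w \<in> {A..B}" for w using R unfolding kruzhkov_def by blast
  define F where "F = f B - f A"
  let ?J = "\<lambda>w. \<beta>' (snd w) * \<theta> (fst w) * (s (fst w) * \<bar>R w - \<phi> (flux \<tau> n (fst w))\<bar>)
     + \<beta> (snd w) * \<theta>' (fst w) * \<bar>f (R w) - flux \<tau> n (fst w)\<bar>
     + \<beta> (snd w) * \<theta> (fst w) * (s (fst w) * (\<bar>R w - ?V (fst w)\<bar> - \<bar>R w - \<phi> (flux \<tau> n (fst w))\<bar>) / \<tau>)"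
  define J where "J w = \<beta>' (snd w) * (\<theta> (fst w) * (s (fst w) * \<bar>R w - ?W (fst w)\<bar>))
     + \<beta> (snd w) * (\<kappa> * (\<theta> (fst w) * (s (fst w) * \<bar>R w - ?W (fst w)\<bar>)) + F * E (fst w)
        + (\<theta> (fst w) * (s (fst w) * \<bar>R w - ?V (fst w)\<bar>) - \<theta> (fst w) * (s (fst w) * \<bar>R w - ?W (fst w)\<bar>)) / \<tau>)" for w
  have J0: "0 \<le> (LINT w|lborel. ?J w)"
    by (rule kruzhkov_resolvent[OF R tau scheme_resolves[OF tau] scheme_measurable[OF tau] scheme_range[OF tau] scheme_isCont_AE[OF tau] th(1,2) be])
  note bb = C1c_bounded_borel[OF th(1)] C1c_bounded_borel[OF bC]
  note [measurable] = bb[THEN bounded_borel_measurable] bounded_borel_measurable[OF E(1)] scheme_measurable[OF tau]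
    borel_measurable_continuous_onI[OF resolvesD(3)[OF scheme_resolves[OF tau]]]
  obtain S0 where S0: "S0 > 0" "\<And>x. \<bar>\<beta> x\<bar> \<le> S0" using bounded_borel_bound[OF bb(3)] by blast
  obtain S1 where S1: "S1 > 0" "\<And>x. \<bar>\<beta>' x\<bar> \<le> S1" using bounded_borel_bound[OF bb(4)] by blast
  obtain E0 where E0: "E0 > 0" "\<And>x. \<bar>E x\<bar> \<le> E0" using bounded_borel_bound[OF E(1)] by blast
  have F0: "F \<ge> 0" using f_mono[OF A_le_B] by (simp add: F_def)
  have mb: "0 \<le> \<theta> x * (s x * \<bar>R w - scheme \<tau> k x\<bar>)" "\<theta> x * (s x * \<bar>R w - scheme \<tau> k x\<bar>) \<le> \<Theta> * (b * B)" for x w k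
  proof -
    show "0 \<le> \<theta> x * (s x * \<bar>R w - scheme \<tau> k x\<bar>)" using th(2)[of x] s_pos[of x] by simp
    have "\<bar>R w - scheme \<tau> k x\<bar> \<le> B" using Rr[of w] scheme_range[OF tau, of k x] A_pos by auto
    then show "\<theta> x * (s x * \<bar>R w - scheme \<tau> k x\<bar>) \<le> \<Theta> * (b * B)"
      using th(2,3)[of x] s_pos[of x] s_bounds(2)[of x] weight_nonneg b_pos by (intro mult_mono) auto
  qed
  let ?m = "\<Theta> * (b * B)"
  have iJ: "integrable lborel J"
  proof (rule plane_integrable[of _ "S1 * ?m + S0 * (\<kappa> * ?m + F * E0 + (?m + ?m) / \<tau>)" "max K K2"])
    have "J \<in> borel_measurable (borel \<Otimes>\<^sub>M borel)" unfolding J_def by measurable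
    then show "J \<in> borel_measurable borel" by (simp add: borel_prod)
    fix w
    let ?p = "\<theta> (fst w) * (s (fst w) * \<bar>R w - ?W (fst w)\<bar>)" and ?q = "\<theta> (fst w) * (s (fst w) * \<bar>R w - ?V (fst w)\<bar>)"
    have pq: "\<bar>?p\<bar> \<le> ?m" "\<bar>?q\<bar> \<le> ?m" using mb[of "fst w" w "Suc n"] mb[of "fst w" w n] by auto
    have "\<bar>\<beta>' (snd w) * ?p\<bar> \<le> S1 * ?m" unfolding abs_mult[of "\<beta>' (snd w)"] using pq S1 by (intro mult_mono) auto
    moreover have "\<bar>\<kappa> * ?p + F * E (fst w) + (?q - ?p) / \<tau>\<bar> \<le> \<kappa> * ?m + F * E0 + (?m + ?m) / \<tau>"
    proof -
      have "\<bar>\<kappa> * ?p\<bar> \<le> \<kappa> * ?m" unfolding abs_mult[of \<kappa>] using pq kappa_pos by (intro mult_mono) auto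
      moreover have "\<bar>F * E (fst w)\<bar> \<le> F * E0" unfolding abs_mult using E0 F0 by (intro mult_mono) auto
      moreover have "\<bar>(?q - ?p) / \<tau>\<bar> \<le> (?m + ?m) / \<tau>" unfolding abs_divide using pq tau by (intro frac_le) linarith+
      ultimately show ?thesis by linarith
    qed
    then have "\<bar>\<beta> (snd w) * (\<kappa> * ?p + F * E (fst w) + (?q - ?p) / \<tau>)\<bar> \<le> S0 * (\<kappa> * ?m + F * E0 + (?m + ?m) / \<tau>)"
      unfolding abs_mult[of "\<beta> (snd w)"] using S0 by (intro mult_mono) auto
    ultimately show "\<bar>J w\<bar> \<le> S1 * ?m + S0 * (\<kappa> * ?m + F * E0 + (?m + ?m) / \<tau>)" unfolding J_def by linarith
  next
    fix x t assume "\<bar>x\<bar> \<ge> max K K2 \<or> \<bar>t\<bar> \<ge> max K K2"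
    then show "J (x, t) = 0" using K(1)[of x] K(2)[of x] K2 by (auto simp: J_def)
  qed
  have JJ: "?J w \<le> J w" for w
  proof -
    let ?x = "fst w"
    let ?d = "\<bar>f (R w) - flux \<tau> n ?x\<bar>"
    have Wf: "\<phi> (flux \<tau> n ?x) = ?W ?x" by (simp add: scheme_Suc)
    have dF: "?d \<le> F" using Rr[of w] resolvesD(1)[OF scheme_resolves[OF tau], of n ?x] f_mono[of A "R w"] f_mono[of "R w" B]
      by (auto simp: F_def)
    have dk: "?d \<le> \<kappa> * (s ?x * \<bar>R w - ?W ?x\<bar>)"
      using flux_le_mass[of "f (R w)" "flux \<tau> n ?x" ?x] by (simp add: phi_f Wf \<kappa>_def)
    have "\<theta>' ?x * ?d \<le> (\<theta> ?x + E ?x) * ?d" using E(3) by (intro mult_right_mono) auto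
    also have "\<dots> \<le> \<theta> ?x * (\<kappa> * (s ?x * \<bar>R w - ?W ?x\<bar>)) + F * E ?x"
      using mult_left_mono[OF dk th(2)[of ?x]] mult_left_mono[OF dF E(2)[of ?x]] by (simp add: algebra_simps)
    finally have "\<beta> (snd w) * (\<theta>' ?x * ?d) \<le> \<beta> (snd w) * (\<kappa> * (\<theta> ?x * (s ?x * \<bar>R w - ?W ?x\<bar>)) + F * E ?x)"
      using b0 by (intro mult_left_mono) (simp_all add: algebra_simps)
    then show ?thesis unfolding J_def Wf by (simp add: algebra_simps diff_divide_distrib)
  qed
  have "0 \<le> (LINT w|lborel. J w)"
  proof (cases "integrable lborel ?J")
    case True
    show ?thesis using J0 integral_mono[OF True iJ JJ] by linarith
  next
    case False
    have "?J \<in> borel_measurable (borel \<Otimes>\<^sub>M borel)" by measurable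
    moreover obtain T1 where T1: "T1 > 0" "\<And>x. \<bar>\<theta>' x\<bar> \<le> T1" using bounded_borel_bound[OF bb(2)] by blast
    obtain K1 where K1: "\<forall>x. \<bar>x\<bar> \<ge> K1 \<longrightarrow> \<theta> x = 0 \<and> \<theta>' x = 0" using th(1) unfolding C1c_def by blast
    \<comment> \<open>Bounded with bounded support, which contradicts the assumption of this
      case.\<close>
    have "integrable lborel ?J"
    proof (rule plane_integrable[of _ "S1 * ?m + S0 * T1 * F + S0 * ((?m + ?m) / \<tau>)" "max K1 K2"])
      show "?J \<in> borel_measurable borel" using calculation by (simp add: borel_prod)
      fix w
      let ?p = "\<theta> (fst w) * (s (fst w) * \<bar>R w - ?W (fst w)\<bar>)" and ?q = "\<theta> (fst w) * (s (fst w) * \<bar>R w - ?V (fst w)\<bar>)"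
      have pq: "\<bar>?p\<bar> \<le> ?m" "\<bar>?q\<bar> \<le> ?m" using mb[of "fst w" w "Suc n"] mb[of "fst w" w n] by auto
      have dF: "\<bar>f (R w) - flux \<tau> n (fst w)\<bar> \<le> F"
        using Rr[of w] resolvesD(1)[OF scheme_resolves[OF tau], of n "fst w"] f_mono[of A "R w"] f_mono[of "R w" B] by (auto simp: F_def)
      have n1: "\<bar>\<beta>' (snd w) * ?p\<bar> \<le> S1 * ?m" unfolding abs_mult[of "\<beta>' (snd w)"] using pq S1 by (intro mult_mono) auto
      have n2: "\<bar>\<beta> (snd w) * \<theta>' (fst w) * \<bar>f (R w) - flux \<tau> n (fst w)\<bar>\<bar> \<le> S0 * T1 * F"
        unfolding abs_mult abs_abs by (intro mult_mono S0(2) T1(2) dF mult_nonneg_nonneg abs_ge_zero less_imp_le[OF S0(1)] less_imp_le[OF T1(1)])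
      have n3: "\<bar>\<beta> (snd w) * ((?q - ?p) / \<tau>)\<bar> \<le> S0 * ((?m + ?m) / \<tau>)"
        
      proof -
        have "\<bar>?q - ?p\<bar> \<le> ?m + ?m" using pq by linarith
        then have "\<bar>(?q - ?p) / \<tau>\<bar> \<le> (?m + ?m) / \<tau>" unfolding abs_divide using tau by (simp add: divide_right_mono)
        then show ?thesis unfolding abs_mult[of "\<beta> (snd w)"] by (intro mult_mono S0(2) less_imp_le[OF S0(1)] abs_ge_zero)
      qed
      have eqJ: "?J w = \<beta>' (snd w) * ?p + \<beta> (snd w) * \<theta>' (fst w) * \<bar>f (R w) - flux \<tau> n (fst w)\<bar> + \<beta> (snd w) * ((?q - ?p) / \<tau>)"
        by (simp add: scheme_Suc algebra_simps)
      show "\<bar>?J w\<bar> \<le> S1 * ?m + S0 * T1 * F + S0 * ((?m + ?m) / \<tau>)"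
        unfolding eqJ by (intro order_trans[OF abs_triangle_ineq] add_mono n1 n2 n3)
    next
      fix x t assume "\<bar>x\<bar> \<ge> max K1 K2 \<or> \<bar>t\<bar> \<ge> max K1 K2"
      then show "?J (x, t) = 0" using K1 K2 by auto
    qed
    then show ?thesis using False by simp
  qed
  also have "(LINT w|lborel. J w) = (LINT t|lborel. LINT x|lborel. J (x, t))"
    by (rule plane_Fubini(2)[OF iJ, symmetric])
  also have "\<dots> = (LINT t|lborel. \<beta>' t * \<alpha> (Suc n) t + \<beta> t * (\<kappa> * \<alpha> (Suc n) t + (\<alpha> n t - \<alpha> (Suc n) t) / \<tau> + \<epsilon>))"
  proof (rule integral_cong_AE)
    show "(\<lambda>t. LINT x|lborel. J (x, t)) \<in> borel_measurable lborel"
    proof -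
      have [measurable]: "J \<in> borel_measurable (borel \<Otimes>\<^sub>M borel)" unfolding J_def by measurable
      have "(\<lambda>t. LINT x|lborel. J (x, t)) \<in> borel_measurable borel"
        by (rule lborel.borel_measurable_lebesgue_integral) measurable
      then show ?thesis by simp
    qed
    note [measurable] = bounded_borel_measurable[OF ba]
    show "(\<lambda>t. \<beta>' t * \<alpha> (Suc n) t + \<beta> t * (\<kappa> * \<alpha> (Suc n) t + (\<alpha> n t - \<alpha> (Suc n) t) / \<tau> + \<epsilon>)) \<in> borel_measurable lborel"
      by measurable
    have "AE t in lborel. t \<ge> 0 \<longrightarrow> (AE x in lborel. R (x, t) = \<rho> t x)" using sol unfolding kruzhkov_solution_def by blast
    then show "AE t in lborel. (LINT x|lborel. J (x, t))
       = \<beta>' t * \<alpha> (Suc n) t + \<beta> t * (\<kappa> * \<alpha> (Suc n) t + (\<alpha> n t - \<alpha> (Suc n) t) / \<tau> + \<epsilon>)"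
    proof eventually_elim
      case (elim t)
      show ?case
      proof (cases "t \<ge> 0")
        case False then show ?thesis using neg[of t] by (simp add: J_def)
      next
        case True
        have ae: "AE x in lborel. R (x, t) = \<rho> t x" using elim True by blast
        note br = slice_bounded_borel[OF sol True]
        let ?g = "\<lambda>k x. \<theta> x * (s x * \<bar>\<rho> t x - scheme \<tau> k x\<bar>)"
        have i: "integrable lborel (?g k)" for k by (intro weight_mass_integrable bounded_borel_diff br bV)
        have iE: "integrable lborel E" by (rule LINT_compact_support(1)[OF E(1) K(2)])
        have gk: "(LINT x|lborel. ?g k x) = \<alpha> k t" for k using True by (simp add: \<alpha>_def gap_def)
        have Rt: "(\<lambda>x. R (x, t)) \<in> borel_measurable borel" by measurable
        have rt: "\<rho> t \<in> borel_measurable borel" using br by (rule bounded_borel_measurable)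
        have "(LINT x|lborel. J (x, t)) = (LINT x|lborel. \<beta>' t * ?g (Suc n) x + \<beta> t * (\<kappa> * ?g (Suc n) x + F * E x + (?g n x - ?g (Suc n) x) / \<tau>))"
        proof (rule integral_cong_AE)
          have [measurable]: "J \<in> borel_measurable (borel \<Otimes>\<^sub>M borel)" unfolding J_def by measurable
          have "(\<lambda>x. J (x, t)) \<in> borel_measurable borel" by measurable
          then show "(\<lambda>x. J (x, t)) \<in> borel_measurable lborel" by simp
          note rt[measurable]
          show "(\<lambda>x. \<beta>' t * ?g (Suc n) x + \<beta> t * (\<kappa> * ?g (Suc n) x + F * E x + (?g n x - ?g (Suc n) x) / \<tau>)) \<in> borel_measurable lborel"
            by measurable
          show "AE x in lborel. J (x, t) = \<beta>' t * ?g (Suc n) x + \<beta> t * (\<kappa> * ?g (Suc n) x + F * E x + (?g n x - ?g (Suc n) x) / \<tau>)"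
            using ae by eventually_elim (simp add: J_def)
        qed
        also have "\<dots> = \<beta>' t * (LINT x|lborel. ?g (Suc n) x) + \<beta> t * (\<kappa> * (LINT x|lborel. ?g (Suc n) x) + F * (LINT x|lborel. E x)
            + ((LINT x|lborel. ?g n x) - (LINT x|lborel. ?g (Suc n) x)) / \<tau>)"
        proof -
          note ig = i[of n] i[of "Suc n"]
          have h1: "integrable lborel (\<lambda>x. \<kappa> * ?g (Suc n) x)" "integrable lborel (\<lambda>x. F * E x)"
            "integrable lborel (\<lambda>x. (?g n x - ?g (Suc n) x) / \<tau>)" "integrable lborel (\<lambda>x. \<beta>' t * ?g (Suc n) x)"
            by (intro integrable_mult_right ig iE integrable_divide Bochner_Integration.integrable_diff)+
          have h2: "integrable lborel (\<lambda>x. \<kappa> * ?g (Suc n) x + F * E x + (?g n x - ?g (Suc n) x) / \<tau>)"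
            by (intro Bochner_Integration.integrable_add h1)
          show ?thesis
            unfolding Bochner_Integration.integral_add[OF h1(4) integrable_mult_right[OF h2, of "\<beta> t"]]
            using Bochner_Integration.integral_add[OF Bochner_Integration.integrable_add[OF h1(1,2)] h1(3)]
              Bochner_Integration.integral_add[OF h1(1,2)] Bochner_Integration.integral_diff[OF ig] by simp
        qed
        finally show ?thesis unfolding gk eps F_def by (simp add: algebra_simps)
      qed
    qed
  qed
  finally show "0 \<le> (LINT t|lborel. \<beta>' t * \<alpha> (Suc n) t + \<beta> t * (\<kappa> * \<alpha> (Suc n) t + (\<alpha> n t - \<alpha> (Suc n) t) / \<tau> + \<epsilon>))" .
qed

text \<open>The tangent line at \<open>Q\<close> lies above the concave square root.\<close>

lemma sqrt_increment_le:
  assumes "Q > 0" "Q + h \<ge> 0" shows "sqrt (Q + h) \<le> sqrt Q + h / (2 * sqrt Q)"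
proof (rule real_le_lsqrt)
  have s: "sqrt Q > 0" "sqrt Q * sqrt Q = Q" using assms by simp_all
  have e: "sqrt Q + h / (2 * sqrt Q) = (2 * (sqrt Q * sqrt Q) + h) / (2 * sqrt Q)" using s(1) by (simp add: field_simps)
  show "0 \<le> sqrt Q + h / (2 * sqrt Q)" unfolding e s(2) using assms s(1) by (intro divide_nonneg_pos) auto
  have "(sqrt Q + h / (2 * sqrt Q))\<^sup>2 = (sqrt Q)\<^sup>2 + (h / (2 * sqrt Q))\<^sup>2 + 2 * sqrt Q * (h / (2 * sqrt Q))"
    by (rule power2_sum)
  also have "\<dots> = Q + (h / (2 * sqrt Q))\<^sup>2 + h" using s(1) assms(1) by simp
  finally show "Q + h \<le> (sqrt Q + h / (2 * sqrt Q))\<^sup>2" by simp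
qed

text \<open>\<open>gap_decrease\<close> says \<alpha>_(n+1)' <= \<kappa> \<alpha>_(n+1) +
  (\<alpha>_n - \<alpha>_(n+1)) / \<tau> + \<epsilon>, a semi-discrete analogue of the
  Crandall-Liggett recursion. Supersolutions are exp(\<kappa> t) (2 C q_n + \<epsilon> t) with q_n
  the stated root: its radicand grows, when n+1 is lowered to n, by exactly \<tau> times its time
  derivative, so concavity of the square root gives (q_n - q_(n+1)) / \<tau> <= q_(n+1)'.\<close>

lemma gap_estimate:
  assumes sol: "kruzhkov_solution R \<rho>" and tau: "\<tau> > 0" "\<kappa> * \<tau> \<le> 1" and r: "r \<ge> 0"
  shows "gap \<theta> \<rho> (scheme \<tau> n) r \<le> exp (\<kappa> * r) * (2 * (\<Theta> * M) * sqrt ((r - n * \<tau>)\<^sup>2 + r * \<tau> + \<tau>\<^sup>2) + \<epsilon> * r)"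
proof -
  define C where "C = \<Theta> * M"
  have C0: "C \<ge> 0" using weight_nonneg M_nonneg by (simp add: C_def)
  note e0 = eps_nonneg
  define \<alpha> where "\<alpha> n = gap \<theta> \<rho> (scheme \<tau> n)" for n
  note bV = scheme_bounded_borel[OF tau(1)]
  have ba: "bounded_borel (\<alpha> k)" for k
    unfolding \<alpha>_def by (rule gap_bounded_borel[OF sol scheme_measurable[OF tau(1)] scheme_range[OF tau(1)]])
  have ca: "continuous_on {0..} (\<alpha> k)" for k unfolding \<alpha>_def by (rule gap_continuous[OF sol bV])
  have b\<gamma>: "bounded_borel (\<lambda>t. \<kappa> * \<alpha> (Suc n) t + (\<alpha> n t - \<alpha> (Suc n) t) / \<tau> + \<epsilon>)" for n
    unfolding divide_inverse by (intro bounded_borel_intros ba)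
  have dec: "\<alpha> (Suc n) t2 - \<alpha> (Suc n) t1 \<le> (LINT t:{t1..t2}|lborel. \<kappa> * \<alpha> (Suc n) t + (\<alpha> n t - \<alpha> (Suc n) t) / \<tau> + \<epsilon>)"
    if "0 \<le> t1" "t1 \<le> t2" for n t1 t2
    using gap_decrease[OF sol tau(1) that] by (simp add: \<alpha>_def)
  have init: "\<alpha> k 0 \<le> C * (k * \<tau>)" for k
  proof -
    have "AE x in lborel. \<rho> 0 x = 1 / s x" using sol unfolding kruzhkov_solution_def by blast
    have b0: "\<rho> 0 \<in> borel_measurable borel" using slice_bounded_borel[OF sol] by (auto intro: bounded_borel_measurable)
    note [measurable] = b0 scheme_measurable[OF tau(1)] C1c_bounded_borel(1)[OF th(1), THEN bounded_borel_measurable]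
    have "\<alpha> k 0 = (LINT x|lborel. \<theta> x * (s x * \<bar>\<rho> 0 x - scheme \<tau> k x\<bar>))" by (simp add: \<alpha>_def gap_def)
    also have "\<dots> = (LINT x|lborel. \<theta> x * (s x * \<bar>scheme \<tau> 0 x - scheme \<tau> k x\<bar>))"
    proof (rule integral_cong_AE)
      show "AE x in lborel. \<theta> x * (s x * \<bar>\<rho> 0 x - scheme \<tau> k x\<bar>) = \<theta> x * (s x * \<bar>scheme \<tau> 0 x - scheme \<tau> k x\<bar>)"
        using \<open>AE x in lborel. \<rho> 0 x = 1 / s x\<close> by eventually_elim simp
    qed measurable
    also have "\<dots> \<le> \<Theta> * (LINT x|lborel. s x * \<bar>scheme \<tau> 0 x - scheme \<tau> k x\<bar>)"
      by (rule weight_mass_le[OF bounded_borel_diff[OF bV bV]]) (use scheme_initial_mass[OF tau(1)] in blast)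
    also have "\<dots> \<le> \<Theta> * (M * (k * \<tau>))"
      using scheme_initial_mass[OF tau(1), of k] weight_nonneg unfolding dist1_def by (intro mult_left_mono) auto
    finally show ?thesis by (simp add: C_def mult.assoc)
  qed
  \<comment> \<open>The initial profile solves no resolvent equation, so its gap is compared with
    that of the first step; this also closes the inequality for the first step itself in
    \<open>one\<close>.\<close>
  have close: "\<alpha> 0 t \<le> \<alpha> (Suc 0) t + C * \<tau>" if "t \<ge> 0" for t
  proof -
    have "\<alpha> 0 t - \<alpha> (Suc 0) t \<le> (LINT x|lborel. \<theta> x * (s x * \<bar>scheme \<tau> 0 x - scheme \<tau> (Suc 0) x\<bar>))"
      using gap_triangle[OF sol that bV[of 0] bV[of "Suc 0"]] by (simp add: \<alpha>_def)
    also have "\<dots> \<le> \<Theta> * (LINT x|lborel. s x * \<bar>scheme \<tau> 0 x - scheme \<tau> (Suc 0) x\<bar>)"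
      by (rule weight_mass_le[OF bounded_borel_diff[OF bV bV]]) (use scheme_step_mass[OF tau(1)] tau(1) in blast)+
    also have "\<dots> \<le> \<Theta> * (M * \<tau>)"
      using scheme_step_mass[OF tau(1), of 0] weight_nonneg unfolding dist1_def by (intro mult_left_mono) auto
    finally show ?thesis by (simp add: C_def mult.assoc)
  qed
  define q where "q n t = sqrt ((t - real n * \<tau>)\<^sup>2 + t * \<tau> + \<tau>\<^sup>2)" for n t
  have rad: "(t - real n * \<tau>)\<^sup>2 + t * \<tau> + \<tau>\<^sup>2 > 0" if "t \<ge> 0" for n t
    using that tau(1) by (intro add_nonneg_pos add_nonneg_nonneg) auto
  have qpos: "q n t > 0" if "t \<ge> 0" for n t using rad[OF that] by (simp add: q_def)
  have ex1: "exp (\<kappa> * t) \<ge> 1" if "t \<ge> 0" for t using that kappa_pos by simp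
  have one: "\<alpha> (Suc 0) t \<le> exp (\<kappa> * t) * (C * (t + \<tau>) + \<epsilon> * t)" if "t \<ge> 0" for t
  proof (rule differential_comparison[OF ca _ b\<gamma> dec _ _ _ _ that])
    show "\<alpha> (Suc 0) 0 \<le> exp (\<kappa> * 0) * (C * (0 + \<tau>) + \<epsilon> * 0)" using init[of "Suc 0"] by simp
    show "((\<lambda>t. exp (\<kappa> * t) * (C * (t + \<tau>) + \<epsilon> * t)) has_real_derivative
       \<kappa> * (exp (\<kappa> * t) * (C * (t + \<tau>) + \<epsilon> * t)) + exp (\<kappa> * t) * (C + \<epsilon>)) (at t)" for t
      by (auto intro!: derivative_eq_intros simp: algebra_simps)
    show "continuous_on {0..} (\<lambda>t. \<kappa> * (exp (\<kappa> * t) * (C * (t + \<tau>) + \<epsilon> * t)) + exp (\<kappa> * t) * (C + \<epsilon>))"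
      by (intro continuous_intros)
    show "\<kappa> \<ge> 0" using kappa_pos by simp
    fix t :: real assume t: "t \<ge> 0"
    have "(\<alpha> 0 t - \<alpha> (Suc 0) t) / \<tau> \<le> C" using close[OF t] tau(1) by (simp add: pos_divide_le_eq)
    moreover have "1 * (C + \<epsilon>) \<le> exp (\<kappa> * t) * (C + \<epsilon>)" using ex1[OF t] C0 e0 by (intro mult_right_mono) auto
    ultimately show "\<kappa> * \<alpha> (Suc 0) t + (\<alpha> 0 t - \<alpha> (Suc 0) t) / \<tau> + \<epsilon>
      \<le> \<kappa> * (exp (\<kappa> * t) * (C * (t + \<tau>) + \<epsilon> * t)) + exp (\<kappa> * t) * (C + \<epsilon>)
        + \<kappa> * (\<alpha> (Suc 0) t - exp (\<kappa> * t) * (C * (t + \<tau>) + \<epsilon> * t))"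
      by (simp add: algebra_simps)
  qed
  have "\<alpha> n t \<le> exp (\<kappa> * t) * (2 * C * q n t + \<epsilon> * t)" if "t \<ge> 0" for t
    using that
  proof (induction n arbitrary: t)
    case 0
    have "(q 0 t)\<^sup>2 = t\<^sup>2 + t * \<tau> + \<tau>\<^sup>2"
      using rad[OF 0, of 0] unfolding q_def by (subst real_sqrt_pow2) (simp_all add: less_imp_le)
    \<comment> \<open>The factor 2 in front of \<open>C\<close> and the summand \<tau>^2 in the
      radicand serve to dominate t + 2 \<tau>, the cost of the detour through the first
      step.\<close>
    then have "(2 * q 0 t)\<^sup>2 = (t + 2 * \<tau>)\<^sup>2 + 3 * t\<^sup>2" by (simp add: power2_eq_square algebra_simps)
    then have "(t + 2 * \<tau>)\<^sup>2 \<le> (2 * q 0 t)\<^sup>2" using zero_le_power2[of t] by linarith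
    then have qt: "t + 2 * \<tau> \<le> 2 * q 0 t" by (rule power2_le_imp_le) (use qpos[OF 0, of 0] in linarith)
    have "\<alpha> 0 t \<le> exp (\<kappa> * t) * (C * (t + \<tau>) + \<epsilon> * t) + 1 * (C * \<tau>)" using close[OF 0] one[OF 0] by linarith
    also have "\<dots> \<le> exp (\<kappa> * t) * (C * (t + \<tau>) + \<epsilon> * t) + exp (\<kappa> * t) * (C * \<tau>)"
      using ex1[OF 0] C0 tau(1) by (intro add_left_mono mult_right_mono) auto
    also have "\<dots> = exp (\<kappa> * t) * (C * (t + 2 * \<tau>) + \<epsilon> * t)" by (simp add: algebra_simps)
    also have "\<dots> \<le> exp (\<kappa> * t) * (C * (2 * q 0 t) + \<epsilon> * t)"
      using qt C0 by (intro mult_left_mono add_right_mono) auto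
    finally show ?case by (simp add: mult.assoc mult.left_commute)
  next
    case (Suc n)
    let ?\<Psi> = "\<lambda>n t. exp (\<kappa> * t) * (2 * C * q n t + \<epsilon> * t)"
    let ?q' = "\<lambda>t. (2 * (t - real (Suc n) * \<tau>) + \<tau>) / (2 * q (Suc n) t)"
    have k0: "(0 :: real) \<ge> 0" by simp
    show ?case
    proof (rule differential_comparison[OF ca _ b\<gamma> dec _ _ k0 _ Suc.prems, where \<Psi>="?\<Psi> (Suc n)"
        and \<Psi>'="\<lambda>t. \<kappa> * ?\<Psi> (Suc n) t + exp (\<kappa> * t) * (2 * C * ?q' t + \<epsilon>)"])
      have "real (Suc n) * \<tau> \<le> q (Suc n) 0" unfolding q_def by (rule real_le_rsqrt) simp
      then have "C * (real (Suc n) * \<tau>) \<le> C * q (Suc n) 0" using C0 by (rule mult_left_mono)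
      also have "\<dots> \<le> 2 * C * q (Suc n) 0" using C0 qpos[of 0 "Suc n"] by simp
      finally show "\<alpha> (Suc n) 0 \<le> ?\<Psi> (Suc n) 0" using init[of "Suc n"] by simp
      fix t :: real assume t: "t \<ge> 0"
      have "(q (Suc n) has_real_derivative ?q' t) (at t)"
        unfolding q_def[abs_def] using rad[OF t, of "Suc n"]
        by (auto intro!: derivative_eq_intros simp: divide_simps)
      then show "(?\<Psi> (Suc n) has_real_derivative \<kappa> * ?\<Psi> (Suc n) t + exp (\<kappa> * t) * (2 * C * ?q' t + \<epsilon>)) (at t)"
        by (auto intro!: derivative_eq_intros simp: algebra_simps)
      assume le: "?\<Psi> (Suc n) t \<le> \<alpha> (Suc n) t"
      have eq: "(t - real n * \<tau>)\<^sup>2 + t * \<tau> + \<tau>\<^sup>2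
         = ((t - real (Suc n) * \<tau>)\<^sup>2 + t * \<tau> + \<tau>\<^sup>2) + (2 * (t - real (Suc n) * \<tau>) + \<tau>) * \<tau>"
        by (simp add: power2_eq_square algebra_simps)
      have "q n t \<le> q (Suc n) t + (2 * (t - real (Suc n) * \<tau>) + \<tau>) * \<tau> / (2 * q (Suc n) t)"
        unfolding q_def eq by (rule sqrt_increment_le[OF rad[OF t]]) (rule less_imp_le[OF rad[OF t, of n, unfolded eq]])
      then have dq: "(q n t - q (Suc n) t) / \<tau> \<le> ?q' t" using tau(1) by (simp add: pos_divide_le_eq algebra_simps)
      \<comment> \<open>Here \<kappa> \<tau> <= 1 enters: where \<alpha> is above the supersolution,
        it may be replaced by it on the right-hand side, so the comparison runs with rate 0.\<close>
      have "(1 / \<tau> - \<kappa>) \<ge> 0" using tau by (simp add: field_simps)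
      then have "(1 / \<tau> - \<kappa>) * ?\<Psi> (Suc n) t \<le> (1 / \<tau> - \<kappa>) * \<alpha> (Suc n) t" using le by (rule mult_left_mono[rotated])
      moreover have "\<alpha> n t / \<tau> \<le> ?\<Psi> n t / \<tau>" using Suc.IH[OF t] tau(1) by (intro divide_right_mono) auto
      ultimately have d1: "\<kappa> * \<alpha> (Suc n) t + (\<alpha> n t - \<alpha> (Suc n) t) / \<tau> + \<epsilon>
         \<le> \<kappa> * ?\<Psi> (Suc n) t + (?\<Psi> n t - ?\<Psi> (Suc n) t) / \<tau> + \<epsilon>"
        by (simp add: left_diff_distrib diff_divide_distrib)
      have d2: "(?\<Psi> n t - ?\<Psi> (Suc n) t) / \<tau> = exp (\<kappa> * t) * (2 * C * ((q n t - q (Suc n) t) / \<tau>))"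
        by (simp add: algebra_simps diff_divide_distrib)
      have d3: "exp (\<kappa> * t) * (2 * C * ((q n t - q (Suc n) t) / \<tau>)) \<le> exp (\<kappa> * t) * (2 * C * ?q' t)" using dq C0 by (intro mult_left_mono) auto
      have d4: "\<epsilon> \<le> exp (\<kappa> * t) * \<epsilon>" using mult_right_mono[OF ex1[OF t] e0] by simp
      show "\<kappa> * \<alpha> (Suc n) t + (\<alpha> n t - \<alpha> (Suc n) t) / \<tau> + \<epsilon>
         \<le> \<kappa> * ?\<Psi> (Suc n) t + exp (\<kappa> * t) * (2 * C * ?q' t + \<epsilon>) + 0 * (\<alpha> (Suc n) t - ?\<Psi> (Suc n) t)"
        unfolding distrib_left[of "exp (\<kappa> * t)" "2 * C * ?q' t"] mult_zero_left using d1 d2 d3 d4 by linarith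
    next
      have cq: "continuous_on {0..} (q (Suc n))" unfolding q_def[abs_def] by (intro continuous_intros)
      show "continuous_on {0..} (\<lambda>t. \<kappa> * ?\<Psi> (Suc n) t + exp (\<kappa> * t) * (2 * C * ?q' t + \<epsilon>))"
        by (intro continuous_intros cq) (use qpos[of _ "Suc n"] in \<open>auto dest!: less_imp_neq[symmetric]\<close>)
    qed
  qed
  from this[OF r] show ?thesis unfolding \<alpha>_def C_def q_def by simp
qed

text \<open>Both solutions are compared with the scheme after \<open>Suc N\<close> steps of size t /
  (Suc N), so that t - n \<tau> = 0. As N grows the root vanishes and only the cut-off contribution
  remains, once for each solution.\<close>

lemma kruzhkov_solutions_close:
  assumes sol: "kruzhkov_solution R \<rho>" "kruzhkov_solution R' \<rho>'" and t: "t > 0"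
  shows "(LINT x|lborel. \<theta> x * (s x * \<bar>\<rho> t x - \<rho>' t x\<bar>)) \<le> 2 * exp (\<kappa> * t) * (\<epsilon> * t)"
proof -
  define \<tau> where "\<tau> N = t / real (Suc N)" for N
  have tp: "\<tau> N > 0" for N using t by (simp add: \<tau>_def)
  have t0: "\<tau> \<longlonglongrightarrow> 0" unfolding \<tau>_def using LIMSEQ_Suc[OF lim_const_over_n] .
  let ?u = "\<lambda>N. 2 * (exp (\<kappa> * t) * (2 * (\<Theta> * M) * sqrt (t * \<tau> N + (\<tau> N)\<^sup>2) + \<epsilon> * t))"
  have le: "(LINT x|lborel. \<theta> x * (s x * \<bar>\<rho> t x - \<rho>' t x\<bar>)) \<le> ?u N" if kt: "\<kappa> * \<tau> N \<le> 1" for N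
  proof -
    let ?V = "scheme (\<tau> N) (Suc N)"
    have bV: "bounded_borel ?V" by (rule scheme_bounded_borel[OF tp])
    have z: "t - real (Suc N) * \<tau> N = 0" by (simp add: \<tau>_def)
    have g: "gap \<theta> \<rho> ?V t \<le> exp (\<kappa> * t) * (2 * (\<Theta> * M) * sqrt (t * \<tau> N + (\<tau> N)\<^sup>2) + \<epsilon> * t)"
      "gap \<theta> \<rho>' ?V t \<le> exp (\<kappa> * t) * (2 * (\<Theta> * M) * sqrt (t * \<tau> N + (\<tau> N)\<^sup>2) + \<epsilon> * t)"
      using gap_estimate[OF sol(1) tp kt, of t "Suc N"] gap_estimate[OF sol(2) tp kt, of t "Suc N"] t unfolding z by simp_all
    have br: "bounded_borel (\<rho> t)" "bounded_borel (\<rho>' t)" using slice_bounded_borel[OF sol(1)] slice_bounded_borel[OF sol(2)] t by simp_all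
    have "(LINT x|lborel. \<theta> x * (s x * \<bar>\<rho> t x - \<rho>' t x\<bar>))
       \<le> (LINT x|lborel. \<theta> x * (s x * \<bar>\<rho> t x - ?V x\<bar>) + \<theta> x * (s x * \<bar>\<rho>' t x - ?V x\<bar>))"
    proof (rule integral_mono)
      show "integrable lborel (\<lambda>x. \<theta> x * (s x * \<bar>\<rho> t x - \<rho>' t x\<bar>))" by (intro weight_mass_integrable bounded_borel_diff br)
      show "integrable lborel (\<lambda>x. \<theta> x * (s x * \<bar>\<rho> t x - ?V x\<bar>) + \<theta> x * (s x * \<bar>\<rho>' t x - ?V x\<bar>))"
        by (intro Bochner_Integration.integrable_add weight_mass_integrable bounded_borel_diff br bV)
      show "\<theta> x * (s x * \<bar>\<rho> t x - \<rho>' t x\<bar>) \<le> \<theta> x * (s x * \<bar>\<rho> t x - ?V x\<bar>) + \<theta> x * (s x * \<bar>\<rho>' t x - ?V x\<bar>)" for x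
        unfolding distrib_left[symmetric] using th(2)[of x] s_pos[of x] by (intro mult_left_mono; linarith)
    qed
    also have "\<dots> = gap \<theta> \<rho> ?V t + gap \<theta> \<rho>' ?V t"
      unfolding gap_def using t
      by (simp add: Bochner_Integration.integral_add weight_mass_integrable[OF bounded_borel_diff[OF br(1) bV]]
        weight_mass_integrable[OF bounded_borel_diff[OF br(2) bV]])
    finally show ?thesis using g by linarith
  qed
  have "(\<lambda>N. \<kappa> * \<tau> N) \<longlonglongrightarrow> \<kappa> * 0" by (intro tendsto_intros t0)
  then have "\<forall>\<^sub>F N in sequentially. \<kappa> * \<tau> N < 1" by (rule order_tendstoD(2)) simp
  then have ev: "\<forall>\<^sub>F N in sequentially. (LINT x|lborel. \<theta> x * (s x * \<bar>\<rho> t x - \<rho>' t x\<bar>)) \<le> ?u N"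
    by eventually_elim (rule le, erule less_imp_le)
  have "?u \<longlonglongrightarrow> 2 * (exp (\<kappa> * t) * (2 * (\<Theta> * M) * sqrt (t * 0 + 0\<^sup>2) + \<epsilon> * t))" by (intro tendsto_intros t0)
  from tendsto_lowerbound[OF this ev] show ?thesis by (simp add: mult.assoc)
qed

end

text \<open>The weight is exp x between a cut-off near -c and one just beyond \<open>m\<close>. The
  left cut-off lets in at most a multiple of exp(1 - c), which vanishes as c grows; on the right the
  weight falls and helps. On [-m, m] the weight is at least exp(-m).\<close>

lemma kruzhkov_solution_unique:
  assumes sol: "kruzhkov_solution R \<rho>" "kruzhkov_solution R' \<rho>'" and t: "t > 0"
  shows "AE x in lborel. \<rho> t x = \<rho>' t x"
proof (rule AE_lborel_of_Icc)
  fix m :: nat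
  define c where "c n = real m + 1 + real n" for n
  define F where "F = f B - f A"
  have F0: "F \<ge> 0" using f_mono[OF A_le_B] by (simp add: F_def)
  let ?r = "\<lambda>c x. ramp (x + c) * (1 - ramp (x - m))"
  let ?th = "\<lambda>c x. exp x * ?r c x"
  let ?th' = "\<lambda>c x. exp x * ?r c x + exp x * (ramp' (x + c) * (1 - ramp (x - m)) - ramp (x + c) * ramp' (x - m))"
  \<comment> \<open>The left ramp acts on the unit interval [-c, 1 - c], where \<open>ramp'\<close>
    is at most 2 and exp x at most exp(1 - c).\<close>
  let ?E = "\<lambda>c x. indicator {-c..1 - c} x * (2 * exp (1 - c)) :: real"
  have br: "bounded_borel (\<rho> t)" "bounded_borel (\<rho>' t)"
    using sol t unfolding kruzhkov_solution_def by (intro range_bounded_borel; auto)+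
  let ?g = "\<lambda>x. s x * \<bar>\<rho> t x - \<rho>' t x\<bar>"
  have bg: "bounded_borel ?g" by (intro bounded_borel_intros s_bounded_borel br)
  have ig: "integrable lborel (\<lambda>x. indicator {-real m..real m} x * ?g x)"
    using bounded_borel_Icc[OF bg, of "- real m" "real m"] by (simp add: set_integrable_def)
  have rr: "0 \<le> ?r c x" "?r c x \<le> 1" for c x
    using ramp_range[of "x + c"] ramp_range[of "x - m"] by (auto intro: mult_le_one)
  have C: "C1c (?th c) (?th' c)" if cm: "c \<ge> m + 1" for c :: real
    unfolding C1c_def
  proof (intro conjI allI)
    fix x
    have D: "((\<lambda>x. ramp (x + c)) has_real_derivative ramp' (x + c)) (at x)" for c x :: real
      using DERIV_shift[of ramp "ramp' (x + c)" x c] ramp_deriv by simp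
    show "(?th c has_real_derivative ?th' c x) (at x)"
      using D[of c x] D[of "- real m" x] by (auto intro!: derivative_eq_intros simp: algebra_simps)
  next
    show "continuous_on UNIV (?th' c)"
      by (intro continuous_intros continuous_on_compose2[OF ramp'_continuous[of UNIV]] continuous_on_compose2[OF ramp_continuous[of UNIV]]) auto
    show "\<exists>K. \<forall>x. K \<le> \<bar>x\<bar> \<longrightarrow> ?th c x = 0 \<and> ?th' c x = 0"
    proof (intro exI[of _ "c + 1"] allI impI)
      fix x assume "c + 1 \<le> \<bar>x\<bar>"
      then have "x + c \<le> 0 \<or> x - m \<ge> 1" using cm by linarith
      then show "?th c x = 0 \<and> ?th' c x = 0" by (auto simp: ramp_values)
    qed
  qed
  have z: "?th c x = 0" if cm: "c \<ge> m + 1" and x: "\<bar>x\<bar> \<ge> c + 1" for c x :: real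
  proof -
    have "x + c \<le> 0 \<or> x - m \<ge> 1" using cm x by linarith
    then show ?thesis by (auto simp: ramp_values)
  qed
  have key: "exp (- real m) * (LINT x:{-real m..real m}|lborel. ?g x) \<le> 2 * exp (\<kappa> * t) * (F * (2 * exp (1 - c n)) * t)" for n
  proof -
    have cm: "c n \<ge> m + 1" by (simp add: c_def)
    have IE: "(LINT x|lborel. ?E (c n) x) = 2 * exp (1 - c n)" by simp
    have "(LINT x|lborel. ?th (c n) x * ?g x) \<le> 2 * exp (\<kappa> * t) * (F * (2 * exp (1 - c n)) * t)"
    proof (rule kruzhkov_solutions_close[OF C[OF cm] _ _ _ _ _ _ _ _ sol t])
      show "0 \<le> ?th (c n) x" for x using rr[of x "c n"] by simp
      show "?th (c n) x \<le> exp (real m + 1)" for x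
      proof (cases "x \<ge> m + 1")
        case True then show ?thesis by (simp add: ramp_values)
      next
        case False
        then have "exp x * ?r (c n) x \<le> exp (real m + 1) * 1" using rr[of x "c n"] by (intro mult_mono) auto
        then show ?thesis by simp
      qed
      show "bounded_borel (?E (c n))"
        by (rule bounded_borelI[of _ "2 * exp (1 - c n)"]) (auto simp: indicator_def)
      show "0 \<le> ?E (c n) x" for x by (simp add: indicator_def)
      show "?th' (c n) x \<le> ?th (c n) x + ?E (c n) x" for x
      proof -
        have "ramp (x + c n) * ramp' (x - m) \<ge> 0" by (simp add: ramp_range ramp_values)
        moreover have "exp x * (ramp' (x + c n) * (1 - ramp (x - m))) \<le> ?E (c n) x"
        proof (cases "x \<in> {- c n..1 - c n}")
          case True
          have "ramp' (x + c n) * (1 - ramp (x - m)) \<le> 2 * 1"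
            using ramp_range[of "x - m"] ramp_values(5,6)[of "x + c n"] by (intro mult_mono) auto
          then have "exp x * (ramp' (x + c n) * (1 - ramp (x - m))) \<le> exp (1 - c n) * 2"
            using True ramp_range[of "x - m"] ramp_values(5)[of "x + c n"] by (intro mult_mono) auto
          then show ?thesis using True by simp
        next
          case False
          then have "ramp' (x + c n) = 0" using ramp_values(3,4)[of "x + c n"] by fastforce
          then show ?thesis by (simp add: indicator_def)
        qed
        ultimately have "exp x * (ramp' (x + c n) * (1 - ramp (x - m))) - exp x * (ramp (x + c n) * ramp' (x - m)) \<le> ?E (c n) x"
          using exp_ge_zero[of x] mult_nonneg_nonneg[of "exp x" "ramp (x + c n) * ramp' (x - m)"] by linarith
        then show ?thesis by (simp add: right_diff_distrib)
      qed
      show "?th (c n) x = 0" if "\<bar>x\<bar> \<ge> c n + 1" for x by (rule z[OF cm that])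
      show "?E (c n) x = 0" if "\<bar>x\<bar> \<ge> c n + 1" for x using that by (auto simp: indicator_def c_def)
      show "F * (2 * exp (1 - c n)) = (f B - f A) * (LINT x|lborel. ?E (c n) x)" unfolding IE F_def ..
    qed
    moreover have "exp (- real m) * (LINT x:{-real m..real m}|lborel. ?g x) \<le> (LINT x|lborel. ?th (c n) x * ?g x)"
    proof -
      have "(LINT x|lborel. exp (- real m) * (indicator {-real m..real m} x * ?g x)) \<le> (LINT x|lborel. ?th (c n) x * ?g x)"
      proof (rule integral_mono)
        show "integrable lborel (\<lambda>x. exp (- real m) * (indicator {-real m..real m} x * ?g x))" using ig by simp
        show "integrable lborel (\<lambda>x. ?th (c n) x * ?g x)"
        proof (rule LINT_compact_support(1)[of _ "c n + 1"])
          show "bounded_borel (\<lambda>x. ?th (c n) x * ?g x)"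
            by (rule bounded_borel_mult[OF C1c_bounded_borel(1)[OF C[OF cm]] bg])
        qed (use z[OF cm] in simp)
        fix x
        have g0: "?g x \<ge> 0" using s_pos[of x] by simp
        show "exp (- real m) * (indicator {-real m..real m} x * ?g x) \<le> ?th (c n) x * ?g x"
        proof (cases "x \<in> {-real m..real m}")
          case True
          then have "?r (c n) x = 1" by (simp add: ramp_values c_def)
          then show ?thesis using True g0 by (auto intro!: mult_right_mono)
        next
          case False
          then show ?thesis using rr[of x "c n"] g0 by simp
        qed
      qed
      then show ?thesis by (simp add: set_lebesgue_integral_def)
    qed
    ultimately show ?thesis by linarith
  qed
  have "(\<lambda>n. exp (1 - c n)) = (\<lambda>n. exp (- real m) * exp (- real n))" by (simp add: c_def mult_exp_exp)
  moreover have "(\<lambda>n. exp (- real n)) \<longlonglongrightarrow> 0"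
    by (rule filterlim_compose[OF exp_at_bot]) (simp add: filterlim_uminus_at_bot filterlim_real_sequentially)
  ultimately have "(\<lambda>n. exp (1 - c n)) \<longlonglongrightarrow> 0" using tendsto_mult_right_zero by auto
  then have "(\<lambda>n. 2 * exp (\<kappa> * t) * (F * (2 * exp (1 - c n)) * t)) \<longlonglongrightarrow> 2 * exp (\<kappa> * t) * (F * (2 * 0) * t)"
    by (intro tendsto_intros)
  from tendsto_lowerbound[OF this always_eventually[OF allI[OF key]]]
  have i1: "(LINT x:{-real m..real m}|lborel. ?g x) \<le> 0" by (simp add: mult_le_0_iff)
  have g0: "0 \<le> indicator {-real m..real m} x * ?g x" for x using s_pos[of x] by simp
  have i2: "0 \<le> (LINT x:{-real m..real m}|lborel. ?g x)"
    using g0 by (simp add: set_lebesgue_integral_def Bochner_Integration.integral_nonneg)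
  from antisym[OF i1 i2] have "(LINT x|lborel. indicator {-real m..real m} x * ?g x) = 0" by (simp add: set_lebesgue_integral_def)
  then have "AE x in lborel. indicator {-real m..real m} x * ?g x = 0"
    using integral_nonneg_eq_0_iff_AE[OF ig] g0 by simp
  then show "AE x in lborel. x \<in> {-real m..real m} \<longrightarrow> \<rho> t x = \<rho>' t x"
  proof eventually_elim
    case (elim x)
    then show ?case using s_pos[of x] by auto
  qed
qed

end

section \<open>Product tests, smooth functions on the plane, and Borel representatives\<close>

lemma product_test:
  assumes \<theta>: "C1c \<theta> \<theta>'" and \<beta>: "time_test \<beta> \<beta>'"
  defines "\<psi> \<equiv> \<lambda>z :: real \<times> real. \<theta> (fst z) * \<beta> (snd z)"
  shows "Ck_on 1 UNIV \<psi>" "supported_in_upper_half \<psi>"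
    "dx \<psi> = (\<lambda>z. \<theta>' (fst z) * \<beta> (snd z))" "dt \<psi> = (\<lambda>z. \<theta> (fst z) * \<beta>' (snd z))"
proof -
  have bC: "C1c \<beta> \<beta>'" using \<beta> by (simp add: time_test_def)
  have d: "(\<theta> has_real_derivative \<theta>' x) (at x)" "(\<beta> has_real_derivative \<beta>' x) (at x)" for x
    using \<theta> bC unfolding C1c_def by blast+
  note c = C1c_continuous[OF \<theta>] C1c_continuous[OF bC]
  have "has_gradient_on UNIV \<psi> (\<lambda>z. \<theta>' (fst z) * \<beta> (snd z)) (\<lambda>z. \<theta> (fst z) * \<beta>' (snd z))"
    unfolding has_gradient_on_def \<psi>_def
  proof
    fix z :: "real \<times> real"
    have "((\<lambda>z. \<theta> (fst z)) has_derivative (\<lambda>h. fst h * \<theta>' (fst z))) (at z)"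
      by (rule DERIV_compose_FDERIV[OF d(1)]) (rule has_derivative_fst[OF has_derivative_ident])
    moreover have "((\<lambda>z. \<beta> (snd z)) has_derivative (\<lambda>h. snd h * \<beta>' (snd z))) (at z)"
      by (rule DERIV_compose_FDERIV[OF d(2)]) (rule has_derivative_snd[OF has_derivative_ident])
    ultimately have "((\<lambda>z. \<theta> (fst z) * \<beta> (snd z)) has_derivative
        (\<lambda>h. \<theta> (fst z) * (snd h * \<beta>' (snd z)) + fst h * \<theta>' (fst z) * \<beta> (snd z))) (at z)"
      by (rule has_derivative_mult)
    then show "((\<lambda>z. \<theta> (fst z) * \<beta> (snd z)) has_derivative
        (\<lambda>h. \<theta>' (fst z) * \<beta> (snd z) * fst h + \<theta> (fst z) * \<beta>' (snd z) * snd h)) (at z within UNIV)"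
      by (simp add: algebra_simps)
  qed
  moreover have "continuous_on UNIV (\<lambda>z :: real \<times> real. \<theta>' (fst z) * \<beta> (snd z))" "continuous_on UNIV (\<lambda>z :: real \<times> real. \<theta> (fst z) * \<beta>' (snd z))"
    by (intro continuous_intros continuous_on_compose2[OF c(1)] continuous_on_compose2[OF c(2)]
      continuous_on_compose2[OF c(3)] continuous_on_compose2[OF c(4)]; simp)+
  ultimately show "Ck_on 1 UNIV \<psi>" unfolding One_nat_def Ck_on.simps by blast
  obtain K1 where K1: "\<forall>x. \<bar>x\<bar> \<ge> K1 \<longrightarrow> \<theta> x = 0 \<and> \<theta>' x = 0" using \<theta> unfolding C1c_def by blast
  obtain K2 where K2: "\<forall>x. \<bar>x\<bar> \<ge> K2 \<longrightarrow> \<beta> x = 0 \<and> \<beta>' x = 0" using bC unfolding C1c_def by blast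
  obtain t0 where t0: "t0 > 0" "\<forall>t\<le>t0. \<beta> t = 0 \<and> \<beta>' t = 0" using \<beta> unfolding time_test_def by blast
  have sub: "{z. \<psi> z \<noteq> 0} \<subseteq> {-K1..K1} \<times> {t0..K2}"
  proof
    fix z assume "z \<in> {z. \<psi> z \<noteq> 0}"
    then have nz: "\<theta> (fst z) \<noteq> 0" "\<beta> (snd z) \<noteq> 0" by (auto simp: \<psi>_def)
    have "\<not> K1 \<le> \<bar>fst z\<bar>" "\<not> K2 \<le> \<bar>snd z\<bar>" "\<not> snd z \<le> t0" using nz K1 K2 t0(2) by blast+
    then have "fst z \<in> {-K1..K1}" "snd z \<in> {t0..K2}" by auto
    then show "z \<in> {-K1..K1} \<times> {t0..K2}" by (simp add: mem_Times_iff)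
  qed
  have cp: "compact ({-K1..K1} \<times> {t0..K2})" by (intro compact_Times compact_Icc)
  have "bounded {z. \<psi> z \<noteq> 0}" by (rule bounded_subset[OF compact_imp_bounded[OF cp] sub])
  moreover have "closure {z. \<psi> z \<noteq> 0} \<subseteq> {-K1..K1} \<times> {t0..K2}" by (rule closure_minimal[OF sub compact_imp_closed[OF cp]])
  then have "closure {z. \<psi> z \<noteq> 0} \<subseteq> UNIV \<times> {0<..}" using t0(1) by auto
  ultimately show "supported_in_upper_half \<psi>" by (simp add: supported_in_upper_half_def compact_closure)
  show "dx \<psi> = (\<lambda>z. \<theta>' (fst z) * \<beta> (snd z))"
    unfolding dx_def \<psi>_def by (auto intro!: DERIV_imp_deriv DERIV_cmult_right d)
  show "dt \<psi> = (\<lambda>z. \<theta> (fst z) * \<beta>' (snd z))"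
    unfolding dt_def \<psi>_def by (auto intro!: DERIV_imp_deriv DERIV_cmult d)
qed

lemma has_gradient_on_continuous: "has_gradient_on S f f1 f2 \<Longrightarrow> continuous_on S f"
  unfolding has_gradient_on_def continuous_on_eq_continuous_within by (blast intro: has_derivative_continuous)

lemma has_gradient_on_add:
  assumes "has_gradient_on S f f1 f2" "has_gradient_on S g g1 g2"
  shows "has_gradient_on S (\<lambda>z. f z + g z) (\<lambda>z. f1 z + g1 z) (\<lambda>z. f2 z + g2 z)"
  unfolding has_gradient_on_def
proof
  fix z assume "z \<in> S"
  then have "((\<lambda>z. f z + g z) has_derivative (\<lambda>h. (f1 z * fst h + f2 z * snd h) + (g1 z * fst h + g2 z * snd h))) (at z within S)"
    using assms unfolding has_gradient_on_def by (intro has_derivative_add) blast+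
  then show "((\<lambda>z. f z + g z) has_derivative (\<lambda>h. (f1 z + g1 z) * fst h + (f2 z + g2 z) * snd h)) (at z within S)"
    by (simp add: algebra_simps)
qed

lemma has_gradient_on_mult:
  assumes "has_gradient_on S f f1 f2" "has_gradient_on S g g1 g2"
  shows "has_gradient_on S (\<lambda>z. f z * g z) (\<lambda>z. f1 z * g z + f z * g1 z) (\<lambda>z. f2 z * g z + f z * g2 z)"
  unfolding has_gradient_on_def
proof
  fix z assume "z \<in> S"
  then have "((\<lambda>z. f z * g z) has_derivative (\<lambda>h. f z * (g1 z * fst h + g2 z * snd h) + (f1 z * fst h + f2 z * snd h) * g z)) (at z within S)"
    using assms unfolding has_gradient_on_def by (intro has_derivative_mult) blast+
  then show "((\<lambda>z. f z * g z) has_derivative (\<lambda>h. (f1 z * g z + f z * g1 z) * fst h + (f2 z * g z + f z * g2 z) * snd h)) (at z within S)"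
    by (simp add: algebra_simps)
qed

lemma has_gradient_on_const: "has_gradient_on S (\<lambda>z. c) (\<lambda>z. 0) (\<lambda>z. 0)"
  and has_gradient_on_fst: "has_gradient_on S fst (\<lambda>z. 1) (\<lambda>z. 0)"
  and has_gradient_on_snd: "has_gradient_on S snd (\<lambda>z. 0) (\<lambda>z. 1)"
  unfolding has_gradient_on_def by (auto intro: has_derivative_fst has_derivative_snd)

lemma has_gradient_on_chain:
  assumes "has_gradient_on S f f1 f2" "\<And>z. z \<in> S \<Longrightarrow> (p has_real_derivative p' z) (at (f z))"
  shows "has_gradient_on S (\<lambda>z. p (f z)) (\<lambda>z. p' z * f1 z) (\<lambda>z. p' z * f2 z)"
  unfolding has_gradient_on_def
proof
  fix z assume z: "z \<in> S"
  then have "(f has_derivative (\<lambda>h. f1 z * fst h + f2 z * snd h)) (at z within S)"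
    using assms(1) unfolding has_gradient_on_def by blast
  from DERIV_compose_FDERIV[OF assms(2)[OF z] this]
  show "((\<lambda>z. p (f z)) has_derivative (\<lambda>h. p' z * f1 z * fst h + p' z * f2 z * snd h)) (at z within S)"
    by (simp add: algebra_simps)
qed

lemma Ck_on_Suc_imp: "Ck_on (Suc k) S f \<Longrightarrow> Ck_on k S f"
proof (induction k arbitrary: f)
  case 0 then show ?case by (auto intro: has_gradient_on_continuous)
next
  case (Suc k)
  then obtain f1 f2 where "has_gradient_on S f f1 f2" "Ck_on (Suc k) S f1" "Ck_on (Suc k) S f2"
    unfolding Ck_on.simps(2)[of "Suc k"] by blast
  then show ?case using Suc.IH unfolding Ck_on.simps(2)[of k S f] by blast
qed

lemma Ck_on_const: "Ck_on k S (\<lambda>z. c)"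
proof (induction k arbitrary: c)
  case (Suc k) then show ?case using has_gradient_on_const[of S c] unfolding Ck_on.simps(2) by blast
qed simp

lemma Ck_on_fst: "Ck_on k S fst" and Ck_on_snd: "Ck_on k S snd"
proof -
  show "Ck_on k S fst"
  proof (cases k)
    case (Suc j) then show ?thesis using has_gradient_on_fst[of S] Ck_on_const[of j S] unfolding Suc Ck_on.simps(2) by blast
  qed (auto intro: continuous_intros)
  show "Ck_on k S snd"
  proof (cases k)
    case (Suc j) then show ?thesis using has_gradient_on_snd[of S] Ck_on_const[of j S] unfolding Suc Ck_on.simps(2) by blast
  qed (auto intro: continuous_intros)
qed

lemma Ck_on_add: "Ck_on k S f \<Longrightarrow> Ck_on k S g \<Longrightarrow> Ck_on k S (\<lambda>z. f z + g z)"
proof (induction k arbitrary: f g)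
  case 0 then show ?case by (auto intro: continuous_on_add)
next
  case (Suc k)
  from Suc.prems obtain f1 f2 g1 g2 where "has_gradient_on S f f1 f2" "Ck_on k S f1" "Ck_on k S f2"
    "has_gradient_on S g g1 g2" "Ck_on k S g1" "Ck_on k S g2" unfolding Ck_on.simps(2) by blast
  then show ?case using has_gradient_on_add[of S f f1 f2 g g1 g2] Suc.IH[of f1 g1] Suc.IH[of f2 g2] unfolding Ck_on.simps(2) by blast
qed

lemma Ck_on_mult: "Ck_on k S f \<Longrightarrow> Ck_on k S g \<Longrightarrow> Ck_on k S (\<lambda>z. f z * g z)"
proof (induction k arbitrary: f g)
  case 0 then show ?case by (auto intro: continuous_on_mult)
next
  case (Suc k)
  from Suc.prems obtain f1 f2 g1 g2 where G: "has_gradient_on S f f1 f2" "Ck_on k S f1" "Ck_on k S f2"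
    "has_gradient_on S g g1 g2" "Ck_on k S g1" "Ck_on k S g2" unfolding Ck_on.simps(2) by blast
  note fg = Suc.prems[THEN Ck_on_Suc_imp]
  have "Ck_on k S (\<lambda>z. f1 z * g z + f z * g1 z)" "Ck_on k S (\<lambda>z. f2 z * g z + f z * g2 z)"
    by (intro Ck_on_add Suc.IH G fg)+
  then show ?case using has_gradient_on_mult[OF G(1) G(4)] unfolding Ck_on.simps(2) by blast
qed

lemma smooth_on_const: "smooth_on S (\<lambda>z. c)" and smooth_on_fst: "smooth_on S fst" and smooth_on_snd: "smooth_on S snd"
  by (simp_all add: smooth_on_def Ck_on_const Ck_on_fst Ck_on_snd)

lemma smooth_on_add: "smooth_on S f \<Longrightarrow> smooth_on S g \<Longrightarrow> smooth_on S (\<lambda>z. f z + g z)"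
  and smooth_on_mult: "smooth_on S f \<Longrightarrow> smooth_on S g \<Longrightarrow> smooth_on S (\<lambda>z. f z * g z)"
  by (simp_all add: smooth_on_def Ck_on_add Ck_on_mult)

text \<open>A derivative of a power is a power with exponent lowered by one times a smooth factor,
  so the induction on the order runs over all exponents simultaneously.\<close>

lemma smooth_on_powr:
  assumes N: "has_gradient_on S N N1 N2" "smooth_on S N1" "smooth_on S N2" and pos: "\<And>z. z \<in> S \<Longrightarrow> N z > 0"
  shows "smooth_on S (\<lambda>z. N z powr \<alpha>)"
proof -
  have gr: "has_gradient_on S (\<lambda>z. N z powr \<alpha>) (\<lambda>z. \<alpha> * N z powr (\<alpha> - 1) * N1 z) (\<lambda>z. \<alpha> * N z powr (\<alpha> - 1) * N2 z)" for \<alpha>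
    by (rule has_gradient_on_chain[OF N(1)]) (rule has_real_derivative_powr[OF pos])
  have "Ck_on k S (\<lambda>z. N z powr \<alpha>)" for k
  proof (induction k arbitrary: \<alpha>)
    case 0 then show ?case using has_gradient_on_continuous[OF gr] by simp
  next
    case (Suc k)
    have "Ck_on k S (\<lambda>z. \<alpha> * N z powr (\<alpha> - 1) * N1 z)" "Ck_on k S (\<lambda>z. \<alpha> * N z powr (\<alpha> - 1) * N2 z)"
      using N(2,3) by (intro Ck_on_mult Ck_on_const Suc.IH; simp add: smooth_on_def)+
    then show ?case using gr[of \<alpha>] unfolding Ck_on.simps(2) by blast
  qed
  then show ?thesis by (simp add: smooth_on_def)
qed

text \<open>On a bounded window the two functions are densities of finite measures that agree on all
  rays; such measures coincide, and densities are unique up to null sets.\<close>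

lemma AE_eq_of_interval_integrals:
  assumes h: "bounded_borel h1" "bounded_borel h2" "\<And>x. 0 \<le> h1 x" "\<And>x. 0 \<le> h2 x"
    and eq: "\<And>p q. p \<le> q \<Longrightarrow> (LINT x:{p<..q}|lborel. h1 x) = (LINT x:{p<..q}|lborel. h2 x)"
  shows "AE x in lborel. h1 x = h2 x"
proof (rule AE_lborel_of_Icc)
  fix m :: nat
  \<comment> \<open>The window is open on the left, so it starts below -m in order to contain all of
    [-m, m].\<close>
  let ?h = "\<lambda>h x. indicator {-real m - 1<..real m} x * (h x :: real)"
  let ?N = "\<lambda>h. density lborel (\<lambda>x. ennreal (?h h x))"
  have i: "integrable lborel (?h h)" if "bounded_borel h" for h
    using set_integrable_subset[OF bounded_borel_Icc[OF that, of "-real m - 1" "real m"], of "{-real m - 1<..real m}"]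
    by (simp add: set_integrable_def greaterThanAtMost_subseteq_atLeastAtMost_iff)
  have i2: "integrable lborel (\<lambda>x. ?h h x * indicator {y<..} x)" if "bounded_borel h" for h y
    by (rule integrable_mult_indicator[OF _ i[OF that], where A="{y<..}", simplified, THEN Bochner_Integration.integrable_cong[THEN iffD1, rotated -1]])
       (auto simp: mult.commute)
  have em: "emeasure (?N h) {y<..} = ennreal (LINT x|lborel. ?h h x * indicator {y<..} x)"
    if hb: "bounded_borel h" and h0: "\<And>x. 0 \<le> h x" for h y
  proof -
    have m: "(\<lambda>x. ennreal (?h h x)) \<in> borel_measurable lborel" using i[OF hb] by simp
    have "emeasure (?N h) {y<..} = (\<integral>\<^sup>+x. ennreal (?h h x) * indicator {y<..} x \<partial>lborel)"
      by (rule emeasure_density[OF m]) simp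
    also have "\<dots> = (\<integral>\<^sup>+x. ennreal (?h h x * indicator {y<..} x) \<partial>lborel)"
      by (rule nn_integral_cong) (auto simp: indicator_def)
    also have "\<dots> = ennreal (LINT x|lborel. ?h h x * indicator {y<..} x)"
      by (rule nn_integral_eq_integral[OF i2[OF hb]]) (use h0 in auto)
    finally show ?thesis .
  qed
  have "?N h1 = ?N h2"
  proof (rule measure_eqI_lessThan)
    show "emeasure (?N h1) {y<..} < \<infinity>" for y by (simp add: em[OF h(1,3)])
    show "emeasure (?N h1) {y<..} = emeasure (?N h2) {y<..}" for y
    proof -
      let ?y = "max y (-real m - 1)"
      have e: "(LINT x|lborel. ?h h x * indicator {y<..} x) = (LINT x:{min ?y (real m)<..real m}|lborel. h x)" for h
        unfolding set_lebesgue_integral_def by (rule Bochner_Integration.integral_cong) (auto simp: indicator_def)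
      show ?thesis unfolding em[OF h(1,3)] em[OF h(2,4)] e by (subst eq) auto
    qed
  qed simp_all
  then have "AE x in lborel. ennreal (?h h1 x) = ennreal (?h h2 x)"
    by (subst (asm) sigma_finite_measure.density_unique_iff[OF lborel.sigma_finite_measure_axioms]) (use i[OF h(1)] i[OF h(2)] in auto)
  then show "AE x in lborel. x \<in> {-real m..real m} \<longrightarrow> h1 x = h2 x"
  proof eventually_elim
    case (elim x)
    then show ?case using h(3,4)[of x] by (auto simp: indicator_def split: if_splits)
  qed
qed

text \<open>Differences of two steep ramps decrease the problem to interval integrals: they converge
  pointwise to the indicator of (p, q].\<close>

lemma AE_eq_of_test_integrals:
  assumes h: "bounded_borel h1" "bounded_borel h2" "\<And>x. 0 \<le> h1 x" "\<And>x. 0 \<le> h2 x"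
    and eq: "\<And>\<theta> \<theta>'. C1c \<theta> \<theta>' \<Longrightarrow> (\<And>x. 0 \<le> \<theta> x) \<Longrightarrow> (LINT x|lborel. \<theta> x * h1 x) = (LINT x|lborel. \<theta> x * h2 x)"
  shows "AE x in lborel. h1 x = h2 x"
proof (rule AE_eq_of_interval_integrals[OF h])
  fix p q :: real assume pq: "p \<le> q"
  define d :: "nat \<Rightarrow> real" where "d n = 1 / real (Suc n)" for n
  have d: "d n > 0" "d n \<le> 1" for n by (simp_all add: d_def)
  \<comment> \<open>A shift that makes the left end positive, as \<open>ramp_time_test\<close>
    demands; \<open>C1c\<close> is unaffected by translation.\<close>
  let ?c = "1 + \<bar>p\<bar>"
  let ?b = "\<lambda>n x. ramp ((x - p) / d n) - ramp ((x - q) / d n)"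
  let ?b' = "\<lambda>n x. (ramp' ((x - p) / d n) - ramp' ((x - q) / d n)) / d n"
  have C: "C1c (?b n) (?b' n)" for n
  proof -
    have T: "C1c (\<lambda>t. ramp ((t - (p + ?c)) / d n) - ramp ((t - (q + ?c)) / d n))
        (\<lambda>t. (ramp' ((t - (p + ?c)) / d n) - ramp' ((t - (q + ?c)) / d n)) / d n)"
      using ramp_time_test[of "p + ?c" "q + ?c" "d n"] pq d(1)[of n] by (simp add: time_test_def)
    obtain K where K: "\<forall>t. \<bar>t\<bar> \<ge> K \<longrightarrow> ramp ((t - (p + ?c)) / d n) - ramp ((t - (q + ?c)) / d n) = 0 \<and>
        (ramp' ((t - (p + ?c)) / d n) - ramp' ((t - (q + ?c)) / d n)) / d n = 0" using T unfolding C1c_def by blast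
    show ?thesis unfolding C1c_def
    proof (intro conjI allI)
      fix x
      have "((\<lambda>t. ramp ((t - (p + ?c)) / d n) - ramp ((t - (q + ?c)) / d n)) has_real_derivative ?b' n x) (at (x + ?c))"
        using T[unfolded C1c_def, THEN conjunct1, rule_format, of "x + ?c"] by simp
      from this[unfolded DERIV_shift] show "(?b n has_real_derivative ?b' n x) (at x)" by simp
    next
      show "continuous_on UNIV (?b' n)"
        by (intro continuous_intros continuous_on_compose2[OF ramp'_continuous[of UNIV]]) (use d(1)[of n] in auto)
      show "\<exists>K. \<forall>x. K \<le> \<bar>x\<bar> \<longrightarrow> ?b n x = 0 \<and> ?b' n x = 0"
      proof (intro exI[of _ "K + ?c"] allI impI)
        fix x :: real assume "K + ?c \<le> \<bar>x\<bar>"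
        then have "K \<le> \<bar>x + ?c\<bar>" by linarith
        then show "?b n x = 0 \<and> ?b' n x = 0" using K[rule_format, of "x + ?c"] by simp
      qed
    qed
  qed
  have nn: "0 \<le> ?b n x" for n x
  proof -
    have "(x - q) / d n \<le> (x - p) / d n" using pq d(1)[of n] by (intro divide_right_mono) auto
    then show ?thesis using ramp_mono by simp
  qed
  have lim: "(\<lambda>n. LINT x|lborel. ?b n x * h x) \<longlonglongrightarrow> (LINT x:{p<..q}|lborel. h x)" if hb: "bounded_borel h" for h
    unfolding set_lebesgue_integral_def real_scaleR_def
  proof (rule integral_dominated_convergence[where w="\<lambda>x. indicator {p..q+1} x * \<bar>h x\<bar>"])
    note [measurable] = bounded_borel_measurable[OF hb]
    show "(\<lambda>x. indicator {p<..q} x * h x) \<in> borel_measurable lborel" by measurable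
    show "(\<lambda>x. ?b n x * h x) \<in> borel_measurable lborel" for n
      using C1c_bounded_borel(1)[OF C[of n], THEN bounded_borel_measurable] by simp
    show "integrable lborel (\<lambda>x. indicator {p..q+1} x * \<bar>h x\<bar>)"
      using bounded_borel_Icc[OF bounded_borel_abs[OF hb], of p "q + 1"] by (simp add: set_integrable_def)
    show "AE x in lborel. (\<lambda>n. ?b n x * h x) \<longlonglongrightarrow> indicator {p<..q} x * h x"
    proof (intro AE_I2 tendsto_mult_right)
      fix x
      have d0: "d \<longlonglongrightarrow> 0" unfolding d_def by (rule LIMSEQ_Suc[OF lim_1_over_n])
      have r: "(\<lambda>n. ramp ((x - c) / d n)) \<longlonglongrightarrow> (if x \<le> c then 0 else 1)" for c
      proof (cases "x \<le> c")
        case True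
        then show ?thesis using d(1) by (simp add: ramp_values divide_nonpos_pos)
      next
        case False
        then have "\<forall>\<^sub>F n in sequentially. d n < x - c" by (intro order_tendstoD(2)[OF d0]) simp
        then have "\<forall>\<^sub>F n in sequentially. ramp ((x - c) / d n) = 1"
          by eventually_elim (use d(1) in \<open>simp add: ramp_values le_divide_eq\<close>)
        then show ?thesis using False by (simp add: tendsto_eventually)
      qed
      have "(\<lambda>n. ?b n x) \<longlonglongrightarrow> (if x \<le> p then 0 else 1) - (if x \<le> q then 0 else 1)" by (rule tendsto_diff[OF r r])
      moreover have "(if x \<le> p then 0 else 1) - (if x \<le> q then 0 else 1) = (indicator {p<..q} x :: real)"
        using pq by (auto simp: indicator_def)
      ultimately show "(\<lambda>n. ?b n x) \<longlonglongrightarrow> indicator {p<..q} x" by simp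
    qed
    show "AE x in lborel. norm (?b n x * h x) \<le> indicator {p..q+1} x * \<bar>h x\<bar>" for n
    proof (intro AE_I2)
      fix x
      have "?b n x \<le> indicator {p..q+1} x"
      proof (cases "x \<in> {p..q+1}")
        case True
        then show ?thesis using ramp_range(2)[of "(x - p) / d n"] ramp_range(1)[of "(x - q) / d n"] by simp
      next
        case False
        then have "x \<le> p \<or> x \<ge> q + 1" by auto
        then show ?thesis
        proof
          assume "x \<le> p"
          then have "(x - p) / d n \<le> 0" "(x - q) / d n \<le> 0" using pq d(1)[of n] by (auto intro!: divide_nonpos_pos)
          then show ?thesis by (simp add: ramp_values)
        next
          assume "x \<ge> q + 1"
          then have "(x - p) / d n \<ge> 1" "(x - q) / d n \<ge> 1" using pq d[of n] by (auto simp: le_divide_eq)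
          then show ?thesis by (simp add: ramp_values)
        qed
      qed
      then show "norm (?b n x * h x) \<le> indicator {p..q+1} x * \<bar>h x\<bar>"
        using nn[of x n] by (auto simp: abs_mult intro!: mult_right_mono)
    qed
  qed
  have "(\<lambda>n. LINT x|lborel. ?b n x * h1 x) = (\<lambda>n. LINT x|lborel. ?b n x * h2 x)"
    using eq[OF C nn] by blast
  then show "(LINT x:{p<..q}|lborel. h1 x) = (LINT x:{p<..q}|lborel. h2 x)"
    using LIMSEQ_unique[OF lim[OF h(1)]] lim[OF h(2)] by simp
qed

lemma lebesgue_on_borel_version:
  fixes u :: "'a::euclidean_space \<Rightarrow> real"
  assumes u: "u \<in> borel_measurable (lebesgue_on S)" and S: "S \<in> sets borel"
  shows "\<exists>h\<in>borel_measurable borel. AE z in lborel. z \<in> S \<longrightarrow> h z = u z"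
proof -
  have "(\<lambda>z. indicator S z *\<^sub>R u z) \<in> borel_measurable lebesgue"
    using u S by (subst borel_measurable_restrict_space_iff[symmetric]) auto
  from completion_ex_borel_measurable_real[OF this]
  obtain h where h: "h \<in> borel_measurable lborel" "AE z in lborel. indicator S z *\<^sub>R u z = h z" by blast
  from h(2) have "AE z in lborel. z \<in> S \<longrightarrow> h z = u z" by eventually_elim (auto simp: indicator_def)
  then show ?thesis using h(1) by (intro bexI[of _ h]) auto
qed

lemma AE_plane_slices:
  assumes "AE z in lborel. P (z :: real \<times> real)"
  shows "AE t in lborel. AE x in lborel. P (x, t)"
proof -
  have "AE z in lborel \<Otimes>\<^sub>M lborel. P z" unfolding lborel_prod by (rule assms)
  then obtain N where N: "{z \<in> space (lborel \<Otimes>\<^sub>M lborel). \<not> P z} \<subseteq> N" "emeasure (lborel \<Otimes>\<^sub>M lborel) N = 0" "N \<in> sets (lborel \<Otimes>\<^sub>M lborel)"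
    by (rule AE_E)
  have "AE z in lborel \<Otimes>\<^sub>M lborel. z \<notin> N" using N(2,3) by (intro AE_not_in) (simp add: null_sets_def)
  then have "AE x in lborel. AE t in lborel. (x, t) \<notin> N" by (rule lborel_pair.AE_pair)
  moreover have "{z \<in> space (lborel \<Otimes>\<^sub>M lborel). (fst z, snd z) \<notin> N} \<in> sets (lborel \<Otimes>\<^sub>M lborel)"
  proof -
    have "{z \<in> space (lborel \<Otimes>\<^sub>M lborel). (fst z, snd z) \<notin> N} = space (lborel \<Otimes>\<^sub>M lborel) - N" by auto
    then show ?thesis using sets.Diff[OF sets.top N(3)] by simp
  qed
  ultimately have "AE t in lborel. AE x in lborel. (x, t) \<notin> N"
    using lborel_pair.AE_commute[of "\<lambda>x t. (x, t) \<notin> N"] by simp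
  then show ?thesis
  proof eventually_elim
    case (elim t)
    then show ?case by eventually_elim (use N(1) in \<open>auto simp: space_pair_measure\<close>)
  qed
qed

text \<open>A Borel version on the plane may be wrong on exceptional lines t = const, so every slice
  with t >= 0 receives its own version; Fubini gives agreement for almost every t. Truncation to
  [lo, hi] makes the range condition hold everywhere.\<close>

lemma slice_versions:
  fixes u :: "real \<times> real \<Rightarrow> real"
  assumes u: "u \<in> borel_measurable (lebesgue_on (UNIV \<times> {0..}))" and sl: "\<And>t. t \<ge> 0 \<Longrightarrow> (\<lambda>x. u (x, t)) \<in> borel_measurable lebesgue"
    and rng: "\<And>x t. t \<ge> 0 \<Longrightarrow> u (x, t) \<in> {lo..hi}"
  shows "\<exists>U V. U \<in> borel_measurable borel \<and> (\<forall>z. U z \<in> {lo..hi}) \<and> (AE z in lborel. z \<in> UNIV \<times> {0..} \<longrightarrow> U z = u z) \<and>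
    (\<forall>t\<ge>0. V t \<in> borel_measurable borel \<and> (\<forall>x. V t x \<in> {lo..hi}) \<and> (AE x in lborel. V t x = u (x, t))) \<and>
    (AE t in lborel. t \<ge> 0 \<longrightarrow> (AE x in lborel. U (x, t) = V t x))"
proof -
  have lohi: "lo \<le> hi" using rng[of 0 0] by simp
  define c where "c y = max lo (min hi y)" for y
  have cr: "c y \<in> {lo..hi}" for y using lohi by (auto simp: c_def)
  have ci: "c y = y" if "y \<in> {lo..hi}" for y using that by (auto simp: c_def)
  have [measurable]: "c \<in> borel_measurable borel" unfolding c_def[abs_def] by measurable
  have "UNIV \<times> {0 :: real..} \<in> sets (borel :: (real \<times> real) measure)" by (intro borel_closed closed_Times) auto
  from lebesgue_on_borel_version[OF u this]
  obtain U where U: "U \<in> borel_measurable borel" "AE z in lborel. z \<in> UNIV \<times> {0..} \<longrightarrow> U z = u z" by blast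
  have "\<exists>h. t \<ge> 0 \<longrightarrow> h \<in> borel_measurable borel \<and> (AE x in lborel. h x = u (x, t))" for t
  proof (cases "t \<ge> 0")
    case True
    from completion_ex_borel_measurable_real[OF sl[OF True]]
    obtain h where h: "h \<in> borel_measurable lborel" "AE x in lborel. u (x, t) = h x" by blast
    from h(2) have "AE x in lborel. h x = u (x, t)" by eventually_elim simp
    then show ?thesis using h(1) by auto
  qed blast
  then obtain V where V: "\<forall>t. t \<ge> 0 \<longrightarrow> V t \<in> borel_measurable borel \<and> (AE x in lborel. V t x = u (x, t))"
    using choice[of "\<lambda>t h. t \<ge> 0 \<longrightarrow> h \<in> borel_measurable borel \<and> (AE x in lborel. h x = u (x, t))"] by blast
  have Uc: "AE z in lborel. z \<in> UNIV \<times> {0..} \<longrightarrow> c (U z) = u z"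
    using U(2) by eventually_elim (use rng ci in auto)
  have Vc: "AE x in lborel. c (V t x) = u (x, t)" if t: "t \<ge> 0" for t
    using V[rule_format, OF t, THEN conjunct2] by eventually_elim (use rng[OF t] ci in simp)
  show ?thesis
  proof (intro exI[of _ "\<lambda>z. c (U z)"] exI[of _ "\<lambda>t x. c (V t x)"] conjI allI impI)
    show "(\<lambda>z. c (U z)) \<in> borel_measurable borel" using U(1) by measurable
    show "(\<lambda>x. c (V t x)) \<in> borel_measurable borel" if t: "t \<ge> 0" for t
      using V[rule_format, OF t, THEN conjunct1] by measurable
    from AE_plane_slices[OF Uc] show "AE t in lborel. t \<ge> 0 \<longrightarrow> (AE x in lborel. c (U (x, t)) = c (V t x))"
    proof eventually_elim
      case (elim t)
      show ?case
      proof
        assume t: "t \<ge> 0"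
        show "AE x in lborel. c (U (x, t)) = c (V t x)" using elim Vc[OF t] by eventually_elim (use t in simp)
      qed
    qed
  qed (use Uc Vc cr in simp_all)
qed

lemma L1loc_slice_measurable:
  assumes w: "L1loc_continuous_on T w" and t: "t \<in> T" shows "(\<lambda>x. w (x, t)) \<in> borel_measurable lebesgue"
proof (rule borel_measurable_LIMSEQ_metric)
  have i: "set_integrable lebesgue {-real n..real n} (\<lambda>x. w (x, t))" for n
    using w t compact_Icc unfolding L1loc_continuous_on_def by blast
  show "(\<lambda>x. indicator {-real n..real n} x *\<^sub>R w (x, t)) \<in> borel_measurable lebesgue" for n
    using i[of n] unfolding set_integrable_def by (rule borel_measurable_integrable)
  show "(\<lambda>n. indicator {-real n..real n} x *\<^sub>R w (x, t)) \<longlonglongrightarrow> w (x, t)" for x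
  proof (rule tendsto_eventually)
    obtain N :: nat where N: "\<bar>x\<bar> \<le> real N" using real_arch_simple by blast
    show "\<forall>\<^sub>F n in sequentially. indicator {-real n..real n} x *\<^sub>R w (x, t) = w (x, t)"
      using eventually_ge_at_top[of N]
    proof eventually_elim
      case (elim n)
      then have "x \<in> {-real n..real n}" using N by auto
      then show ?case by simp
    qed
  qed
qed

lemma L1loc_slice_tendsto:
  assumes w: "L1loc_continuous_on {0..} w" and t0: "t0 \<ge> 0" and C: "C \<ge> 0"
    and P: "\<And>t. t \<ge> 0 \<Longrightarrow> bounded_borel (P t)"
    and le: "\<And>t. t \<ge> 0 \<Longrightarrow> AE x in lborel. \<bar>P t x - P t0 x\<bar> \<le> C * norm (w (x, t) - w (x, t0))"
  shows "((\<lambda>t. LINT x:{-K..K}|lborel. \<bar>P t x - P t0 x\<bar>) \<longlongrightarrow> 0) (at t0 within {0..})"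
proof (rule Lim_null_comparison)
  have "((\<lambda>t. LINT x:{-K..K}|lebesgue. norm (w (x, t) - w (x, t0))) \<longlongrightarrow> 0) (at t0 within {0..})"
    using w t0 compact_Icc unfolding L1loc_continuous_on_def by blast
  then show "((\<lambda>t. C * (LINT x:{-K..K}|lebesgue. norm (w (x, t) - w (x, t0)))) \<longlongrightarrow> 0) (at t0 within {0..})"
    by (rule tendsto_mult_right_zero)
  have "norm (LINT x:{-K..K}|lborel. \<bar>P t x - P t0 x\<bar>) \<le> C * (LINT x:{-K..K}|lebesgue. norm (w (x, t) - w (x, t0)))" if t: "t \<ge> 0" for t
  proof -
    have i: "set_integrable lebesgue {-K..K} (\<lambda>x. w (x, r))" if "r \<ge> 0" for r
      using w that compact_Icc unfolding L1loc_continuous_on_def by simp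
    have iw: "integrable lebesgue (\<lambda>x. C * (indicator {-K..K} x *\<^sub>R norm (w (x, t) - w (x, t0))))"
      using set_integrable_norm[OF set_integral_diff(1)[OF i[OF t] i[OF t0]]] by (simp add: set_integrable_def)
    have ip: "integrable lborel (\<lambda>x. indicator {-K..K} x *\<^sub>R \<bar>P t x - P t0 x\<bar>)"
      using bounded_borel_Icc[OF bounded_borel_abs[OF bounded_borel_diff[OF P[OF t] P[OF t0]]], of "-K" K] by (simp add: set_integrable_def)
    have "norm (LINT x:{-K..K}|lborel. \<bar>P t x - P t0 x\<bar>) = (LINT x|lborel. indicator {-K..K} x *\<^sub>R \<bar>P t x - P t0 x\<bar>)"
      by (simp add: set_lebesgue_integral_def Bochner_Integration.integral_nonneg)
    also have "\<dots> = (LINT x|lebesgue. indicator {-K..K} x *\<^sub>R \<bar>P t x - P t0 x\<bar>)"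
      by (rule integral_completion[symmetric]) (rule borel_measurable_integrable[OF ip])
    also have "\<dots> \<le> (LINT x|lebesgue. C * (indicator {-K..K} x *\<^sub>R norm (w (x, t) - w (x, t0))))"
    proof (rule integral_mono_AE[OF _ iw])
      show "integrable lebesgue (\<lambda>x. indicator {-K..K} x *\<^sub>R \<bar>P t x - P t0 x\<bar>)"
        using ip by (subst integrable_completion) (auto intro: borel_measurable_integrable)
      show "AE x in lebesgue. indicator {-K..K} x *\<^sub>R \<bar>P t x - P t0 x\<bar> \<le> C * (indicator {-K..K} x *\<^sub>R norm (w (x, t) - w (x, t0)))"
        using AE_completion[OF le[OF t]] by eventually_elim (simp add: indicator_def)
    qed
    also have "\<dots> = C * (LINT x:{-K..K}|lebesgue. norm (w (x, t) - w (x, t0)))" by (simp add: set_lebesgue_integral_def)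
    finally show ?thesis .
  qed
  then show "\<forall>\<^sub>F t in at t0 within {0..}. norm (LINT x:{-K..K}|lborel. \<bar>P t x - P t0 x\<bar>) \<le> C * (LINT x:{-K..K}|lebesgue. norm (w (x, t) - w (x, t0)))"
    by (auto simp: eventually_at_filter)
qed

lemma test_mean_continuous:
  fixes V :: "real \<Rightarrow> real \<Rightarrow> real"
  assumes \<theta>: "C1c \<theta> \<theta>'" and V: "\<And>t. t \<ge> 0 \<Longrightarrow> bounded_borel (V t)"
    and lim: "\<And>t0 K. t0 \<ge> 0 \<Longrightarrow> ((\<lambda>t. LINT x:{-K..K}|lborel. \<bar>V t x - V t0 x\<bar>) \<longlongrightarrow> 0) (at t0 within {0..})"
  shows "continuous_on {0..} (\<lambda>t. LINT x|lborel. \<theta> x * V t x)"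
  unfolding continuous_on_def
proof
  fix t0 :: real assume "t0 \<in> {0..}"
  then have t0: "t0 \<ge> 0" by simp
  obtain K where K: "\<forall>x. \<bar>x\<bar> \<ge> K \<longrightarrow> \<theta> x = 0 \<and> \<theta>' x = 0" using \<theta> unfolding C1c_def by blast
  note b\<theta> = C1c_bounded_borel(1)[OF \<theta>]
  obtain S where S: "S > 0" "\<And>x. \<bar>\<theta> x\<bar> \<le> S" using bounded_borel_bound[OF b\<theta>] by blast
  have i: "integrable lborel (\<lambda>x. \<theta> x * V t x)" if "t \<ge> 0" for t
    by (rule LINT_compact_support(1)[of _ K]) (use bounded_borel_mult[OF b\<theta> V[OF that]] K in simp_all)
  have est: "norm ((LINT x|lborel. \<theta> x * V t x) - (LINT x|lborel. \<theta> x * V t0 x)) \<le> S * (LINT x:{-K..K}|lborel. \<bar>V t x - V t0 x\<bar>)" if t: "t \<ge> 0" for t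
  proof -
    have j: "integrable lborel (\<lambda>x. S * (indicator {-K..K} x * \<bar>V t x - V t0 x\<bar>))"
      using bounded_borel_Icc[OF bounded_borel_abs[OF bounded_borel_diff[OF V[OF t] V[OF t0]]], of "-K" K] by (simp add: set_integrable_def)
    have d: "integrable lborel (\<lambda>x. \<theta> x * V t x - \<theta> x * V t0 x)" using i[OF t] i[OF t0] by simp
    have "norm ((LINT x|lborel. \<theta> x * V t x) - (LINT x|lborel. \<theta> x * V t0 x)) = norm (LINT x|lborel. \<theta> x * V t x - \<theta> x * V t0 x)"
      using i[OF t] i[OF t0] by simp
    also have "\<dots> \<le> (LINT x|lborel. norm (\<theta> x * V t x - \<theta> x * V t0 x))" by (rule integral_norm_bound)
    also have "\<dots> \<le> (LINT x|lborel. S * (indicator {-K..K} x * \<bar>V t x - V t0 x\<bar>))"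
    proof (rule integral_mono[OF integrable_norm[OF d] j])
      fix x
      show "norm (\<theta> x * V t x - \<theta> x * V t0 x) \<le> S * (indicator {-K..K} x * \<bar>V t x - V t0 x\<bar>)"
      proof (cases "\<bar>x\<bar> \<ge> K")
        case True then show ?thesis using K S(1) by simp
      next
        case False
        then have x: "x \<in> {-K..K}" by auto
        have "\<bar>\<theta> x\<bar> * \<bar>V t x - V t0 x\<bar> \<le> S * \<bar>V t x - V t0 x\<bar>" using S(2) by (rule mult_right_mono) simp
        then show ?thesis using x by (simp add: abs_mult flip: right_diff_distrib)
      qed
    qed
    finally show ?thesis by (simp add: set_lebesgue_integral_def)
  qed
  have "((\<lambda>t. (LINT x|lborel. \<theta> x * V t x) - (LINT x|lborel. \<theta> x * V t0 x)) \<longlongrightarrow> 0) (at t0 within {0..})"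
    by (rule Lim_null_comparison[OF _ tendsto_mult_right_zero[OF lim[OF t0, of K], of S]]) (use est in \<open>auto simp: eventually_at_filter\<close>)
  then show "((\<lambda>t. LINT x|lborel. \<theta> x * V t x) \<longlongrightarrow> (LINT x|lborel. \<theta> x * V t0 x)) (at t0 within {0..})" by (rule LIM_zero_cancel)
qed

lemma abs_fst_le_norm: "\<bar>fst y\<bar> \<le> norm (y :: real \<times> real)" and abs_snd_le_norm: "\<bar>snd y\<bar> \<le> norm y"
  using norm_fst_le[of "fst y" "snd y"] norm_snd_le[of "snd y" "fst y"] unfolding prod.collapse by simp_all

lemma convex_state_space: "0 < a \<Longrightarrow> convex (state_space {a..b})"
proof -
  assume a: "0 < a"
  have "state_space {a..b} = {z. fst z > 0} \<inter> {z. (a, -1) \<bullet> z \<le> 0} \<inter> {z. (-b, 1) \<bullet> z \<le> 0}"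
    by (auto simp: state_space_def field_simps)
  moreover have "{z :: real \<times> real. fst z > 0} = {z. (1, 0) \<bullet> z > 0}" by auto
  ultimately show ?thesis by (simp add: convex_Int convex_halfspace_le convex_halfspace_gt)
qed

section \<open>The second component of an admissible solution\<close>

context elastic
begin

lemma state_space_ratio:
  assumes "z \<in> state_space {a..b}" shows "0 < fst z" "0 < snd z" "fst z / snd z \<in> {A..B}"
proof -
  obtain \<eta> v where w: "z = (\<eta>, v)" and p: "\<eta> > 0" "v / \<eta> \<in> {a..b}" using assms by (auto simp: state_space_def)
  have v: "v > 0" "a * \<eta> \<le> v" "v \<le> b * \<eta>"
  proof -
    show "a * \<eta> \<le> v" "v \<le> b * \<eta>" using p by (auto simp: field_simps)
    then show "v > 0" using mult_pos_pos[OF a_pos p(1)] by linarith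
  qed
  then show "0 < fst z" "0 < snd z" "fst z / snd z \<in> {A..B}"
    using a_pos b_pos p(1) by (auto simp: w A_def B_def field_simps)
qed

lemma admissible_ratio:
  assumes "admissible_weak_solution {a..b} G s w" "t \<ge> 0"
  shows "0 < snd (w (x, t))" "fst (w (x, t)) / snd (w (x, t)) \<in> {A..B}"
proof -
  have "w (x, t) \<in> state_space {a..b}"
    using assms unfolding admissible_weak_solution_def weak_solution_def by (auto simp: image_subset_iff)
  from state_space_ratio[OF this] show "0 < snd (w (x, t))" "fst (w (x, t)) / snd (w (x, t)) \<in> {A..B}" by blast+
qed

text \<open>The derivative in eta vanishes, so the entropy flux may be zero. Taking c = 1 and c = -1
  yields the equation v_t = 0 for all C^1 product tests.\<close>

lemma convex_extension_snd: "convex_extension {a..b} G (\<lambda>z. c * snd z) (\<lambda>z. 0)"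
proof -
  let ?S = "state_space {a..b}"
  have sm: "smooth_on ?S (\<lambda>z. c * snd z)" by (intro smooth_on_mult smooth_on_const smooth_on_snd)
  then have ck: "Ck_on 1 ?S (\<lambda>z. c * snd z)" unfolding smooth_on_def by blast
  have cv: "convex_on ?S (\<lambda>z. c * snd z)"
    by (rule convex_onI) (simp_all add: algebra_simps convex_state_space[OF a_pos])
  have "has_gradient_on ?S (\<lambda>z. c * snd z) (\<lambda>z. 0) (\<lambda>z. c)"
    using has_gradient_on_mult[OF has_gradient_on_const[of ?S c] has_gradient_on_snd[of ?S]] by simp
  then show ?thesis unfolding convex_extension_def
    using sm ck cv has_gradient_on_const[of ?S 0] Ck_on_const[of 1 ?S 0]
    by (intro conjI exI[of _ "\<lambda>z. 0"] exI[of _ "\<lambda>z. c"]) auto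
qed

text \<open>For each \<theta> the mean of v against \<theta> neither grows nor decays, by
  \<open>weak_decrease\<close> in both directions, so it keeps its initial value. The entropy
  inequalities are used rather than the weak equation because the latter admits smooth tests only,
  while the ramps are merely C^1.\<close>

lemma admissible_snd:
  assumes adm: "admissible_weak_solution {a..b} G s w"
  shows "t \<ge> 0 \<Longrightarrow> AE x in lborel. snd (w (x, t)) = s x"
    "AE z in lborel. z \<in> UNIV \<times> {0..} \<longrightarrow> snd (w z) = s (fst z)"
proof -
  have ws: "weak_solution {a..b} G s w" using adm by (simp add: admissible_weak_solution_def)
  have wm: "w \<in> borel_measurable (lebesgue_on (UNIV \<times> {0..}))" and wc: "L1loc_continuous_on {0..} w"
    and w0: "AE x in lebesgue. w (x, 0) = (1, s x)" and wb: "bounded (w ` (UNIV \<times> {0..}))"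
    using ws unfolding weak_solution_def by blast+
  obtain C where C: "\<forall>y\<in>w ` (UNIV \<times> {0..}). norm y \<le> C" using wb unfolding bounded_iff by blast
  have rng: "snd (w (x, r)) \<in> {0..C}" if "r \<ge> 0" for x r
  proof -
    have "norm (w (x, r)) \<le> C" using C that by simp
    then show ?thesis using admissible_ratio(1)[OF adm that, of x] abs_snd_le_norm[of "w (x, r)"] by simp
  qed
  have sm: "(\<lambda>z. snd (w z)) \<in> borel_measurable (lebesgue_on (UNIV \<times> {0..}))"
    by (rule measurable_compose[OF wm]) (intro borel_measurable_continuous_onI continuous_intros)
  have sl: "(\<lambda>x. snd (w (x, r))) \<in> borel_measurable lebesgue" if "r \<ge> 0" for r
    by (rule measurable_compose[OF L1loc_slice_measurable[OF wc]]) (use that in \<open>auto intro!: borel_measurable_continuous_onI continuous_intros\<close>)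
  obtain U V where U: "U \<in> borel_measurable borel" "\<And>z. U z \<in> {0..C}" "AE z in lborel. z \<in> UNIV \<times> {0..} \<longrightarrow> U z = snd (w z)"
    and V: "\<And>t. t \<ge> 0 \<Longrightarrow> V t \<in> borel_measurable borel" "\<And>t x. t \<ge> 0 \<Longrightarrow> V t x \<in> {0..C}"
      "\<And>t. t \<ge> 0 \<Longrightarrow> AE x in lborel. V t x = snd (w (x, t))"
    and UV: "AE t in lborel. t \<ge> 0 \<longrightarrow> (AE x in lborel. U (x, t) = V t x)"
    using slice_versions[OF sm sl rng] by blast
  have [measurable]: "U \<in> borel_measurable (borel \<Otimes>\<^sub>M borel)" using U(1) by (simp add: borel_prod)
  have bV: "bounded_borel (V t)" if "t \<ge> 0" for t
    by (rule bounded_borelI[of _ C]) (use V(1,2)[OF that] in auto)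
  have lim: "((\<lambda>t. LINT x:{-K..K}|lborel. \<bar>V t x - V t0 x\<bar>) \<longlongrightarrow> 0) (at t0 within {0..})" if t0: "t0 \<ge> 0" for t0 K
  proof (rule L1loc_slice_tendsto[OF wc t0 _ bV, of 1])
    fix t :: real assume t: "t \<ge> 0"
    show "AE x in lborel. \<bar>V t x - V t0 x\<bar> \<le> 1 * norm (w (x, t) - w (x, t0))"
      using V(3)[OF t] V(3)[OF t0]
    proof eventually_elim
      case (elim x)
      then show ?case using abs_snd_le_norm[of "w (x, t) - w (x, t0)"] by simp
    qed
  qed simp_all
  have mean: "(LINT x|lborel. \<theta> x * V t x) = (LINT x|lborel. \<theta> x * s x)"
    if t: "t \<ge> 0" and \<theta>: "C1c \<theta> \<theta>'" and \<theta>0: "\<And>x. 0 \<le> \<theta> x" for t \<theta> \<theta>'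
  proof -
    define \<alpha> where "\<alpha> r = (if r \<ge> 0 then LINT x|lborel. \<theta> x * V r x else 0)" for r
    obtain K where K: "\<forall>x. \<bar>x\<bar> \<ge> K \<longrightarrow> \<theta> x = 0 \<and> \<theta>' x = 0" using \<theta> unfolding C1c_def by blast
    note b\<theta> = C1c_bounded_borel(1)[OF \<theta>]
    obtain S where S: "S > 0" "\<And>x. \<bar>\<theta> x\<bar> \<le> S" using bounded_borel_bound[OF b\<theta>] by blast
    have i: "integrable lborel (\<lambda>x. \<theta> x * V r x)" if "r \<ge> 0" for r
      by (rule LINT_compact_support(1)[of _ K]) (use bounded_borel_mult[OF b\<theta> bV[OF that]] K in simp_all)
    have c0: "continuous_on {0..} (\<lambda>r. LINT x|lborel. \<theta> x * V r x)" by (rule test_mean_continuous[OF \<theta> bV lim])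
    then have c\<alpha>: "continuous_on {0..} \<alpha>"
      by (rule continuous_on_cong[THEN iffD1, rotated -1]) (auto simp: \<alpha>_def)
    have b\<alpha>: "bounded_borel \<alpha>"
    proof (rule bounded_borelI)
      have "(\<lambda>r. indicator {0..} r *\<^sub>R \<alpha> r) \<in> borel_measurable borel"
        by (rule borel_measurable_continuous_on_indicator[OF _ c\<alpha>]) simp
      moreover have "(\<lambda>r. indicator {0..} r *\<^sub>R \<alpha> r) = \<alpha>" by (auto simp: \<alpha>_def indicator_def fun_eq_iff)
      ultimately show "\<alpha> \<in> borel_measurable borel" by simp
      have iC: "integrable lborel (\<lambda>x. \<theta> x * C)"
        by (rule LINT_compact_support(1)[of _ K]) (use bounded_borel_mult[OF b\<theta> bounded_borel_const] K in simp_all)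
      have C0: "C \<ge> 0" using U(2)[of 0] by simp
      show "\<bar>\<alpha> r\<bar> \<le> (LINT x|lborel. \<theta> x * C)" for r
      proof (cases "r \<ge> 0")
        case True
        have "(LINT x|lborel. \<theta> x * V r x) \<le> (LINT x|lborel. \<theta> x * C)"
          by (rule integral_mono[OF i[OF True] iC]) (use V(2)[OF True] \<theta>0 in \<open>auto intro: mult_left_mono\<close>)
        moreover have "0 \<le> (LINT x|lborel. \<theta> x * V r x)"
          using V(2)[OF True] \<theta>0 by (intro Bochner_Integration.integral_nonneg) simp
        ultimately show ?thesis using True by (simp add: \<alpha>_def)
      next
        case False
        then show ?thesis using \<theta>0 C0 by (simp add: \<alpha>_def Bochner_Integration.integral_nonneg)
      qed
    qed
    have test: "0 \<le> c * (LINT r|lborel. \<beta>' r * \<alpha> r)" if \<beta>: "time_test \<beta> \<beta>'" for \<beta> \<beta>' c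
    proof -
      have bC: "C1c \<beta> \<beta>'" using \<beta> by (simp add: time_test_def)
      obtain K2 where K2: "\<forall>x. \<bar>x\<bar> \<ge> K2 \<longrightarrow> \<beta> x = 0 \<and> \<beta>' x = 0" using bC unfolding C1c_def by blast
      obtain t0 where "t0 > 0" "\<forall>t\<le>t0. \<beta> t = 0 \<and> \<beta>' t = 0" using \<beta> unfolding time_test_def by blast
      then have neg: "\<beta>' t = 0" if "t \<le> 0" for t using that by simp
      note b\<beta>' = C1c_bounded_borel(2)[OF bC]
      obtain S1 where S1: "S1 > 0" "\<And>x. \<bar>\<beta>' x\<bar> \<le> S1" using bounded_borel_bound[OF b\<beta>'] by blast
      note [measurable] = b\<theta>[THEN bounded_borel_measurable] b\<beta>'[THEN bounded_borel_measurable]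
      let ?J = "\<lambda>z. \<theta> (fst z) * \<beta>' (snd z) * U z"
      have Jm: "?J \<in> borel_measurable (borel \<Otimes>\<^sub>M borel)" by measurable
      have iJ: "integrable lborel ?J"
      proof (rule plane_integrable[of _ "S * S1 * C" "max K K2"])
        show "?J \<in> borel_measurable borel" using Jm by (simp add: borel_prod)
        show "\<bar>?J z\<bar> \<le> S * S1 * C" for z
          using U(2)[of z] S S1 unfolding abs_mult by (intro mult_mono mult_nonneg_nonneg) (auto simp: less_imp_le)
        show "?J (x, t) = 0" if "\<bar>x\<bar> \<ge> max K K2 \<or> \<bar>t\<bar> \<ge> max K K2" for x t using that K K2 by auto
      qed
      note pt = product_test[OF \<theta> \<beta>]
      let ?psi = "\<lambda>z. \<theta> (fst z) * \<beta> (snd z)"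
      have "\<forall>z. ?psi z \<ge> 0" using \<theta>0 \<beta> unfolding time_test_def by simp
      then have "0 \<le> (LINT z:UNIV \<times> {0<..}|lebesgue. dt ?psi z * (c * snd (w z)) + dx ?psi z * 0)"
        using adm convex_extension_snd[of c] pt(1,2) unfolding admissible_weak_solution_def by blast
      also have "\<dots> = (LINT z|lborel. c * ?J z)"
      proof (rule lebesgue_plane_transfer)
        show "(\<lambda>z. c * ?J z) \<in> borel_measurable borel" using Jm by (simp add: borel_prod)
        show "AE z in lborel. z \<in> UNIV \<times> {0<..} \<longrightarrow> dt ?psi z * (c * snd (w z)) + dx ?psi z * 0 = c * ?J z"
          using U(3) by eventually_elim (auto simp: pt(4))
        show "c * ?J z = 0" if "z \<notin> UNIV \<times> {0<..}" for z using that neg by (cases z) auto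
      qed
      also have "\<dots> = c * (LINT t|lborel. LINT x|lborel. ?J (x, t))" using plane_Fubini(2)[OF iJ] by simp
      also have "(LINT t|lborel. LINT x|lborel. ?J (x, t)) = (LINT r|lborel. \<beta>' r * \<alpha> r)"
      proof (rule integral_cong_AE)
        have "(\<lambda>t. LINT x|lborel. ?J (x, t)) \<in> borel_measurable borel"
          by (rule lborel.borel_measurable_lebesgue_integral) measurable
        then show "(\<lambda>t. LINT x|lborel. ?J (x, t)) \<in> borel_measurable lborel" by simp
        show "(\<lambda>r. \<beta>' r * \<alpha> r) \<in> borel_measurable lborel" using bounded_borel_measurable[OF b\<alpha>] by measurable
        show "AE r in lborel. (LINT x|lborel. ?J (x, r)) = \<beta>' r * \<alpha> r"
          using UV
        proof eventually_elim
          case (elim r)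
          show ?case
          proof (cases "r \<ge> 0")
            case True
            have Vm[measurable]: "V r \<in> borel_measurable borel" by (rule V(1)[OF True])
            have ae: "AE x in lborel. U (x, r) = V r x" using elim True by blast
            have [measurable]: "(\<lambda>x. U (x, r)) \<in> borel_measurable borel" by measurable
            have "(LINT x|lborel. \<theta> x * \<beta>' r * U (x, r)) = (LINT x|lborel. \<beta>' r * (\<theta> x * V r x))"
            proof (rule integral_cong_AE)
              show "AE x in lborel. \<theta> x * \<beta>' r * U (x, r) = \<beta>' r * (\<theta> x * V r x)"
                using ae by eventually_elim simp
            qed measurable
            then show ?thesis using True by (simp add: \<alpha>_def)
          qed (use neg in simp)
        qed
      qed
      finally show ?thesis .
    qed
    have "\<alpha> t - \<alpha> 0 \<le> (LINT t:{0..t}|lborel. 0)"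
      by (rule weak_decrease[OF b\<alpha> c\<alpha> bounded_borel_const]) (use test[of _ _ 1] t in simp_all)
    moreover have "(- \<alpha> t) - (- \<alpha> 0) \<le> (LINT t:{0..t}|lborel. 0)"
    proof (rule weak_decrease[OF _ continuous_on_minus[OF c\<alpha>] bounded_borel_const])
      show "bounded_borel (\<lambda>r. - \<alpha> r)" using bounded_borel_mult[OF bounded_borel_const[of "-1"] b\<alpha>] by simp
    qed (use test[of _ _ "-1"] t in simp_all)
    ultimately have "\<alpha> t = \<alpha> 0" by simp
    moreover have "\<alpha> 0 = (LINT x|lborel. \<theta> x * s x)"
    proof -
      have "AE x in lborel. w (x, 0) = (1, s x)" using w0 by (simp add: AE_completion_iff)
      then have ae: "AE x in lborel. V 0 x = s x" using V(3)[OF order_refl] by eventually_elim simp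
      note [measurable] = V(1)[OF order_refl] b\<theta>[THEN bounded_borel_measurable]
      have "(LINT x|lborel. \<theta> x * V 0 x) = (LINT x|lborel. \<theta> x * s x)"
        by (rule integral_cong_AE) (measurable, use ae in eventually_elim, simp)
      then show ?thesis by (simp add: \<alpha>_def)
    qed
    ultimately show ?thesis using t by (simp add: \<alpha>_def)
  qed
  have Vs: "AE x in lborel. V t x = s x" if t: "t \<ge> 0" for t
  proof (rule AE_eq_of_test_integrals[OF bV[OF t] s_bounded_borel])
    show "(LINT x|lborel. \<theta> x * V t x) = (LINT x|lborel. \<theta> x * s x)" if "C1c \<theta> \<theta>'" "\<And>x. 0 \<le> \<theta> x" for \<theta> \<theta>'
      by (rule mean[OF t that])
  qed (use V(2)[OF t] s_pos in \<open>auto simp: less_imp_le\<close>)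
  show "AE x in lborel. snd (w (x, t)) = s x" if t: "t \<ge> 0" for t
    using Vs[OF t] V(3)[OF t] by eventually_elim simp
  have "AE t in lborel. AE x in lborel. t \<ge> 0 \<longrightarrow> U (x, t) = s x"
    using UV
  proof eventually_elim
    case (elim t)
    show ?case
    proof (cases "t \<ge> 0")
      case True
      then have "AE x in lborel. U (x, t) = V t x" using elim by blast
      then show ?thesis using Vs[OF True] by eventually_elim simp
    qed simp
  qed
  moreover have m: "{z \<in> space (lborel \<Otimes>\<^sub>M lborel). 0 \<le> snd z \<longrightarrow> U (fst z, snd z) = s (fst z)} \<in> sets (lborel \<Otimes>\<^sub>M lborel)"
    using s_measurable by measurable
  ultimately have "AE x in lborel. AE t in lborel. t \<ge> 0 \<longrightarrow> U (x, t) = s x"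
    using lborel_pair.AE_commute[of "\<lambda>x t. t \<ge> 0 \<longrightarrow> U (x, t) = s x"] by blast
  then have "AE z in lborel \<Otimes>\<^sub>M lborel. 0 \<le> snd z \<longrightarrow> U (fst z, snd z) = s (fst z)"
    by (intro lborel_pair.AE_pair_measure) (use m in auto)
  then have "AE z in lborel. 0 \<le> snd z \<longrightarrow> U z = s (fst z)" by (simp only: lborel_prod prod.collapse)
  then show "AE z in lborel. z \<in> UNIV \<times> {0..} \<longrightarrow> snd (w z) = s (fst z)"
    using U(3) by eventually_elim auto
qed

end

section \<open>From regularized entropies to Kruzhkov's inequality, and uniqueness\<close>

lemma DERIV_within_Icc_nondecreasing:
  fixes h :: "real \<Rightarrow> real"
  assumes d: "\<And>x. x \<in> {A..B} \<Longrightarrow> (h has_real_derivative h' x) (at x within {A..B})" "\<And>x. x \<in> {A..B} \<Longrightarrow> h' x \<ge> 0"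
    and lh: "l \<le> r" "l \<in> {A..B}" "r \<in> {A..B}"
  shows "h l \<le> h r"
proof -
  have sub: "{l..r} \<subseteq> {A..B}" using lh by auto
  have "\<exists>x\<in>{l..r}. h r - h l = (\<lambda>x. (*) (h' x)) x (r - l)"
  proof (rule mvt_very_simple[OF lh(1)])
    fix x assume "l \<le> x" "x \<le> r"
    then have "x \<in> {A..B}" using lh by simp
    from has_field_derivative_subset[OF d(1)[OF this] sub]
    show "(h has_derivative (*) (h' x)) (at x within {l..r})" unfolding has_field_derivative_def .
  qed
  then obtain x where x: "x \<in> {l..r}" "h r - h l = h' x * (r - l)" by blast
  have "0 \<le> h' x * (r - l)" using d(2)[of x] x(1) sub lh(1) by (intro mult_nonneg_nonneg) auto
  then show ?thesis using x(2) by linarith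
qed

context elastic
begin

text \<open>The factor (r - k) / sqrt((r - k)^2 + \<epsilon>^2), the derivative of the regularized
  absolute value, replaces sgn(r - k); \<open>q\<close> is the antiderivative vanishing at k.
  Because f' lies between 0 and \<open>L'\<close>, the error in the flux is at most
  \<open>L'\<close> times the error in the absolute value, which is at most \<epsilon>.\<close>

lemma kruzhkov_flux:
  assumes k: "k \<in> {A..B}" and e: "\<epsilon> > 0" and L': "\<And>r. r \<in> {A..B} \<Longrightarrow> f' r \<le> L'"
  shows "\<exists>q. (\<forall>r\<in>{A..B}. (q has_real_derivative (r - k) / sqrt ((r - k)\<^sup>2 + \<epsilon>\<^sup>2) * f' r) (at r within {A..B})) \<and>
     (\<forall>r\<in>{A..B}. \<bar>q r - \<bar>f r - f k\<bar>\<bar> \<le> L' * \<epsilon>)"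
proof -
  define e where "e r = (r - k) / sqrt ((r - k)\<^sup>2 + \<epsilon>\<^sup>2)" for r
  have pos: "(r - k)\<^sup>2 + \<epsilon>\<^sup>2 > 0" for r using \<open>\<epsilon> > 0\<close> by (intro add_nonneg_pos) auto
  have nz: "sqrt ((r - k)\<^sup>2 + \<epsilon>\<^sup>2) \<noteq> 0" for r using pos[of r] unfolding real_sqrt_eq_zero_cancel_iff by linarith
  have ce: "continuous_on {A..B} (\<lambda>r. e r * f' r)"
    unfolding e_def by (intro continuous_intros f'_continuous) (use nz in blast)
  from antiderivative_continuous[OF this]
  obtain q0 where q0: "\<And>x. x \<in> {A..B} \<Longrightarrow> (q0 has_vector_derivative e x * f' x) (at x within {A..B})" by blast
  define q where "q r = q0 r - q0 k" for r
  have qd: "(q has_real_derivative e r * f' r) (at r within {A..B})" if "r \<in> {A..B}" for r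
    using q0[OF that] unfolding q_def has_real_derivative_iff_has_vector_derivative
    by (auto intro!: derivative_eq_intros)
  have qk: "q k = 0" by (simp add: q_def)
  have el: "\<bar>e r\<bar> \<le> 1" for r
    unfolding e_def abs_divide using pos[of r] real_sqrt_ge_abs1[of "r - k" \<epsilon>] by (simp add: divide_le_eq_1)
  \<comment> \<open>With c = 1 for r >= k and c = -1 for r <= k, \<open>D\<close> is the flux error,
    and \<open>H\<close> is the comparison function whose derivative uses \<open>L'\<close> in place
    of f'; monotonicity of \<open>D\<close> and of H - D gives the two-sided bound.\<close>
  define D where "D c r = c * (f r - f k) - q r" for c r
  define H where "H c r = L' * (c * (r - k) - sqrt ((r - k)\<^sup>2 + \<epsilon>\<^sup>2) + \<epsilon>)" for c r
  have Dd: "(D c has_real_derivative (c - e r) * f' r) (at r within {A..B})" if "r \<in> {A..B}" for c r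
    unfolding D_def using f_deriv[OF that] qd[OF that] by (auto intro!: derivative_eq_intros simp: algebra_simps)
  have sd: "((\<lambda>r. sqrt ((r - k)\<^sup>2 + \<epsilon>\<^sup>2)) has_real_derivative e r) (at r within T)" for r T
  proof -
    have i: "((\<lambda>r. (r - k)\<^sup>2 + \<epsilon>\<^sup>2) has_real_derivative 2 * (r - k)) (at r within T)"
      by (auto intro!: derivative_eq_intros)
    have "((\<lambda>r. sqrt ((r - k)\<^sup>2 + \<epsilon>\<^sup>2)) has_real_derivative
        inverse (sqrt ((r - k)\<^sup>2 + \<epsilon>\<^sup>2)) / 2 * (2 * (r - k))) (at r within T)"
      by (rule DERIV_chain2[where f=sqrt and g="\<lambda>r. (r - k)\<^sup>2 + \<epsilon>\<^sup>2", OF DERIV_real_sqrt[OF pos[of r]] i])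
    moreover have "inverse y / 2 * (2 * x) = x / y" for x y :: real by (cases "y = 0") (simp_all add: field_simps)
    ultimately show ?thesis by (simp only: e_def)
  qed
  have Hd: "(H c has_real_derivative L' * (c - e r)) (at r within {A..B})" for c r
  proof -
    have "((\<lambda>r. c * (r - k) - sqrt ((r - k)\<^sup>2 + \<epsilon>\<^sup>2) + \<epsilon>) has_real_derivative c * (1 - 0) - e r + 0) (at r within {A..B})"
      by (intro DERIV_add DERIV_diff DERIV_cmult DERIV_ident DERIV_const sd)
    from DERIV_cmult[OF this, of L'] show ?thesis unfolding H_def by simp
  qed
  have D0: "D c k = 0" "H c k = 0" for c using \<open>\<epsilon> > 0\<close> qk by (simp_all add: D_def H_def)
  have L0: "L' \<ge> 0" using L'[OF k] f'_pos[OF k] by linarith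
  have Hle: "H c r \<le> L' * \<epsilon>" if "c * (r - k) \<le> \<bar>r - k\<bar>" for c r
    unfolding H_def using that real_sqrt_ge_abs1[of "r - k" \<epsilon>] by (intro mult_left_mono[OF _ L0]) linarith
  have "\<bar>q r - \<bar>f r - f k\<bar>\<bar> \<le> L' * \<epsilon>" if r: "r \<in> {A..B}" for r
  proof (cases "k \<le> r")
    case True
    have hyp: "1 * (r - k) \<le> \<bar>r - k\<bar>" by simp
    have e1: "1 - e x \<ge> 0" for x using el[of x] by linarith
    have "D 1 k \<le> D 1 r"
      by (rule DERIV_within_Icc_nondecreasing[OF Dd _ True k r]) (use e1 f'_pos in \<open>auto intro!: mult_nonneg_nonneg simp: less_imp_le\<close>)
    moreover have "H 1 k - D 1 k \<le> H 1 r - D 1 r"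
    proof (rule DERIV_within_Icc_nondecreasing[OF DERIV_diff[OF Hd Dd] _ True k r])
      show "0 \<le> L' * (1 - e x) - (1 - e x) * f' x" if "x \<in> {A..B}" for x
        using mult_nonneg_nonneg[OF e1[of x], of "L' - f' x"] L'[OF that] by (simp add: algebra_simps)
    qed
    moreover have "\<bar>f r - f k\<bar> = f r - f k" using f_mono[OF True] by simp
    ultimately show ?thesis using Hle[of 1 r, OF hyp] unfolding D0 by (simp add: D_def abs_le_iff)
  next
    case False
    then have rk: "r \<le> k" by simp
    have hyp: "- 1 * (r - k) \<le> \<bar>r - k\<bar>" by simp
    have e1: "1 + e x \<ge> 0" for x using el[of x] by linarith
    have "- D (-1) r \<le> - D (-1) k"
    proof (rule DERIV_within_Icc_nondecreasing[OF DERIV_minus[OF Dd] _ rk r k])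
      show "0 \<le> - ((- 1 - e x) * f' x)" if "x \<in> {A..B}" for x
        using mult_nonneg_nonneg[OF e1[of x], of "f' x"] f'_pos[OF that] by (simp add: algebra_simps)
    qed
    moreover have "D (-1) r - H (-1) r \<le> D (-1) k - H (-1) k"
    proof (rule DERIV_within_Icc_nondecreasing[OF DERIV_diff[OF Dd Hd] _ rk r k])
      show "0 \<le> (- 1 - e x) * f' x - L' * (- 1 - e x)" if "x \<in> {A..B}" for x
        using mult_nonneg_nonneg[OF e1[of x], of "L' - f' x"] L'[OF that] by (simp add: algebra_simps)
    qed
    moreover have "\<bar>f r - f k\<bar> = f k - f r" using f_mono[OF rk] by simp
    ultimately show ?thesis using Hle[of "-1" r, OF hyp] unfolding D0 by (simp add: D_def abs_le_iff)
  qed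
  then show ?thesis using qd unfolding e_def by blast
qed

text \<open>The entropy is the Euclidean norm of the linear image (eta - k v, \<epsilon> v), hence
  convex, and it is smooth because \<epsilon> v > 0 keeps it away from 0. It is homogeneous of
  degree one, so its eta-derivative depends on eta / v alone, as a flux of the form q(eta / v)
  requires.\<close>

lemma kruzhkov_extension:
  assumes e: "\<epsilon> > 0"
    and q: "\<And>r. r \<in> {A..B} \<Longrightarrow> (q has_real_derivative (r - k) / sqrt ((r - k)\<^sup>2 + \<epsilon>\<^sup>2) * f' r) (at r within {A..B})"
  shows "convex_extension {a..b} G (\<lambda>z. sqrt ((fst z - k * snd z)\<^sup>2 + \<epsilon>\<^sup>2 * (snd z)\<^sup>2)) (\<lambda>z. q (fst z / snd z))"
proof -
  let ?S = "state_space {a..b}"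
  let ?e = "\<lambda>r. (r - k) / sqrt ((r - k)\<^sup>2 + \<epsilon>\<^sup>2)"
  define N :: "real \<times> real \<Rightarrow> real" where "N z = (fst z - k * snd z)\<^sup>2 + \<epsilon>\<^sup>2 * (snd z)\<^sup>2" for z
  define N1 :: "real \<times> real \<Rightarrow> real" where "N1 z = 2 * (fst z + (- k) * snd z)" for z
  define N2 :: "real \<times> real \<Rightarrow> real" where "N2 z = (- 2 * k) * (fst z + (- k) * snd z) + 2 * \<epsilon>\<^sup>2 * snd z" for z
  note sr = state_space_ratio
  have Np: "N z > 0" if "z \<in> ?S" for z unfolding N_def using sr(2)[OF that] e by (intro add_nonneg_pos) auto
  have gu: "has_gradient_on ?S (\<lambda>z. fst z + (- k) * snd z) (\<lambda>z. 1 + (0 * snd z + (- k) * 0)) (\<lambda>z. 0 + (0 * snd z + (- k) * 1))"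
    by (rule has_gradient_on_add[OF has_gradient_on_fst has_gradient_on_mult[OF has_gradient_on_const has_gradient_on_snd]])
  have gN: "has_gradient_on ?S N N1 N2"
  proof -
    let ?u = "\<lambda>z. fst z + (- k) * snd z"
    have "has_gradient_on ?S (\<lambda>z. ?u z * ?u z + \<epsilon>\<^sup>2 * (snd z * snd z))
       (\<lambda>z. ((1 + (0 * snd z + (- k) * 0)) * ?u z + ?u z * (1 + (0 * snd z + (- k) * 0)))
          + (0 * (snd z * snd z) + \<epsilon>\<^sup>2 * (0 * snd z + snd z * 0)))
       (\<lambda>z. ((0 + (0 * snd z + (- k) * 1)) * ?u z + ?u z * (0 + (0 * snd z + (- k) * 1)))
          + (0 * (snd z * snd z) + \<epsilon>\<^sup>2 * (1 * snd z + snd z * 1)))"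
      by (rule has_gradient_on_add[OF has_gradient_on_mult[OF gu gu]
        has_gradient_on_mult[OF has_gradient_on_const has_gradient_on_mult[OF has_gradient_on_snd has_gradient_on_snd]]])
    moreover have "(\<lambda>z. ?u z * ?u z + \<epsilon>\<^sup>2 * (snd z * snd z)) = N" by (simp add: fun_eq_iff N_def power2_eq_square)
    moreover have "(\<lambda>z. ((1 + (0 * snd z + (- k) * 0)) * ?u z + ?u z * (1 + (0 * snd z + (- k) * 0)))
          + (0 * (snd z * snd z) + \<epsilon>\<^sup>2 * (0 * snd z + snd z * 0))) = N1" by (simp add: fun_eq_iff N1_def)
    moreover have "(\<lambda>z. ((0 + (0 * snd z + (- k) * 1)) * ?u z + ?u z * (0 + (0 * snd z + (- k) * 1)))
          + (0 * (snd z * snd z) + \<epsilon>\<^sup>2 * (1 * snd z + snd z * 1))) = N2" by (simp add: fun_eq_iff N2_def algebra_simps)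
    ultimately show ?thesis by (simp only:)
  qed
  have smN: "smooth_on ?S N1" "smooth_on ?S N2"
    unfolding N1_def N2_def by (intro smooth_on_add smooth_on_mult smooth_on_const smooth_on_fst smooth_on_snd)+
  have Epowr: "(\<lambda>z. sqrt (N z)) = (\<lambda>z. N z powr (1 / 2))" by (simp add: powr_half_sqrt N_def)
  have smE: "smooth_on ?S (\<lambda>z. sqrt (N z))" unfolding Epowr by (rule smooth_on_powr[OF gN smN Np])
  then have ckE: "Ck_on 1 ?S (\<lambda>z. sqrt (N z))" unfolding smooth_on_def by blast
  have gE: "has_gradient_on ?S (\<lambda>z. sqrt (N z)) (\<lambda>z. inverse (sqrt (N z)) / 2 * N1 z) (\<lambda>z. inverse (sqrt (N z)) / 2 * N2 z)"
    by (rule has_gradient_on_chain[OF gN, where p=sqrt and p'="\<lambda>z. inverse (sqrt (N z)) / 2"]) (rule DERIV_real_sqrt[OF Np])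
  have cvE: "convex_on ?S (\<lambda>z. sqrt (N z))"
  proof (rule convex_onI)
    define T where "T z = (fst z - k * snd z, \<epsilon> * snd z)" for z :: "real \<times> real"
    have NT: "sqrt (N z) = norm (T z)" for z by (simp add: N_def T_def norm_Pair power_mult_distrib)
    fix t :: real and x y assume t: "0 < t" "t < 1"
    have "T ((1 - t) *\<^sub>R x + t *\<^sub>R y) = (1 - t) *\<^sub>R T x + t *\<^sub>R T y" by (simp add: T_def algebra_simps)
    then have "norm (T ((1 - t) *\<^sub>R x + t *\<^sub>R y)) \<le> norm ((1 - t) *\<^sub>R T x) + norm (t *\<^sub>R T y)"
      by (simp only: norm_triangle_ineq)
    then show "sqrt (N ((1 - t) *\<^sub>R x + t *\<^sub>R y)) \<le> (1 - t) * sqrt (N x) + t * sqrt (N y)" unfolding NT using t by simp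
  qed (rule convex_state_space[OF a_pos])
  let ?d = "\<lambda>r. ?e r * f' r"
  let ?Q1 = "\<lambda>z. ?d (fst z / snd z) * (1 / snd z)"
  let ?Q2 = "\<lambda>z. ?d (fst z / snd z) * (- fst z / (snd z)\<^sup>2)"
  have gQ: "has_gradient_on ?S (\<lambda>z. q (fst z / snd z)) ?Q1 ?Q2"
    unfolding has_gradient_on_def
  proof
    fix z assume z: "z \<in> ?S"
    have sz: "snd z \<noteq> 0" using sr(2)[OF z] by simp
    have dr: "((\<lambda>z. fst z / snd z) has_derivative (\<lambda>h. (1 / snd z) * fst h + (- fst z / (snd z)\<^sup>2) * snd h)) (at z within ?S)"
      by (rule has_derivative_eq_rhs[OF has_derivative_divide[OF has_derivative_fst[OF has_derivative_ident] has_derivative_snd[OF has_derivative_ident] sz]])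
         (simp add: fun_eq_iff divide_inverse power2_eq_square mult_ac)
    have im: "(\<lambda>z. fst z / snd z) ` ?S \<subseteq> {A..B}" using sr(3) by blast
    have "((\<lambda>z. q (fst z / snd z)) has_derivative
        (\<lambda>h. ?d (fst z / snd z) * ((1 / snd z) * fst h + (- fst z / (snd z)\<^sup>2) * snd h))) (at z within ?S)"
    proof (rule has_derivative_in_compose2[OF _ im z dr])
      fix r assume "r \<in> {A..B}"
      then show "(q has_derivative (*) (?d r)) (at r within {A..B})" using q[of r] unfolding has_field_derivative_def by blast
    qed
    then show "((\<lambda>z. q (fst z / snd z)) has_derivative (\<lambda>h. ?Q1 z * fst h + ?Q2 z * snd h)) (at z within ?S)"
      by (simp only: distrib_left mult.assoc)
  qed
  have sq: "sqrt ((r - k)\<^sup>2 + \<epsilon>\<^sup>2) \<noteq> 0" for r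
    using e sum_power2_gt_zero_iff[of "r - k" \<epsilon>] unfolding real_sqrt_eq_zero_cancel_iff by linarith
  have cd: "continuous_on {A..B} ?d" by (intro continuous_intros f'_continuous) (use sq in simp)
  have sn: "snd z \<noteq> 0" if "z \<in> ?S" for z using sr(2)[OF that] by simp
  note cfs = continuous_on_fst[OF continuous_on_id] continuous_on_snd[OF continuous_on_id]
  have c1: "continuous_on ?S (\<lambda>z. fst z / snd z)" by (rule continuous_on_divide[OF cfs]) (use sn in blast)
  have im: "(\<lambda>z. fst z / snd z) ` ?S \<subseteq> {A..B}" using sr(3) by blast
  have cr: "continuous_on ?S (\<lambda>z. ?d (fst z / snd z))" by (rule continuous_on_compose2[OF cd c1 im])
  have c2: "continuous_on ?S (\<lambda>z. 1 / snd z)"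
    by (rule continuous_on_divide[OF continuous_on_const cfs(2)]) (use sn in blast)
  have c3: "continuous_on ?S (\<lambda>z. - fst z / (snd z)\<^sup>2)"
    by (rule continuous_on_divide[OF continuous_on_minus[OF cfs(1)] continuous_on_power[OF cfs(2)]])
       (use sn in \<open>simp only: power_eq_0_iff, blast\<close>)
  note cQ = continuous_on_mult[OF cr c2] continuous_on_mult[OF cr c3]
  have rel: "?Q1 z = inverse (sqrt (N z)) / 2 * N1 z * (snd z / (fst z)\<^sup>2) * g (snd z / fst z)"
     "?Q2 z = - (inverse (sqrt (N z)) / 2 * N1 z) * (1 / fst z) * g (snd z / fst z)" if z: "z \<in> ?S" for z
  proof -
    define r v where "r = fst z / snd z" and "v = snd z"
    have v: "v > 0" "r > 0" using sr(1,2)[OF z] by (simp_all add: v_def r_def)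
    have zz: "z = (r * v, v)" using sn[OF z] by (simp add: r_def v_def)
    have rz: "fst z / snd z = r" "snd z / fst z = 1 / r" using v by (simp_all add: zz)
    have "N z = v\<^sup>2 * ((r - k)\<^sup>2 + \<epsilon>\<^sup>2)" by (simp add: N_def zz power2_eq_square algebra_simps)
    then have "sqrt (N z) = v * sqrt ((r - k)\<^sup>2 + \<epsilon>\<^sup>2)" using v by (simp add: real_sqrt_mult)
    moreover have "N1 z = 2 * (v * (r - k))" by (simp add: N1_def zz algebra_simps)
    ultimately have E1: "inverse (sqrt (N z)) / 2 * N1 z = ?e r" using v sq[of r] by (simp add: inverse_eq_divide)
    have "g (1 / r) / r\<^sup>2 * (1 / v) = v / (r * v)\<^sup>2 * g (1 / r)" using v by (simp add: power2_eq_square)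
    then show "?Q1 z = inverse (sqrt (N z)) / 2 * N1 z * (snd z / (fst z)\<^sup>2) * g (snd z / fst z)"
      unfolding E1 rz f'_def by (simp only: zz fst_conv snd_conv mult.assoc)
    have "g (1 / r) / r\<^sup>2 * (- (r * v) / v\<^sup>2) = - (1 / (r * v) * g (1 / r))" using v by (simp add: power2_eq_square)
    then show "?Q2 z = - (inverse (sqrt (N z)) / 2 * N1 z) * (1 / fst z) * g (snd z / fst z)"
      unfolding E1 rz f'_def by (simp only: zz fst_conv snd_conv mult.assoc mult_minus_left mult_minus_right)
  qed
  have "convex_extension {a..b} G (\<lambda>z. sqrt (N z)) (\<lambda>z. q (fst z / snd z))"
    unfolding convex_extension_def
  proof (intro conjI exI)
    show "Ck_on 1 ?S (\<lambda>z. q (fst z / snd z))" unfolding One_nat_def Ck_on.simps using gQ cQ by blast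
    show "\<forall>(\<eta>, v)\<in>?S. ?Q1 (\<eta>, v) = inverse (sqrt (N (\<eta>, v))) / 2 * N1 (\<eta>, v) * (v / \<eta>\<^sup>2) * g (v / \<eta>) \<and>
        ?Q2 (\<eta>, v) = - (inverse (sqrt (N (\<eta>, v))) / 2 * N1 (\<eta>, v)) * (1 / \<eta>) * g (v / \<eta>)"
    proof (intro ballI, clarify)
      fix \<eta> v assume "(\<eta>, v) \<in> ?S"
      from rel[OF this, unfolded fst_conv snd_conv]
      show "?Q1 (\<eta>, v) = inverse (sqrt (N (\<eta>, v))) / 2 * N1 (\<eta>, v) * (v / \<eta>\<^sup>2) * g (v / \<eta>) \<and>
        ?Q2 (\<eta>, v) = - (inverse (sqrt (N (\<eta>, v))) / 2 * N1 (\<eta>, v)) * (1 / \<eta>) * g (v / \<eta>)"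
        unfolding fst_conv snd_conv by blast
    qed
  qed (rule ckE smE cvE gE gQ)+
  then show ?thesis by (simp add: N_def)
qed

text \<open>Since v = s almost everywhere, the regularized entropy equals s sqrt((R - k)^2 +
  \<epsilon>^2). Its distance from Kruzhkov's integrand is at most \<epsilon> times the fixed
  integrable function \<open>W\<close>, so \<epsilon> may tend to 0.\<close>

lemma admissible_kruzhkov:
  assumes adm: "admissible_weak_solution {a..b} G s w"
    and R: "R \<in> borel_measurable borel" "\<And>z. R z \<in> {A..B}"
    and ae: "AE z in lborel. z \<in> UNIV \<times> {0..} \<longrightarrow> R z = fst (w z) / snd (w z)"
  shows "kruzhkov R"
  unfolding kruzhkov_def
proof (intro conjI allI ballI impI)
  show Rm[measurable]: "R \<in> borel_measurable (borel \<Otimes>\<^sub>M borel)" using R(1) by (simp add: borel_prod)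
  show "R z \<in> {A..B}" for z by (rule R(2))
  fix k \<theta> \<theta>' \<beta> \<beta>'
  assume k: "k \<in> {A..B}" and "C1c \<theta> \<theta>' \<and> (\<forall>x. 0 \<le> \<theta> x) \<and> time_test \<beta> \<beta>'"
  then have \<theta>: "C1c \<theta> \<theta>'" "\<And>x. 0 \<le> \<theta> x" and \<beta>: "time_test \<beta> \<beta>'" by auto
  have bC: "C1c \<beta> \<beta>'" using \<beta> by (simp add: time_test_def)
  obtain K1 where K1: "\<forall>x. \<bar>x\<bar> \<ge> K1 \<longrightarrow> \<theta> x = 0 \<and> \<theta>' x = 0" using \<theta>(1) unfolding C1c_def by blast
  obtain K2 where K2: "\<forall>x. \<bar>x\<bar> \<ge> K2 \<longrightarrow> \<beta> x = 0 \<and> \<beta>' x = 0" using bC unfolding C1c_def by blast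
  obtain t0 where "t0 > 0" "\<forall>t\<le>t0. \<beta> t = 0 \<and> \<beta>' t = 0" using \<beta> unfolding time_test_def by blast
  then have neg: "\<beta> t = 0 \<and> \<beta>' t = 0" if "t \<le> 0" for t using that by simp
  note bb = C1c_bounded_borel[OF \<theta>(1)] C1c_bounded_borel[OF bC]
  note [measurable] = bb[THEN bounded_borel_measurable] s_measurable
  obtain S1 where S1: "S1 > 0" "\<And>x. \<bar>\<theta> x\<bar> \<le> S1" using bounded_borel_bound[OF bb(1)] by blast
  obtain S2 where S2: "S2 > 0" "\<And>x. \<bar>\<theta>' x\<bar> \<le> S2" using bounded_borel_bound[OF bb(2)] by blast
  obtain S3 where S3: "S3 > 0" "\<And>x. \<bar>\<beta> x\<bar> \<le> S3" using bounded_borel_bound[OF bb(3)] by blast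
  obtain S4 where S4: "S4 > 0" "\<And>x. \<bar>\<beta>' x\<bar> \<le> S4" using bounded_borel_bound[OF bb(4)] by blast
  obtain r0 where r0: "r0 \<in> {A..B}" "\<And>r. r \<in> {A..B} \<Longrightarrow> f' r \<le> f' r0"
    using continuous_attains_sup[OF compact_Icc _ f'_continuous] A_less_B by auto
  define L' where "L' = f' r0"
  have L': "f' r \<le> L'" if "r \<in> {A..B}" for r unfolding L'_def by (rule r0(2)[OF that])
  have L0: "L' > 0" unfolding L'_def by (rule f'_pos[OF r0(1)])
  define F where "F = f B - f A"
  have F0: "F \<ge> 0" using f_mono[OF A_le_B] by (simp add: F_def)
  define h where "h z = \<beta>' (snd z) * \<theta> (fst z) * (s (fst z) * \<bar>R z - k\<bar>) + \<beta> (snd z) * \<theta>' (fst z) * \<bar>f (R z) - f k\<bar>" for z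
  define W where "W z = \<bar>\<beta>' (snd z) * \<theta> (fst z)\<bar> * b + \<bar>\<beta> (snd z) * \<theta>' (fst z)\<bar> * L'" for z
  have [measurable]: "f \<in> borel_measurable borel" by (rule borel_measurable_continuous_onI[OF f_continuous])
  have hm: "h \<in> borel_measurable (borel \<Otimes>\<^sub>M borel)" "W \<in> borel_measurable (borel \<Otimes>\<^sub>M borel)"
    unfolding h_def W_def by measurable
  have ih: "integrable lborel h"
  proof (rule plane_integrable[of _ "S4 * S1 * (b * B) + S3 * S2 * F" "max K1 K2"])
    show "h \<in> borel_measurable borel" using hm(1) by (simp add: borel_prod)
    fix z
    have "\<bar>R z - k\<bar> \<le> B" using R(2)[of z] k A_pos by auto
    then have sR: "\<bar>s (fst z) * \<bar>R z - k\<bar>\<bar> \<le> b * B"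
      unfolding abs_mult abs_abs using s_pos[of "fst z"] s_bounds(2)[of "fst z"] b_pos by (intro mult_mono) auto
    have dF: "\<bar>f (R z) - f k\<bar> \<le> F"
      using R(2)[of z] k f_mono[of A "R z"] f_mono[of "R z" B] f_mono[of A k] f_mono[of k B] by (auto simp: F_def)
    have n1: "\<bar>\<beta>' (snd z) * \<theta> (fst z) * (s (fst z) * \<bar>R z - k\<bar>)\<bar> \<le> S4 * S1 * (b * B)"
      unfolding abs_mult[of "\<beta>' (snd z) * \<theta> (fst z)"] abs_mult[of "\<beta>' (snd z)"]
      by (intro mult_mono sR S4(2) S1(2) mult_nonneg_nonneg abs_ge_zero less_imp_le[OF S4(1)] less_imp_le[OF S1(1)])
    have n2: "\<bar>\<beta> (snd z) * \<theta>' (fst z) * \<bar>f (R z) - f k\<bar>\<bar> \<le> S3 * S2 * F"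
      unfolding abs_mult abs_abs
      by (intro mult_mono dF S3(2) S2(2) mult_nonneg_nonneg abs_ge_zero less_imp_le[OF S3(1)] less_imp_le[OF S2(1)])
    show "\<bar>h z\<bar> \<le> S4 * S1 * (b * B) + S3 * S2 * F"
      unfolding h_def by (intro order_trans[OF abs_triangle_ineq] add_mono n1 n2)
  next
    show "h (x, t) = 0" if "\<bar>x\<bar> \<ge> max K1 K2 \<or> \<bar>t\<bar> \<ge> max K1 K2" for x t using that K1 K2 by (auto simp: h_def)
  qed
  have iW: "integrable lborel W"
  proof (rule plane_integrable[of _ "S4 * S1 * b + S3 * S2 * L'" "max K1 K2"])
    show "W \<in> borel_measurable borel" using hm(2) by (simp add: borel_prod)
    fix z
    have n1: "\<bar>\<beta>' (snd z) * \<theta> (fst z)\<bar> * b \<le> S4 * S1 * b" unfolding abs_mult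
      by (intro mult_mono order_refl S4(2) S1(2) mult_nonneg_nonneg abs_ge_zero less_imp_le[OF S4(1)] less_imp_le[OF S1(1)] less_imp_le[OF b_pos])
    have n2: "\<bar>\<beta> (snd z) * \<theta>' (fst z)\<bar> * L' \<le> S3 * S2 * L'" unfolding abs_mult
      by (intro mult_mono order_refl S3(2) S2(2) mult_nonneg_nonneg abs_ge_zero less_imp_le[OF S3(1)] less_imp_le[OF S2(1)] less_imp_le[OF L0])
    have "W z \<ge> 0" unfolding W_def using b_pos L0 by simp
    then show "\<bar>W z\<bar> \<le> S4 * S1 * b + S3 * S2 * L'" using n1 n2 by (simp add: W_def)
  next
    show "W (x, t) = 0" if "\<bar>x\<bar> \<ge> max K1 K2 \<or> \<bar>t\<bar> \<ge> max K1 K2" for x t using that K1 K2 by (auto simp: W_def)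
  qed
  have key: "0 \<le> (LINT z|lborel. h z) + \<epsilon> * (LINT z|lborel. W z)" if e: "\<epsilon> > 0" for \<epsilon>
  proof -
    obtain q where q: "\<And>r. r \<in> {A..B} \<Longrightarrow> (q has_real_derivative (r - k) / sqrt ((r - k)\<^sup>2 + \<epsilon>\<^sup>2) * f' r) (at r within {A..B})"
      and ql: "\<And>r. r \<in> {A..B} \<Longrightarrow> \<bar>q r - \<bar>f r - f k\<bar>\<bar> \<le> L' * \<epsilon>"
      using kruzhkov_flux[OF k e L'] by blast
    have cq: "continuous_on {A..B} q" using q by (meson DERIV_continuous continuous_on_eq_continuous_within)
    have [measurable]: "(\<lambda>z. q (R z)) \<in> borel_measurable (borel \<Otimes>\<^sub>M borel)"
      by (rule continuous_compose_measurable[OF cq _ Rm R(2)]) simp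
    define H where "H z = \<beta>' (snd z) * \<theta> (fst z) * (s (fst z) * sqrt ((R z - k)\<^sup>2 + \<epsilon>\<^sup>2)) + \<beta> (snd z) * \<theta>' (fst z) * q (R z)" for z
    have Hm: "H \<in> borel_measurable (borel \<Otimes>\<^sub>M borel)" unfolding H_def by measurable
    have close: "\<bar>H z - h z\<bar> \<le> \<epsilon> * W z" for z
    proof -
      let ?r = "sqrt ((R z - k)\<^sup>2 + \<epsilon>\<^sup>2) - \<bar>R z - k\<bar>"
      have "\<bar>?r\<bar> \<le> \<epsilon>" using sqrt_sum_squares_le_sum_abs[of "R z - k" \<epsilon>] real_sqrt_ge_abs1[of "R z - k" \<epsilon>] e by simp
      then have "\<bar>s (fst z) * ?r\<bar> \<le> b * \<epsilon>"
        unfolding abs_mult using s_pos[of "fst z"] s_bounds(2)[of "fst z"] b_pos by (intro mult_mono) auto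
      then have n1: "\<bar>\<beta>' (snd z) * \<theta> (fst z) * (s (fst z) * ?r)\<bar> \<le> \<bar>\<beta>' (snd z) * \<theta> (fst z)\<bar> * (b * \<epsilon>)"
        unfolding abs_mult[of "\<beta>' (snd z) * \<theta> (fst z)"] by (rule mult_left_mono) simp
      have n2: "\<bar>\<beta> (snd z) * \<theta>' (fst z) * (q (R z) - \<bar>f (R z) - f k\<bar>)\<bar> \<le> \<bar>\<beta> (snd z) * \<theta>' (fst z)\<bar> * (L' * \<epsilon>)"
        unfolding abs_mult[of "\<beta> (snd z) * \<theta>' (fst z)"] by (rule mult_left_mono[OF ql[OF R(2)]]) simp
      have "H z - h z = \<beta>' (snd z) * \<theta> (fst z) * (s (fst z) * ?r) + \<beta> (snd z) * \<theta>' (fst z) * (q (R z) - \<bar>f (R z) - f k\<bar>)"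
        by (simp add: H_def h_def right_diff_distrib)
      then have "\<bar>H z - h z\<bar> \<le> \<bar>\<beta>' (snd z) * \<theta> (fst z)\<bar> * (b * \<epsilon>) + \<bar>\<beta> (snd z) * \<theta>' (fst z)\<bar> * (L' * \<epsilon>)"
        using order_trans[OF abs_triangle_ineq add_mono[OF n1 n2]] by simp
      then show ?thesis by (simp add: W_def algebra_simps)
    qed
    have iD: "integrable lborel (\<lambda>z. H z - h z)"
    proof (rule Bochner_Integration.integrable_bound[OF integrable_mult_right[OF iW, of \<epsilon>]])
      show "(\<lambda>z. H z - h z) \<in> borel_measurable lborel" using Hm hm(1) by (simp add: borel_prod)
      show "AE z in lborel. norm (H z - h z) \<le> norm (\<epsilon> * W z)"
      proof (rule AE_I2)
        show "norm (H z - h z) \<le> norm (\<epsilon> * W z)" for z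
          using close[of z] abs_ge_self[of "\<epsilon> * W z"] unfolding real_norm_def by linarith
      qed
    qed
    have iH: "integrable lborel H" using Bochner_Integration.integrable_add[OF iD ih] by simp
    let ?psi = "\<lambda>z. \<theta> (fst z) * \<beta> (snd z)"
    let ?E = "\<lambda>z. sqrt ((fst z - k * snd z)\<^sup>2 + \<epsilon>\<^sup>2 * (snd z)\<^sup>2)" and ?Q = "\<lambda>z. q (fst z / snd z)"
    note pt = product_test[OF \<theta>(1) \<beta>]
    have "\<forall>z. ?psi z \<ge> 0" using \<theta>(2) \<beta> unfolding time_test_def by simp
    then have "Ck_on 1 UNIV ?psi \<and> supported_in_upper_half ?psi \<and> (\<forall>z. ?psi z \<ge> 0)" using pt(1,2) by blast
    moreover have "convex_extension {a..b} G ?E ?Q" by (rule kruzhkov_extension[OF e q])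
    ultimately have "0 \<le> (LINT z:UNIV \<times> {0<..}|lebesgue. dt ?psi z * ?E (w z) + dx ?psi z * ?Q (w z))"
      using adm[unfolded admissible_weak_solution_def, THEN conjunct2, rule_format, of ?E ?Q ?psi] by blast
    also have "\<dots> = (LINT z|lborel. H z)"
    proof (rule lebesgue_plane_transfer)
      show "H \<in> borel_measurable borel" using Hm by (simp add: borel_prod)
      show "AE z in lborel. z \<in> UNIV \<times> {0<..} \<longrightarrow> dt ?psi z * ?E (w z) + dx ?psi z * ?Q (w z) = H z"
        using ae admissible_snd(2)[OF adm]
      proof eventually_elim
        case (elim z)
        show ?case
        proof
          assume "z \<in> UNIV \<times> {0<..}"
          then have "z \<in> UNIV \<times> {0..}" by auto
          then have sv: "snd (w z) = s (fst z)" and Rz: "R z = fst (w z) / s (fst z)" using elim by simp_all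
          have sp: "s (fst z) > 0" by (rule s_pos)
          have fw: "fst (w z) = R z * s (fst z)" using Rz sp by simp
          have "(R z * s (fst z) - k * s (fst z))\<^sup>2 + \<epsilon>\<^sup>2 * (s (fst z))\<^sup>2 = (s (fst z))\<^sup>2 * ((R z - k)\<^sup>2 + \<epsilon>\<^sup>2)"
            by (simp add: power2_eq_square algebra_simps)
          then have "?E (w z) = s (fst z) * sqrt ((R z - k)\<^sup>2 + \<epsilon>\<^sup>2)" using sp by (simp add: sv fw real_sqrt_mult)
          moreover have "?Q (w z) = q (R z)" by (simp add: sv Rz)
          ultimately show "dt ?psi z * ?E (w z) + dx ?psi z * ?Q (w z) = H z"
            unfolding pt(3,4) H_def by (simp add: mult_ac)
        qed
      qed
      show "H z = 0" if "z \<notin> UNIV \<times> {0<..}" for z using that neg by (cases z) (auto simp: H_def)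
    qed
    also have "\<dots> \<le> (LINT z|lborel. h z + \<epsilon> * W z)"
    proof (rule integral_mono[OF iH Bochner_Integration.integrable_add[OF ih integrable_mult_right[OF iW]]])
      show "H z \<le> h z + \<epsilon> * W z" for z using close[of z] by linarith
    qed
    finally show ?thesis using ih iW by simp
  qed
  have W0: "(LINT z|lborel. W z) \<ge> 0"
    by (rule Bochner_Integration.integral_nonneg) (use b_pos L0 in \<open>simp add: W_def\<close>)
  have "0 \<le> (LINT z|lborel. h z)"
  proof (rule field_le_epsilon)
    fix e :: real assume e: "e > 0"
    let ?I = "LINT z|lborel. W z"
    have "0 \<le> (LINT z|lborel. h z) + e / (?I + 1) * ?I" by (rule key) (use e W0 in simp)
    moreover have "e / (?I + 1) * ?I \<le> e" using e W0 by (simp add: field_simps)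
    ultimately show "0 \<le> (LINT z|lborel. h z) + e" by linarith
  qed
  then show "0 \<le> (LINT z|lborel. \<beta>' (snd z) * \<theta> (fst z) * (s (fst z) * \<bar>R z - k\<bar>) + \<beta> (snd z) * \<theta>' (fst z) * \<bar>f (R z) - f k\<bar>)"
    by (simp add: h_def)
qed

theorem admissible_kruzhkov_solution:
  assumes adm: "admissible_weak_solution {a..b} G s w"
  obtains R \<rho> where "kruzhkov_solution R \<rho>" "\<And>t. t \<ge> 0 \<Longrightarrow> AE x in lborel. w (x, t) = (s x * \<rho> t x, s x)"
proof -
  have ws: "weak_solution {a..b} G s w" using adm by (simp add: admissible_weak_solution_def)
  have wm: "w \<in> borel_measurable (lebesgue_on (UNIV \<times> {0..}))" and wc: "L1loc_continuous_on {0..} w"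
    and w0: "AE x in lebesgue. w (x, 0) = (1, s x)"
    using ws unfolding weak_solution_def by blast+
  have fs: "fst \<in> borel_measurable (borel :: (real \<times> real) measure)" "snd \<in> borel_measurable (borel :: (real \<times> real) measure)"
    by (intro borel_measurable_continuous_onI continuous_intros)+
  have um: "(\<lambda>z. fst (w z) / snd (w z)) \<in> borel_measurable (lebesgue_on (UNIV \<times> {0..}))"
    by (intro borel_measurable_divide measurable_compose[OF wm] fs)
  have usl: "(\<lambda>x. fst (w (x, t)) / snd (w (x, t))) \<in> borel_measurable lebesgue" if "t \<ge> 0" for t
    by (intro borel_measurable_divide measurable_compose[OF L1loc_slice_measurable[OF wc]] fs) (use that in simp_all)
  obtain R \<rho> where R: "R \<in> borel_measurable borel" "\<And>z. R z \<in> {A..B}"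
      "AE z in lborel. z \<in> UNIV \<times> {0..} \<longrightarrow> R z = fst (w z) / snd (w z)"
    and \<rho>: "\<And>t. t \<ge> 0 \<Longrightarrow> \<rho> t \<in> borel_measurable borel" "\<And>t x. t \<ge> 0 \<Longrightarrow> \<rho> t x \<in> {A..B}"
      "\<And>t. t \<ge> 0 \<Longrightarrow> AE x in lborel. \<rho> t x = fst (w (x, t)) / snd (w (x, t))"
    and R\<rho>: "AE t in lborel. t \<ge> 0 \<longrightarrow> (AE x in lborel. R (x, t) = \<rho> t x)"
    using slice_versions[OF um usl admissible_ratio(2)[OF adm]] by blast
  have rs: "AE x in lborel. \<rho> t x = fst (w (x, t)) / s x \<and> snd (w (x, t)) = s x" if t: "t \<ge> 0" for t
    using \<rho>(3)[OF t] admissible_snd(1)[OF adm t] by eventually_elim simp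
  have "kruzhkov_solution R \<rho>"
    unfolding kruzhkov_solution_def
  proof (intro conjI allI impI)
    show "kruzhkov R" by (rule admissible_kruzhkov[OF adm R])
    show "((\<lambda>t. LINT x:{-K..K}|lborel. \<bar>\<rho> t x - \<rho> t0 x\<bar>) \<longlongrightarrow> 0) (at t0 within {0..})" if t0: "t0 \<ge> 0" for t0 K
    proof (rule L1loc_slice_tendsto[OF wc t0, of "1 / a"])
      show "bounded_borel (\<rho> t)" if "t \<ge> 0" for t by (rule range_bounded_borel[OF \<rho>(1,2)[OF that]])
      fix t :: real assume t: "t \<ge> 0"
      show "AE x in lborel. \<bar>\<rho> t x - \<rho> t0 x\<bar> \<le> 1 / a * norm (w (x, t) - w (x, t0))"
        using rs[OF t] rs[OF t0]
      proof eventually_elim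
        case (elim x)
        have "\<rho> t x - \<rho> t0 x = fst (w (x, t) - w (x, t0)) / s x" using elim by (simp add: diff_divide_distrib)
        then have "\<bar>\<rho> t x - \<rho> t0 x\<bar> = \<bar>fst (w (x, t) - w (x, t0))\<bar> / s x" using s_pos[of x] by (simp add: abs_divide)
        also have "\<dots> \<le> norm (w (x, t) - w (x, t0)) / a"
          using s_bounds(1)[of x] a_pos by (intro frac_le abs_fst_le_norm) auto
        finally show ?case by simp
      qed
    qed (use a_pos in simp)
    have "AE x in lborel. w (x, 0) = (1, s x)" using w0 by (simp add: AE_completion_iff)
    then show "AE x in lborel. \<rho> 0 x = 1 / s x" using rs[OF order_refl] by eventually_elim simp
  qed (use \<rho>(1,2) R\<rho> in simp_all)
  moreover have "AE x in lborel. w (x, t) = (s x * \<rho> t x, s x)" if t: "t \<ge> 0" for t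
    using rs[OF t]
  proof eventually_elim
    case (elim x)
    then show ?case using s_pos[of x] by (simp add: prod_eq_iff)
  qed
  ultimately show ?thesis by (rule that)
qed

theorem admissible_unique:
  assumes adm: "admissible_weak_solution {a..b} G s w" "admissible_weak_solution {a..b} G s w'" and t: "t \<ge> 0"
  shows "AE x in lebesgue. w' (x, t) = w (x, t)"
proof -
  obtain R \<rho> where k: "kruzhkov_solution R \<rho>" and w: "\<And>t. t \<ge> 0 \<Longrightarrow> AE x in lborel. w (x, t) = (s x * \<rho> t x, s x)"
    using admissible_kruzhkov_solution[OF adm(1)] by blast
  obtain R' \<rho>' where k': "kruzhkov_solution R' \<rho>'" and w': "\<And>t. t \<ge> 0 \<Longrightarrow> AE x in lborel. w' (x, t) = (s x * \<rho>' t x, s x)"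
    using admissible_kruzhkov_solution[OF adm(2)] by blast
  have "AE x in lborel. \<rho> t x = \<rho>' t x"
  proof (cases "t = 0")
    case True
    have "AE x in lborel. \<rho> 0 x = 1 / s x" "AE x in lborel. \<rho>' 0 x = 1 / s x"
      using k k' unfolding kruzhkov_solution_def by blast+
    then show ?thesis unfolding True by eventually_elim simp
  next
    case False
    with t have "t > 0" by simp
    then show ?thesis by (rule kruzhkov_solution_unique[OF k k'])
  qed
  then have "AE x in lborel. w' (x, t) = w (x, t)" using w[OF t] w'[OF t] by eventually_elim simp
  then show ?thesis by (rule AE_completion)
qed

end

section \<open>Data for the locales and conclusion\<close>

text \<open>\<open>P x\<close> is the variation of s over the half line up to x, with the empty
  partition giving 0. Extending a partition that ends before x by the points x and y shows that its
  increments dominate those of s.\<close>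

lemma bounded_total_variation_majorant:
  assumes "bounded_total_variation s"
  shows "\<exists>P (TV :: real). mono P \<and> (\<forall>x. 0 \<le> P x) \<and> (\<forall>x. P x \<le> TV) \<and> (\<forall>x y. x \<le> y \<longrightarrow> \<bar>s y - s x\<bar> \<le> P y - P x)"
proof -
  obtain M where M: "\<And>(n::nat) p. (\<forall>i<n. p i \<le> p (Suc i)) \<Longrightarrow> (\<Sum>i<n. \<bar>s (p (Suc i)) - s (p i)\<bar>) \<le> M"
    using assms unfolding bounded_total_variation_def by blast
  define V where "V x = {(\<Sum>i<n. \<bar>s (p (Suc i)) - s (p i)\<bar>) | n p. (\<forall>i<n. p i \<le> p (Suc i)) \<and> p n \<le> x}" for x
  define P where "P x = Sup (V x)" for x
  have bd: "bdd_above (V x)" for x by (rule bdd_aboveI[of _ M]) (use M in \<open>auto simp: V_def\<close>)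
  have z: "0 \<in> V x" for x unfolding V_def by (intro CollectI exI[of _ 0] exI[of _ "\<lambda>_. x"]) simp
  have ext: "v + \<bar>s y - s x\<bar> \<le> P y" if v: "v \<in> V x" and xy: "x \<le> y" for v x y
  proof -
    obtain n p where p: "v = (\<Sum>i<n. \<bar>s (p (Suc i)) - s (p i)\<bar>)" "\<forall>i<n. p i \<le> p (Suc i)" "p n \<le> x"
      using v unfolding V_def by blast
    \<comment> \<open>The partition with x and y appended, in this order; the jump from
      \<open>p n\<close> to x only adds to the sum.\<close>
    define q where "q i = (if i \<le> n then p i else if i = Suc n then x else y)" for i
    have qm: "\<forall>i<Suc (Suc n). q i \<le> q (Suc i)" using p(2,3) xy by (auto simp: q_def less_Suc_eq)
    have "(\<Sum>i<Suc (Suc n). \<bar>s (q (Suc i)) - s (q i)\<bar>) = (\<Sum>i<n. \<bar>s (q (Suc i)) - s (q i)\<bar>) + \<bar>s x - s (p n)\<bar> + \<bar>s y - s x\<bar>"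
      by (simp add: q_def)
    also have "(\<Sum>i<n. \<bar>s (q (Suc i)) - s (q i)\<bar>) = v" unfolding p(1) by (rule sum.cong) (auto simp: q_def)
    finally have e: "(\<Sum>i<Suc (Suc n). \<bar>s (q (Suc i)) - s (q i)\<bar>) = v + \<bar>s x - s (p n)\<bar> + \<bar>s y - s x\<bar>" .
    have "(\<Sum>i<Suc (Suc n). \<bar>s (q (Suc i)) - s (q i)\<bar>) \<in> V y"
      unfolding V_def by (intro CollectI exI[of _ "Suc (Suc n)"] exI[of _ q] conjI refl qm) (simp add: q_def)
    from cSup_upper[OF this bd] show ?thesis unfolding e P_def by linarith
  qed
  have var: "\<bar>s y - s x\<bar> \<le> P y - P x" if xy: "x \<le> y" for x y
  proof -
    have "Sup (V x) \<le> P y - \<bar>s y - s x\<bar>"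
    proof (rule cSup_least)
      show "V x \<noteq> {}" using z by blast
      show "v \<le> P y - \<bar>s y - s x\<bar>" if "v \<in> V x" for v using ext[OF that xy] by linarith
    qed
    then show ?thesis by (simp add: P_def)
  qed
  show ?thesis
  proof (intro exI[of _ P] exI[of _ M] conjI allI impI)
    show "mono P"
    proof (rule monoI)
      fix x y :: real assume "x \<le> y"
      then show "P x \<le> P y" using var[of x y] abs_ge_zero[of "s y - s x"] by linarith
    qed
    show "0 \<le> P x" for x unfolding P_def by (rule cSup_upper[OF z bd])
    show "P x \<le> M" for x unfolding P_def by (rule cSup_least) (use z M in \<open>auto simp: V_def\<close>)
  qed (rule var)
qed

lemma C2_on_Icc_deriv:
  assumes "C2_on {a..b} G"
  shows "\<sigma> \<in> {a..b} \<Longrightarrow> (G has_real_derivative deriv_on {a..b} G \<sigma>) (at \<sigma> within {a..b})"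
    "continuous_on {a..b} (deriv_on {a..b} G)" "continuous_on {a..b} G"
  using assms unfolding C2_on_def differentiable_on_def deriv_on_def has_real_derivative_iff_has_vector_derivative
  by (auto simp: vector_derivative_works intro: differentiable_imp_continuous_on[unfolded differentiable_on_def])

text \<open>Outside the physical range \<open>{1/b..1/a}\<close> the flux is continued with slope one, which keeps it
  bi-Lipschitz on the whole line.\<close>

lemma flux_extension:
  fixes G :: "real \<Rightarrow> real"
  assumes ab: "0 < a" "a < b" and C2: "C2_on {a..b} G" and pos: "\<forall>\<sigma>\<in>{a..b}. deriv_on {a..b} G \<sigma> > 0"
  shows "\<exists>f m L. m > 0 \<and> (\<forall>x y. x \<le> y \<longrightarrow> m * (y - x) \<le> f y - f x) \<and> (\<forall>x y. x \<le> y \<longrightarrow> f y - f x \<le> L * (y - x)) \<and>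
    surj f \<and> (\<forall>r. r \<in> {1 / b..1 / a} \<longrightarrow> f r = - G (1 / r))"
proof -
  let ?A = "1 / b" and ?B = "1 / a" and ?g = "deriv_on {a..b} G"
  note G = C2_on_Icc_deriv[OF C2]
  have A: "0 < ?A" "?A \<le> ?B" using ab by (simp_all add: frac_le)
  have rpos: "r > 0" if "r \<in> {?A..?B}" for r
  proof -
    have "?A \<le> r" using that by simp
    with A(1) show ?thesis by (rule less_le_trans)
  qed
  have inv: "1 / r \<in> {a..b}" if "r \<in> {?A..?B}" for r
  proof -
    have "r > 0" by (rule rpos[OF that])
    then show ?thesis using that ab by (simp add: field_simps)
  qed
  define F where "F r = - G (1 / r)" for r
  define d where "d r = ?g (1 / r) / r\<^sup>2" for r
  have Fd: "(F has_real_derivative d r) (at r within {?A..?B})" if r: "r \<in> {?A..?B}" for r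
  proof -
    have rp: "r > 0" by (rule rpos[OF r])
    have i: "((\<lambda>r. 1 / r) has_real_derivative - (1 / r\<^sup>2)) (at r within {?A..?B})"
      using rp by (auto intro!: derivative_eq_intros simp: power2_eq_square)
    have "(G has_real_derivative ?g (1 / r)) (at (1 / r) within (\<lambda>r. 1 / r) ` {?A..?B})"
      by (rule has_field_derivative_subset[OF G(1)[OF inv[OF r]]]) (use inv in blast)
    from DERIV_minus[OF DERIV_image_chain[OF this i]] show ?thesis by (simp add: o_def F_def[abs_def] d_def)
  qed
  have ci: "continuous_on {?A..?B} (\<lambda>r. 1 / r)" using A by (intro continuous_intros) auto
  have cd: "continuous_on {?A..?B} d"
    unfolding d_def using A by (intro continuous_intros continuous_on_compose2[OF G(2) ci]) (use inv in auto)
  have dpos: "d r > 0" if "r \<in> {?A..?B}" for r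
  proof -
    have "r > 0" by (rule rpos[OF that])
    then show ?thesis using pos inv[OF that] by (simp add: d_def)
  qed
  have ne: "{?A..?B} \<noteq> {}" using A by simp
  obtain r1 where r1: "r1 \<in> {?A..?B}" "\<forall>r\<in>{?A..?B}. d r1 \<le> d r" using continuous_attains_inf[OF compact_Icc ne cd] by blast
  obtain r2 where r2: "r2 \<in> {?A..?B}" "\<forall>r\<in>{?A..?B}. d r \<le> d r2" using continuous_attains_sup[OF compact_Icc ne cd] by blast
  \<comment> \<open>The 1 accounts for the slope of the continuation outside the physical
    range.\<close>
  define m L where "m = min 1 (d r1)" and "L = max 1 (d r2)"
  have m: "m > 0" using dpos[OF r1(1)] by (simp add: m_def)
  define c where "c r = max ?A (min ?B r)" for r
  have cr: "c r \<in> {?A..?B}" for r using A by (auto simp: c_def)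
  have ci: "c r = r" if "r \<in> {?A..?B}" for r using that by (auto simp: c_def)
  define f where "f r = F (c r) + (r - c r)" for r
  have est: "m * (y - x) \<le> f y - f x \<and> f y - f x \<le> L * (y - x)" if xy: "x \<le> y" for x y
  proof -
    have cc: "c x \<le> c y" "c y - c x \<le> y - x" using xy A by (auto simp: c_def)
    have sub: "{c x..c y} \<subseteq> {?A..?B}" using cr[of x] cr[of y] by auto
    have "\<exists>r\<in>{c x..c y}. F (c y) - F (c x) = (\<lambda>r. (*) (d r)) r (c y - c x)"
    proof (rule mvt_very_simple[OF cc(1)])
      fix r assume "c x \<le> r" "r \<le> c y"
      then have "r \<in> {?A..?B}" using sub by auto
      from has_field_derivative_subset[OF Fd[OF this] sub]
      show "(F has_derivative (*) (d r)) (at r within {c x..c y})" unfolding has_field_derivative_def .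
    qed
    then obtain r where r: "r \<in> {c x..c y}" "F (c y) - F (c x) = d r * (c y - c x)" by blast
    have rr: "r \<in> {?A..?B}" using r(1) cr[of x] cr[of y] by auto
    have dr: "m \<le> d r" "d r \<le> L" "m \<le> 1" "1 \<le> L" using r1(2) r2(2) rr by (auto simp: m_def L_def intro: min.coboundedI2 max.coboundedI2)
    define p u where "p = c y - c x" and "u = y - x - (c y - c x)"
    have pu: "0 \<le> p" "0 \<le> u" "y - x = p + u" using cc by (simp_all add: p_def u_def)
    have e: "f y - f x = d r * p + u" using r(2) by (simp add: f_def p_def u_def)
    have "m * p \<le> d r * p" "d r * p \<le> L * p" "m * u \<le> 1 * u" "1 * u \<le> L * u"
      by (intro mult_right_mono dr pu)+
    then show ?thesis unfolding e pu(3) distrib_left by simp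
  qed
  have cF: "continuous_on {?A..?B} F"
    using Fd by (meson DERIV_continuous continuous_on_eq_continuous_within)
  have cc: "continuous_on UNIV c" unfolding c_def[abs_def] by (intro continuous_intros)
  have cf: "continuous_on UNIV f"
    unfolding f_def[abs_def] by (intro continuous_intros continuous_on_compose2[OF cF cc] cc) (use cr in blast)
  have sf: "surj f"
  proof (rule surjI[of f "\<lambda>u. SOME r. f r = u"], rule someI_ex)
    fix u
    \<comment> \<open>With slope at least \<open>m\<close>, moving by \<open>y\<close> to the right
      of 0 raises f by at least |u - f 0|, and moving by \<open>y\<close> to the left lowers it as
      much, so u is attained in between.\<close>
    define y where "y = \<bar>u - f 0\<bar> / m"
    have y: "y \<ge> 0" "m * y = \<bar>u - f 0\<bar>" using m by (simp_all add: y_def)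
    have "u \<le> f y" using est[OF y(1)] y(2) by auto
    moreover have "f (-y) \<le> u" using est[of "-y" 0] y by auto
    ultimately show "\<exists>r. f r = u"
      using IVT'[of f "-y" u y] y(1) continuous_on_subset[OF cf subset_UNIV] by auto
  qed
  show ?thesis
  proof (rule exI[of _ f], rule exI[of _ m], rule exI[of _ L], intro conjI allI impI)
    show "m * (y - x) \<le> f y - f x" "f y - f x \<le> L * (y - x)" if "x \<le> y" for x y
      using est[OF that] by blast+
    show "f r = - G (1 / r)" if "r \<in> {?A..?B}" for r by (simp add: f_def ci[OF that] F_def)
  qed (rule m sf)+
qed

theorem theorem2p2:
  fixes a b :: real and \<sigma>\<^sub>0 G :: "real \<Rightarrow> real"
  assumes "0 < a" and "a < b"
    and "range \<sigma>\<^sub>0 \<subseteq> {a..b}" and "bounded_total_variation \<sigma>\<^sub>0"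
    and "C2_on {a..b} G" and "\<forall>\<sigma>\<in>{a..b}. deriv_on {a..b} G \<sigma> > 0"
  shows "\<exists>w. admissible_weak_solution {a..b} G \<sigma>\<^sub>0 w \<and> continuous_in_BV2 w \<and>
           (\<forall>w'. admissible_weak_solution {a..b} G \<sigma>\<^sub>0 w' \<and> continuous_in_BV2 w' \<longrightarrow>
              (\<forall>t\<ge>0. AE x in lebesgue. w' (x, t) = w (x, t)))"
proof -
  obtain P TV where P0: "mono P \<and> (\<forall>x. 0 \<le> P x) \<and> (\<forall>x. P x \<le> TV) \<and> (\<forall>x y. x \<le> y \<longrightarrow> \<bar>\<sigma>\<^sub>0 y - \<sigma>\<^sub>0 x\<bar> \<le> P y - P x)"
    using bounded_total_variation_majorant[OF assms(4)] by (elim exE) (rule that)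
  note P = P0[THEN conjunct1] P0[THEN conjunct2, THEN conjunct1, rule_format]
    P0[THEN conjunct2, THEN conjunct2, THEN conjunct1, rule_format] P0[THEN conjunct2, THEN conjunct2, THEN conjunct2, rule_format]
  obtain f m L where f0: "m > 0 \<and> (\<forall>x y. x \<le> y \<longrightarrow> m * (y - x) \<le> f y - f x) \<and> (\<forall>x y. x \<le> y \<longrightarrow> f y - f x \<le> L * (y - x)) \<and>
    surj f \<and> (\<forall>r. r \<in> {1 / b..1 / a} \<longrightarrow> f r = - G (1 / r))"
    using flux_extension[OF assms(1,2,5,6)] by (elim exE) (rule that)
  note f = f0[THEN conjunct1] f0[THEN conjunct2, THEN conjunct1, rule_format] f0[THEN conjunct2, THEN conjunct2, THEN conjunct1, rule_format]
    and sf = f0[THEN conjunct2, THEN conjunct2, THEN conjunct2, THEN conjunct1]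
    and fG = f0[THEN conjunct2, THEN conjunct2, THEN conjunct2, THEN conjunct2, rule_format]
  \<comment> \<open>The datum is a difference of two increasing functions and therefore Borel, which
    the locale requires.\<close>
  have "mono (\<lambda>x. P x + \<sigma>\<^sub>0 x)"
  proof (rule monoI)
    fix x y :: real assume "x \<le> y"
    then show "P x + \<sigma>\<^sub>0 x \<le> P y + \<sigma>\<^sub>0 y" using P(4)[of x y] by (simp add: abs_le_iff)
  qed
  from borel_measurable_diff[OF borel_measurable_mono[OF this] borel_measurable_mono[OF P(1)]]
  have sm: "\<sigma>\<^sub>0 \<in> borel_measurable borel" by simp
  have s: "a \<le> \<sigma>\<^sub>0 x" "\<sigma>\<^sub>0 x \<le> b" for x using assms(3) by (auto simp: image_subset_iff)
  interpret F: flux_data a b m L TV \<sigma>\<^sub>0 f "inv f" P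
  proof unfold_locales
    show "a \<le> b" using assms(2) by simp
    show "f (inv f u) = u" for u by (rule surj_f_inv_f[OF sf])
  qed (rule assms(1) s sm P f | assumption)+
  interpret E: elastic a b m L TV \<sigma>\<^sub>0 f "inv f" P G
  proof unfold_locales
    show "deriv_on {a..b} G \<sigma> > 0" if "\<sigma> \<in> {a..b}" for \<sigma> using assms(6) that by blast
    show "f r = - G (1 / r)" if "r \<in> {F.A..F.B}" for r using that unfolding F.A_def F.B_def by (rule fG)
  qed (rule assms)+
  show ?thesis
  proof (intro exI conjI allI impI)
    show "admissible_weak_solution {a..b} G \<sigma>\<^sub>0 F.w_sol" by (rule E.w_sol_admissible)
    show "continuous_in_BV2 F.w_sol" by (rule F.w_sol_BV[OF assms(4)])
    fix w' and t :: real
    assume "admissible_weak_solution {a..b} G \<sigma>\<^sub>0 w' \<and> continuous_in_BV2 w'" "0 \<le> t"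
    then show "AE x in lebesgue. w' (x, t) = F.w_sol (x, t)"
      by (intro E.admissible_unique[OF E.w_sol_admissible]) simp_all
  qed
qed

end
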